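(* Let $a,b$ be integers with $2\le a<b$ and let $\alpha_0,\alpha_1,\alpha_2\in\mathbb{C}\setminus\{0\}$. Then the Brieskorn singularity $$V(a,b,b)=\{(x,y,z)\in\mathbb{C}^3:\alpha_0x^a+\alpha_1y^b+\alpha_2z^b=0\}$$ is metrically conical at $0$.
   Context: The metric on a (semi)algebraic set $V\subset\mathbb{C}^N$ is always the inner metric: the distance between two points is the infimum of the lengths of rectifiable curves in $V$ joining them (as opposed to the outer metric, which is the restriction of the Euclidean distance of the ambient space). A metric cone on a compact Riemannian manifold $(M,g)$ is the quotient of $[0,\epsilon)\times M$ obtained by collapsing $\{0\}\times M$ to a point (the cone point), with the length metric induced by $dr^2+r^2g$, where $r$ is the coordinate on $[0,\epsilon)$. A set $V$ is metrically conical at $p\in V$ if some neighborhood of $p$ in $V$, with its inner metric, is bi-Lipschitz homeomorphic to a metric cone, by a homeomorphism taking $p$ to the cone point. *)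

theory Defs
  imports "HOL-Analysis.Analysis"
begin

section \<open>The inner metric\<close>

definition curve_length :: "(real \<Rightarrow> 'a::metric_space) \<Rightarrow> ennreal" where
  "curve_length \<gamma> =
     (SUP (n, t) \<in> {(n::nat, t::nat \<Rightarrow> real). mono t \<and> range t \<subseteq> {0..1}}.
        \<Sum>i<n. ennreal (dist (\<gamma> (t i)) (\<gamma> (t (Suc i)))))"

definition rectifiable :: "(real \<Rightarrow> 'a::metric_space) \<Rightarrow> bool" where
  "rectifiable \<gamma> \<longleftrightarrow> path \<gamma> \<and> curve_length \<gamma> < \<infinity>"

text \<open>The value is \<open>\<infinity>\<close> for points that no rectifiable curve in \<open>V\<close> joins.\<close>

definition inner_dist :: "'a::metric_space set \<Rightarrow> 'a \<Rightarrow> 'a \<Rightarrow> ennreal" where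
  "inner_dist V x y =
     (INF \<gamma> \<in> {\<gamma>. rectifiable \<gamma> \<and> path_image \<gamma> \<subseteq> V \<and> pathstart \<gamma> = x \<and> pathfinish \<gamma> = y}.
        curve_length \<gamma>)"


section \<open>Compact Riemannian manifolds\<close>

text \<open>
  The dimension of a manifold has to be existentially quantified in the definition of a conical
  set, so coordinate space is the library's \<open>Euclidean_space d\<close>: the sequences
  \<open>x :: nat \<Rightarrow> real\<close> with \<open>x i = 0\<close> for \<open>i \<ge> d\<close>.
\<close>

definition coord_partial :: "nat \<Rightarrow> ((nat \<Rightarrow> real) \<Rightarrow> real) \<Rightarrow> (nat \<Rightarrow> real) \<Rightarrow> real" where
  "coord_partial i f x = deriv (\<lambda>t. f (x(i := t))) (x i)"

text \<open>
  Functions of class \<open>C\<^sup>k\<close> on an open subset \<open>S\<close> of \<open>d\<close>-dimensional coordinate space: all partial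
  derivatives of order at most \<open>k\<close> exist and are continuous.
\<close>

primrec coord_Ck_on :: "nat \<Rightarrow> nat \<Rightarrow> (nat \<Rightarrow> real) set \<Rightarrow> ((nat \<Rightarrow> real) \<Rightarrow> real) \<Rightarrow> bool" where
  "coord_Ck_on d 0 S f \<longleftrightarrow> continuous_map (subtopology (Euclidean_space d) S) euclideanreal f"
| "coord_Ck_on d (Suc k) S f \<longleftrightarrow>
     continuous_map (subtopology (Euclidean_space d) S) euclideanreal f \<and>
     (\<forall>i<d. \<exists>f'. (\<forall>x\<in>S. ((\<lambda>t. f (x(i := t))) has_real_derivative f' x) (at (x i))) \<and>
                 coord_Ck_on d k S f')"

definition coord_smooth_on :: "nat \<Rightarrow> (nat \<Rightarrow> real) set \<Rightarrow> ((nat \<Rightarrow> real) \<Rightarrow> real) \<Rightarrow> bool" where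
  "coord_smooth_on d S f \<longleftrightarrow> (\<forall>k. coord_Ck_on d k S f)"

text \<open>A chart is a pair of its domain and its coordinate map.\<close>

type_synonym 'm chart = "'m set \<times> ('m \<Rightarrow> nat \<Rightarrow> real)"

text \<open>
  A compact \<open>d\<close>-dimensional smooth manifold without boundary \<open>M\<close>, not necessarily connected,
  with atlas \<open>A\<close>, and a smooth Riemannian metric \<open>g\<close> on it, where \<open>g c x i j\<close> is the \<open>(i, j)\<close>
  component at the point \<open>x\<close> of the metric tensor in the chart \<open>c\<close>.
\<close>

locale compact_riemannian_manifold =
  fixes d :: nat
    and M :: "'m topology"
    and A :: "'m chart set"
    and g :: "'m chart \<Rightarrow> 'm \<Rightarrow> nat \<Rightarrow> nat \<Rightarrow> real"
  assumes compact: "compact_space M"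
    and Hausdorff: "Hausdorff_space M"
    and atlas_covers: "topspace M = \<Union> (fst ` A)"
    and chart_domain: "(U, \<phi>) \<in> A \<Longrightarrow> openin M U"
    and chart_range: "(U, \<phi>) \<in> A \<Longrightarrow> openin (Euclidean_space d) (\<phi> ` U)"
    and chart_homeomorphic:
      "(U, \<phi>) \<in> A \<Longrightarrow>
         homeomorphic_map (subtopology M U) (subtopology (Euclidean_space d) (\<phi> ` U)) \<phi>"
    and transition_smooth:
      "(U, \<phi>) \<in> A \<Longrightarrow> (W, \<psi>) \<in> A \<Longrightarrow> k < d \<Longrightarrow>
         coord_smooth_on d (\<phi> ` (U \<inter> W)) (\<lambda>u. \<psi> (inv_into U \<phi> u) k)"
    and metric_smooth:
      "(U, \<phi>) \<in> A \<Longrightarrow> i < d \<Longrightarrow> j < d \<Longrightarrow>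
         coord_smooth_on d (\<phi> ` U) (\<lambda>u. g (U, \<phi>) (inv_into U \<phi> u) i j)"
    and metric_symmetric:
      "(U, \<phi>) \<in> A \<Longrightarrow> x \<in> U \<Longrightarrow> i < d \<Longrightarrow> j < d \<Longrightarrow> g (U, \<phi>) x i j = g (U, \<phi>) x j i"
    and metric_positive:
      "(U, \<phi>) \<in> A \<Longrightarrow> x \<in> U \<Longrightarrow> \<exists>i<d. v i \<noteq> 0 \<Longrightarrow>
         (\<Sum>i<d. \<Sum>j<d. g (U, \<phi>) x i j * v i * v j) > 0"
    and metric_transforms:
      "(U, \<phi>) \<in> A \<Longrightarrow> (W, \<psi>) \<in> A \<Longrightarrow> x \<in> U \<inter> W \<Longrightarrow> i < d \<Longrightarrow> j < d \<Longrightarrow>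
         g (U, \<phi>) x i j =
           (\<Sum>k<d. \<Sum>l<d. coord_partial i (\<lambda>u. \<psi> (inv_into U \<phi> u) k) (\<phi> x) *
                           coord_partial j (\<lambda>u. \<psi> (inv_into U \<phi> u) l) (\<phi> x) *
                           g (W, \<psi>) x k l)"

text \<open>Curves of class \<open>C\<^sup>1\<close> on \<open>[0, 1]\<close>, with one-sided derivatives at the end points.\<close>

definition C1_curve :: "nat \<Rightarrow> 'm topology \<Rightarrow> 'm chart set \<Rightarrow> (real \<Rightarrow> 'm) \<Rightarrow> bool" where
  "C1_curve d M A \<gamma> \<longleftrightarrow>
     continuous_map (top_of_set {0..1}) M \<gamma> \<and>
     (\<forall>(U, \<phi>) \<in> A. \<forall>i<d. \<exists>v.
        continuous_on {t \<in> {0..1}. \<gamma> t \<in> U} v \<and>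
        (\<forall>t \<in> {t \<in> {0..1}. \<gamma> t \<in> U}.
           ((\<lambda>s. \<phi> (\<gamma> s) i) has_real_derivative v t) (at t within {0..1})))"

text \<open>
  \<open>g(\<gamma>'(t), \<gamma>'(t))\<close>, computed in some chart at \<open>\<gamma> t\<close>; the choice is immaterial by
  \<open>metric_transforms\<close>.
\<close>

definition speed_sq ::
    "nat \<Rightarrow> 'm chart set \<Rightarrow> ('m chart \<Rightarrow> 'm \<Rightarrow> nat \<Rightarrow> nat \<Rightarrow> real) \<Rightarrow> (real \<Rightarrow> 'm) \<Rightarrow> real \<Rightarrow> real" where
  "speed_sq d A g \<gamma> t =
     (let c = SOME c. c \<in> A \<and> \<gamma> t \<in> fst c;
          v = (\<lambda>i. vector_derivative (\<lambda>s. snd c (\<gamma> s) i) (at t within {0..1}))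
      in \<Sum>i<d. \<Sum>j<d. g c (\<gamma> t) i j * v i * v j)"


section \<open>Metric cones\<close>

text \<open>The cone is the quotient of \<open>[0, \<epsilon>) \<times> M\<close> that collapses \<open>{0} \<times> M\<close> to a point.\<close>

definition cone_rel :: "real \<Rightarrow> 'm topology \<Rightarrow> ((real \<times> 'm) \<times> (real \<times> 'm)) set" where
  "cone_rel \<epsilon> M =
     {(P, Q). P \<in> {0..<\<epsilon>} \<times> topspace M \<and> Q \<in> {0..<\<epsilon>} \<times> topspace M \<and>
              (P = Q \<or> fst P = 0 \<and> fst Q = 0)}"

definition cone :: "real \<Rightarrow> 'm topology \<Rightarrow> (real \<times> 'm) set set" where
  "cone \<epsilon> M = ({0..<\<epsilon>} \<times> topspace M) // cone_rel \<epsilon> M"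

definition cone_point :: "'m topology \<Rightarrow> (real \<times> 'm) set" where
  "cone_point M = {0} \<times> topspace M"

text \<open>
  \<open>cone_curve d M A g \<epsilon> P Q l\<close>: the points \<open>P\<close> and \<open>Q\<close> of the cone are joined by a curve of length
  \<open>l\<close> with respect to \<open>dr\<^sup>2 + r\<^sup>2 g\<close>. The curves are the concatenations of finitely many pieces that
  lift to \<open>C\<^sup>1\<close> curves \<open>(\<rho>, \<gamma>)\<close> in \<open>[0, \<epsilon>) \<times> M\<close>. Consecutive pieces need only fit together
  in the quotient, so a curve may leave the cone point in a different direction from the one it
  arrived in.
\<close>

inductive cone_curve ::
    "nat \<Rightarrow> 'm topology \<Rightarrow> 'm chart set \<Rightarrow> ('m chart \<Rightarrow> 'm \<Rightarrow> nat \<Rightarrow> nat \<Rightarrow> real) \<Rightarrow> real \<Rightarrow>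
     (real \<times> 'm) set \<Rightarrow> (real \<times> 'm) set \<Rightarrow> real \<Rightarrow> bool"
  for d M A g \<epsilon> where
  piece:
    "\<lbrakk>\<forall>t\<in>{0..1}. (\<rho> has_real_derivative \<rho>' t) (at t within {0..1}); continuous_on {0..1} \<rho>';
      \<rho> ` {0..1} \<subseteq> {0..<\<epsilon>}; C1_curve d M A \<gamma>\<rbrakk> \<Longrightarrow>
     cone_curve d M A g \<epsilon> (cone_rel \<epsilon> M `` {(\<rho> 0, \<gamma> 0)}) (cone_rel \<epsilon> M `` {(\<rho> 1, \<gamma> 1)})
       (integral {0..1} (\<lambda>t. sqrt ((\<rho>' t)\<^sup>2 + (\<rho> t)\<^sup>2 * speed_sq d A g \<gamma> t)))"
| join:
    "\<lbrakk>cone_curve d M A g \<epsilon> P Q l; cone_curve d M A g \<epsilon> Q R l'\<rbrakk> \<Longrightarrow>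
     cone_curve d M A g \<epsilon> P R (l + l')"

definition cone_dist ::
    "nat \<Rightarrow> 'm topology \<Rightarrow> 'm chart set \<Rightarrow> ('m chart \<Rightarrow> 'm \<Rightarrow> nat \<Rightarrow> nat \<Rightarrow> real) \<Rightarrow> real \<Rightarrow>
     (real \<times> 'm) set \<Rightarrow> (real \<times> 'm) set \<Rightarrow> ennreal" where
  "cone_dist d M A g \<epsilon> P Q = (INF l \<in> {l. cone_curve d M A g \<epsilon> P Q l}. ennreal l)"


section \<open>Metrically conical sets\<close>

text \<open>
  A bi-Lipschitz bijection is a homeomorphism for the two metrics.
\<close>

definition bi_Lipschitz_homeo ::
    "'p set \<Rightarrow> ('p \<Rightarrow> 'p \<Rightarrow> ennreal) \<Rightarrow> 'q set \<Rightarrow> ('q \<Rightarrow> 'q \<Rightarrow> ennreal) \<Rightarrow> ('p \<Rightarrow> 'q) \<Rightarrow> bool" where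
  "bi_Lipschitz_homeo S dS T dT h \<longleftrightarrow>
     bij_betw h S T \<and>
     (\<exists>L::real. L \<ge> 1 \<and> (\<forall>x\<in>S. \<forall>y\<in>S.
        dT (h x) (h y) \<le> ennreal L * dS x y \<and> dS x y \<le> ennreal L * dT (h x) (h y)))"

text \<open>
  The points of the manifold are taken from the ambient type of \<open>V\<close>, with an arbitrary topology
  on them. This is no restriction: the base of a cone injects into the cone, hence into \<open>V\<close>,
  as soon as the cone is in bijection with a subset of \<open>V\<close>.
\<close>

definition metrically_conical :: "'a::euclidean_space set \<Rightarrow> 'a \<Rightarrow> bool" where
  "metrically_conical V p \<longleftrightarrow>
     p \<in> V \<and>
     (\<exists>U d (M :: 'a topology) A g \<epsilon> h.
        U \<subseteq> V \<and> (\<exists>W. open W \<and> p \<in> W \<and> W \<inter> V \<subseteq> U) \<and>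
        compact_riemannian_manifold d M A g \<and> \<epsilon> > 0 \<and>
        bi_Lipschitz_homeo U (inner_dist U) (cone \<epsilon> M) (cone_dist d M A g \<epsilon>) h \<and>
        h p = cone_point M)"

text \<open>On \<open>\<complex> \<times> \<complex> \<times> \<complex>\<close> the library's product metric is the Euclidean metric.\<close>

definition brieskorn ::
    "complex \<Rightarrow> complex \<Rightarrow> complex \<Rightarrow> nat \<Rightarrow> nat \<Rightarrow> nat \<Rightarrow> (complex \<times> complex \<times> complex) set" where
  "brieskorn \<alpha>\<^sub>0 \<alpha>\<^sub>1 \<alpha>\<^sub>2 p q r = {(x, y, z). \<alpha>\<^sub>0 * x ^ p + \<alpha>\<^sub>1 * y ^ q + \<alpha>\<^sub>2 * z ^ r = 0}"

end

theory Submission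
  imports Defs
begin

text \<open>
  After rescaling the coordinates take \<open>\<alpha>\<^sub>i = 1\<close>. Let \<open>M\<close> be the set of \<open>(x, y, z)\<close> with
  \<open>x\<^sup>a + y\<^sup>b + z\<^sup>b = 0\<close> and \<open>\<bar>y\<bar>\<^sup>2\<^sup>b + \<bar>z\<bar>\<^sup>2\<^sup>b = 1\<close>, a compact submanifold with the metric
  induced from \<open>\<complex>\<^sup>3\<close>. The dilation \<open>(r, (x, y, z)) \<mapsto> (r\<^sup>\<beta> x, r y, r z)\<close> with \<open>\<beta> = b / a\<close>
  parametrizes \<open>V(a, b, b)\<close> by the cone on \<open>M\<close>. It fails to be bi-Lipschitz only near the branch
  locus \<open>x = 0\<close>, because \<open>x\<close> moves as \<open>r\<^sup>\<beta>\<close> while \<open>y\<close> and \<open>z\<close> move as \<open>r\<close>, and there \<open>y\<close> and \<open>z\<close>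
  vary only like \<open>x\<^sup>a\<close>. So it is precomposed with the inverse of a homeomorphism \<open>push r\<close> of \<open>M\<close>, which
  replaces \<open>x\<close> by \<open>max (r\<^sup>\<beta>\<^sup>-\<^sup>1) (min 1 ((\<bar>x\<bar> / \<delta>)\<^sup>a\<^sup>-\<^sup>1)) x\<close> near the branch locus and follows the
  branches in \<open>y\<close> and \<open>z\<close>; the factor \<open>\<bar>x\<bar>\<^sup>a\<^sup>-\<^sup>1\<close> is the derivative of \<open>x\<^sup>a\<close>, so the two regimes match
  with constants independent of \<open>r\<close>. The result is bi-Lipschitz near every point with a uniform
  constant, for the Euclidean distances of \<open>\<real> \<times> M\<close> (scaled by \<open>r\<close> on \<open>M\<close>) and of \<open>\<complex>\<^sup>3\<close>; subdividing
  curves turns this into a bi-Lipschitz estimate for the inner metrics.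
\<close>

section \<open>Coordinatewise smooth functions\<close>

text \<open>Write dx, dy, dz for the coordinate differences of two points of the link. After
  dilation by r their distance is about r * (r^(\<beta>-1) |dx| + |dy| + |dz|). Near the branch
  locus y and z are non-zero and feel x only through x^a, so a small change dx forces a change of
  about |x|^(a-1) |dx| in (y, z). Hence the density of the pulled-back metric in the x direction,
  divided by r, is comparable with r^(\<beta>-1) + |x|^(a-1), which degenerates on x = 0 as r tends
  to 0. The factor used by \<open>push\<close> is this density up to constants, normalised to 1 away
  from the branch locus. Since it grows at most like a power of |x|, multiplying x by it distorts
  lengths by about the same factor. A global Euclidean comparison is impossible: two points of the
  link that differ by a root of unity in x, far from x = 0, are about r^\<beta> apart in
  \<complex>^3 but about r apart in the cone. Hence all estimates hold only in neighbourhoods, whose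
  size may depend on the point while the constant may not. No such estimate is made at the cone
  point, where bounds on the norm suffice.\<close>

lemma openin_Euclidean_space:
  "openin (Euclidean_space d) S \<longleftrightarrow> (\<exists>T. open T \<and> S = T \<inter> {x. \<forall>i\<ge>d. x i = 0})"
  by (simp add: Euclidean_space_def euclidean_product_topology openin_subtopology)

lemma openin_Euclidean_space_zero: "openin (Euclidean_space d) S \<Longrightarrow> x \<in> S \<Longrightarrow> d \<le> i \<Longrightarrow> x i = 0"
  by (auto simp: openin_Euclidean_space)

lemma subtopology_Euclidean_space:
  assumes "openin (Euclidean_space d) S"
  shows "subtopology (Euclidean_space d) S = top_of_set S"
proof -
  have "{x. \<forall>i\<ge>d. x i = 0} \<inter> S = S"
    using assms by (auto simp: openin_Euclidean_space)
  then show ?thesis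
    by (simp add: Euclidean_space_def euclidean_product_topology subtopology_subtopology)
qed

text \<open>Basic open sets of the product topology restrict only finitely many coordinates, so one
  radius serves for all of them.\<close>

lemma open_function_box:
  fixes T :: "(nat \<Rightarrow> real) set"
  assumes "open T" "x \<in> T"
  obtains e where "e > 0" "\<And>y. (\<forall>i. \<bar>y i - x i\<bar> < e) \<Longrightarrow> y \<in> T"
proof -
  have "openin (product_topology (\<lambda>i. euclidean) UNIV) T"
    using assms by (simp add: euclidean_product_topology)
  from product_topology_open_contains_basis[OF this assms(2)]
  obtain X where X: "x \<in> Pi\<^sub>E UNIV X" "\<And>i. open (X i)" "finite {i. X i \<noteq> UNIV}" "Pi\<^sub>E UNIV X \<subseteq> T"
    by (auto simp: open_openin[symmetric])
  have "\<exists>e>0. \<forall>y. \<bar>y - x i\<bar> < e \<longrightarrow> y \<in> X i" for i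
  proof -
    have "x i \<in> X i" using X(1) by auto
    then obtain e where "e > 0" "ball (x i) e \<subseteq> X i" using X(2) openE by blast
    then show ?thesis
      by (intro exI[of _ e]) (auto simp: subset_iff dist_real_def abs_minus_commute)
  qed
  then obtain e where e: "\<And>i. e i > 0" "\<And>i y. \<bar>y - x i\<bar> < e i \<Longrightarrow> y \<in> X i"
    by metis
  define m where "m = Min (insert 1 (e ` {i. X i \<noteq> UNIV}))"
  have "m > 0" unfolding m_def using X(3) e(1) by (subst Min_gr_iff) auto
  moreover have "y \<in> T" if "\<forall>i. \<bar>y i - x i\<bar> < m" for y
  proof -
    have "y i \<in> X i" for i
    proof (cases "X i = UNIV")
      case False
      then have "m \<le> e i" unfolding m_def using X(3) by (intro Min_le) auto
      then show ?thesis using e(2)[of "y i" i] that by (meson less_le_trans)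
    qed auto
    then show ?thesis using X(4) by auto
  qed
  ultimately show ?thesis using that by blast
qed

lemma Euclidean_space_box:
  assumes "openin (Euclidean_space d) S" "x \<in> S"
  obtains e where "e > 0" "\<And>y. (\<forall>i<d. \<bar>y i - x i\<bar> < e) \<Longrightarrow> (\<forall>i\<ge>d. y i = 0) \<Longrightarrow> y \<in> S"
proof -
  obtain T where T: "open T" "S = T \<inter> {x. \<forall>i\<ge>d. x i = 0}"
    using assms by (auto simp: openin_Euclidean_space)
  obtain e where e: "e > 0" "\<And>y. (\<forall>i. \<bar>y i - x i\<bar> < e) \<Longrightarrow> y \<in> T"
    using open_function_box[of T x] T assms(2) by auto
  have "y \<in> S" if "\<forall>i<d. \<bar>y i - x i\<bar> < e" "\<forall>i\<ge>d. y i = 0" for y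
  proof -
    have "\<bar>y i - x i\<bar> < e" for i
      using that e(1) openin_Euclidean_space_zero[OF assms, of i] by (cases "i < d") auto
    then show ?thesis using e(2) that T(2) by auto
  qed
  then show ?thesis using that e(1) by blast
qed

lemma openin_Euclidean_space_preimage:
  assumes S: "openin (Euclidean_space d) S" and "continuous_on S F" "open T"
  shows "openin (Euclidean_space d) (S \<inter> F -` T)"
proof -
  have "openin (top_of_set S) (S \<inter> F -` T)"
    by (rule continuous_openin_preimage_gen[OF assms(2,3)])
  then have "openin (subtopology (Euclidean_space d) S) (S \<inter> F -` T)"
    by (simp only: subtopology_Euclidean_space[OF S])
  then show ?thesis by (rule openin_trans_full[OF _ S])
qed

lemma continuous_on_Euclidean_space_box:
  fixes F :: "(nat \<Rightarrow> real) \<Rightarrow> real"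
  assumes S: "openin (Euclidean_space d) S" and x: "x \<in> S" and F: "continuous_on S F" "F x < \<epsilon>"
  obtains e where "e > 0"
    "\<And>y. (\<forall>i<d. \<bar>y i - x i\<bar> < e) \<Longrightarrow> (\<forall>i\<ge>d. y i = 0) \<Longrightarrow> y \<in> S \<and> F y < \<epsilon>"
proof -
  have "openin (Euclidean_space d) (S \<inter> F -` {..<\<epsilon>})"
    by (rule openin_Euclidean_space_preimage[OF S F(1)]) simp
  moreover have "x \<in> S \<inter> F -` {..<\<epsilon>}" using x F(2) by simp
  ultimately show ?thesis
    by (rule Euclidean_space_box) (use that in auto)
qed

lemma eventually_fun_upd_in:
  assumes "openin (Euclidean_space d) S" "x \<in> S" "i < d"
  shows "\<forall>\<^sub>F t in nhds (x i). x(i := t) \<in> S"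
proof -
  obtain e where e: "e > 0" "\<And>y. (\<forall>i<d. \<bar>y i - x i\<bar> < e) \<Longrightarrow> (\<forall>i\<ge>d. y i = 0) \<Longrightarrow> y \<in> S"
    using Euclidean_space_box[OF assms(1,2)] by metis
  show ?thesis
    unfolding eventually_nhds_metric
  proof (intro exI[of _ e] conjI allI impI)
    fix t assume "dist t (x i) < e"
    then show "x(i := t) \<in> S"
      using e assms openin_Euclidean_space_zero[OF assms(1,2)] by (intro e(2)) (auto simp: dist_real_def)
  qed (use e in auto)
qed

section \<open>Functions of class C^k with values in a normed space\<close>

text \<open>Vector-valued counterpart of \<open>coord_Ck_on\<close>: parametrizations take values in
  the ambient space and branches of roots in the complex numbers, and neither has to be split into
  real components.\<close>

primrec Ck_on :: "nat \<Rightarrow> nat \<Rightarrow> (nat \<Rightarrow> real) set \<Rightarrow> ((nat \<Rightarrow> real) \<Rightarrow> 'b::real_normed_vector) \<Rightarrow> bool" where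
  "Ck_on d 0 S f \<longleftrightarrow> continuous_on S f"
| "Ck_on d (Suc k) S f \<longleftrightarrow> continuous_on S f \<and>
     (\<forall>i<d. \<exists>f'. (\<forall>x\<in>S. ((\<lambda>t. f (x(i := t))) has_vector_derivative f' x) (at (x i))) \<and>
                 Ck_on d k S f')"

definition smooth_on :: "nat \<Rightarrow> (nat \<Rightarrow> real) set \<Rightarrow> ((nat \<Rightarrow> real) \<Rightarrow> 'b::real_normed_vector) \<Rightarrow> bool" where
  "smooth_on d S f \<longleftrightarrow> (\<forall>k. Ck_on d k S f)"

lemma coord_Ck_on_iff:
  assumes "openin (Euclidean_space d) S"
  shows "coord_Ck_on d k S f \<longleftrightarrow> Ck_on d k S f"
  by (induction k arbitrary: f)
     (simp_all add: subtopology_Euclidean_space[OF assms] has_real_derivative_iff_has_vector_derivative)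

lemma coord_smooth_on_iff:
  "openin (Euclidean_space d) S \<Longrightarrow> coord_smooth_on d S f \<longleftrightarrow> smooth_on d S f"
  by (simp add: coord_smooth_on_def smooth_on_def coord_Ck_on_iff)

lemma Ck_on_continuous: "Ck_on d k S f \<Longrightarrow> continuous_on S f"
  by (cases k) auto

lemma Ck_on_Suc: "Ck_on d (Suc k) S f \<Longrightarrow> Ck_on d k S f"
proof (induction k arbitrary: f)
  case (Suc k)
  then show ?case by (simp only: Ck_on.simps(2)) blast
qed auto

lemma Ck_on_subset: "Ck_on d k S f \<Longrightarrow> T \<subseteq> S \<Longrightarrow> Ck_on d k T f"
proof (induction k arbitrary: f)
  case (Suc k)
  then show ?case
    by (simp add: subset_iff) (meson continuous_on_subset subsetI)
qed (auto intro: continuous_on_subset)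

lemma Ck_on_cong:
  assumes S: "openin (Euclidean_space d) S"
  shows "Ck_on d k S f \<Longrightarrow> (\<And>x. x \<in> S \<Longrightarrow> f x = g x) \<Longrightarrow> Ck_on d k S g"
proof (induction k arbitrary: f g)
  case 0
  then show ?case by (metis Ck_on.simps(1) continuous_on_cong)
next
  case (Suc k)
  have cont: "continuous_on S g" using Suc.prems by (metis Ck_on.simps(2) continuous_on_cong)
  show ?case
    unfolding Ck_on.simps
  proof (intro conjI cont allI impI)
    fix i assume i: "i < d"
    then obtain f' where f': "\<forall>x\<in>S. ((\<lambda>t. f (x(i := t))) has_vector_derivative f' x) (at (x i))" "Ck_on d k S f'"
      using Suc.prems(1) unfolding Ck_on.simps by blast
    have "((\<lambda>t. g (x(i := t))) has_vector_derivative f' x) (at (x i))" if "x \<in> S" for x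
    proof -
      \<comment> \<open>Openness of \<open>S\<close> keeps \<open>x(i := t)\<close> in
        \<open>S\<close> for \<open>t\<close> near \<open>x i\<close>, so agreement on
        \<open>S\<close> passes to the derivatives.\<close>
      have "\<forall>\<^sub>F t in at (x i). f (x(i := t)) = g (x(i := t))"
        using eventually_nhds_conv_at[THEN iffD1, OF eventually_fun_upd_in[OF S that i], THEN conjunct1]
        by (rule eventually_mono) (rule Suc.prems(2))
      then show ?thesis
        using has_derivative_transform_eventually[OF f'(1)[rule_format, OF that, unfolded has_vector_derivative_def], of "\<lambda>t. g (x(i := t))"]
          Suc.prems(2)[OF that] unfolding has_vector_derivative_def by simp
    qed
    then show "\<exists>f'. (\<forall>x\<in>S. ((\<lambda>t. g (x(i := t))) has_vector_derivative f' x) (at (x i))) \<and> Ck_on d k S f'"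
      using f'(2) by blast
  qed
qed

lemma Ck_on_const: "Ck_on d k S (\<lambda>x. c)"
proof (induction k arbitrary: c)
  case (Suc k)
  then show ?case by (auto intro!: exI[of _ "\<lambda>x. 0"])
qed auto

lemma Ck_on_linear:
  assumes L: "bounded_linear L"
  shows "Ck_on d k S f \<Longrightarrow> Ck_on d k S (\<lambda>x. L (f x))"
proof (induction k arbitrary: f)
  case 0
  then show ?case using bounded_linear.continuous_on[OF L] by simp
next
  case (Suc k)
  show ?case
    unfolding Ck_on.simps
  proof (intro conjI allI impI)
    show "continuous_on S (\<lambda>x. L (f x))" by (rule bounded_linear.continuous_on[OF L Ck_on_continuous[OF Suc.prems]])
    fix i assume "i < d"
    then obtain f' where f': "\<forall>x\<in>S. ((\<lambda>t. f (x(i := t))) has_vector_derivative f' x) (at (x i))" "Ck_on d k S f'"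
      using Suc.prems(1) unfolding Ck_on.simps by blast
    then show "\<exists>f'. (\<forall>x\<in>S. ((\<lambda>t. L (f (x(i := t)))) has_vector_derivative f' x) (at (x i))) \<and> Ck_on d k S f'"
      using Suc.IH[OF f'(2)] bounded_linear.has_vector_derivative[OF L f'(1)[rule_format]]
      by (intro exI[of _ "\<lambda>x. L (f' x)"] conjI ballI)
  qed
qed

lemma Ck_on_add: "Ck_on d k S f \<Longrightarrow> Ck_on d k S g \<Longrightarrow> Ck_on d k S (\<lambda>x. f x + g x)"
proof (induction k arbitrary: f g)
  case (Suc k)
  show ?case
    unfolding Ck_on.simps
  proof (intro conjI allI impI)
    show "continuous_on S (\<lambda>x. f x + g x)" using Suc.prems by (auto intro: continuous_on_add)
    fix i assume i: "i < d"
    then obtain f' where f': "\<forall>x\<in>S. ((\<lambda>t. f (x(i := t))) has_vector_derivative f' x) (at (x i))" "Ck_on d k S f'"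
      using Suc.prems(1) unfolding Ck_on.simps by blast
    obtain g' where g': "\<forall>x\<in>S. ((\<lambda>t. g (x(i := t))) has_vector_derivative g' x) (at (x i))" "Ck_on d k S g'"
      using Suc.prems(2) i unfolding Ck_on.simps by blast
    show "\<exists>h. (\<forall>x\<in>S. ((\<lambda>t. f (x(i := t)) + g (x(i := t))) has_vector_derivative h x) (at (x i))) \<and> Ck_on d k S h"
    proof (intro exI[of _ "\<lambda>x. f' x + g' x"] conjI ballI)
      fix x assume x: "x \<in> S"
      show "((\<lambda>t. f (x(i := t)) + g (x(i := t))) has_vector_derivative f' x + g' x) (at (x i))"
        by (rule has_vector_derivative_add[OF f'(1)[rule_format, OF x] g'(1)[rule_format, OF x]])
    qed (rule Suc.IH[OF f'(2) g'(2)])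
  qed
qed (auto intro: continuous_on_add)

text \<open>One Leibniz rule for algebra products and inner products alike. Each summand of the
  derivative keeps one undifferentiated factor, which is still of class C^k by
  \<open>Ck_on_Suc\<close>.\<close>

lemma Ck_on_bilinear:
  assumes B: "bounded_bilinear B"
  shows "Ck_on d k S f \<Longrightarrow> Ck_on d k S g \<Longrightarrow> Ck_on d k S (\<lambda>x. B (f x) (g x))"
proof (induction k arbitrary: f g)
  case 0
  then show ?case using bounded_bilinear.continuous_on[OF B] by simp
next
  case (Suc k)
  show ?case
    unfolding Ck_on.simps
  proof (intro conjI allI impI)
    show "continuous_on S (\<lambda>x. B (f x) (g x))"
      by (rule bounded_bilinear.continuous_on[OF B Ck_on_continuous[OF Suc.prems(1)] Ck_on_continuous[OF Suc.prems(2)]])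
    fix i assume i: "i < d"
    then obtain f' where f': "\<forall>x\<in>S. ((\<lambda>t. f (x(i := t))) has_vector_derivative f' x) (at (x i))" "Ck_on d k S f'"
      using Suc.prems(1) unfolding Ck_on.simps by blast
    obtain g' where g': "\<forall>x\<in>S. ((\<lambda>t. g (x(i := t))) has_vector_derivative g' x) (at (x i))" "Ck_on d k S g'"
      using Suc.prems(2) i unfolding Ck_on.simps by blast
    have "Ck_on d k S (\<lambda>x. B (f x) (g' x) + B (f' x) (g x))"
      by (rule Ck_on_add[OF Suc.IH[OF Ck_on_Suc[OF Suc.prems(1)] g'(2)] Suc.IH[OF f'(2) Ck_on_Suc[OF Suc.prems(2)]]])
    moreover have "((\<lambda>t. B (f (x(i := t))) (g (x(i := t)))) has_vector_derivative B (f x) (g' x) + B (f' x) (g x)) (at (x i))"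
      if "x \<in> S" for x
      using bounded_bilinear.has_vector_derivative[OF B f'(1)[rule_format, OF that] g'(1)[rule_format, OF that]] by simp
    ultimately show "\<exists>h. (\<forall>x\<in>S. ((\<lambda>t. B (f (x(i := t))) (g (x(i := t)))) has_vector_derivative h x) (at (x i))) \<and> Ck_on d k S h"
      by (intro exI[of _ "\<lambda>x. B (f x) (g' x) + B (f' x) (g x)"] conjI ballI)
  qed
qed

lemma smooth_on_continuous: "smooth_on d S f \<Longrightarrow> continuous_on S f"
  using Ck_on_continuous smooth_on_def by blast

lemma smooth_on_subset: "smooth_on d S f \<Longrightarrow> T \<subseteq> S \<Longrightarrow> smooth_on d T f"
  unfolding smooth_on_def using Ck_on_subset by blast

lemma smooth_on_cong:
  "openin (Euclidean_space d) S \<Longrightarrow> smooth_on d S f \<Longrightarrow> (\<And>x. x \<in> S \<Longrightarrow> f x = g x) \<Longrightarrow> smooth_on d S g"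
  unfolding smooth_on_def using Ck_on_cong by blast

lemma smooth_on_const [simp, intro]: "smooth_on d S (\<lambda>x. c)"
  by (simp add: smooth_on_def Ck_on_const)

lemma smooth_on_linear: "bounded_linear L \<Longrightarrow> smooth_on d S f \<Longrightarrow> smooth_on d S (\<lambda>x. L (f x))"
  by (simp add: smooth_on_def Ck_on_linear)

lemma smooth_on_add [intro]: "smooth_on d S f \<Longrightarrow> smooth_on d S g \<Longrightarrow> smooth_on d S (\<lambda>x. f x + g x)"
  by (simp add: smooth_on_def Ck_on_add)

lemma smooth_on_bilinear:
  "bounded_bilinear B \<Longrightarrow> smooth_on d S f \<Longrightarrow> smooth_on d S g \<Longrightarrow> smooth_on d S (\<lambda>x. B (f x) (g x))"
  by (simp add: smooth_on_def Ck_on_bilinear)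

lemma smooth_on_mult [intro]:
  fixes f g :: "_ \<Rightarrow> 'b::real_normed_algebra"
  shows "smooth_on d S f \<Longrightarrow> smooth_on d S g \<Longrightarrow> smooth_on d S (\<lambda>x. f x * g x)"
  by (rule smooth_on_bilinear[OF bounded_bilinear_mult])

lemma smooth_on_uminus [intro]: "smooth_on d S f \<Longrightarrow> smooth_on d S (\<lambda>x. - f x)"
  by (rule smooth_on_linear[OF bounded_linear_minus[OF bounded_linear_ident]])

lemma smooth_on_diff [intro]: "smooth_on d S f \<Longrightarrow> smooth_on d S g \<Longrightarrow> smooth_on d S (\<lambda>x. f x - g x)"
  using smooth_on_add[of d S f "\<lambda>x. - g x"] by auto

lemma smooth_on_power [intro]:
  fixes f :: "_ \<Rightarrow> 'b::{real_normed_algebra,monoid_mult}"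
  shows "smooth_on d S f \<Longrightarrow> smooth_on d S (\<lambda>x. f x ^ n)"
  by (induction n) auto

lemma smooth_on_Pair [intro]:
  assumes "smooth_on d S f" "smooth_on d S g"
  shows "smooth_on d S (\<lambda>x. (f x, g x))"
proof -
  have "bounded_linear (\<lambda>x. (x, 0))" "bounded_linear (\<lambda>x. (0, x))"
    by (auto intro: bounded_linear_Pair bounded_linear_ident bounded_linear_zero)
  from smooth_on_add[OF smooth_on_linear[OF this(1) assms(1)] smooth_on_linear[OF this(2) assms(2)]]
  show ?thesis by simp
qed

lemma smooth_on_coordinate [intro]: "smooth_on d S (\<lambda>x. x i :: real)"
proof -
  have cont: "continuous_on S (\<lambda>x::nat \<Rightarrow> real. x i)"
    by (rule continuous_on_subset[OF continuous_on_product_coordinates]) auto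
  have "Ck_on d k S (\<lambda>x. x i)" for k
  proof (cases k)
    case (Suc l)
    show ?thesis
      unfolding Suc Ck_on.simps
    proof (intro conjI allI impI cont)
      fix j
      have "((\<lambda>t. (x(j := t)) i) has_vector_derivative (if i = j then 1 else 0)) (at (x j))" for x :: "nat \<Rightarrow> real"
        by (cases "i = j") simp_all
      then show "\<exists>f'. (\<forall>x\<in>S. ((\<lambda>t. (x(j := t)) i) has_vector_derivative f' x) (at (x j))) \<and> Ck_on d l S f'"
        by (intro exI[of _ "\<lambda>x. if i = j then 1 else 0"] conjI ballI Ck_on_const)
    qed
  qed (use cont in auto)
  then show ?thesis by (simp add: smooth_on_def)
qed

definition partial :: "nat \<Rightarrow> ((nat \<Rightarrow> real) \<Rightarrow> 'b::real_normed_vector) \<Rightarrow> (nat \<Rightarrow> real) \<Rightarrow> 'b" where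
  "partial i f x = vector_derivative (\<lambda>t. f (x(i := t))) (at (x i))"

lemma smooth_on_has_partial:
  assumes "smooth_on d S f" "i < d" "x \<in> S"
  shows "((\<lambda>t. f (x(i := t))) has_vector_derivative partial i f x) (at (x i))"
proof -
  have "Ck_on d (Suc 0) S f" using assms(1) unfolding smooth_on_def by blast
  then obtain f' where "((\<lambda>t. f (x(i := t))) has_vector_derivative f' x) (at (x i))"
    using assms(2,3) unfolding Ck_on.simps by blast
  then show ?thesis unfolding partial_def using vector_derivative_at by metis
qed

lemma smooth_on_partial:
  assumes S: "openin (Euclidean_space d) S" and f: "smooth_on d S f" and i: "i < d"
  shows "smooth_on d S (partial i f)"
  unfolding smooth_on_def
proof
  fix k
  have "Ck_on d (Suc k) S f" using f unfolding smooth_on_def by blast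
  then obtain f' where f': "\<forall>x\<in>S. ((\<lambda>t. f (x(i := t))) has_vector_derivative f' x) (at (x i))" "Ck_on d k S f'"
    using i unfolding Ck_on.simps by blast
  show "Ck_on d k S (partial i f)"
    unfolding partial_def by (rule Ck_on_cong[OF S f'(2)]) (use f'(1) vector_derivative_at in metis)
qed

lemma coord_partial_eq: "coord_partial i f x = partial i f x"
  unfolding coord_partial_def partial_def deriv_def vector_derivative_def
  by (simp add: has_real_derivative_iff_has_vector_derivative)


section \<open>Differentiability from continuous partial derivatives, and the chain rule\<close>

text \<open>The coordinates are changed one at a time. On a small box the continuous partial
  derivatives stay within \<epsilon> of their values at \<open>x\<close>, so each change contributes
  an error of at most \<epsilon> times its length.\<close>

lemma partial_increment:
  assumes S: "openin (Euclidean_space d) S" and f: "smooth_on d S f" and x: "x \<in> S" and "\<epsilon> > 0"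
  obtains e where "e > 0"
    "\<And>y. (\<forall>i<d. \<bar>y i - x i\<bar> < e) \<Longrightarrow> (\<forall>i\<ge>d. y i = 0) \<Longrightarrow>
       y \<in> S \<and> norm (f y - f x - (\<Sum>i<d. (y i - x i) *\<^sub>R partial i f x)) \<le> \<epsilon> * (\<Sum>i<d. \<bar>y i - x i\<bar>)"
proof -
  define F where "F y = (\<Sum>i<d. norm (partial i f y - partial i f x))" for y
  have "continuous_on S F"
    unfolding F_def using smooth_on_continuous[OF smooth_on_partial[OF S f]] by (intro continuous_intros) auto
  moreover have "F x < \<epsilon>" using \<open>\<epsilon> > 0\<close> by (simp add: F_def)
  ultimately obtain e where e: "e > 0"
    "\<And>y. (\<forall>i<d. \<bar>y i - x i\<bar> < e) \<Longrightarrow> (\<forall>i\<ge>d. y i = 0) \<Longrightarrow> y \<in> S \<and> F y < \<epsilon>"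
    using continuous_on_Euclidean_space_box[OF S x] by metis
  have near: "norm (partial i f y - partial i f x) \<le> \<epsilon>"
    if "\<forall>i<d. \<bar>y i - x i\<bar> < e" "\<forall>i\<ge>d. y i = 0" "i < d" for y i
  proof -
    have "norm (partial i f y - partial i f x) \<le> F y"
      unfolding F_def using that(3)
      by (intro member_le_sum[where f = "\<lambda>i. norm (partial i f y - partial i f x)"]) auto
    then show ?thesis using e(2)[OF that(1,2)] by simp
  qed
  have x0: "\<forall>i\<ge>d. x i = 0" using openin_Euclidean_space_zero[OF S x] by blast
  have main: "norm (f y - f x - (\<Sum>i<k. (y i - x i) *\<^sub>R partial i f x)) \<le> \<epsilon> * (\<Sum>i<k. \<bar>y i - x i\<bar>)"
    if "k \<le> d" "\<forall>i<d. \<bar>y i - x i\<bar> < e" "\<forall>i\<ge>d. y i = 0" "\<forall>i\<ge>k. y i = x i" for k y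
    using that
  proof (induction k arbitrary: y)
    case 0
    then have "y = x" by auto
    then show ?case by simp
  next
    case (Suc k)
    \<comment> \<open>Resetting coordinate \<open>k\<close> leaves a point that differs from
      \<open>x\<close> only in coordinates below \<open>k\<close>, as the induction hypothesis
      requires.\<close>
    define z where "z = y(k := x k)"
    have "norm (f z - f x - (\<Sum>i<k. (z i - x i) *\<^sub>R partial i f x)) \<le> \<epsilon> * (\<Sum>i<k. \<bar>z i - x i\<bar>)"
      using Suc.prems x0 \<open>e > 0\<close> by (intro Suc.IH) (auto simp: z_def Suc_le_eq)
    then have 1: "norm (f z - f x - (\<Sum>i<k. (y i - x i) *\<^sub>R partial i f x)) \<le> \<epsilon> * (\<Sum>i<k. \<bar>y i - x i\<bar>)"
      by (simp add: z_def)
    \<comment> \<open>With the linear part subtracted, the derivative of \<open>h\<close> is small,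
      and the mean value inequality bounds the error itself.\<close>
    define h where "h t = f (y(k := t)) - t *\<^sub>R partial k f x" for t
    have "norm (h (y k) - h (x k)) \<le> \<epsilon> * norm (y k - x k)"
    proof (rule differentiable_bound[where S = "closed_segment (x k) (y k)"
          and f' = "\<lambda>t s. s *\<^sub>R (partial k f (y(k := t)) - partial k f x)"])
      fix t assume t: "t \<in> closed_segment (x k) (y k)"
      have "\<bar>t - x k\<bar> \<le> \<bar>y k - x k\<bar>"
        using t by (auto simp: closed_segment_eq_real_ivl split: if_splits)
      then have "\<bar>t - x k\<bar> < e"
        using Suc.prems(2)[rule_format, OF Suc_le_lessD[OF Suc.prems(1)]] by linarith
      then have yt: "\<forall>i<d. \<bar>(y(k := t)) i - x i\<bar> < e" "\<forall>i\<ge>d. (y(k := t)) i = 0"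
        using Suc.prems(1-3) by auto
      have "y(k := t) \<in> S" using e(2)[of "y(k := t)"] yt by blast
      from smooth_on_has_partial[OF f _ this, of k] Suc.prems(1)
      have "((\<lambda>t. f (y(k := t))) has_vector_derivative partial k f (y(k := t))) (at t)"
        by simp
      then have "(h has_vector_derivative partial k f (y(k := t)) - partial k f x) (at t)"
        unfolding h_def by (auto intro!: derivative_eq_intros)
      then show "(h has_derivative (\<lambda>s. s *\<^sub>R (partial k f (y(k := t)) - partial k f x)))
          (at t within closed_segment (x k) (y k))"
        using has_derivative_at_withinI has_vector_derivative_def by blast
      show "onorm (\<lambda>s::real. s *\<^sub>R (partial k f (y(k := t)) - partial k f x)) \<le> \<epsilon>"
        using near[of "y(k := t)", OF yt, of k] Suc.prems(1) \<open>\<epsilon> > 0\<close>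
        by (intro onorm_bound) (auto simp: mult.commute[of \<epsilon>] intro!: mult_left_mono)
    qed auto
    moreover have "h (y k) - h (x k) = f y - f z - (y k - x k) *\<^sub>R partial k f x"
      by (simp add: h_def z_def algebra_simps)
    ultimately have "norm (f y - f z - (y k - x k) *\<^sub>R partial k f x) \<le> \<epsilon> * \<bar>y k - x k\<bar>" by simp
    with 1 have "norm ((f z - f x - (\<Sum>i<k. (y i - x i) *\<^sub>R partial i f x)) + (f y - f z - (y k - x k) *\<^sub>R partial k f x))
        \<le> \<epsilon> * (\<Sum>i<k. \<bar>y i - x i\<bar>) + \<epsilon> * \<bar>y k - x k\<bar>"
      by (meson norm_triangle_mono)
    then show ?case by (simp add: algebra_simps)
  qed
  show ?thesis
  proof (rule that[of e])
    fix y assume y: "\<forall>i<d. \<bar>y i - x i\<bar> < e" "\<forall>i\<ge>d. y i = 0"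
    then show "y \<in> S \<and> norm (f y - f x - (\<Sum>i<d. (y i - x i) *\<^sub>R partial i f x)) \<le> \<epsilon> * (\<Sum>i<d. \<bar>y i - x i\<bar>)"
      using e(2)[OF y] main[of d y] x0 by auto
  qed (use e in auto)
qed

text \<open>Every coordinate of the curve moves by O(|t - t0|), so the error in
  \<open>partial_increment\<close> is o(|t - t0|). The set \<open>T\<close> makes the rule available
  at the end points of an interval.\<close>

lemma has_vector_derivative_along_curve:
  assumes S: "openin (Euclidean_space d) S" and f: "smooth_on d S f"
    and t0: "c t0 \<in> S" and ev: "\<forall>\<^sub>F t in at t0 within T. c t \<in> S"
    and c: "\<And>i. i < d \<Longrightarrow> ((\<lambda>t. c t i) has_real_derivative v i) (at t0 within T)"
  shows "((\<lambda>t. f (c t)) has_vector_derivative (\<Sum>i<d. v i *\<^sub>R partial i f (c t0))) (at t0 within T)"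
proof -
  define R where "R t = f (c t) - f (c t0) - (\<Sum>i<d. (c t i - c t0 i) *\<^sub>R partial i f (c t0))" for t
  have lin: "((\<lambda>t. f (c t0) + (\<Sum>i<d. (c t i - c t0 i) *\<^sub>R partial i f (c t0))) has_vector_derivative
      (\<Sum>i<d. v i *\<^sub>R partial i f (c t0))) (at t0 within T)"
  proof -
    have "((\<lambda>t. (\<Sum>i<d. (c t i - c t0 i) *\<^sub>R partial i f (c t0))) has_vector_derivative
      (\<Sum>i<d. v i *\<^sub>R partial i f (c t0))) (at t0 within T)"
    proof (rule has_vector_derivative_sum)
      fix i assume "i \<in> {..<d}"
      then have "((\<lambda>t. c t i - c t0 i) has_real_derivative v i) (at t0 within T)"
        using c[of i] by (auto intro!: derivative_eq_intros)
      then have "((\<lambda>t. (c t i - c t0 i)) has_vector_derivative v i) (at t0 within T)"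
        by (simp add: has_real_derivative_iff_has_vector_derivative)
      from bounded_linear.has_vector_derivative[OF bounded_linear_scaleR_left this]
      show "((\<lambda>t. (c t i - c t0 i) *\<^sub>R partial i f (c t0)) has_vector_derivative v i *\<^sub>R partial i f (c t0)) (at t0 within T)" .
    qed
    from has_vector_derivative_add[OF has_vector_derivative_const[of "f (c t0)"] this] show ?thesis
      by (simp only: add_0_left)
  qed
  \<comment> \<open>The sum collects Lipschitz constants of the coordinates at \<open>t0\<close>;
    the leading 1 keeps \<open>K\<close> positive even for \<open>d = 0\<close>.\<close>
  define K where "K = 1 + (\<Sum>i<d. \<bar>v i\<bar> + 1)"
  have "K > 0" unfolding K_def by (rule add_pos_nonneg) (auto intro!: sum_nonneg)
  have lip: "\<forall>\<^sub>F t in at t0 within T. (\<forall>i<d. \<bar>c t i - c t0 i\<bar> \<le> (\<bar>v i\<bar> + 1) * \<bar>t - t0\<bar>)"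
  proof -
    have "\<forall>\<^sub>F t in at t0 within T. \<bar>c t i - c t0 i\<bar> \<le> (\<bar>v i\<bar> + 1) * \<bar>t - t0\<bar>" if "i < d" for i
    proof -
      have "\<forall>\<^sub>F t in at t0 within T. norm (c t i - c t0 i - v i * (t - t0)) \<le> 1 * norm (t - t0)"
        using c[OF that, unfolded has_field_derivative_def has_derivative_within_alt2, THEN conjunct2]
          zero_less_one by blast
      then show ?thesis
      proof eventually_elim
        case (elim t)
        have "\<bar>c t i - c t0 i\<bar> \<le> \<bar>c t i - c t0 i - v i * (t - t0)\<bar> + \<bar>v i * (t - t0)\<bar>" by linarith
        moreover have "\<bar>c t i - c t0 i - v i * (t - t0)\<bar> \<le> \<bar>t - t0\<bar>" using elim by simp
        moreover have "\<bar>v i * (t - t0)\<bar> = \<bar>v i\<bar> * \<bar>t - t0\<bar>" by (rule abs_mult)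
        ultimately show ?case unfolding distrib_right by linarith
      qed
    qed
    then have "\<forall>\<^sub>F t in at t0 within T. \<forall>i\<in>{..<d}. \<bar>c t i - c t0 i\<bar> \<le> (\<bar>v i\<bar> + 1) * \<bar>t - t0\<bar>"
      by (intro eventually_ball_finite) auto
    then show ?thesis by (simp only: Ball_def lessThan_iff)
  qed
  have "(R has_derivative (\<lambda>h. 0)) (at t0 within T)"
    unfolding has_derivative_within_alt2
  proof (intro conjI allI impI)
    fix \<epsilon> :: real assume "\<epsilon> > 0"
    then have "\<epsilon> / K > 0" using \<open>K > 0\<close> by simp
    obtain e where e: "e > 0"
      "\<And>y. (\<forall>i<d. \<bar>y i - c t0 i\<bar> < e) \<Longrightarrow> (\<forall>i\<ge>d. y i = 0) \<Longrightarrow>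
       y \<in> S \<and> norm (f y - f (c t0) - (\<Sum>i<d. (y i - c t0 i) *\<^sub>R partial i f (c t0))) \<le> \<epsilon> / K * (\<Sum>i<d. \<bar>y i - c t0 i\<bar>)"
      by (rule partial_increment[OF S f t0 \<open>\<epsilon> / K > 0\<close>]) (rule that; assumption)
    have "\<forall>\<^sub>F t in at t0 within T. K * \<bar>t - t0\<bar> < e"
    proof -
      have "((\<lambda>t. K * \<bar>t - t0\<bar>) \<longlongrightarrow> K * \<bar>t0 - t0\<bar>) (at t0 within T)"
        by (intro tendsto_intros)
      then show ?thesis using e(1) by (simp add: order_tendstoD(2))
    qed
    then show "\<forall>\<^sub>F t in at t0 within T. norm (R t - R t0 - 0) \<le> \<epsilon> * norm (t - t0)"
      using lip ev
    proof eventually_elim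
      case (elim t)
      have le: "(\<Sum>i<d. \<bar>c t i - c t0 i\<bar>) \<le> K * \<bar>t - t0\<bar>"
      proof -
        have "(\<Sum>i<d. \<bar>c t i - c t0 i\<bar>) \<le> (\<Sum>i<d. (\<bar>v i\<bar> + 1) * \<bar>t - t0\<bar>)"
          using elim(2) by (intro sum_mono) auto
        also have "\<dots> = (\<Sum>i<d. \<bar>v i\<bar> + 1) * \<bar>t - t0\<bar>" by (simp add: sum_distrib_right)
        also have "\<dots> \<le> K * \<bar>t - t0\<bar>" unfolding K_def by (intro mult_right_mono) auto
        finally show ?thesis .
      qed
      have "\<bar>c t i - c t0 i\<bar> < e" if "i < d" for i
      proof -
        have "\<bar>c t i - c t0 i\<bar> \<le> (\<Sum>i<d. \<bar>c t i - c t0 i\<bar>)"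
          using that by (intro member_le_sum[where f = "\<lambda>i. \<bar>c t i - c t0 i\<bar>"]) auto
        then show ?thesis using le elim(1) by linarith
      qed
      then have "norm (R t) \<le> \<epsilon> / K * (\<Sum>i<d. \<bar>c t i - c t0 i\<bar>)"
        using e(2)[of "c t"] openin_Euclidean_space_zero[OF S elim(3)] unfolding R_def by blast
      also have "\<dots> \<le> \<epsilon> / K * (K * \<bar>t - t0\<bar>)" using le \<open>\<epsilon> / K > 0\<close> by (intro mult_left_mono) auto
      also have "\<dots> = \<epsilon> * \<bar>t - t0\<bar>" using \<open>K > 0\<close> by simp
      finally show ?case by (simp add: R_def)
    qed
  qed auto
  then have "(R has_vector_derivative 0) (at t0 within T)"
    by (simp add: has_vector_derivative_def)
  from has_vector_derivative_add[OF lin this] show ?thesis by (simp add: R_def)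
qed

section \<open>Submanifolds of a Euclidean space with the induced metric\<close>

text \<open>Functions on the whole ambient space that may serve as chart coordinates. Preservation
  of smoothness under composition makes transition maps smooth; the local Lipschitz bound gives
  continuity, the immersion property and control of coordinate differences by Euclidean
  distances.\<close>

definition smooth_fun :: "nat \<Rightarrow> ('m::euclidean_space \<Rightarrow> real) \<Rightarrow> bool" where
  "smooth_fun d q \<longleftrightarrow>
     (\<forall>p. \<exists>e>0. \<exists>K. \<forall>p'\<in>ball p e. \<forall>p''\<in>ball p e. \<bar>q p' - q p''\<bar> \<le> K * dist p' p'') \<and>
     (\<forall>S f. openin (Euclidean_space d) S \<longrightarrow> smooth_on d S f \<longrightarrow> smooth_on d S (\<lambda>u. q (f u)))"

lemma smooth_fun_continuous:
  assumes "smooth_fun d q"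
  shows "continuous_on UNIV q"
proof -
  have "isCont q p" for p
  proof -
    obtain e K where eK: "e > 0" "\<And>p' p''. p' \<in> ball p e \<Longrightarrow> p'' \<in> ball p e \<Longrightarrow> \<bar>q p' - q p''\<bar> \<le> K * dist p' p''"
      using assms unfolding smooth_fun_def by meson
    have "((\<lambda>p'. K * dist p' p) \<longlongrightarrow> K * dist p p) (at p)" by (intro tendsto_intros)
    then have lim: "((\<lambda>p'. K * dist p' p) \<longlongrightarrow> 0) (at p)" by simp
    have ev: "\<forall>\<^sub>F p' in at p. norm (q p' - q p) \<le> K * dist p' p"
      unfolding eventually_at using eK by (intro exI[of _ e]) (auto simp: dist_commute)
    show ?thesis
      unfolding isCont_def by (rule LIM_zero_cancel) (rule Lim_null_comparison[OF ev lim])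
  qed
  then show ?thesis by (simp add: continuous_on_eq_continuous_at)
qed

text \<open>A chart whose coordinates extend to the ambient space and whose inverse is a smooth
  parametrization into it. Any two such charts are automatically compatible, so all of them together
  can form the atlas.\<close>

definition good_chart :: "'m::euclidean_space set \<Rightarrow> nat \<Rightarrow> 'm chart \<Rightarrow> bool" where
  "good_chart M d = (\<lambda>(U, \<phi>).
     openin (top_of_set M) U \<and> inj_on \<phi> U \<and> openin (Euclidean_space d) (\<phi> ` U) \<and>
     smooth_on d (\<phi> ` U) (inv_into U \<phi>) \<and> (\<forall>i<d. smooth_fun d (\<lambda>p. \<phi> p i)))"

text \<open>The first fundamental form of the parametrization inverse to the chart.\<close>

definition induced_metric :: "'m::euclidean_space chart \<Rightarrow> 'm \<Rightarrow> nat \<Rightarrow> nat \<Rightarrow> real" where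
  "induced_metric c p i j =
     partial i (inv_into (fst c) (snd c)) (snd c p) \<bullet> partial j (inv_into (fst c) (snd c)) (snd c p)"

lemma good_chartD:
  assumes "good_chart M d (U, \<phi>)"
  shows "openin (top_of_set M) U" "inj_on \<phi> U" "openin (Euclidean_space d) (\<phi> ` U)"
    "smooth_on d (\<phi> ` U) (inv_into U \<phi>)" "\<And>i. i < d \<Longrightarrow> smooth_fun d (\<lambda>p. \<phi> p i)"
  using assms unfolding good_chart_def by auto

lemma good_chart_continuous:
  assumes "good_chart M d (U, \<phi>)"
  shows "continuous_on U \<phi>"
proof (rule continuous_on_coordinatewise_then_product)
  fix i
  show "continuous_on U (\<lambda>p. \<phi> p i)"
  proof (cases "i < d")
    case True
    then show ?thesis
      using smooth_fun_continuous[OF good_chartD(5)[OF assms]] continuous_on_subset by blast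
  next
    case False
    then have "\<phi> p i = 0" if "p \<in> U" for p
      using openin_Euclidean_space_zero[OF good_chartD(3)[OF assms], of "\<phi> p" i] that by auto
    then show ?thesis by (metis (no_types, lifting) continuous_on_const continuous_on_cong)
  qed
qed

lemma good_chart_inter_image:
  assumes "good_chart M d (U, \<phi>)" "openin (top_of_set M) W"
  shows "openin (Euclidean_space d) (\<phi> ` (U \<inter> W))"
proof -
  obtain T where T: "open T" "W = M \<inter> T" using assms(2) by (auto simp: openin_open)
  have "U \<subseteq> M" using good_chartD(1)[OF assms(1)] openin_imp_subset by blast
  then have "\<phi> ` (U \<inter> W) = \<phi> ` U \<inter> inv_into U \<phi> -` T"
    using T good_chartD(2)[OF assms(1)] by (auto simp: inv_into_f_f)
  then show ?thesis
    using openin_Euclidean_space_preimage[OF good_chartD(3)[OF assms(1)] smooth_on_continuous[OF good_chartD(4)[OF assms(1)]] T(1)]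
    by simp
qed

text \<open>The coordinates of the second chart are defined on the ambient space and may be composed
  with the first parametrization directly.\<close>

lemma good_chart_transition:
  assumes "good_chart M d (U, \<phi>)" "good_chart M d (W, \<psi>)" "k < d"
  shows "smooth_on d (\<phi> ` (U \<inter> W)) (\<lambda>u. \<psi> (inv_into U \<phi> u) k)"
proof -
  have "openin (Euclidean_space d) (\<phi> ` (U \<inter> W))"
    by (rule good_chart_inter_image[OF assms(1) good_chartD(1)[OF assms(2)]])
  moreover have "smooth_on d (\<phi> ` (U \<inter> W)) (inv_into U \<phi>)"
    by (rule smooth_on_subset[OF good_chartD(4)[OF assms(1)]]) auto
  ultimately show ?thesis
    using good_chartD(5)[OF assms(2,3)] unfolding smooth_fun_def by blast
qed

lemma sum_inner_eq_norm_sq: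
  fixes e :: "nat \<Rightarrow> 'm::real_inner"
  shows "(\<Sum>i<d. \<Sum>j<d. (e i \<bullet> e j) * v i * v j) = (norm (\<Sum>i<d. v i *\<^sub>R e i))\<^sup>2"
proof -
  have "(norm (\<Sum>i<d. v i *\<^sub>R e i))\<^sup>2 = (\<Sum>i<d. v i *\<^sub>R e i) \<bullet> (\<Sum>j<d. v j *\<^sub>R e j)"
    by (rule power2_norm_eq_inner)
  also have "\<dots> = (\<Sum>i<d. \<Sum>j<d. (v i *\<^sub>R e i) \<bullet> (v j *\<^sub>R e j))"
    by (simp only: inner_sum_left inner_sum_right) (rule sum.swap)
  also have "\<dots> = (\<Sum>i<d. \<Sum>j<d. (e i \<bullet> e j) * v i * v j)"
    by (intro sum.cong refl) (simp add: algebra_simps)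
  finally show ?thesis ..
qed

lemma eventually_in_chart:
  assumes U: "openin (top_of_set M) U" and \<gamma>: "continuous_on T \<gamma>" "\<gamma> ` T \<subseteq> M" and t: "t \<in> T" "\<gamma> t \<in> U"
  shows "\<forall>\<^sub>F s in at t within T. \<gamma> s \<in> U"
proof -
  obtain W where W: "open W" "U = M \<inter> W" using U by (auto simp: openin_open)
  have "(\<gamma> \<longlongrightarrow> \<gamma> t) (at t within T)" using \<gamma>(1) t(1) by (simp add: continuous_on_def)
  then have "\<forall>\<^sub>F s in at t within T. \<gamma> s \<in> W" using W t(2) by (auto elim: topological_tendstoD)
  moreover have "\<forall>\<^sub>F s in at t within T. s \<in> T" by (auto simp: eventually_at_topological)
  ultimately show ?thesis
    by eventually_elim (use W \<gamma>(2) in auto)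
qed

text \<open>If the derivative in direction \<open>v\<close> vanished, the parametrization would move
  by o(t) along the line through \<open>\<phi> x\<close> with direction \<open>v\<close>. A
  Lipschitz coordinate would then also change by o(t), but coordinate \<open>i\<close> changes by
  \<open>t * v i\<close>.\<close>

lemma good_chart_immersion:
  assumes c: "good_chart M d (U, \<phi>)" and x: "x \<in> U" and v: "\<exists>i<d. v i \<noteq> 0"
  shows "(\<Sum>k<d. v k *\<^sub>R partial k (inv_into U \<phi>) (\<phi> x)) \<noteq> 0"
proof
  let ?\<sigma> = "inv_into U \<phi>"
  assume 0: "(\<Sum>k<d. v k *\<^sub>R partial k ?\<sigma> (\<phi> x)) = 0"
  obtain i where i: "i < d" "v i \<noteq> 0" using v by blast
  note S = good_chartD(3)[OF c]
  have \<phi>x: "\<phi> x \<in> \<phi> ` U" using x by simp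
  define c where "c t = (\<lambda>k. if k < d then \<phi> x k + t * v k else 0)" for t
  have c0: "c 0 = \<phi> x"
    using openin_Euclidean_space_zero[OF S \<phi>x] by (auto simp: c_def fun_eq_iff)
  obtain e where e: "e > 0" "\<And>y. (\<forall>i<d. \<bar>y i - \<phi> x i\<bar> < e) \<Longrightarrow> (\<forall>i\<ge>d. y i = 0) \<Longrightarrow> y \<in> \<phi> ` U"
    using Euclidean_space_box[OF S \<phi>x] by metis
  have ev: "\<forall>\<^sub>F t in at 0. c t \<in> \<phi> ` U"
  proof -
    have "\<forall>\<^sub>F t in at 0. \<bar>t\<bar> * (\<Sum>k<d. \<bar>v k\<bar>) < e"
    proof -
      have "((\<lambda>t. \<bar>t\<bar> * (\<Sum>k<d. \<bar>v k\<bar>)) \<longlongrightarrow> \<bar>0\<bar> * (\<Sum>k<d. \<bar>v k\<bar>)) (at 0)"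
        by (intro tendsto_intros)
      then show ?thesis using e(1) by (simp add: order_tendstoD(2))
    qed
    then show ?thesis
    proof eventually_elim
      case (elim t)
      have "\<bar>t * v k\<bar> < e" if "k < d" for k
      proof -
        have "\<bar>v k\<bar> \<le> (\<Sum>k<d. \<bar>v k\<bar>)"
          using that by (intro member_le_sum[where f = "\<lambda>k. \<bar>v k\<bar>"]) auto
        then have "\<bar>t * v k\<bar> \<le> \<bar>t\<bar> * (\<Sum>k<d. \<bar>v k\<bar>)" by (simp add: abs_mult mult_left_mono)
        with elim show ?thesis by linarith
      qed
      then show ?case by (intro e(2)) (auto simp: c_def)
    qed
  qed
  have der: "((\<lambda>t. ?\<sigma> (c t)) has_vector_derivative (\<Sum>k<d. v k *\<^sub>R partial k ?\<sigma> (c 0))) (at 0)"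
  proof (rule has_vector_derivative_along_curve[OF S good_chartD(4)[OF c]])
    fix k assume "k < d"
    then show "((\<lambda>t. c t k) has_real_derivative v k) (at 0)"
      unfolding c_def by (auto intro!: derivative_eq_intros)
  qed (use c0 \<phi>x ev in auto)
  then have "((\<lambda>t. ?\<sigma> (c t)) has_derivative (\<lambda>h. 0)) (at 0)"
    by (simp add: c0 0 has_vector_derivative_def)
  then have small: "\<forall>\<epsilon>>0. \<forall>\<^sub>F t in at 0. norm (?\<sigma> (c t) - ?\<sigma> (c 0)) \<le> \<epsilon> * norm t"
    unfolding has_derivative_within_alt2 by simp
  have \<sigma>0: "?\<sigma> (c 0) = x" using c0 good_chartD(2)[OF c] x by simp
  obtain r K where rK: "r > 0" "\<And>p' p''. p' \<in> ball x r \<Longrightarrow> p'' \<in> ball x r \<Longrightarrow> \<bar>\<phi> p' i - \<phi> p'' i\<bar> \<le> K * dist p' p''"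
    using good_chartD(5)[OF c i(1)] unfolding smooth_fun_def by meson
  \<comment> \<open>Chosen so that a displacement of \<open>\<epsilon> * \<bar>t\<bar>\<close>
    changes coordinate \<open>i\<close> by at most half of
    \<open>\<bar>t * v i\<bar>\<close>.\<close>
  define \<epsilon> where "\<epsilon> = \<bar>v i\<bar> / (2 * (\<bar>K\<bar> + 1))"
  have \<epsilon>: "\<epsilon> > 0" using i by (simp add: \<epsilon>_def)
  have "((\<lambda>t. ?\<sigma> (c t)) \<longlongrightarrow> ?\<sigma> (c 0)) (at 0)"
    using has_vector_derivative_continuous[OF der] by (simp add: continuous_at)
  then have "\<forall>\<^sub>F t in at 0. ?\<sigma> (c t) \<in> ball x r"
    by (rule topological_tendstoD) (use rK(1) \<sigma>0 in auto)
  moreover have "\<forall>\<^sub>F t::real in at 0. t \<noteq> 0" by (simp add: eventually_neq_at_within)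
  ultimately have "\<forall>\<^sub>F t::real in at 0. False"
    using ev small[rule_format, OF \<epsilon>]
  proof eventually_elim
    case (elim t)
    have "\<phi> (?\<sigma> (c t)) = c t" using elim(3) by (rule f_inv_into_f)
    then have "\<bar>t * v i\<bar> = \<bar>\<phi> (?\<sigma> (c t)) i - \<phi> x i\<bar>" using i by (simp add: c_def)
    also have "\<dots> \<le> K * dist (?\<sigma> (c t)) x" using elim(1) rK by (intro rK(2)) auto
    also have "\<dots> \<le> (\<bar>K\<bar> + 1) * dist (?\<sigma> (c t)) x" by (intro mult_right_mono) auto
    also have "\<dots> \<le> (\<bar>K\<bar> + 1) * (\<epsilon> * \<bar>t\<bar>)"
      using elim(4) \<sigma>0 by (intro mult_left_mono) (auto simp: dist_norm)
    also have "\<dots> = \<bar>v i\<bar> * \<bar>t\<bar> / 2" by (simp add: \<epsilon>_def divide_simps)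
    also have "\<dots> < \<bar>t * v i\<bar>" using i(2) elim(2) by (simp add: abs_mult)
    finally show False by simp
  qed
  then show False by (simp add: trivial_limit_def[symmetric])
qed

lemma has_vector_derivative_transform_eventually:
  assumes "(f has_vector_derivative D) (at x within S)" "\<forall>\<^sub>F t in at x within S. f t = g t"
    "f x = g x" "x \<in> S"
  shows "(g has_vector_derivative D) (at x within S)"
  using has_derivative_transform_eventually assms unfolding has_vector_derivative_def by blast

text \<open>Chain rule for the first parametrization written as the second one after the transition
  map; it yields the transformation law of the metric.\<close>

lemma good_chart_partial_transition:
  assumes c: "good_chart M d (U, \<phi>)" and c': "good_chart M d (W, \<psi>)" and x: "x \<in> U \<inter> W" and i: "i < d"
  shows "partial i (inv_into U \<phi>) (\<phi> x) =
    (\<Sum>k<d. partial i (\<lambda>u. \<psi> (inv_into U \<phi> u) k) (\<phi> x) *\<^sub>R partial k (inv_into W \<psi>) (\<psi> x))"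
proof -
  let ?\<sigma> = "inv_into U \<phi>" and ?\<tau> = "inv_into W \<psi>"
  define c where "c t = \<psi> (?\<sigma> ((\<phi> x)(i := t)))" for t
  have S: "openin (Euclidean_space d) (\<phi> ` (U \<inter> W))"
    by (rule good_chart_inter_image[OF \<open>good_chart M d (U, \<phi>)\<close> good_chartD(1)[OF c']])
  have xS: "\<phi> x \<in> \<phi> ` (U \<inter> W)" using x by blast
  have "\<forall>\<^sub>F t in nhds (\<phi> x i). (\<phi> x)(i := t) \<in> \<phi> ` (U \<inter> W)"
    by (rule eventually_fun_upd_in[OF S xS i])
  then have ev: "\<forall>\<^sub>F t in at (\<phi> x i). (\<phi> x)(i := t) \<in> \<phi> ` (U \<inter> W)"
    by (simp add: eventually_nhds_conv_at)
  have in_W: "?\<sigma> u \<in> W" if "u \<in> \<phi> ` (U \<inter> W)" for u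
    using that good_chartD(2)[OF \<open>good_chart M d (U, \<phi>)\<close>] by (auto simp: inv_into_f_f)
  have cx: "c (\<phi> x i) = \<psi> x"
    using x good_chartD(2)[OF \<open>good_chart M d (U, \<phi>)\<close>] by (simp add: c_def inv_into_f_f)
  have der: "((\<lambda>t. ?\<tau> (c t)) has_vector_derivative
      (\<Sum>k<d. partial i (\<lambda>u. \<psi> (?\<sigma> u) k) (\<phi> x) *\<^sub>R partial k ?\<tau> (c (\<phi> x i)))) (at (\<phi> x i))"
  proof (rule has_vector_derivative_along_curve[OF good_chartD(3,4)[OF c']])
    show "c (\<phi> x i) \<in> \<psi> ` W" using cx x by simp
    show "\<forall>\<^sub>F t in at (\<phi> x i). c t \<in> \<psi> ` W"
      using ev by eventually_elim (use in_W in \<open>auto simp: c_def\<close>)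
    fix k assume "k < d"
    from smooth_on_has_partial[OF good_chart_transition[OF \<open>good_chart M d (U, \<phi>)\<close> c' this] i xS]
    show "((\<lambda>t. c t k) has_real_derivative partial i (\<lambda>u. \<psi> (?\<sigma> u) k) (\<phi> x)) (at (\<phi> x i))"
      by (simp add: c_def has_real_derivative_iff_has_vector_derivative)
  qed
  have eq: "\<forall>\<^sub>F t in at (\<phi> x i). ?\<tau> (c t) = ?\<sigma> ((\<phi> x)(i := t))"
    using ev by eventually_elim (use in_W good_chartD(2)[OF c'] in \<open>auto simp: c_def inv_into_f_f\<close>)
  have eq0: "?\<tau> (c (\<phi> x i)) = ?\<sigma> ((\<phi> x)(i := \<phi> x i))"
    using cx x good_chartD(2)[OF c'] good_chartD(2)[OF \<open>good_chart M d (U, \<phi>)\<close>] by (simp add: inv_into_f_f)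
  have "((\<lambda>t. ?\<sigma> ((\<phi> x)(i := t))) has_vector_derivative
      (\<Sum>k<d. partial i (\<lambda>u. \<psi> (?\<sigma> u) k) (\<phi> x) *\<^sub>R partial k ?\<tau> (c (\<phi> x i)))) (at (\<phi> x i))"
    by (rule has_vector_derivative_transform_eventually[OF der eq eq0 UNIV_I])
  then show ?thesis unfolding partial_def cx by (rule vector_derivative_at)
qed

text \<open>Only compactness and a good chart at each point remain to be checked for a concrete set;
  every axiom on the metric follows from its being induced.\<close>

locale good_submanifold =
  fixes M :: "'m::euclidean_space set" and d :: nat
  assumes compact_M: "compact M"
    and charts: "\<And>p. p \<in> M \<Longrightarrow> \<exists>c. good_chart M d c \<and> p \<in> fst c"
begin

definition "atlas = {c. good_chart M d c}"

lemma atlas_iff [simp]: "c \<in> atlas \<longleftrightarrow> good_chart M d c" by (simp add: atlas_def)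

sublocale compact_riemannian_manifold d "top_of_set M" atlas induced_metric
proof
  show "compact_space (top_of_set M)"
    using compact_M by (simp add: compact_space_subtopology)
  show "Hausdorff_space (top_of_set M)"
    by (simp add: Hausdorff_space_subtopology)
  show "topspace (top_of_set M) = \<Union> (fst ` atlas)"
  proof
    show "\<Union> (fst ` atlas) \<subseteq> topspace (top_of_set M)"
      using good_chartD(1) openin_imp_subset by fastforce
    show "topspace (top_of_set M) \<subseteq> \<Union> (fst ` atlas)"
      using charts by force
  qed
next
  fix U \<phi> assume "(U, \<phi>) \<in> atlas"
  then have c: "good_chart M d (U, \<phi>)" by simp
  then show "openin (top_of_set M) U" "openin (Euclidean_space d) (\<phi> ` U)"
    by (rule good_chartD)+
  have "U \<subseteq> M" using good_chartD(1)[OF c] openin_imp_subset by blast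
  then have UM: "subtopology (top_of_set M) U = top_of_set U"
    by (simp add: subtopology_subtopology Int_absorb1)
  have "homeomorphic_maps (top_of_set U) (top_of_set (\<phi> ` U)) \<phi> (inv_into U \<phi>)"
    using good_chart_continuous[OF c] smooth_on_continuous[OF good_chartD(4)[OF c]] good_chartD(2)[OF c]
    by (auto simp: homeomorphic_maps_def inv_into_into)
  then show "homeomorphic_map (subtopology (top_of_set M) U) (subtopology (Euclidean_space d) (\<phi> ` U)) \<phi>"
    unfolding UM subtopology_Euclidean_space[OF good_chartD(3)[OF c]] homeomorphic_map_maps by blast
next
  fix U \<phi> W \<psi> k assume "(U, \<phi>) \<in> atlas" "(W, \<psi>) \<in> atlas" "k < d"
  then have c: "good_chart M d (U, \<phi>)" "good_chart M d (W, \<psi>)" by auto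
  then show "coord_smooth_on d (\<phi> ` (U \<inter> W)) (\<lambda>u. \<psi> (inv_into U \<phi> u) k)"
    using coord_smooth_on_iff[OF good_chart_inter_image[OF c(1) good_chartD(1)[OF c(2)]]]
      good_chart_transition[OF c \<open>k < d\<close>] by blast
next
  fix U \<phi> i j assume "(U, \<phi>) \<in> atlas" and ij: "i < d" "j < d"
  then have c: "good_chart M d (U, \<phi>)" by auto
  have "smooth_on d (\<phi> ` U) (\<lambda>u. partial i (inv_into U \<phi>) u \<bullet> partial j (inv_into U \<phi>) u)"
    by (intro smooth_on_bilinear[OF bounded_bilinear_inner] smooth_on_partial good_chartD(3,4)[OF c] ij)
  then have "smooth_on d (\<phi> ` U) (\<lambda>u. induced_metric (U, \<phi>) (inv_into U \<phi> u) i j)"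
    by (rule smooth_on_cong[OF good_chartD(3)[OF c]]) (simp add: induced_metric_def f_inv_into_f)
  then show "coord_smooth_on d (\<phi> ` U) (\<lambda>u. induced_metric (U, \<phi>) (inv_into U \<phi> u) i j)"
    using coord_smooth_on_iff[OF good_chartD(3)[OF c]] by blast
next
  fix U \<phi> x i j
  show "induced_metric (U, \<phi>) x i j = induced_metric (U, \<phi>) x j i"
    by (simp add: induced_metric_def inner_commute)
next
  fix U \<phi> x and v :: "nat \<Rightarrow> real"
  assume "(U, \<phi>) \<in> atlas" "x \<in> U" "\<exists>i<d. v i \<noteq> 0"
  then show "(\<Sum>i<d. \<Sum>j<d. induced_metric (U, \<phi>) x i j * v i * v j) > 0"
    using good_chart_immersion[of M d U \<phi> x v] by (simp add: induced_metric_def sum_inner_eq_norm_sq)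
next
  fix U \<phi> W \<psi> x i j
  assume *: "(U, \<phi>) \<in> atlas" "(W, \<psi>) \<in> atlas" and x: "x \<in> U \<inter> W" and ij: "i < d" "j < d"
  have c: "good_chart M d (U, \<phi>)" "good_chart M d (W, \<psi>)" using * by auto
  let ?p = "\<lambda>i k. partial i (\<lambda>u. \<psi> (inv_into U \<phi> u) k) (\<phi> x)" and ?e = "\<lambda>k. partial k (inv_into W \<psi>) (\<psi> x)"
  have "induced_metric (U, \<phi>) x i j = (\<Sum>k<d. ?p i k *\<^sub>R ?e k) \<bullet> (\<Sum>l<d. ?p j l *\<^sub>R ?e l)"
    by (simp add: induced_metric_def good_chart_partial_transition[OF c x] ij)
  also have "\<dots> = (\<Sum>k<d. \<Sum>l<d. (?p i k *\<^sub>R ?e k) \<bullet> (?p j l *\<^sub>R ?e l))"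
    by (simp only: inner_sum_left inner_sum_right) (rule sum.swap)
  finally show "induced_metric (U, \<phi>) x i j = (\<Sum>k<d. \<Sum>l<d.
     coord_partial i (\<lambda>u. \<psi> (inv_into U \<phi> u) k) (\<phi> x) * coord_partial j (\<lambda>u. \<psi> (inv_into U \<phi> u) l) (\<phi> x) *
     induced_metric (W, \<psi>) x k l)"
    by (simp add: coord_partial_eq induced_metric_def algebra_simps)
qed

end

section \<open>Curves in a submanifold\<close>

lemma vector_derivative_unit_interval:
  assumes "t \<in> {0..1}" "(f has_vector_derivative D) (at t within {0..1})"
  shows "vector_derivative f (at t within {0..1::real}) = D"
  using vector_derivative_within_cbox[of 0 1 t f D] assms by simp

context good_submanifold
begin

lemma C1_curve_continuous:
  assumes "C1_curve d (top_of_set M) atlas \<gamma>"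
  shows "continuous_on {0..1} \<gamma>" "\<gamma> ` {0..1} \<subseteq> M"
  using assms[unfolded C1_curve_def, THEN conjunct1] by auto

text \<open>The ambient velocity comes from the chain rule, since the curve equals the
  parametrization applied to its own coordinates as long as it stays in \<open>U\<close>.\<close>

lemma C1_curve_velocity_in_chart:
  assumes \<gamma>: "C1_curve d (top_of_set M) atlas \<gamma>" and c: "good_chart M d (U, \<phi>)"
  obtains v where "\<And>i. i < d \<Longrightarrow> continuous_on {t \<in> {0..1}. \<gamma> t \<in> U} (v i)"
    "\<And>i t. i < d \<Longrightarrow> t \<in> {0..1} \<Longrightarrow> \<gamma> t \<in> U \<Longrightarrow> ((\<lambda>s. \<phi> (\<gamma> s) i) has_real_derivative v i t) (at t within {0..1})"
    "\<And>t. t \<in> {0..1} \<Longrightarrow> \<gamma> t \<in> U \<Longrightarrow>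
       (\<gamma> has_vector_derivative (\<Sum>i<d. v i t *\<^sub>R partial i (inv_into U \<phi>) (\<phi> (\<gamma> t)))) (at t within {0..1})"
proof -
  have "(U, \<phi>) \<in> atlas" using c by simp
  note bspec[OF \<gamma>[unfolded C1_curve_def, THEN conjunct2] this, unfolded prod.case]
  then obtain v where v: "\<And>i. i < d \<Longrightarrow> continuous_on {t \<in> {0..1}. \<gamma> t \<in> U} (v i)"
    "\<And>i t. i < d \<Longrightarrow> t \<in> {0..1} \<Longrightarrow> \<gamma> t \<in> U \<Longrightarrow> ((\<lambda>s. \<phi> (\<gamma> s) i) has_real_derivative v i t) (at t within {0..1})"
    unfolding Ball_def mem_Collect_eq by metis
  note \<gamma>c = C1_curve_continuous[OF \<gamma>]
  have "(\<gamma> has_vector_derivative (\<Sum>i<d. v i t *\<^sub>R partial i (inv_into U \<phi>) (\<phi> (\<gamma> t)))) (at t within {0..1})"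
    if t: "t \<in> {0..1}" "\<gamma> t \<in> U" for t
  proof -
    have ev: "\<forall>\<^sub>F s in at t within {0..1}. \<gamma> s \<in> U"
      by (rule eventually_in_chart[OF good_chartD(1)[OF c] \<gamma>c t])
    have 1: "((\<lambda>s. inv_into U \<phi> (\<phi> (\<gamma> s))) has_vector_derivative
        (\<Sum>i<d. v i t *\<^sub>R partial i (inv_into U \<phi>) (\<phi> (\<gamma> t)))) (at t within {0..1})"
      by (rule has_vector_derivative_along_curve[OF good_chartD(3,4)[OF c] _ _ v(2)])
         (use t ev in \<open>auto elim: eventually_mono\<close>)
    have 2: "\<forall>\<^sub>F s in at t within {0..1}. inv_into U \<phi> (\<phi> (\<gamma> s)) = \<gamma> s"
      using ev by eventually_elim (rule inv_into_f_f[OF good_chartD(2)[OF c]])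
    show ?thesis
      by (rule has_vector_derivative_transform_eventually[OF 1 2 inv_into_f_f[OF good_chartD(2)[OF c] t(2)] t(1)])
  qed
  with v show ?thesis by (rule that)
qed

text \<open>Whatever chart \<open>SOME\<close> picks, the quadratic form of the induced metric on
  coordinate velocities is the squared norm of the ambient velocity, which does not depend on the
  chart.\<close>

lemma speed_sq_eq:
  assumes \<gamma>: "C1_curve d (top_of_set M) atlas \<gamma>" and t: "t \<in> {0..1}"
    and D: "(\<gamma> has_vector_derivative D) (at t within {0..1})"
  shows "speed_sq d atlas induced_metric \<gamma> t = (norm D)\<^sup>2"
proof -
  define c where "c = (SOME c. c \<in> atlas \<and> \<gamma> t \<in> fst c)"
  have "\<gamma> t \<in> M" using C1_curve_continuous(2)[OF \<gamma>] t by blast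
  then have "c \<in> atlas \<and> \<gamma> t \<in> fst c"
    unfolding c_def atlas_iff by (rule someI_ex[OF charts])
  moreover obtain U \<phi> where "c = (U, \<phi>)" by (cases c)
  ultimately have U: "c = (U, \<phi>)" "good_chart M d (U, \<phi>)" "\<gamma> t \<in> U" by simp_all
  obtain v where v: "\<And>i. i < d \<Longrightarrow> continuous_on {t \<in> {0..1}. \<gamma> t \<in> U} (v i)"
    "\<And>i t. i < d \<Longrightarrow> t \<in> {0..1} \<Longrightarrow> \<gamma> t \<in> U \<Longrightarrow> ((\<lambda>s. \<phi> (\<gamma> s) i) has_real_derivative v i t) (at t within {0..1})"
    "\<And>t. t \<in> {0..1} \<Longrightarrow> \<gamma> t \<in> U \<Longrightarrow>
       (\<gamma> has_vector_derivative (\<Sum>i<d. v i t *\<^sub>R partial i (inv_into U \<phi>) (\<phi> (\<gamma> t)))) (at t within {0..1})"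
    by (rule C1_curve_velocity_in_chart[OF \<gamma> U(2)]) (rule that; assumption)
  note v = v(2)[OF _ t U(3)] v(3)[OF t U(3)]
  have "vector_derivative (\<lambda>s. \<phi> (\<gamma> s) i) (at t within {0..1}) = v i t" if "i < d" for i
    by (rule vector_derivative_unit_interval[OF t v(1)[OF that, unfolded has_real_derivative_iff_has_vector_derivative]])
  then have "speed_sq d atlas induced_metric \<gamma> t =
      (\<Sum>i<d. \<Sum>j<d. induced_metric c (\<gamma> t) i j * v i t * v j t)"
    unfolding speed_sq_def Let_def c_def[symmetric] by (intro sum.cong refl) (simp add: U(1))
  also have "\<dots> = (norm (\<Sum>i<d. v i t *\<^sub>R partial i (inv_into U \<phi>) (\<phi> (\<gamma> t))))\<^sup>2"
    by (simp add: U(1) induced_metric_def sum_inner_eq_norm_sq)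
  also have "(\<Sum>i<d. v i t *\<^sub>R partial i (inv_into U \<phi>) (\<phi> (\<gamma> t))) = D"
    using vector_derivative_unit_interval[OF t v(2)] vector_derivative_unit_interval[OF t D] by (rule trans[OF sym])
  finally show ?thesis .
qed

lemma C1_curve_velocity:
  assumes \<gamma>: "C1_curve d (top_of_set M) atlas \<gamma>"
  obtains \<gamma>' where "continuous_on {0..1} \<gamma>'"
    "\<And>t. t \<in> {0..1} \<Longrightarrow> (\<gamma> has_vector_derivative \<gamma>' t) (at t within {0..1})"
    "\<And>t. t \<in> {0..1} \<Longrightarrow> speed_sq d atlas induced_metric \<gamma> t = (norm (\<gamma>' t))\<^sup>2"
proof -
  define \<gamma>' where "\<gamma>' t = vector_derivative \<gamma> (at t within {0..1})" for t
  note \<gamma>c = C1_curve_continuous[OF \<gamma>]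
  have *: "(\<gamma> has_vector_derivative \<gamma>' t) (at t within {0..1}) \<and> continuous (at t within {0..1}) \<gamma>'"
    if t: "t \<in> {0..1}" for t
  proof -
    have "\<gamma> t \<in> M" using \<gamma>c(2) t by auto
    then obtain c where "good_chart M d c" "\<gamma> t \<in> fst c" using charts[of "\<gamma> t"] by blast
    moreover obtain U \<phi> where "c = (U, \<phi>)" by (cases c)
    ultimately have c: "good_chart M d (U, \<phi>)" "\<gamma> t \<in> U" by simp_all
    obtain v where v: "\<And>i. i < d \<Longrightarrow> continuous_on {t \<in> {0..1}. \<gamma> t \<in> U} (v i)"
    "\<And>i t. i < d \<Longrightarrow> t \<in> {0..1} \<Longrightarrow> \<gamma> t \<in> U \<Longrightarrow> ((\<lambda>s. \<phi> (\<gamma> s) i) has_real_derivative v i t) (at t within {0..1})"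
    "\<And>t. t \<in> {0..1} \<Longrightarrow> \<gamma> t \<in> U \<Longrightarrow>
       (\<gamma> has_vector_derivative (\<Sum>i<d. v i t *\<^sub>R partial i (inv_into U \<phi>) (\<phi> (\<gamma> t)))) (at t within {0..1})"
      by (rule C1_curve_velocity_in_chart[OF \<gamma> c(1)]) (rule that; assumption)
    note v = v(1,3)
    have \<gamma>'eq: "\<gamma>' s = (\<Sum>i<d. v i s *\<^sub>R partial i (inv_into U \<phi>) (\<phi> (\<gamma> s)))"
      if "s \<in> {s \<in> {0..1}. \<gamma> s \<in> U}" for s
      unfolding \<gamma>'_def by (rule vector_derivative_unit_interval[OF _ v(2)]) (use that in auto)
    have "continuous_on {s \<in> {0..1}. \<gamma> s \<in> U} (\<lambda>s. \<Sum>i<d. v i s *\<^sub>R partial i (inv_into U \<phi>) (\<phi> (\<gamma> s)))"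
    proof (intro continuous_on_sum continuous_on_scaleR)
      fix i assume "i \<in> {..<d}"
      then have i: "i < d" by simp
      show "continuous_on {s \<in> {0..1}. \<gamma> s \<in> U} (v i)" by (rule v(1)[OF i])
      have 1: "continuous_on {s \<in> {0..1}. \<gamma> s \<in> U} (\<lambda>s. \<phi> (\<gamma> s))"
        by (rule continuous_on_compose2[OF good_chart_continuous[OF c(1)] continuous_on_subset[OF \<gamma>c(1)]]) auto
      show "continuous_on {s \<in> {0..1}. \<gamma> s \<in> U} (\<lambda>s. partial i (inv_into U \<phi>) (\<phi> (\<gamma> s)))"
        by (rule continuous_on_compose2[OF smooth_on_continuous[OF smooth_on_partial[OF good_chartD(3,4)[OF c(1)] i]] 1]) auto
    qed
    then have cont: "continuous_on {s \<in> {0..1}. \<gamma> s \<in> U} \<gamma>'"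
      by (rule continuous_on_eq) (use \<gamma>'eq in auto)
    obtain W where W: "open W" "U = M \<inter> W" using good_chartD(1)[OF c(1)] by (auto simp: openin_open)
    have "{s \<in> {0..1}. \<gamma> s \<in> U} = {0..1} \<inter> \<gamma> -` W" using W(2) \<gamma>c(2) by auto
    then have "openin (top_of_set {0..1}) {s \<in> {0..1}. \<gamma> s \<in> U}"
      using continuous_openin_preimage_gen[OF \<gamma>c(1) W(1)] by simp
    then obtain T where T: "open T" "{s \<in> {0..1}. \<gamma> s \<in> U} = {0..1} \<inter> T" by (auto simp: openin_open)
    have "t \<in> T" using T(2) t c(2) by blast
    \<comment> \<open>The times at which the curve is in \<open>U\<close> form a relatively open
      set, so continuity there is continuity within the whole interval.\<close>
    have "continuous (at t within {0..1} \<inter> T) \<gamma>'"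
      using cont t c(2) unfolding T(2)[symmetric] by (simp add: continuous_on_eq_continuous_within)
    then have "continuous (at t within {0..1}) \<gamma>'"
      using at_within_nhd[of t T "{0..1} \<inter> T" "{0..1}"] T(1) \<open>t \<in> T\<close> by simp
    moreover have "(\<gamma> has_vector_derivative \<gamma>' t) (at t within {0..1})"
      using v(2)[OF t c(2)] \<gamma>'eq[of t] t c(2) by simp
    ultimately show ?thesis by blast
  qed
  show ?thesis
  proof (rule that[of \<gamma>'])
    show "continuous_on {0..1} \<gamma>'" using * by (simp add: continuous_on_eq_continuous_within)
    show "(\<gamma> has_vector_derivative \<gamma>' t) (at t within {0..1})"
      "speed_sq d atlas induced_metric \<gamma> t = (norm (\<gamma>' t))\<^sup>2" if "t \<in> {0..1}" for t
      using * that speed_sq_eq[OF \<gamma> that] by blast+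
  qed
qed

text \<open>A straight segment in the coordinates of one chart. \<open>C1_curve\<close> asks for
  continuous derivatives in every chart of the atlas, so the other charts are reached through the
  smooth transition maps.\<close>

lemma C1_curve_chart_segment:
  assumes c: "good_chart M d (U, \<phi>)"
    and seg: "\<And>t. t \<in> {0..1} \<Longrightarrow> (\<lambda>k. (1 - t) * x k + t * y k) \<in> \<phi> ` U"
  defines "\<gamma> \<equiv> \<lambda>t. inv_into U \<phi> (\<lambda>k. (1 - t) * x k + t * y k)"
  shows "C1_curve d (top_of_set M) atlas \<gamma>"
    "\<And>t. t \<in> {0..1} \<Longrightarrow> (\<gamma> has_vector_derivative
       (\<Sum>k<d. (y k - x k) *\<^sub>R partial k (inv_into U \<phi>) (\<lambda>k. (1 - t) * x k + t * y k))) (at t within {0..1})"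
proof -
  define c where "c t = (\<lambda>k. (1 - t) * x k + t * y k)" for t
  have \<gamma>: "\<gamma> t = inv_into U \<phi> (c t)" for t by (simp add: \<gamma>_def c_def)
  have cS: "c t \<in> \<phi> ` U" if "t \<in> {0..1}" for t using seg[OF that] by (simp add: c_def)
  have cd: "((\<lambda>t. c t k) has_real_derivative (y k - x k)) (at t within T)" for k t T
    unfolding c_def by (auto intro!: derivative_eq_intros)
  have cc: "continuous_on T c" for T
  proof (rule continuous_on_coordinatewise_then_product)
    show "continuous_on T (\<lambda>t. c t k)" for k unfolding c_def by (intro continuous_intros)
  qed
  have \<gamma>c: "continuous_on {0..1} \<gamma>"
    unfolding \<gamma>
    by (rule continuous_on_compose2[OF smooth_on_continuous[OF good_chartD(4)[OF assms(1)]] cc]) (use cS in blast)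
  have \<gamma>U: "\<gamma> t \<in> U" if "t \<in> {0..1}" for t
    unfolding \<gamma> by (rule inv_into_into[OF cS[OF that]])
  have UM: "U \<subseteq> M" using good_chartD(1)[OF assms(1)] openin_imp_subset by blast
  have \<gamma>M: "\<gamma> ` {0..1} \<subseteq> M" using \<gamma>U UM by blast
  show "(\<gamma> has_vector_derivative (\<Sum>k<d. (y k - x k) *\<^sub>R partial k (inv_into U \<phi>) (\<lambda>k. (1 - t) * x k + t * y k))) (at t within {0..1})"
    if t: "t \<in> {0..1}" for t
    using has_vector_derivative_along_curve[OF good_chartD(3,4)[OF assms(1)] cS[OF t] _ cd, of "{0..1}"] cS
    unfolding \<gamma>[symmetric] by (simp add: c_def eventually_at_filter)
  show "C1_curve d (top_of_set M) atlas \<gamma>"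
    unfolding C1_curve_def
  proof (intro conjI ballI)
    show "continuous_map (top_of_set {0..1}) (top_of_set M) \<gamma>" using \<gamma>c \<gamma>M by auto
    fix c' assume c'0: "c' \<in> atlas"
    obtain W \<psi> where c'W: "c' = (W, \<psi>)" by (cases c')
    then have c': "good_chart M d (W, \<psi>)" using c'0 by simp
    let ?S = "\<phi> ` (U \<inter> W)"
    have S: "openin (Euclidean_space d) ?S"
      by (rule good_chart_inter_image[OF assms(1) good_chartD(1)[OF c']])
    have cSW: "c t \<in> ?S" if "t \<in> {0..1}" "\<gamma> t \<in> W" for t
    proof -
      have "c t = \<phi> (\<gamma> t)" unfolding \<gamma> by (rule f_inv_into_f[OF cS[OF that(1)], symmetric])
      then show ?thesis using \<gamma>U[OF that(1)] that(2) by blast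
    qed
    have "\<exists>v. continuous_on {t \<in> {0..1}. \<gamma> t \<in> W} v \<and>
        (\<forall>t \<in> {t \<in> {0..1}. \<gamma> t \<in> W}. ((\<lambda>s. \<psi> (\<gamma> s) i) has_real_derivative v t) (at t within {0..1}))"
      if i: "i < d" for i
    proof (intro exI conjI ballI)
      let ?f = "\<lambda>u. \<psi> (inv_into U \<phi> u) i"
      have f: "smooth_on d ?S ?f" by (rule good_chart_transition[OF assms(1) c' i])
      show "continuous_on {t \<in> {0..1}. \<gamma> t \<in> W} (\<lambda>t. \<Sum>k<d. (y k - x k) *\<^sub>R partial k ?f (c t))"
      proof (intro continuous_on_sum continuous_on_scaleR continuous_on_const)
        fix k assume "k \<in> {..<d}"
        then have k: "k < d" by simp
        show "continuous_on {t \<in> {0..1}. \<gamma> t \<in> W} (\<lambda>t. partial k ?f (c t))"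
          by (rule continuous_on_compose2[OF smooth_on_continuous[OF smooth_on_partial[OF S f k]] cc]) (use cSW in blast)
      qed
      fix t assume "t \<in> {t \<in> {0..1}. \<gamma> t \<in> W}"
      then have t: "t \<in> {0..1}" "\<gamma> t \<in> W" by auto
      have "\<forall>\<^sub>F s in at t within {0..1}. \<gamma> s \<in> W"
        by (rule eventually_in_chart[OF good_chartD(1)[OF c'] \<gamma>c \<gamma>M t])
      moreover have "\<forall>\<^sub>F s in at t within {0..1}. s \<in> {0..1}" by (auto simp: eventually_at_filter)
      ultimately have "\<forall>\<^sub>F s in at t within {0..1}. c s \<in> ?S" by eventually_elim (rule cSW)
      from has_vector_derivative_along_curve[OF S f cSW[OF t] this cd]
      show "((\<lambda>s. \<psi> (\<gamma> s) i) has_real_derivative (\<Sum>k<d. (y k - x k) *\<^sub>R partial k ?f (c t))) (at t within {0..1})"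
        unfolding \<gamma>[symmetric] has_real_derivative_iff_has_vector_derivative .
    qed
    then show "case c' of (U, \<phi>) \<Rightarrow> \<forall>i<d. \<exists>v. continuous_on {t \<in> {0..1}. \<gamma> t \<in> U} v \<and>
        (\<forall>t \<in> {t \<in> {0..1}. \<gamma> t \<in> U}. ((\<lambda>s. \<phi> (\<gamma> s) i) has_real_derivative v t) (at t within {0..1}))"
      unfolding c'W by simp
  qed
qed

text \<open>Points near \<open>m\<close> are joined by a segment in one chart: the chart is
  Lipschitz, which bounds the coordinate velocity, and the partial derivatives of the
  parametrization are bounded on a box.\<close>

lemma short_curves_near:
  assumes m: "m \<in> M"
  obtains e K where "e > 0" "K \<ge> 0"
    "\<And>m' m''. m' \<in> M \<inter> ball m e \<Longrightarrow> m'' \<in> M \<inter> ball m e \<Longrightarrow>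
      \<exists>\<gamma>. C1_curve d (top_of_set M) atlas \<gamma> \<and> \<gamma> 0 = m' \<and> \<gamma> 1 = m'' \<and>
          (\<forall>t\<in>{0..1}. speed_sq d atlas induced_metric \<gamma> t \<le> (K * dist m' m'')\<^sup>2)"
proof -
  obtain c where "good_chart M d c" "m \<in> fst c" using charts[OF m] by blast
  moreover obtain U \<phi> where "c = (U, \<phi>)" by (cases c)
  ultimately have c: "good_chart M d (U, \<phi>)" "m \<in> U" by simp_all
  let ?\<sigma> = "inv_into U \<phi>"
  note S = good_chartD(3)[OF c(1)] and \<sigma> = good_chartD(4)[OF c(1)]
  have xS: "\<phi> m \<in> \<phi> ` U" using c(2) by simp
  define F where "F u = (\<Sum>k<d. norm (partial k ?\<sigma> u))" for u
  have Fc: "continuous_on (\<phi> ` U) F"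
    unfolding F_def using smooth_on_continuous[OF smooth_on_partial[OF S \<sigma>]] by (intro continuous_intros) auto
  \<comment> \<open>By continuity \<open>F\<close>, the sum of the norms of the partial derivatives,
    stays below this value on a box around \<open>\<phi> m\<close>.\<close>
  define B where "B = F (\<phi> m) + 1"
  have "B > 0" unfolding B_def F_def by (intro add_nonneg_pos sum_nonneg) auto
  have FB: "F (\<phi> m) < B" by (simp add: B_def)
  obtain r where r: "r > 0"
    "\<And>y. (\<forall>i<d. \<bar>y i - \<phi> m i\<bar> < r) \<Longrightarrow> (\<forall>i\<ge>d. y i = 0) \<Longrightarrow> y \<in> \<phi> ` U \<and> F y < B"
    by (rule continuous_on_Euclidean_space_box[OF S xS Fc FB]) (rule that; assumption)
  obtain W where W: "open W" "U = M \<inter> W" using good_chartD(1)[OF c(1)] by (auto simp: openin_open)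
  obtain w where w: "w > 0" "ball m w \<subseteq> W" using W c(2) by (meson IntD2 openE)
  have "\<forall>i. \<exists>e K. i < d \<longrightarrow> e > 0 \<and>
      (\<forall>p'\<in>ball m e. \<forall>p''\<in>ball m e. \<bar>\<phi> p' i - \<phi> p'' i\<bar> \<le> K * dist p' p'')"
    using good_chartD(5)[OF c(1)] unfolding smooth_fun_def by meson
  then obtain e' K' where e': "\<And>i. i < d \<Longrightarrow> e' i > 0"
    and K': "\<And>i p' p''. i < d \<Longrightarrow> p' \<in> ball m (e' i) \<Longrightarrow> p'' \<in> ball m (e' i) \<Longrightarrow> \<bar>\<phi> p' i - \<phi> p'' i\<bar> \<le> K' i * dist p' p''"
    by metis
  define K where "K = (\<Sum>i<d. \<bar>K' i\<bar>) + 1"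
  have "K > 0" unfolding K_def by (intro add_nonneg_pos sum_nonneg) auto
  \<comment> \<open>Within \<open>e\<close> of \<open>m\<close> the points of \<open>M\<close> lie
    in \<open>U\<close> (by \<open>w\<close>), have coordinates in the box (by
    \<open>r / K\<close>), and obey the Lipschitz bound of every coordinate (by
    \<open>e' i\<close>).\<close>
  define e where "e = Min ({w, r / K} \<union> e' ` {..<d})"
  have e: "e > 0" unfolding e_def using w(1) r(1) \<open>K > 0\<close> e' by (subst Min_gr_iff) auto
  have ew: "e \<le> w" "e \<le> r / K" and ei: "\<And>i. i < d \<Longrightarrow> e \<le> e' i"
    unfolding e_def by (rule Min_le; simp)+
  have lip: "\<bar>\<phi> p' i - \<phi> p'' i\<bar> \<le> K * dist p' p''" if "i < d" "p' \<in> ball m e" "p'' \<in> ball m e" for i p' p''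
  proof -
    have "\<bar>\<phi> p' i - \<phi> p'' i\<bar> \<le> K' i * dist p' p''"
      using that ei[OF that(1)] by (intro K') auto
    also have "K' i \<le> K"
    proof -
      have "\<bar>K' i\<bar> \<le> (\<Sum>i<d. \<bar>K' i\<bar>)"
        using that(1) by (intro member_le_sum[where f = "\<lambda>i. \<bar>K' i\<bar>"]) auto
      then show ?thesis unfolding K_def by linarith
    qed
    finally show ?thesis by (simp add: mult_right_mono)
  qed
  have inU: "p \<in> U" if "p \<in> M \<inter> ball m e" for p using that ew(1) w(2) W(2) by auto
  have box: "\<bar>\<phi> p i - \<phi> m i\<bar> < r" if "p \<in> M \<inter> ball m e" "i < d" for p i
  proof -
    have "\<bar>\<phi> p i - \<phi> m i\<bar> \<le> K * dist p m" using that e by (intro lip) auto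
    also have "\<dots> < K * e" using that \<open>K > 0\<close> by (simp add: dist_commute)
    also have "\<dots> \<le> r" using ew(2) \<open>K > 0\<close> by (simp add: field_simps)
    finally show ?thesis .
  qed
  show ?thesis
  proof (rule that[of e "K * B"])
    fix m' m'' assume m': "m' \<in> M \<inter> ball m e" and m'': "m'' \<in> M \<inter> ball m e"
    let ?c = "\<lambda>t k. (1 - t) * \<phi> m' k + t * \<phi> m'' k"
    have seg: "?c t \<in> \<phi> ` U \<and> F (?c t) < B" if t: "t \<in> {0..1}" for t
    proof (rule r(2))
      show "\<forall>i<d. \<bar>?c t i - \<phi> m i\<bar> < r"
      proof (intro allI impI)
        fix i assume i: "i < d"
        have "?c t i - \<phi> m i = (1 - t) * (\<phi> m' i - \<phi> m i) + t * (\<phi> m'' i - \<phi> m i)"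
          by (simp add: algebra_simps)
        moreover have "\<bar>(1 - t) * (\<phi> m' i - \<phi> m i) + t * (\<phi> m'' i - \<phi> m i)\<bar> < r"
          using convex_bound_lt[OF box[OF m' i] box[OF m'' i], of "1 - t" t] t
          by (intro le_less_trans[OF abs_triangle_ineq]) (simp add: abs_mult)
        ultimately show "\<bar>?c t i - \<phi> m i\<bar> < r" by simp
      qed
      have "\<phi> m' i = 0" "\<phi> m'' i = 0" if "d \<le> i" for i
        using openin_Euclidean_space_zero[OF S _ that] inU[OF m'] inU[OF m''] by auto
      then show "\<forall>i\<ge>d. ?c t i = 0" by simp
    qed
    define \<gamma> where "\<gamma> t = ?\<sigma> (?c t)" for t
    have \<gamma>: "C1_curve d (top_of_set M) atlas \<gamma>"
      unfolding \<gamma>_def by (rule C1_curve_chart_segment(1)[OF c(1)]) (use seg in blast)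
    have "speed_sq d atlas induced_metric \<gamma> t \<le> (K * B * dist m' m'')\<^sup>2" if t: "t \<in> {0..1}" for t
    proof -
      have "(\<gamma> has_vector_derivative (\<Sum>k<d. (\<phi> m'' k - \<phi> m' k) *\<^sub>R partial k ?\<sigma> (?c t))) (at t within {0..1})"
        unfolding \<gamma>_def by (rule C1_curve_chart_segment(2)[OF c(1) _ t]) (use seg in blast)
      then have "speed_sq d atlas induced_metric \<gamma> t = (norm (\<Sum>k<d. (\<phi> m'' k - \<phi> m' k) *\<^sub>R partial k ?\<sigma> (?c t)))\<^sup>2"
        by (rule speed_sq_eq[OF \<gamma> t])
      also have "\<dots> \<le> (K * B * dist m' m'')\<^sup>2"
      proof (rule power_mono)
        have "norm (\<Sum>k<d. (\<phi> m'' k - \<phi> m' k) *\<^sub>R partial k ?\<sigma> (?c t)) \<le>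
            (\<Sum>k<d. norm ((\<phi> m'' k - \<phi> m' k) *\<^sub>R partial k ?\<sigma> (?c t)))"
          by (rule norm_sum)
        also have "\<dots> \<le> (\<Sum>k<d. K * dist m' m'' * norm (partial k ?\<sigma> (?c t)))"
          using lip m' m'' by (intro sum_mono) (auto simp: dist_commute intro!: mult_right_mono)
        also have "\<dots> = K * dist m' m'' * F (?c t)" by (simp add: F_def sum_distrib_left)
        also have "\<dots> \<le> K * dist m' m'' * B"
          using seg[OF t] \<open>K > 0\<close> by (intro mult_left_mono) auto
        finally show "norm (\<Sum>k<d. (\<phi> m'' k - \<phi> m' k) *\<^sub>R partial k ?\<sigma> (?c t)) \<le> K * B * dist m' m''"
          by (simp add: algebra_simps)
      qed auto
      finally show ?thesis .
    qed
    moreover have "\<gamma> 0 = m'" "\<gamma> 1 = m''"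
      unfolding \<gamma>_def using inU[OF m'] inU[OF m''] good_chartD(2)[OF c(1)] by (auto simp: inv_into_f_f)
    ultimately show "\<exists>\<gamma>. C1_curve d (top_of_set M) atlas \<gamma> \<and> \<gamma> 0 = m' \<and> \<gamma> 1 = m'' \<and>
        (\<forall>t\<in>{0..1}. speed_sq d atlas induced_metric \<gamma> t \<le> (K * B * dist m' m'')\<^sup>2)"
      using \<gamma> by blast
  qed (use e \<open>K > 0\<close> \<open>B > 0\<close> in auto)
qed

text \<open>Compactness makes the constant uniform: finitely many of the neighbourhoods from
  \<open>short_curves_near\<close> cover \<open>M\<close>. Only the radius still depends on the
  point.\<close>

lemma short_curves:
  obtains K where "K \<ge> 0"
    "\<And>m. m \<in> M \<Longrightarrow> \<exists>e>0. \<forall>m' m''. m' \<in> M \<inter> ball m e \<longrightarrow> m'' \<in> M \<inter> ball m e \<longrightarrow>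
      (\<exists>\<gamma>. C1_curve d (top_of_set M) atlas \<gamma> \<and> \<gamma> 0 = m' \<and> \<gamma> 1 = m'' \<and>
          (\<forall>t\<in>{0..1}. speed_sq d atlas induced_metric \<gamma> t \<le> (K * dist m' m'')\<^sup>2))"
proof -
  define P where "P K m' m'' \<longleftrightarrow> (\<exists>\<gamma>. C1_curve d (top_of_set M) atlas \<gamma> \<and> \<gamma> 0 = m' \<and> \<gamma> 1 = m'' \<and>
          (\<forall>t\<in>{0..1}. speed_sq d atlas induced_metric \<gamma> t \<le> (K * dist m' m'')\<^sup>2))" for K m' m''
  have mono: "P L m' m''" if P: "P K m' m''" and "0 \<le> K" "K \<le> L" for K L m' m''
  proof -
    have "(K * dist m' m'')\<^sup>2 \<le> (L * dist m' m'')\<^sup>2"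
      using that by (intro power_mono mult_right_mono) auto
    moreover obtain \<gamma> where "C1_curve d (top_of_set M) atlas \<gamma>" "\<gamma> 0 = m'" "\<gamma> 1 = m''"
      "\<forall>t\<in>{0..1}. speed_sq d atlas induced_metric \<gamma> t \<le> (K * dist m' m'')\<^sup>2"
      using P unfolding P_def by blast
    ultimately show ?thesis
      unfolding P_def by (intro exI[of _ \<gamma>] conjI ballI) (auto intro: order_trans)
  qed
  have "\<exists>e K. m \<in> M \<longrightarrow> e > 0 \<and> K \<ge> 0 \<and> (\<forall>m' m''. m' \<in> M \<inter> ball m e \<longrightarrow> m'' \<in> M \<inter> ball m e \<longrightarrow> P K m' m'')" for m
  proof (cases "m \<in> M")
    case True
    obtain e K where "e > 0" "K \<ge> 0" "\<And>m' m''. m' \<in> M \<inter> ball m e \<Longrightarrow> m'' \<in> M \<inter> ball m e \<Longrightarrow> P K m' m''"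
      unfolding P_def by (rule short_curves_near[OF True]) (rule that[unfolded P_def]; assumption)
    then show ?thesis by (intro exI[of _ e] exI[of _ K]) blast
  qed auto
  then obtain e K where eK: "\<And>m. m \<in> M \<Longrightarrow> e m > 0" "\<And>m. m \<in> M \<Longrightarrow> K m \<ge> 0"
    "\<And>m m' m''. m \<in> M \<Longrightarrow> m' \<in> M \<inter> ball m (e m) \<Longrightarrow> m'' \<in> M \<inter> ball m (e m) \<Longrightarrow> P (K m) m' m''"
    by metis
  have "M \<subseteq> (\<Union>m\<in>M. ball m (e m))" using eK(1) by force
  then obtain C where C: "C \<subseteq> M" "finite C" "M \<subseteq> (\<Union>m\<in>C. ball m (e m))"
    using compactE_image[OF compact_M, of M "\<lambda>m. ball m (e m)"] by auto
  define L where "L = (\<Sum>m\<in>C. K m)"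
  have KL: "K m \<le> L" if "m \<in> C" for m
    unfolding L_def using that C eK(2) by (intro member_le_sum) auto
  show ?thesis
  proof (rule that[of L])
    show "L \<ge> 0" unfolding L_def using C(1) eK(2) by (intro sum_nonneg) auto
    fix m assume "m \<in> M"
    then obtain n where n: "n \<in> C" "m \<in> ball n (e n)" using C(3) by blast
    then obtain r where r: "r > 0" "ball m r \<subseteq> ball n (e n)" by (meson open_ball openE)
    have "P L m' m''" if "m' \<in> M \<inter> ball m r" "m'' \<in> M \<inter> ball m r" for m' m''
      using eK(3)[of n m' m''] mono[OF _ eK(2) KL[OF n(1)]] n(1) C(1) that r(2) by blast
    then show "\<exists>e>0. \<forall>m' m''. m' \<in> M \<inter> ball m e \<longrightarrow> m'' \<in> M \<inter> ball m e \<longrightarrow>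
      (\<exists>\<gamma>. C1_curve d (top_of_set M) atlas \<gamma> \<and> \<gamma> 0 = m' \<and> \<gamma> 1 = m'' \<and>
          (\<forall>t\<in>{0..1}. speed_sq d atlas induced_metric \<gamma> t \<le> (L * dist m' m'')\<^sup>2))"
      using r(1) unfolding P_def by blast
  qed
qed

end

section \<open>Bounding lengths of curves\<close>

lemma le_ennreal_mult_INF:
  fixes f :: "'i \<Rightarrow> ennreal"
  assumes "C > 0" "\<And>l. l \<in> S \<Longrightarrow> x \<le> ennreal C * f l"
  shows "x \<le> ennreal C * (INF l\<in>S. f l)"
proof -
  have C: "ennreal C > 0" using assms(1) by simp
  have "x / ennreal C \<le> (INF l\<in>S. f l)"
    by (rule INF_greatest) (rule divide_le_posI_ennreal[OF C assms(2)])
  then have "ennreal C * (x / ennreal C) \<le> ennreal C * (INF l\<in>S. f l)" by (rule mult_left_mono) simp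
  moreover have "ennreal C * (x / ennreal C) = x"
    using C by (simp add: ennreal_times_divide mult.commute[of _ x] mult_divide_eq_ennreal)
  ultimately show ?thesis by simp
qed

lemma sum_dist_le_curve_length:
  assumes "mono t" "range t \<subseteq> {0..1}"
  shows "ennreal (\<Sum>i<n. dist (\<gamma> (t i)) (\<gamma> (t (Suc i)))) \<le> curve_length \<gamma>"
proof -
  have "(n, t) \<in> {(n::nat, t::nat \<Rightarrow> real). mono t \<and> range t \<subseteq> {0..1}}" using assms by simp
  then have "(case (n, t) of (n, t) \<Rightarrow> \<Sum>i<n. ennreal (dist (\<gamma> (t i)) (\<gamma> (t (Suc i))))) \<le> curve_length \<gamma>"
    unfolding curve_length_def by (rule SUP_upper)
  then show ?thesis by (simp add: sum_ennreal)
qed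

text \<open>\<open>\<Phi>\<close> majorizes arc length along the curve. Its increments telescope
  over a partition and add up under concatenation, so a length can be bounded without being
  computed.\<close>

definition controlled :: "(real \<Rightarrow> 'a::metric_space) \<Rightarrow> real \<Rightarrow> bool" where
  "controlled \<gamma> l \<longleftrightarrow> continuous_on {0..1} \<gamma> \<and>
     (\<exists>\<Phi>::real \<Rightarrow> real. (\<forall>s t. 0 \<le> s \<longrightarrow> s \<le> t \<longrightarrow> t \<le> 1 \<longrightarrow> dist (\<gamma> s) (\<gamma> t) \<le> \<Phi> t - \<Phi> s) \<and> \<Phi> 1 - \<Phi> 0 \<le> l)"

lemma curve_length_controlled:
  assumes "controlled \<gamma> l"
  shows "curve_length \<gamma> \<le> ennreal l"
  unfolding curve_length_def
proof (rule SUP_least, clarify)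
  fix n and t :: "nat \<Rightarrow> real" assume t: "mono t" "range t \<subseteq> {0..1}"
  obtain \<Phi> where \<Phi>: "\<And>s t. 0 \<le> s \<Longrightarrow> s \<le> t \<Longrightarrow> t \<le> 1 \<Longrightarrow> dist (\<gamma> s) (\<gamma> t) \<le> \<Phi> t - \<Phi> s" "\<Phi> 1 - \<Phi> 0 \<le> l"
    using assms unfolding controlled_def by blast
  have t01: "0 \<le> t i" "t i \<le> 1" for i using t(2) by (auto simp: image_subset_iff)
  have "(\<Sum>i<n. dist (\<gamma> (t i)) (\<gamma> (t (Suc i)))) \<le> (\<Sum>i<n. \<Phi> (t (Suc i)) - \<Phi> (t i))"
    using t(1) t01 by (intro sum_mono \<Phi>(1)) (auto simp: mono_def)
  also have "\<dots> = \<Phi> (t n) - \<Phi> (t 0)" by (rule sum_lessThan_telescope)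
  also have "\<dots> \<le> l"
  proof -
    have "0 \<le> \<Phi> (t 0) - \<Phi> 0" using \<Phi>(1)[of 0 "t 0"] t01 zero_le_dist order_trans by blast
    moreover have "0 \<le> \<Phi> 1 - \<Phi> (t n)" using \<Phi>(1)[of "t n" 1] t01 zero_le_dist order_trans by blast
    ultimately show ?thesis using \<Phi>(2) by linarith
  qed
  finally show "(\<Sum>i<n. ennreal (dist (\<gamma> (t i)) (\<gamma> (t (Suc i))))) \<le> ennreal l"
    by (simp add: sum_ennreal ennreal_leI)
qed

lemma controlled_joinpaths:
  assumes 1: "controlled \<gamma>1 l1" and 2: "controlled \<gamma>2 l2" and eq: "\<gamma>1 1 = \<gamma>2 0"
  shows "controlled (\<gamma>1 +++ \<gamma>2) (l1 + l2)"
proof -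
  obtain \<Phi> where \<Phi>: "\<And>s t. 0 \<le> s \<Longrightarrow> s \<le> t \<Longrightarrow> t \<le> 1 \<Longrightarrow> dist (\<gamma>1 s) (\<gamma>1 t) \<le> \<Phi> t - \<Phi> s" "\<Phi> 1 - \<Phi> 0 \<le> l1"
    using 1 unfolding controlled_def by blast
  obtain \<Psi> where \<Psi>: "\<And>s t. 0 \<le> s \<Longrightarrow> s \<le> t \<Longrightarrow> t \<le> 1 \<Longrightarrow> dist (\<gamma>2 s) (\<gamma>2 t) \<le> \<Psi> t - \<Psi> s" "\<Psi> 1 - \<Psi> 0 \<le> l2"
    using 2 unfolding controlled_def by blast
  \<comment> \<open>The control function of the second curve is shifted to start where the first one
    ends.\<close>
  define X where "X t = (if t \<le> 1 / 2 then \<Phi> (2 * t) else \<Psi> (2 * t - 1) - \<Psi> 0 + \<Phi> 1)" for t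
  have "dist ((\<gamma>1 +++ \<gamma>2) s) ((\<gamma>1 +++ \<gamma>2) t) \<le> X t - X s" if st: "0 \<le> s" "s \<le> t" "t \<le> 1" for s t
  proof (cases "t \<le> 1 / 2")
    case True
    then show ?thesis using \<Phi>(1)[of "2 * s" "2 * t"] st by (simp add: joinpaths_def X_def)
  next
    case t: False
    show ?thesis
    proof (cases "s \<le> 1 / 2")
      case False
      then show ?thesis using t \<Psi>(1)[of "2 * s - 1" "2 * t - 1"] st by (simp add: joinpaths_def X_def)
    next
      case True
      have "dist (\<gamma>1 (2 * s)) (\<gamma>2 (2 * t - 1)) \<le> dist (\<gamma>1 (2 * s)) (\<gamma>1 1) + dist (\<gamma>2 0) (\<gamma>2 (2 * t - 1))"
        unfolding eq by (rule dist_triangle)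
      then show ?thesis
        using True t \<Phi>(1)[of "2 * s" 1] \<Psi>(1)[of 0 "2 * t - 1"] st by (simp add: joinpaths_def X_def)
    qed
  qed
  moreover have "X 1 - X 0 \<le> l1 + l2" using \<Phi>(2) \<Psi>(2) by (simp add: X_def)
  moreover have "continuous_on {0..1} (\<gamma>1 +++ \<gamma>2)"
    using path_join_imp[of \<gamma>1 \<gamma>2] 1 2 eq by (simp add: path_def controlled_def pathfinish_def pathstart_def)
  ultimately show ?thesis unfolding controlled_def by blast
qed

lemma inner_dist_le_controlled:
  assumes "controlled \<gamma> l" "\<gamma> ` {0..1} \<subseteq> V" "\<gamma> 0 = p" "\<gamma> 1 = q"
  shows "inner_dist V p q \<le> ennreal l"
proof -
  have "curve_length \<gamma> \<le> ennreal l" by (rule curve_length_controlled[OF assms(1)])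
  then have "rectifiable \<gamma>"
    using assms(1) by (auto simp: rectifiable_def path_def controlled_def intro: le_less_trans)
  then have "inner_dist V p q \<le> curve_length \<gamma>"
    unfolding inner_dist_def using assms by (intro INF_lower) (auto simp: path_image_def pathstart_def pathfinish_def)
  with \<open>curve_length \<gamma> \<le> ennreal l\<close> show ?thesis by simp
qed

section \<open>Parametrizations by a cone\<close>

text \<open>The data from which a metrically conical neighbourhood follows. In the two local
  estimates the radius \<open>e\<close> may depend on the point, but \<open>L\<close> may not; the
  neighbourhood is taken in the cone for \<open>k_lipschitz\<close> and in the image for
  \<open>k_inverse_lipschitz\<close>. Near the cone point only the bounds on
  \<open>norm (k r m)\<close> are available.\<close>

locale cone_parametrization = good_submanifold M d
  for M :: "'m::euclidean_space set" and d :: nat +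
  fixes k :: "real \<Rightarrow> 'm \<Rightarrow> 'm" and L :: real
  assumes M_nonempty: "M \<noteq> {}"
    and k_zero: "\<And>m. m \<in> M \<Longrightarrow> k 0 m = 0"
    and k_inj: "\<And>r m r' m'. 0 < r \<Longrightarrow> r < 1 \<Longrightarrow> m \<in> M \<Longrightarrow> 0 < r' \<Longrightarrow> r' < 1 \<Longrightarrow> m' \<in> M \<Longrightarrow>
      k r m = k r' m' \<Longrightarrow> r = r' \<and> m = m'"
    and L_ge_1: "L \<ge> 1"
    and norm_k_le: "\<And>r m. 0 < r \<Longrightarrow> r < 1 \<Longrightarrow> m \<in> M \<Longrightarrow> norm (k r m) \<le> L * r"
    and norm_k_ge: "\<And>r m. 0 < r \<Longrightarrow> r < 1 \<Longrightarrow> m \<in> M \<Longrightarrow> r \<le> L * norm (k r m)"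
    and k_lipschitz: "\<And>r m. 0 < r \<Longrightarrow> r < 1 \<Longrightarrow> m \<in> M \<Longrightarrow>
      \<exists>e>0. \<forall>r' m' r'' m''. 0 < r' \<longrightarrow> r' < 1 \<longrightarrow> m' \<in> M \<longrightarrow> 0 < r'' \<longrightarrow> r'' < 1 \<longrightarrow> m'' \<in> M \<longrightarrow>
        \<bar>r' - r\<bar> < e \<longrightarrow> dist m' m < e \<longrightarrow> \<bar>r'' - r\<bar> < e \<longrightarrow> dist m'' m < e \<longrightarrow>
        dist (k r' m') (k r'' m'') \<le> L * (\<bar>r' - r''\<bar> + r * dist m' m'')"
    and k_inverse_lipschitz: "\<And>r m. 0 < r \<Longrightarrow> r < 1 \<Longrightarrow> m \<in> M \<Longrightarrow>
      \<exists>e>0. \<forall>r' m' r'' m''. 0 < r' \<longrightarrow> r' < 1 \<longrightarrow> m' \<in> M \<longrightarrow> 0 < r'' \<longrightarrow> r'' < 1 \<longrightarrow> m'' \<in> M \<longrightarrow>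
        dist (k r' m') (k r m) < e \<longrightarrow> dist (k r'' m'') (k r m) < e \<longrightarrow>
        \<bar>r' - r''\<bar> + r * dist m' m'' \<le> L * dist (k r' m') (k r'' m'')"
begin

definition "U = (\<lambda>(r, m). k r m) ` ({0..<1} \<times> M)"

text \<open>The fibres of \<open>k\<close> are exactly the classes of the cone, because
  \<open>k\<close> is injective for positive radius and collapses radius 0 to the origin. Taking
  fibres therefore inverts \<open>k\<close> with values in the quotient.\<close>

definition "h p = {(r, m). r \<in> {0..<1} \<and> m \<in> M \<and> k r m = p}"

abbreviation "joined \<equiv> cone_curve d (top_of_set M) atlas induced_metric 1"

lemma k_eq_0_iff: "0 \<le> r \<Longrightarrow> r < 1 \<Longrightarrow> m \<in> M \<Longrightarrow> k r m = 0 \<longleftrightarrow> r = 0"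
  using k_zero[of m] norm_k_ge[of r m] by (cases "r = 0") auto

lemma k_eq_iff:
  assumes "r \<in> {0..<1}" "m \<in> M" "r' \<in> {0..<1}" "m' \<in> M"
  shows "k r m = k r' m' \<longleftrightarrow> (r, m) = (r', m') \<or> r = 0 \<and> r' = 0"
proof (cases "r = 0 \<or> r' = 0")
  case True
  then show ?thesis using assms k_eq_0_iff[of r m] k_eq_0_iff[of r' m'] k_zero by auto
next
  case False
  then show ?thesis using assms k_inj[of r m r' m'] by auto
qed

lemma cone_class:
  assumes "r \<in> {0..<1}" "m \<in> M"
  shows "cone_rel 1 (top_of_set M) `` {(r, m)} = h (k r m)"
proof (rule set_eqI)
  fix x :: "real \<times> 'm"
  obtain r' m' where x: "x = (r', m')" by (cases x)
  have "x \<in> cone_rel 1 (top_of_set M) `` {(r, m)} \<longleftrightarrow>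
      r' \<in> {0..<1} \<and> m' \<in> M \<and> ((r', m') = (r, m) \<or> r' = 0 \<and> r = 0)"
    unfolding x cone_rel_def using assms by auto
  also have "\<dots> \<longleftrightarrow> x \<in> h (k r m)"
    unfolding x h_def using k_eq_iff[OF _ _ assms, of r' m'] by simp blast
  finally show "x \<in> cone_rel 1 (top_of_set M) `` {(r, m)} \<longleftrightarrow> x \<in> h (k r m)" .
qed

lemma cone_eq: "cone 1 (top_of_set M) = h ` U"
proof -
  have "cone 1 (top_of_set M) = (\<lambda>x. cone_rel 1 (top_of_set M) `` {x}) ` ({0..<1} \<times> M)"
    unfolding cone_def quotient_def by auto
  also have "\<dots> = (\<lambda>x. h (case x of (r, m) \<Rightarrow> k r m)) ` ({0..<1} \<times> M)"
  proof (rule image_cong[OF refl])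
    fix x assume "x \<in> {0..<1::real} \<times> M"
    then obtain r m where "x = (r, m)" "r \<in> {0..<1}" "m \<in> M" by blast
    then show "cone_rel 1 (top_of_set M) `` {x} = h (case x of (r, m) \<Rightarrow> k r m)"
      using cone_class[of r m] by (simp only: prod.case)
  qed
  also have "\<dots> = h ` U" unfolding U_def by (simp only: image_image)
  finally show ?thesis .
qed

lemma bij_h: "bij_betw h U (cone 1 (top_of_set M))"
  unfolding cone_eq
proof (rule bij_betw_imageI[OF _ refl], rule inj_onI)
  fix p q assume "p \<in> U" "q \<in> U" "h p = h q"
  moreover have "h p \<noteq> {}" using \<open>p \<in> U\<close> unfolding U_def h_def by (elim imageE) (auto; blast)
  moreover have "x \<in> h p \<Longrightarrow> k (fst x) (snd x) = p" for x p unfolding h_def by auto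
  ultimately show "p = q" by (metis ex_in_conv)
qed

lemma zero_in_U: "0 \<in> U"
proof -
  obtain m where "m \<in> M" using M_nonempty by blast
  then show ?thesis unfolding U_def using k_zero[of m] by (intro image_eqI[of _ _ "(0, m)"]) auto
qed

lemma h_zero: "h 0 = cone_point (top_of_set M)"
  unfolding h_def cone_point_def using k_eq_0_iff k_zero by auto

lemma U_cases:
  assumes "p \<in> U"
  obtains r m where "r \<in> {0..<1}" "m \<in> M" "p = k r m"
  using assms unfolding U_def by auto

section \<open>From curves in the image to curves in the cone\<close>

text \<open>The radius is interpolated linearly while the base point follows
  \<open>\<gamma>\<close>. The length splits into a radial part and a part along \<open>M\<close>,
  the latter weighted by the larger of the two radii.\<close>

lemma joined_of_curve:
  assumes r: "r' \<in> {0..<1}" "r'' \<in> {0..<1}"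
    and \<gamma>: "C1_curve d (top_of_set M) atlas \<gamma>" "\<gamma> 0 = m'" "\<gamma> 1 = m''"
    and B: "0 \<le> B" "\<And>t. t \<in> {0..1} \<Longrightarrow> speed_sq d atlas induced_metric \<gamma> t \<le> B\<^sup>2"
  obtains l where "joined (h (k r' m')) (h (k r'' m'')) l" "l \<le> \<bar>r' - r''\<bar> + max r' r'' * B"
proof -
  define \<rho> where "\<rho> t = (1 - t) * r' + t * r''" for t
  define f where "f = (\<lambda>t. sqrt ((r'' - r')\<^sup>2 + (\<rho> t)\<^sup>2 * speed_sq d atlas induced_metric \<gamma> t))"
  have m: "m' \<in> M" "m'' \<in> M" using C1_curve_continuous(2)[OF \<gamma>(1)] \<gamma>(2,3) by force+
  have \<rho>_le: "0 \<le> \<rho> t" "\<rho> t \<le> max r' r''" if "t \<in> {0..1}" for t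
  proof -
    show "0 \<le> \<rho> t" using that r unfolding \<rho>_def by simp
    have "\<rho> t \<le> (1 - t) * max r' r'' + t * max r' r''"
      unfolding \<rho>_def using that by (intro add_mono mult_left_mono) auto
    then show "\<rho> t \<le> max r' r''" by (simp add: algebra_simps)
  qed
  have "\<rho> ` {0..1} \<subseteq> {0..<1}"
  proof
    fix y assume "y \<in> \<rho> ` {0..1}"
    then obtain t where "t \<in> {0..1}" "y = \<rho> t" by blast
    then show "y \<in> {0..<1}" using \<rho>_le[of t] r by (auto simp: max_def split: if_splits)
  qed
  moreover have "\<forall>t\<in>{0..1}. (\<rho> has_real_derivative (r'' - r')) (at t within {0..1})"
    unfolding \<rho>_def by (auto intro!: derivative_eq_intros)
  ultimately have "joined (cone_rel 1 (top_of_set M) `` {(\<rho> 0, \<gamma> 0)}) (cone_rel 1 (top_of_set M) `` {(\<rho> 1, \<gamma> 1)}) (integral {0..1} f)"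
    unfolding f_def by (intro cone_curve.piece[where \<rho>' = "\<lambda>t. r'' - r'"] \<gamma>(1)) auto
  then have "joined (h (k r' m')) (h (k r'' m'')) (integral {0..1} f)"
    using r m \<gamma>(2,3) by (simp add: \<rho>_def cone_class)
  moreover have "integral {0..1} f \<le> \<bar>r' - r''\<bar> + max r' r'' * B"
  proof (cases "f integrable_on {0..1}")
    case True
    have "f t \<le> \<bar>r' - r''\<bar> + max r' r'' * B" if t: "t \<in> {0..1}" for t
    proof -
      have "(\<rho> t)\<^sup>2 * speed_sq d atlas induced_metric \<gamma> t \<le> (max r' r'')\<^sup>2 * B\<^sup>2"
        using \<rho>_le[OF t] B(2)[OF t] by (intro order_trans[OF mult_left_mono mult_right_mono] power_mono) auto
      then have "f t \<le> sqrt (\<bar>r' - r''\<bar>\<^sup>2 + (max r' r'' * B)\<^sup>2)"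
        unfolding f_def by (intro real_sqrt_le_mono) (simp add: power_mult_distrib power2_commute)
      also have "\<dots> \<le> \<bar>r' - r''\<bar> + max r' r'' * B"
        using r B(1) by (intro sqrt_sum_squares_le_sum mult_nonneg_nonneg) auto
      finally show ?thesis .
    qed
    then have "integral {0..1} f \<le> integral {0..1} (\<lambda>t::real. \<bar>r' - r''\<bar> + max r' r'' * B)"
      by (intro integral_le True) auto
    then show ?thesis by simp
  next
    case False
    \<comment> \<open>The length of a piece is an \<open>integral\<close>, which is 0 by convention
      for a function that is not integrable; the bound holds then too.\<close>
    show ?thesis
      unfolding not_integrable_integral[OF False] using r B(1)
      by (intro add_nonneg_nonneg mult_nonneg_nonneg) (auto simp: le_max_iff_disj)
  qed
  ultimately show ?thesis by (rule that)
qed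

text \<open>A piece needs a C^1 curve in \<open>M\<close> even if only the radius changes;
  \<open>short_curves\<close> with both ends at \<open>m\<close> supplies one of zero speed.\<close>

lemma joined_radial:
  assumes "r' \<in> {0..<1}" "r'' \<in> {0..<1}" "m \<in> M"
  obtains l where "joined (h (k r' m)) (h (k r'' m)) l" "l \<le> \<bar>r' - r''\<bar>"
proof -
  obtain K where K: "K \<ge> 0"
    "\<And>m. m \<in> M \<Longrightarrow> \<exists>e>0. \<forall>m' m''. m' \<in> M \<inter> ball m e \<longrightarrow> m'' \<in> M \<inter> ball m e \<longrightarrow>
      (\<exists>\<gamma>. C1_curve d (top_of_set M) atlas \<gamma> \<and> \<gamma> 0 = m' \<and> \<gamma> 1 = m'' \<and>
          (\<forall>t\<in>{0..1}. speed_sq d atlas induced_metric \<gamma> t \<le> (K * dist m' m'')\<^sup>2))"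
    by (rule short_curves) (rule that; assumption)
  obtain e where e: "e > 0" "\<And>m' m''. m' \<in> M \<inter> ball m e \<Longrightarrow> m'' \<in> M \<inter> ball m e \<Longrightarrow>
      (\<exists>\<gamma>. C1_curve d (top_of_set M) atlas \<gamma> \<and> \<gamma> 0 = m' \<and> \<gamma> 1 = m'' \<and>
          (\<forall>t\<in>{0..1}. speed_sq d atlas induced_metric \<gamma> t \<le> (K * dist m' m'')\<^sup>2))"
    using K(2)[OF assms(3)] by blast
  have mm: "m \<in> M \<inter> ball m e" using assms(3) e(1) by simp
  obtain \<gamma> where \<gamma>: "C1_curve d (top_of_set M) atlas \<gamma>" "\<gamma> 0 = m" "\<gamma> 1 = m"
    "\<And>t. t\<in>{0..1} \<Longrightarrow> speed_sq d atlas induced_metric \<gamma> t \<le> (K * dist m m)\<^sup>2"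
    using e(2)[OF mm mm] by blast
  have 4: "speed_sq d atlas induced_metric \<gamma> t \<le> 0\<^sup>2" if "t\<in>{0..1}" for t
    using \<gamma>(4)[OF that] by simp
  obtain l where "joined (h (k r' m)) (h (k r'' m)) l" "l \<le> \<bar>r' - r''\<bar> + max r' r'' * 0"
    by (rule joined_of_curve[OF assms(1,2) \<gamma>(1-3) order_refl 4]) (assumption, (rule that; assumption))
  then show ?thesis by (intro that[of l]) auto
qed

text \<open>Near a point other than the origin, \<open>k_inverse_lipschitz\<close> turns closeness
  in the image into closeness of radii and base points. The latter are joined by a short curve, and
  the radii are at most \<open>2 * r\<close>, whence the constant
  \<open>(1 + 2 * K) * L\<close>.\<close>

lemma joined_near:
  obtains C where "C > 0"
    "\<And>p. p \<in> U \<Longrightarrow> p \<noteq> 0 \<Longrightarrow> \<exists>e>0. \<forall>p'\<in>U \<inter> ball p e. \<forall>p''\<in>U \<inter> ball p e.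
       \<exists>l. joined (h p') (h p'') l \<and> l \<le> C * dist p' p''"
proof -
  obtain K where K: "K \<ge> 0"
    "\<And>m. m \<in> M \<Longrightarrow> \<exists>e>0. \<forall>m' m''. m' \<in> M \<inter> ball m e \<longrightarrow> m'' \<in> M \<inter> ball m e \<longrightarrow>
      (\<exists>\<gamma>. C1_curve d (top_of_set M) atlas \<gamma> \<and> \<gamma> 0 = m' \<and> \<gamma> 1 = m'' \<and>
          (\<forall>t\<in>{0..1}. speed_sq d atlas induced_metric \<gamma> t \<le> (K * dist m' m'')\<^sup>2))"
    by (rule short_curves) (rule that; assumption)
  define C where "C = (1 + 2 * K) * L"
  have "C > 0" using K(1) L_ge_1 by (simp add: C_def add_pos_nonneg)
  moreover have "\<exists>e>0. \<forall>p'\<in>U \<inter> ball p e. \<forall>p''\<in>U \<inter> ball p e. \<exists>l. joined (h p') (h p'') l \<and> l \<le> C * dist p' p''"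
    if p: "p \<in> U" "p \<noteq> 0" for p
  proof -
    obtain r m where rm: "r \<in> {0..<1}" "m \<in> M" "p = k r m" using U_cases[OF p(1)] .
    then have r: "0 < r" "r < 1" using p(2) k_zero by (auto simp: less_le)
    obtain e1 where e1: "e1 > 0" "\<And>m' m''. m' \<in> M \<inter> ball m e1 \<Longrightarrow> m'' \<in> M \<inter> ball m e1 \<Longrightarrow>
      (\<exists>\<gamma>. C1_curve d (top_of_set M) atlas \<gamma> \<and> \<gamma> 0 = m' \<and> \<gamma> 1 = m'' \<and>
          (\<forall>t\<in>{0..1}. speed_sq d atlas induced_metric \<gamma> t \<le> (K * dist m' m'')\<^sup>2))"
      using K(2)[OF rm(2)] by blast
    obtain e2 where e2: "e2 > 0" "\<And>r' m' r'' m''. 0 < r' \<Longrightarrow> r' < 1 \<Longrightarrow> m' \<in> M \<Longrightarrow> 0 < r'' \<Longrightarrow> r'' < 1 \<Longrightarrow> m'' \<in> M \<Longrightarrow>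
        dist (k r' m') (k r m) < e2 \<Longrightarrow> dist (k r'' m'') (k r m) < e2 \<Longrightarrow>
        \<bar>r' - r''\<bar> + r * dist m' m'' \<le> L * dist (k r' m') (k r'' m'')"
      using k_inverse_lipschitz[OF r rm(2)] by blast
    \<comment> \<open>\<open>norm p\<close> keeps the ball away from the origin,
      \<open>r / L\<close> forces radii below \<open>2 * r\<close>, and \<open>r * e1 / L\<close>
      brings base points within \<open>e1\<close> of \<open>m\<close>.\<close>
    define e where "e = Min {e2, norm p, r / L, r * e1 / L}"
    have L: "L > 0" using L_ge_1 by simp
    have "e \<le> r / L" "e \<le> r * e1 / L" unfolding e_def by (rule Min_le; simp)+
    then have e: "L * e \<le> r" "L * e \<le> r * e1" using L by (simp_all add: field_simps)
    have "e > 0" using e1(1) e2(1) p(2) r L by (simp add: e_def)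
    moreover have "e \<le> e2" "e \<le> norm p" unfolding e_def by (rule Min_le; simp)+
    moreover note e
    ultimately have e: "e > 0" "e \<le> e2" "e \<le> norm p" "L * e \<le> r" "L * e \<le> r * e1" by blast+
    have near: "\<exists>r' m'. 0 < r' \<and> r' < 1 \<and> r' \<le> 2 * r \<and> m' \<in> M \<inter> ball m e1 \<and> q = k r' m' \<and> dist q p < e2"
      if q: "q \<in> U \<inter> ball p e" for q
    proof -
      have "q \<noteq> 0" using q e(3) by auto
      obtain r' m' where rm': "r' \<in> {0..<1}" "m' \<in> M" "q = k r' m'" using U_cases q by blast
      then have r': "0 < r'" "r' < 1" using \<open>q \<noteq> 0\<close> k_zero by (auto simp: less_le)
      have d: "dist q p < e" using q by (simp add: dist_commute)
      have "\<bar>r' - r\<bar> + r * dist m' m \<le> L * dist q p"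
        using e2(2)[OF r' rm'(2) r rm(2)] d e(2) e2(1) rm'(3) rm(3) by auto
      also have "\<dots> < L * e" using d L by simp
      finally have *: "\<bar>r' - r\<bar> + r * dist m' m < L * e" .
      moreover have "0 \<le> r * dist m' m" using r by simp
      ultimately have "\<bar>r' - r\<bar> < r" "r * dist m' m < r * e1" using e(4,5) by linarith+
      then have "r' \<le> 2 * r" "dist m' m < e1" using r by auto
      then show ?thesis using r' rm' d e(2) by (intro exI[of _ r'] exI[of _ m']) (auto simp: dist_commute)
    qed
    have "\<exists>l. joined (h p') (h p'') l \<and> l \<le> C * dist p' p''"
      if p': "p' \<in> U \<inter> ball p e" and p'': "p'' \<in> U \<inter> ball p e" for p' p''
    proof -
      obtain r' m' where 1: "0 < r'" "r' < 1" "r' \<le> 2 * r" "m' \<in> M \<inter> ball m e1" "p' = k r' m'" "dist p' p < e2"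
        using near[OF p'] by blast
      obtain r'' m'' where 2: "0 < r''" "r'' < 1" "r'' \<le> 2 * r" "m'' \<in> M \<inter> ball m e1" "p'' = k r'' m''" "dist p'' p < e2"
        using near[OF p''] by blast
      have est: "\<bar>r' - r''\<bar> + r * dist m' m'' \<le> L * dist p' p''"
        using e2(2)[of r' m' r'' m''] 1 2 rm(3) by auto
      obtain \<gamma> where \<gamma>: "C1_curve d (top_of_set M) atlas \<gamma>" "\<gamma> 0 = m'" "\<gamma> 1 = m''"
        "\<And>t. t\<in>{0..1} \<Longrightarrow> speed_sq d atlas induced_metric \<gamma> t \<le> (K * dist m' m'')\<^sup>2"
        using e1(2)[OF 1(4) 2(4)] by blast
      have B: "0 \<le> K * dist m' m''" using K(1) by simp
      have r'1: "r' \<in> {0..<1}" "r'' \<in> {0..<1}" using 1 2 by auto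
      obtain l where l: "joined (h (k r' m')) (h (k r'' m'')) l" "l \<le> \<bar>r' - r''\<bar> + max r' r'' * (K * dist m' m'')"
        by (rule joined_of_curve[OF r'1 \<gamma>(1-3) B \<gamma>(4)]) (assumption, (rule that; assumption))
      note l(2)
      also have "max r' r'' * (K * dist m' m'') \<le> (2 * r) * (K * dist m' m'')"
        using 1(3) 2(3) B by (intro mult_right_mono) auto
      also have "\<bar>r' - r''\<bar> + (2 * r) * (K * dist m' m'') \<le> (1 + 2 * K) * (\<bar>r' - r''\<bar> + r * dist m' m'')"
        using K(1) r by (simp add: algebra_simps)
      also have "\<dots> \<le> (1 + 2 * K) * (L * dist p' p'')"
        using est K(1) by (intro mult_left_mono) auto
      finally show ?thesis using l(1) 1(5) 2(5) by (intro exI[of _ l]) (auto simp: C_def mult.assoc)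
    qed
    then show ?thesis using e(1) by blast
  qed
  ultimately show ?thesis by (rule that)
qed

lemma joined_chain:
  assumes "\<And>i. i < n \<Longrightarrow> \<exists>l. joined (h (q i)) (h (q (Suc i))) l \<and> l \<le> C * dist (q i) (q (Suc i))" "q 0 \<in> U"
  shows "\<exists>l. joined (h (q 0)) (h (q n)) l \<and> l \<le> C * (\<Sum>i<n. dist (q i) (q (Suc i)))"
  using assms(1)
proof (induction n)
  case 0
  \<comment> \<open>\<open>cone_curve\<close> has no empty concatenation, so a point is joined to
    itself by a radial piece of length at most 0.\<close>
  obtain r m where rm: "r \<in> {0..<1}" "m \<in> M" "q 0 = k r m" using U_cases[OF assms(2)] .
  obtain l where "joined (h (k r m)) (h (k r m)) l" "l \<le> \<bar>r - r\<bar>"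
    by (rule joined_radial[OF rm(1,1,2)]) (rule that; assumption)
  then show ?case using rm(3) by (intro exI[of _ l]) auto
next
  case (Suc n)
  obtain l where l: "joined (h (q 0)) (h (q n)) l" "l \<le> C * (\<Sum>i<n. dist (q i) (q (Suc i)))"
    using Suc.IH Suc.prems by fastforce
  obtain l' where l': "joined (h (q n)) (h (q (Suc n))) l'" "l' \<le> C * dist (q n) (q (Suc n))"
    using Suc.prems[of n] by blast
  have "joined (h (q 0)) (h (q (Suc n))) (l + l')" by (rule cone_curve.join[OF l(1) l'(1)])
  moreover have "l + l' \<le> C * (\<Sum>i<Suc n. dist (q i) (q (Suc i)))"
    using l(2) l'(2) by (simp add: algebra_simps)
  ultimately show ?case by blast
qed

lemma cone_dist_le_joined:
  "joined P Q l \<Longrightarrow> cone_dist d (top_of_set M) atlas induced_metric 1 P Q \<le> ennreal l"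
  unfolding cone_dist_def by (rule INF_lower) simp

text \<open>A curve through the origin is at least as long as the sum of the norms of its end
  points, which bounds two radial segments through the cone point. Any other curve is cut so finely
  that \<open>joined_near\<close> applies to each step.\<close>

lemma cone_dist_le_curve_length:
  obtains C where "C > 0"
    "\<And>\<gamma>. path \<gamma> \<Longrightarrow> path_image \<gamma> \<subseteq> U \<Longrightarrow>
       cone_dist d (top_of_set M) atlas induced_metric 1 (h (\<gamma> 0)) (h (\<gamma> 1)) \<le> ennreal C * curve_length \<gamma>"
proof -
  obtain C where C: "C > 0" "\<And>p. p \<in> U \<Longrightarrow> p \<noteq> 0 \<Longrightarrow> \<exists>e>0. \<forall>p'\<in>U \<inter> ball p e. \<forall>p''\<in>U \<inter> ball p e.
       \<exists>l. joined (h p') (h p'') l \<and> l \<le> C * dist p' p''"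
    by (rule joined_near) (rule that; assumption)
  show ?thesis
  proof (rule that[of "max C L"])
    show "max C L > 0" using C(1) by simp
    fix \<gamma> :: "real \<Rightarrow> 'm" assume "path \<gamma>" and imU: "path_image \<gamma> \<subseteq> U"
    then have cont: "continuous_on {0..1} \<gamma>" by (simp add: path_def)
    have inU: "\<gamma> t \<in> U" if "t \<in> {0..1}" for t using imU that by (auto simp: path_image_def)
    let ?cd = "cone_dist d (top_of_set M) atlas induced_metric 1 (h (\<gamma> 0)) (h (\<gamma> 1))"
    show "?cd \<le> ennreal (max C L) * curve_length \<gamma>"
    proof (cases "\<exists>t\<in>{0..1}. \<gamma> t = 0")
      case True
      then obtain s where s: "s \<in> {0..1}" "\<gamma> s = 0" by blast
      obtain r m where rm: "r \<in> {0..<1}" "m \<in> M" "\<gamma> 0 = k r m" using U_cases[OF inU[of 0]] by auto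
      obtain r' m' where rm': "r' \<in> {0..<1}" "m' \<in> M" "\<gamma> 1 = k r' m'" using U_cases[OF inU[of 1]] by auto
      have z: "0 \<in> {0..<1::real}" by simp
      obtain l where l: "joined (h (k r m)) (h (k 0 m)) l" "l \<le> \<bar>r - 0\<bar>"
        by (rule joined_radial[OF rm(1) z rm(2)]) (rule that; assumption)
      obtain l' where l': "joined (h (k 0 m')) (h (k r' m')) l'" "l' \<le> \<bar>0 - r'\<bar>"
        by (rule joined_radial[OF z rm'(1,2)]) (rule that; assumption)
      have "joined (h (\<gamma> 0)) (h (\<gamma> 1)) (l + l')"
        using cone_curve.join[of d "top_of_set M" atlas induced_metric 1 "h (k r m)" "h (k 0 m)" l "h (k r' m')" l']
          l(1) l'(1) rm rm' k_zero by simp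
      then have "?cd \<le> ennreal (l + l')" by (rule cone_dist_le_joined)
      also have "l + l' \<le> L * (norm (\<gamma> 0) + norm (\<gamma> 1))"
      proof -
        have "r \<le> L * norm (\<gamma> 0)" using norm_k_ge[of r m] rm L_ge_1 by (cases "r = 0") auto
        moreover have "r' \<le> L * norm (\<gamma> 1)" using norm_k_ge[of r' m'] rm' L_ge_1 by (cases "r' = 0") auto
        ultimately show ?thesis using l(2) l'(2) rm(1) rm'(1) by (simp add: algebra_simps)
      qed
      \<comment> \<open>The partition with the points 0, \<open>s\<close>, 1 detects both norms, as
        the curve is at the origin at time \<open>s\<close>.\<close>
      also have "\<dots> \<le> max C L * (\<Sum>i<2. dist (\<gamma> (if i = 0 then 0 else if i = 1 then s else 1)) (\<gamma> (if Suc i = 0 then 0 else if Suc i = 1 then s else 1)))"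
        using s by (simp add: numeral_2_eq_2 mult_right_mono)
      also have "ennreal \<dots> = ennreal (max C L) * ennreal (\<Sum>i<2. dist (\<gamma> (if i = 0 then 0 else if i = 1 then s else 1)) (\<gamma> (if Suc i = 0 then 0 else if Suc i = 1 then s else 1)))"
        using C(1) by (intro ennreal_mult) (auto intro: sum_nonneg)
      also have "\<dots> \<le> ennreal (max C L) * curve_length \<gamma>"
        using s by (intro mult_left_mono sum_dist_le_curve_length[where t = "\<lambda>i. if i = 0 then 0 else if i = 1 then s else 1"])
          (auto simp: mono_def)
      finally show ?thesis by (simp add: ennreal_leI)
    next
      case False
      have "\<exists>e. \<forall>t\<in>{0..1}. e t > 0 \<and> (\<forall>p'\<in>U \<inter> ball (\<gamma> t) (e t). \<forall>p''\<in>U \<inter> ball (\<gamma> t) (e t).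
          \<exists>l. joined (h p') (h p'') l \<and> l \<le> C * dist p' p'')"
        using C(2) inU False by (intro bchoice) blast
      then obtain e where e: "\<And>t. t \<in> {0..1} \<Longrightarrow> e t > 0"
        "\<And>t p' p''. t \<in> {0..1} \<Longrightarrow> p' \<in> U \<inter> ball (\<gamma> t) (e t) \<Longrightarrow> p'' \<in> U \<inter> ball (\<gamma> t) (e t) \<Longrightarrow>
          \<exists>l. joined (h p') (h p'') l \<and> l \<le> C * dist p' p''"
        by blast
      let ?G = "(\<lambda>t. ball (\<gamma> t) (e t)) ` {0..1}"
      have cpt: "compact (\<gamma> ` {0..1})" using cont by (intro compact_continuous_image) auto
      have sub: "\<gamma> ` {0..1} \<subseteq> \<Union> ?G"
      proof
        fix x assume "x \<in> \<gamma> ` {0..1}"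
        then obtain t where "t \<in> {0..1}" "x = \<gamma> t" by blast
        then show "x \<in> \<Union> ?G" using e(1) by (intro UnionI[of "ball (\<gamma> t) (e t)"]) auto
      qed
      have op: "open G" if "G \<in> ?G" for G using that by auto
      \<comment> \<open>A Lebesgue number of the cover of the compact curve by the balls of
        \<open>joined_near\<close>.\<close>
      obtain \<epsilon> where \<epsilon>: "\<epsilon> > 0" "\<And>x. x \<in> \<gamma> ` {0..1} \<Longrightarrow> \<exists>G \<in> ?G. ball x \<epsilon> \<subseteq> G"
        by (rule Heine_Borel_lemma[OF cpt sub op]) (assumption, (rule that; assumption))
      have "uniformly_continuous_on {0..1} \<gamma>" using cont compact_uniformly_continuous by blast
      then obtain \<delta> where \<delta>: "\<delta> > 0" "\<And>s t. s \<in> {0..1} \<Longrightarrow> t \<in> {0..1} \<Longrightarrow> dist s t < \<delta> \<Longrightarrow> dist (\<gamma> s) (\<gamma> t) < \<epsilon>"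
        using \<epsilon>(1) unfolding uniformly_continuous_on_def by (metis dist_commute)
      obtain N where N: "inverse (real (Suc N)) < \<delta>" using reals_Archimedean[OF \<delta>(1)] by blast
      define n where "n = Suc N"
      \<comment> \<open>Truncation at 1 makes the uniform partition a monotone sequence on all of
        \<open>nat\<close> with values in the unit interval, as \<open>curve_length\<close>
        requires.\<close>
      define t where "t i = min (real i / real n) 1" for i
      have n: "n > 0" "1 / real n < \<delta>" using N by (auto simp: n_def inverse_eq_divide)
      have t01: "t i \<in> {0..1}" for i by (simp add: t_def)
      have mono: "mono t" unfolding mono_def t_def by (intro allI impI min.mono divide_right_mono) auto
      have step: "dist (t i) (t (Suc i)) < \<delta>" for i
      proof -
        have "real (Suc i) / real n = real i / real n + 1 / real n" by (simp add: add_divide_distrib)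
        moreover have "\<bar>min x 1 - min (x + c) 1\<bar> \<le> c" if "c \<ge> 0" for x c :: real
          using that by (auto simp: min_def)
        from this[of "1 / real n" "real i / real n"]
        have "\<bar>min (real i / real n) 1 - min (real i / real n + 1 / real n) 1\<bar> \<le> 1 / real n" by simp
        ultimately show ?thesis using n(2) unfolding t_def dist_real_def by linarith
      qed
      have "\<exists>l. joined (h (\<gamma> (t i))) (h (\<gamma> (t (Suc i)))) l \<and> l \<le> C * dist (\<gamma> (t i)) (\<gamma> (t (Suc i)))" for i
      proof -
        have "\<gamma> (t i) \<in> \<gamma> ` {0..1}" using t01 by blast
        then obtain s where s: "s \<in> {0..1}" "ball (\<gamma> (t i)) \<epsilon> \<subseteq> ball (\<gamma> s) (e s)" using \<epsilon>(2) by blast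
        have "\<gamma> (t i) \<in> ball (\<gamma> (t i)) \<epsilon>" "\<gamma> (t (Suc i)) \<in> ball (\<gamma> (t i)) \<epsilon>"
          using \<epsilon>(1) \<delta>(2)[OF t01 t01 step] by auto
        then show ?thesis using s e(2)[OF s(1)] inU[OF t01] by blast
      qed
      moreover have "\<gamma> (t 0) \<in> U" using inU[OF t01] .
      ultimately obtain l where l: "joined (h (\<gamma> (t 0))) (h (\<gamma> (t n))) l" "l \<le> C * (\<Sum>i<n. dist (\<gamma> (t i)) (\<gamma> (t (Suc i))))"
        using joined_chain[of n "\<lambda>i. \<gamma> (t i)" C] by blast
      have "t 0 = 0" "t n = 1" using n(1) by (auto simp: t_def)
      then have "?cd \<le> ennreal l" using l(1) by (auto intro: cone_dist_le_joined)
      also have "l \<le> max C L * (\<Sum>i<n. dist (\<gamma> (t i)) (\<gamma> (t (Suc i))))"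
        by (rule order_trans[OF l(2)]) (auto intro!: mult_right_mono sum_nonneg)
      also have "ennreal \<dots> = ennreal (max C L) * ennreal (\<Sum>i<n. dist (\<gamma> (t i)) (\<gamma> (t (Suc i))))"
        using C(1) by (intro ennreal_mult) (auto intro: sum_nonneg)
      also have "\<dots> \<le> ennreal (max C L) * curve_length \<gamma>"
        using mono t01 by (intro mult_left_mono sum_dist_le_curve_length) auto
      finally show ?thesis by (simp add: ennreal_leI)
    qed
  qed
qed

section \<open>From curves in the cone to curves in the image\<close>

text \<open>Bisection: the inequality is additive over adjacent intervals, by the triangle
  inequality and additivity of the integral, so it suffices to know it for short intervals around
  each point.\<close>

lemma dist_le_integral:
  fixes c :: "real \<Rightarrow> 'b::real_normed_vector" and f :: "real \<Rightarrow> real"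
  assumes ab: "a \<le> b" and f: "f integrable_on {a..b}"
    and local: "\<And>x. x \<in> {a..b} \<Longrightarrow> \<exists>\<delta>>0. \<forall>s t. a \<le> s \<longrightarrow> s \<le> x \<longrightarrow> x \<le> t \<longrightarrow> t \<le> b \<longrightarrow> t - s < \<delta> \<longrightarrow>
      dist (c s) (c t) \<le> integral {s..t} f"
  shows "dist (c a) (c b) \<le> integral {a..b} f"
proof -
  define P where "P s t \<longleftrightarrow> (a \<le> s \<longrightarrow> s \<le> t \<longrightarrow> t \<le> b \<longrightarrow> dist (c s) (c t) \<le> integral {s..t} f)" for s t
  have "P a b"
    using ab
  proof (induction rule: Bolzano)
    case (trans s t u)
    show ?case
      unfolding P_def
    proof (intro impI)
      assume "a \<le> s" "s \<le> u" "u \<le> b"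
      have "f integrable_on {s..u}"
        by (rule integrable_on_subinterval[OF f]) (use \<open>a \<le> s\<close> \<open>u \<le> b\<close> in auto)
      then have "integral {s..t} f + integral {t..u} f = integral {s..u} f"
        by (rule Henstock_Kurzweil_Integration.integral_combine[OF trans(3,4)])
      moreover have "dist (c s) (c u) \<le> dist (c s) (c t) + dist (c t) (c u)" by (rule dist_triangle)
      ultimately show "dist (c s) (c u) \<le> integral {s..u} f"
        using trans \<open>a \<le> s\<close> \<open>u \<le> b\<close> unfolding P_def by fastforce
    qed
  next
    case (local x)
    then obtain \<delta> where "\<delta> > 0" "\<And>s t. a \<le> s \<Longrightarrow> s \<le> x \<Longrightarrow> x \<le> t \<Longrightarrow> t \<le> b \<Longrightarrow> t - s < \<delta> \<Longrightarrow>
        dist (c s) (c t) \<le> integral {s..t} f"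
      using assms(3)[of x] by auto
    then show ?case unfolding P_def by blast
  qed
  then show ?thesis using ab by (simp add: P_def)
qed

lemma dist_le_integral_velocity:
  fixes c :: "real \<Rightarrow> 'b::banach" and c' :: "real \<Rightarrow> 'b"
  assumes c: "\<And>t. t \<in> {0..1} \<Longrightarrow> (c has_vector_derivative c' t) (at t within {0..1})"
    and c': "continuous_on {0..1} c'" and g: "continuous_on {0..1} g"
    and le: "\<And>x. x \<in> {s..t} \<Longrightarrow> norm (c' x) \<le> g x" and st: "0 \<le> s" "s \<le> t" "t \<le> (1::real)"
  shows "dist (c s) (c t) \<le> integral {s..t} g"
proof -
  have sub: "{s..t} \<subseteq> {0..1}" using st by auto
  have "(c' has_integral c t - c s) {s..t}"
    by (rule fundamental_theorem_of_calculus[OF st(2)]) (use c sub has_vector_derivative_within_subset in blast)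
  then have eq: "c t - c s = integral {s..t} c'" by (simp add: integral_unique)
  have "norm (integral {s..t} c') \<le> integral {s..t} g"
    using le by (intro integral_norm_bound_integral integrable_continuous_real continuous_on_subset[OF c' sub]
      continuous_on_subset[OF g sub]) auto
  then show ?thesis by (simp add: dist_norm norm_minus_commute eq[symmetric])
qed

text \<open>\<open>k_lipschitz\<close> bounds the image of a short stretch by \<open>L\<close> times
  its radial change plus \<open>r\<close> times its displacement in \<open>M\<close>. The integrand
  \<open>f\<close> dominates \<open>\<bar>\<rho>'\<bar>\<close> and
  \<open>\<rho> * norm \<gamma>'\<close>; since \<open>r\<close> is at most twice the radius along
  the stretch, the two parts give 1 + 2 = 3 times the integral. Intervals that meet the cone point
  are treated by norms.\<close>

lemma piece_image_controlled:
  assumes \<rho>: "\<And>t. t \<in> {0..1} \<Longrightarrow> (\<rho> has_real_derivative \<rho>' t) (at t within {0..1})" "continuous_on {0..1} \<rho>'"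
      "\<And>t. t \<in> {0..1} \<Longrightarrow> \<rho> t \<in> {0..<1}"
    and \<gamma>: "C1_curve d (top_of_set M) atlas \<gamma>"
  defines "l \<equiv> integral {0..1} (\<lambda>t. sqrt ((\<rho>' t)\<^sup>2 + (\<rho> t)\<^sup>2 * speed_sq d atlas induced_metric \<gamma> t))"
  shows "0 \<le> l" "controlled (\<lambda>t. k (\<rho> t) (\<gamma> t)) (3 * L * l)"
proof -
  obtain \<gamma>' where \<gamma>': "continuous_on {0..1} \<gamma>'"
    "\<And>t. t \<in> {0..1} \<Longrightarrow> (\<gamma> has_vector_derivative \<gamma>' t) (at t within {0..1})"
    "\<And>t. t \<in> {0..1} \<Longrightarrow> speed_sq d atlas induced_metric \<gamma> t = (norm (\<gamma>' t))\<^sup>2"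
    by (rule C1_curve_velocity[OF \<gamma>]) (rule that; assumption)
  have \<gamma>M: "\<gamma> t \<in> M" if "t \<in> {0..1}" for t using C1_curve_continuous(2)[OF \<gamma>] that by blast
  have \<rho>v: "(\<rho> has_vector_derivative \<rho>' t) (at t within {0..1})" if "t \<in> {0..1}" for t
    using \<rho>(1)[OF that] by (simp add: has_real_derivative_iff_has_vector_derivative)
  have \<rho>c: "continuous_on {0..1} \<rho>"
    unfolding continuous_on_eq_continuous_within using \<rho>v has_vector_derivative_continuous by blast
  define f where "f t = sqrt ((\<rho>' t)\<^sup>2 + (\<rho> t * norm (\<gamma>' t))\<^sup>2)" for t
  have f: "continuous_on {0..1} f"
    unfolding f_def by (intro continuous_intros \<rho>(2) \<rho>c \<gamma>'(1))
  have l: "l = integral {0..1} f"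
    unfolding l_def by (rule integral_cong) (simp add: f_def \<gamma>'(3) power_mult_distrib)
  have f_ge: "\<bar>\<rho>' t\<bar> \<le> f t" "\<rho> t * norm (\<gamma>' t) \<le> f t" "0 \<le> f t" for t
  proof -
    show "\<bar>\<rho>' t\<bar> \<le> f t" unfolding f_def by (rule real_sqrt_ge_abs1)
    show "0 \<le> f t" unfolding f_def by simp
    have "\<bar>\<rho> t * norm (\<gamma>' t)\<bar> \<le> f t" unfolding f_def by (rule real_sqrt_ge_abs2)
    then show "\<rho> t * norm (\<gamma>' t) \<le> f t" by linarith
  qed
  have int: "f integrable_on {s..t}" if "0 \<le> s" "t \<le> 1" for s t
    using that by (intro integrable_continuous_real continuous_on_subset[OF f]) auto
  have int_nonneg: "0 \<le> integral {s..t} f" if "0 \<le> s" "t \<le> 1" for s t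
    by (intro integral_nonneg int that) (rule f_ge(3))
  have \<rho>_dist: "\<bar>\<rho> s - \<rho> t\<bar> \<le> integral {s..t} f" if st: "0 \<le> s" "s \<le> t" "t \<le> 1" for s t
    using dist_le_integral_velocity[OF \<rho>v \<rho>(2) f _ st] f_ge(1) by (simp add: dist_real_def)
  have norm_k: "norm (k (\<rho> t) (\<gamma> t)) \<le> L * \<rho> t" if "t \<in> {0..1}" for t
    using norm_k_le[of "\<rho> t" "\<gamma> t"] k_zero[OF \<gamma>M[OF that]] \<rho>(3)[OF that] \<gamma>M[OF that] by (cases "\<rho> t = 0") auto
  let ?c = "\<lambda>t. k (\<rho> t) (\<gamma> t)"
  have L0: "0 \<le> L" using L_ge_1 by simp
  have main: "dist (?c s) (?c t) \<le> 3 * L * integral {s..t} f" if st: "0 \<le> s" "s \<le> t" "t \<le> 1" for s t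
  proof (cases "\<exists>z\<in>{s..t}. \<rho> z = 0")
    case True
    then obtain z where z: "s \<le> z" "z \<le> t" "\<rho> z = 0" by auto
    \<comment> \<open>If the radius vanishes at \<open>z\<close>, then the radii at \<open>s\<close>
      and \<open>t\<close> are bounded by the integrals over the two sides of \<open>z\<close>, and
      the norms of the image points by \<open>L\<close> times these radii.\<close>
    have "dist (?c s) (?c t) \<le> norm (?c s) + norm (?c t)" by (simp add: dist_norm norm_triangle_ineq4)
    also have "\<dots> \<le> L * \<rho> s + L * \<rho> t" using st by (intro add_mono norm_k) auto
    also have "\<dots> \<le> L * integral {s..z} f + L * integral {z..t} f"
      using \<rho>_dist[of s z] \<rho>_dist[of z t] z st L0 by (intro add_mono mult_left_mono) auto
    also have "\<dots> = L * integral {s..t} f"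
      using Henstock_Kurzweil_Integration.integral_combine[OF z(1,2) int[of s t]] st by (simp add: distrib_left[symmetric])
    also have "\<dots> \<le> 3 * L * integral {s..t} f"
      using L0 int_nonneg[of s t] st by (simp add: mult_nonneg_nonneg)
    finally show ?thesis .
  next
    case False
    have "dist (?c s) (?c t) \<le> integral {s..t} (\<lambda>t. 3 * L * f t)"
    proof (rule dist_le_integral[OF st(2)])
      show "(\<lambda>t. 3 * L * f t) integrable_on {s..t}" using int[of s t] st by (intro integrable_on_mult_right) auto
      fix x assume x: "x \<in> {s..t}"
      define r where "r = \<rho> x"
      have x01: "x \<in> {0..1}" using x st by auto
      have r: "0 < r" "r < 1" using \<rho>(3)[OF x01] False x by (auto simp: r_def less_le)
      obtain e where e: "e > 0" "\<And>r' m' r'' m''. 0 < r' \<Longrightarrow> r' < 1 \<Longrightarrow> m' \<in> M \<Longrightarrow> 0 < r'' \<Longrightarrow> r'' < 1 \<Longrightarrow> m'' \<in> M \<Longrightarrow>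
        \<bar>r' - r\<bar> < e \<Longrightarrow> dist m' (\<gamma> x) < e \<Longrightarrow> \<bar>r'' - r\<bar> < e \<Longrightarrow> dist m'' (\<gamma> x) < e \<Longrightarrow>
        dist (k r' m') (k r'' m'') \<le> L * (\<bar>r' - r''\<bar> + r * dist m' m'')"
        using k_lipschitz[OF r \<gamma>M[OF x01]] by blast
      \<comment> \<open>The bound \<open>r / 2\<close> keeps the radius along the stretch above
        \<open>r / 2\<close>, which costs the factor 2 in the \<open>M\<close> direction.\<close>
      define e' where "e' = min e (r / 2)"
      have e': "e' > 0" "e' \<le> e" "e' \<le> r / 2" using e(1) r by (auto simp: e'_def)
      obtain \<delta>1 where \<delta>1: "\<delta>1 > 0" "\<And>u. u \<in> {0..1} \<Longrightarrow> dist u x < \<delta>1 \<Longrightarrow> dist (\<rho> u) (\<rho> x) < e'"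
        using \<rho>c x01 e'(1) unfolding continuous_on_iff by blast
      obtain \<delta>2 where \<delta>2: "\<delta>2 > 0" "\<And>u. u \<in> {0..1} \<Longrightarrow> dist u x < \<delta>2 \<Longrightarrow> dist (\<gamma> u) (\<gamma> x) < e'"
        using C1_curve_continuous(1)[OF \<gamma>] x01 e'(1) unfolding continuous_on_iff by blast
      show "\<exists>\<delta>>0. \<forall>u v. s \<le> u \<longrightarrow> u \<le> x \<longrightarrow> x \<le> v \<longrightarrow> v \<le> t \<longrightarrow> v - u < \<delta> \<longrightarrow>
        dist (?c u) (?c v) \<le> integral {u..v} (\<lambda>t. 3 * L * f t)"
      proof (intro exI[of _ "min \<delta>1 \<delta>2"] conjI allI impI)
        fix u v assume uv: "s \<le> u" "u \<le> x" "x \<le> v" "v \<le> t" "v - u < min \<delta>1 \<delta>2"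
        have near: "w \<in> {0..1} \<and> \<bar>\<rho> w - r\<bar> < e' \<and> dist (\<gamma> w) (\<gamma> x) < e'" if w: "w \<in> {u..v}" for w
        proof -
          have "w \<in> {0..1}" "dist w x < \<delta>1" "dist w x < \<delta>2" using uv w st by (auto simp: dist_real_def)
          then show ?thesis using \<delta>1(2)[of w] \<delta>2(2)[of w] by (auto simp: dist_real_def r_def)
        qed
        have pos: "0 < \<rho> w" "\<rho> w < 1" "r \<le> 2 * \<rho> w" if w: "w \<in> {u..v}" for w
          using near[OF w] \<rho>(3)[of w] e'(3) r by auto
        have u: "u \<in> {u..v}" and v: "v \<in> {u..v}" using uv by auto
        have uv01: "0 \<le> u" "u \<le> v" "v \<le> 1" using uv st by auto
        have "dist (?c u) (?c v) \<le> L * (\<bar>\<rho> u - \<rho> v\<bar> + r * dist (\<gamma> u) (\<gamma> v))"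
          using near[OF u] near[OF v] pos[OF u] pos[OF v] e'(2) \<gamma>M by (intro e(2)) auto
        also have "\<dots> \<le> L * (integral {u..v} f + 2 * integral {u..v} f)"
        proof (intro mult_left_mono add_mono \<rho>_dist uv01 L0)
          have g: "continuous_on {0..1} (\<lambda>t. 2 / r * f t)" by (intro continuous_intros f)
          have "norm (\<gamma>' w) \<le> 2 / r * f w" if w: "w \<in> {u..v}" for w
          proof -
            have "r * norm (\<gamma>' w) \<le> 2 * \<rho> w * norm (\<gamma>' w)" using pos(3)[OF w] by (intro mult_right_mono) auto
            also have "\<dots> \<le> 2 * f w" using f_ge(2)[of w] by simp
            finally show ?thesis using r(1) by (simp add: field_simps)
          qed
          then have "dist (\<gamma> u) (\<gamma> v) \<le> integral {u..v} (\<lambda>t. 2 / r * f t)"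
            by (intro dist_le_integral_velocity[OF \<gamma>'(2,1) g _ uv01])
          also have "\<dots> = 2 / r * integral {u..v} f" by (rule integral_mult_right)
          finally show "r * dist (\<gamma> u) (\<gamma> v) \<le> 2 * integral {u..v} f" using r(1) by (simp add: field_simps)
        qed
        also have "\<dots> = 3 * L * integral {u..v} f" by (simp add: algebra_simps)
        also have "\<dots> = integral {u..v} (\<lambda>t. 3 * L * f t)" by (rule integral_mult_right[symmetric])
        finally show "dist (?c u) (?c v) \<le> integral {u..v} (\<lambda>t. 3 * L * f t)" .
      qed (use \<delta>1 \<delta>2 in auto)
    qed
    also have "\<dots> = 3 * L * integral {s..t} f" by (rule integral_mult_right)
    finally show ?thesis .
  qed
  define \<Phi> where "\<Phi> t = 3 * L * integral {0..t} f" for t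
  have \<Phi>: "dist (?c s) (?c t) \<le> \<Phi> t - \<Phi> s" if st: "0 \<le> s" "s \<le> t" "t \<le> 1" for s t
  proof -
    have eq: "integral {0..t} f = integral {0..s} f + integral {s..t} f"
      by (rule Henstock_Kurzweil_Integration.integral_combine[OF st(1,2) int, symmetric]) (use st in auto)
    show ?thesis using main[OF st] unfolding \<Phi>_def eq distrib_left by simp
  qed
  \<comment> \<open>Continuity of \<open>\<Phi>\<close> gives continuity of the image curve, at
    times of radius 0 as well, where \<open>k_lipschitz\<close> says nothing.\<close>
  have "continuous_on {0..1} ?c"
  proof -
    have \<Phi>c: "continuous_on {0..1} \<Phi>"
      unfolding \<Phi>_def by (intro continuous_intros indefinite_integral_continuous_1 int) auto
    show ?thesis
      unfolding continuous_on_iff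
    proof (intro ballI allI impI)
      fix x e assume x: "x \<in> {0..1::real}" and "(e::real) > 0"
      then obtain \<delta> where \<delta>: "\<delta> > 0" "\<And>y. y \<in> {0..1} \<Longrightarrow> dist y x < \<delta> \<Longrightarrow> dist (\<Phi> y) (\<Phi> x) < e"
        using \<Phi>c unfolding continuous_on_iff by blast
      have "dist (?c y) (?c x) < e" if y: "y \<in> {0..1}" "dist y x < \<delta>" for y
        using \<delta>(2)[OF y] \<Phi>[of x y] \<Phi>[of y x] x y by (cases "x \<le> y") (auto simp: dist_real_def dist_commute)
      then show "\<exists>\<delta>>0. \<forall>y\<in>{0..1}. dist y x < \<delta> \<longrightarrow> dist (?c y) (?c x) < e" using \<delta>(1) by blast
    qed
  qed
  moreover have "\<Phi> 1 - \<Phi> 0 \<le> 3 * L * l" by (simp add: \<Phi>_def l)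
  ultimately show "controlled ?c (3 * L * l)" unfolding controlled_def using \<Phi> by blast
  show "0 \<le> l" unfolding l by (rule int_nonneg) auto
qed

text \<open>Pieces that fit together only in the quotient have image curves that fit together
  exactly, because \<open>h\<close> is injective on \<open>U\<close>; so the image curves can be
  concatenated even where the direction changes at the cone point.\<close>

lemma joined_imp_controlled:
  assumes "joined P Q l"
  shows "0 \<le> l \<and> (\<exists>p\<in>U. \<exists>q\<in>U. P = h p \<and> Q = h q \<and>
    (\<exists>c. controlled c (3 * L * l) \<and> c ` {0..1} \<subseteq> U \<and> c 0 = p \<and> c 1 = q))"
  using assms
proof induction
  case (piece \<rho> \<rho>' \<gamma>)
  let ?l = "integral {0..1} (\<lambda>t. sqrt ((\<rho>' t)\<^sup>2 + (\<rho> t)\<^sup>2 * speed_sq d atlas induced_metric \<gamma> t))"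
  have \<rho>: "\<rho> t \<in> {0..<1}" if "t \<in> {0..1}" for t using piece(3) that by blast
  have \<gamma>M: "\<gamma> t \<in> M" if "t \<in> {0..1}" for t using C1_curve_continuous(2)[OF piece(4)] that by blast
  have 1: "0 \<le> ?l" "controlled (\<lambda>t. k (\<rho> t) (\<gamma> t)) (3 * L * ?l)"
    by (rule piece_image_controlled[OF bspec[OF piece(1)] piece(2) \<rho> piece(4)]; assumption)+
  have 2: "(\<lambda>t. k (\<rho> t) (\<gamma> t)) ` {0..1} \<subseteq> U"
  proof
    fix x assume "x \<in> (\<lambda>t. k (\<rho> t) (\<gamma> t)) ` {0..1}"
    then obtain t where t: "t \<in> {0..1}" "x = k (\<rho> t) (\<gamma> t)" by blast
    show "x \<in> U" unfolding U_def using \<rho>[OF t(1)] \<gamma>M[OF t(1)] t(2)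
      by (intro image_eqI[of _ _ "(\<rho> t, \<gamma> t)"]) auto
  qed
  have z: "0 \<in> {0..1::real}" "1 \<in> {0..1::real}" by auto
  have cls: "cone_rel 1 (top_of_set M) `` {(\<rho> 0, \<gamma> 0)} = h (k (\<rho> 0) (\<gamma> 0))"
    "cone_rel 1 (top_of_set M) `` {(\<rho> 1, \<gamma> 1)} = h (k (\<rho> 1) (\<gamma> 1))"
    by (intro cone_class \<rho> \<gamma>M z)+
  have k_U: "k (\<rho> 0) (\<gamma> 0) \<in> U" "k (\<rho> 1) (\<gamma> 1) \<in> U" using 2 z by blast+
  show ?case
    unfolding cls
    by (intro conjI 1 2 k_U refl bexI[of _ "k (\<rho> 0) (\<gamma> 0)"] bexI[of _ "k (\<rho> 1) (\<gamma> 1)"]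
        exI[of _ "\<lambda>t. k (\<rho> t) (\<gamma> t)"])
next
  case (join P Q l R l')
  obtain p q c where 1: "p \<in> U" "q \<in> U" "P = h p" "Q = h q" "controlled c (3 * L * l)" "c ` {0..1} \<subseteq> U" "c 0 = p" "c 1 = q"
    using join.IH(1) by blast
  obtain q' r c' where 2: "q' \<in> U" "r \<in> U" "Q = h q'" "R = h r" "controlled c' (3 * L * l')" "c' ` {0..1} \<subseteq> U" "c' 0 = q'" "c' 1 = r"
    using join.IH(2) by blast
  have "q = q'" using bij_h 1(2,4) 2(1,3) by (metis bij_betw_imp_inj_on inj_onD)
  then have 3: "controlled (c +++ c') (3 * L * l + 3 * L * l')"
    using controlled_joinpaths[OF 1(5) 2(5)] 1(8) 2(7) by simp
  have 4: "(c +++ c') ` {0..1} \<subseteq> U"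
    using path_image_join_subset[of c c'] 1(6) 2(6) unfolding path_image_def by blast
  have 5: "(c +++ c') 0 = p" "(c +++ c') 1 = r" using 1(7) 2(8) by (simp_all add: joinpaths_def)
  have 6: "3 * L * l + 3 * L * l' = 3 * L * (l + l')" by (simp add: distrib_left)
  show ?case
    using join.IH 1(1,3) 2(2,4) 3 4 5 unfolding 6 by (intro conjI bexI[of _ p] bexI[of _ r] exI[of _ "c +++ c'"]) auto
qed

lemma inner_dist_le_cone_dist:
  assumes "p \<in> U" "q \<in> U"
  shows "inner_dist U p q \<le> ennreal (3 * L) * cone_dist d (top_of_set M) atlas induced_metric 1 (h p) (h q)"
  unfolding cone_dist_def
proof (rule le_ennreal_mult_INF)
  show "3 * L > 0" using L_ge_1 by simp
  fix l assume "l \<in> {l. joined (h p) (h q) l}"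
  then have "joined (h p) (h q) l" by simp
  from joined_imp_controlled[OF this]
  obtain p' q' c where l: "0 \<le> l" and c: "p' \<in> U" "q' \<in> U" "h p = h p'" "h q = h q'" "controlled c (3 * L * l)"
    "c ` {0..1} \<subseteq> U" "c 0 = p'" "c 1 = q'" by blast
  have "p' = p" "q' = q" using bij_h assms c(1-4) by (metis bij_betw_imp_inj_on inj_onD)+
  then have "inner_dist U p q \<le> ennreal (3 * L * l)"
    using inner_dist_le_controlled[OF c(5-8)] by simp
  also have "\<dots> = ennreal (3 * L) * ennreal l" using l L_ge_1 by (intro ennreal_mult) auto
  finally show "inner_dist U p q \<le> ennreal (3 * L) * ennreal l" .
qed

text \<open>One constant is made from both directions: every curve in \<open>U\<close> bounds the
  cone distance, and every curve in the cone bounds the inner distance. \<open>W\<close> certifies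
  that \<open>U\<close> is a neighbourhood of 0 in \<open>V\<close>.\<close>

theorem metrically_conical:
  assumes "U \<subseteq> V" "open W" "0 \<in> W" "W \<inter> V \<subseteq> U"
  shows "metrically_conical V 0"
proof -
  obtain C where C: "C > 0" "\<And>\<gamma>. path \<gamma> \<Longrightarrow> path_image \<gamma> \<subseteq> U \<Longrightarrow>
       cone_dist d (top_of_set M) atlas induced_metric 1 (h (\<gamma> 0)) (h (\<gamma> 1)) \<le> ennreal C * curve_length \<gamma>"
    by (rule cone_dist_le_curve_length) (rule that; assumption)
  let ?cd = "cone_dist d (top_of_set M) atlas induced_metric 1"
  have up: "?cd (h p) (h q) \<le> ennreal C * inner_dist U p q" for p q
    unfolding inner_dist_def
  proof (rule le_ennreal_mult_INF[OF C(1)])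
    fix \<gamma> assume "\<gamma> \<in> {\<gamma>. rectifiable \<gamma> \<and> path_image \<gamma> \<subseteq> U \<and> pathstart \<gamma> = p \<and> pathfinish \<gamma> = q}"
    then show "?cd (h p) (h q) \<le> ennreal C * curve_length \<gamma>"
      using C(2)[of \<gamma>] by (auto simp: rectifiable_def pathstart_def pathfinish_def)
  qed
  define K where "K = max C (3 * L)"
  have K: "K \<ge> 1" "ennreal C \<le> ennreal K" "ennreal (3 * L) \<le> ennreal K"
    using L_ge_1 by (auto simp: K_def le_max_iff_disj intro!: ennreal_leI)
  have "bi_Lipschitz_homeo U (inner_dist U) (cone 1 (top_of_set M)) ?cd h"
    unfolding bi_Lipschitz_homeo_def
  proof (intro conjI bij_h exI[of _ K] K(1) ballI)
    fix p q assume pq: "p \<in> U" "q \<in> U"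
    show "?cd (h p) (h q) \<le> ennreal K * inner_dist U p q"
      by (rule order_trans[OF up mult_right_mono[OF K(2)]]) simp
    show "inner_dist U p q \<le> ennreal K * ?cd (h p) (h q)"
      by (rule order_trans[OF inner_dist_le_cone_dist[OF pq] mult_right_mono[OF K(3)]]) simp
  qed
  moreover have "0 \<in> V" using zero_in_U assms(1) by blast
  moreover have "\<exists>W. open W \<and> 0 \<in> W \<and> W \<inter> V \<subseteq> U" using assms by blast
  ultimately show ?thesis
    unfolding metrically_conical_def using assms(1) compact_riemannian_manifold_axioms h_zero zero_less_one
    by blast
qed

end

section \<open>Branches of roots\<close>

lemma Ck_on_inverse:
  fixes f :: "(nat \<Rightarrow> real) \<Rightarrow> complex"
  assumes "\<And>x. x \<in> S \<Longrightarrow> f x \<noteq> 0"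
  shows "Ck_on d k S f \<Longrightarrow> Ck_on d k S (\<lambda>x. inverse (f x))"
proof (induction k)
  case 0
  then show ?case using assms by (simp add: continuous_on_inverse)
next
  case (Suc k)
  have IH: "Ck_on d k S (\<lambda>x. inverse (f x))" by (rule Suc.IH[OF Ck_on_Suc[OF Suc.prems]])
  show ?case
    unfolding Ck_on.simps
  proof (intro conjI allI impI)
    show "continuous_on S (\<lambda>x. inverse (f x))" by (rule Ck_on_continuous[OF IH])
    fix i assume "i < d"
    then obtain f' where f': "\<forall>x\<in>S. ((\<lambda>t. f (x(i := t))) has_vector_derivative f' x) (at (x i))" "Ck_on d k S f'"
      using Suc.prems unfolding Ck_on.simps by blast
    have "Ck_on d k S (\<lambda>x. - (f' x * (inverse (f x) * inverse (f x))))"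
      by (rule Ck_on_linear[OF bounded_linear_minus[OF bounded_linear_ident]])
         (intro Ck_on_bilinear[OF bounded_bilinear_mult] f'(2) IH)
    moreover have "((\<lambda>t. inverse (f (x(i := t)))) has_vector_derivative - (f' x * (inverse (f x) * inverse (f x)))) (at (x i))"
      if x: "x \<in> S" for x
    proof -
      have "(inverse has_field_derivative - (inverse (f x) * inverse (f x))) (at (f (x(i := x i))))"
        using DERIV_inverse[OF assms[OF x]] by (simp add: power2_eq_square numeral_2_eq_2)
      from field_vector_diff_chain_at[OF f'(1)[rule_format, OF x] this]
      show ?thesis unfolding o_def by (simp only: mult_minus_right)
    qed
    ultimately show "\<exists>g. (\<forall>x\<in>S. ((\<lambda>t. inverse (f (x(i := t)))) has_vector_derivative g x) (at (x i))) \<and> Ck_on d k S g"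
      by (intro exI[of _ "\<lambda>x. - (f' x * (inverse (f x) * inverse (f x)))"] conjI ballI)
  qed
qed

text \<open>The branch of the \<open>n\<close>-th root that takes \<open>c ^ n\<close> to
  \<open>c\<close>, with its cut along the ray opposite to \<open>c ^ n\<close>.\<close>

definition croot :: "nat \<Rightarrow> complex \<Rightarrow> complex \<Rightarrow> complex" where
  "croot n c w = c * exp (Ln (w / c ^ n) / of_nat n)"

lemma croot_power: "n > 0 \<Longrightarrow> c \<noteq> 0 \<Longrightarrow> w \<noteq> 0 \<Longrightarrow> croot n c w ^ n = w"
  by (simp add: croot_def power_mult_distrib exp_of_nat_mult[symmetric])

lemma croot_has_field_derivative:
  assumes "n > 0" "c \<noteq> 0" "w / c ^ n \<notin> \<real>\<^sub>\<le>\<^sub>0"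
  shows "(croot n c has_field_derivative croot n c w / (of_nat n * w)) (at w)"
proof -
  have "w \<noteq> 0" using assms(3) by auto
  then show ?thesis
    unfolding croot_def using assms by (auto intro!: derivative_eq_intros simp: field_simps)
qed

lemma continuous_on_croot:
  assumes "n > 0" "c \<noteq> 0" "continuous_on S f" "\<And>u. u \<in> S \<Longrightarrow> f u / c ^ n \<notin> \<real>\<^sub>\<le>\<^sub>0"
  shows "continuous_on S (\<lambda>u. croot n c (f u))"
  unfolding croot_def using assms by (intro continuous_intros) auto

text \<open>For \<open>h\<close> close to \<open>c\<close> the number \<open>n * Ln (h / c)\<close>
  has imaginary part of modulus less than pi, hence it is the principal logarithm of
  \<open>h ^ n / c ^ n\<close>.\<close>

lemma croot_inverse:
  assumes "n > 0" "c \<noteq> 0"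
  obtains T where "open T" "c \<in> T"
    "\<And>h. h \<in> T \<Longrightarrow> h \<noteq> 0 \<and> h ^ n / c ^ n \<notin> \<real>\<^sub>\<le>\<^sub>0 \<and> croot n c (h ^ n) = h"
proof -
  have cont: "isCont (\<lambda>h. real n * Im (Ln (h / c))) c"
    using assms by (intro continuous_intros) auto
  have "\<forall>\<^sub>F h in nhds c. \<bar>real n * Im (Ln (h / c))\<bar> < pi"
  proof -
    have "((\<lambda>h. real n * Im (Ln (h / c))) \<longlongrightarrow> real n * Im (Ln (c / c))) (nhds c)"
      by (rule tendsto_at_iff_tendsto_nhds[THEN iffD1, OF cont[unfolded isCont_def]])
    moreover have "real n * Im (Ln (c / c)) = 0" using assms(2) by simp
    ultimately have "((\<lambda>h. real n * Im (Ln (h / c))) \<longlongrightarrow> 0) (nhds c)" by (simp only:)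
    then have "((\<lambda>h. \<bar>real n * Im (Ln (h / c))\<bar>) \<longlongrightarrow> 0) (nhds c)" by (rule tendsto_rabs_zero)
    then show ?thesis by (rule order_tendstoD) simp
  qed
  moreover have "\<forall>\<^sub>F h in nhds c. h \<noteq> 0" using assms(2) by (rule t1_space_nhds)
  ultimately have "\<forall>\<^sub>F h in nhds c. h \<noteq> 0 \<and> h ^ n / c ^ n \<notin> \<real>\<^sub>\<le>\<^sub>0 \<and> croot n c (h ^ n) = h"
  proof eventually_elim
    case (elim h)
    let ?w = "Ln (h / c)"
    have e: "exp (of_nat n * ?w) = h ^ n / c ^ n"
      using elim assms by (simp add: exp_of_nat_mult power_divide)
    have Im: "\<bar>Im (of_nat n * ?w)\<bar> < pi" using elim by simp
    have "Ln (h ^ n / c ^ n) = of_nat n * ?w"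
      unfolding e[symmetric] by (rule Ln_exp) (use Im in auto)
    moreover have "h ^ n / c ^ n \<notin> \<real>\<^sub>\<le>\<^sub>0"
    proof
      assume neg: "h ^ n / c ^ n \<in> \<real>\<^sub>\<le>\<^sub>0"
      have nz: "h ^ n / c ^ n \<noteq> 0" using elim assms by simp
      have "Im (Ln (h ^ n / c ^ n)) = pi"
        using neg nz by (auto simp: complex_nonpos_Reals_iff Im_Ln_eq_pi complex_eq_iff less_le)
      then show False using Im \<open>Ln (h ^ n / c ^ n) = of_nat n * ?w\<close> by simp
    qed
    ultimately show ?case using elim assms by (simp add: croot_def)
  qed
  then show ?thesis using that unfolding eventually_nhds by blast
qed

text \<open>Near each point the continuous root \<open>h\<close> agrees with a holomorphic branch
  \<open>croot\<close>, which gives the derivative D * h / (n * f), where D is the derivative of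
  \<open>f\<close>. This formula contains \<open>h\<close> itself, so smoothness follows by
  induction on the order.\<close>

lemma smooth_on_power_root:
  fixes f h :: "(nat \<Rightarrow> real) \<Rightarrow> complex"
  assumes S: "openin (Euclidean_space d) S" and f: "smooth_on d S f" and f0: "\<And>x. x \<in> S \<Longrightarrow> f x \<noteq> 0"
    and h: "continuous_on S h" "\<And>x. x \<in> S \<Longrightarrow> h x ^ n = f x" and n: "n > 0"
  shows "smooth_on d S h"
proof -
  have h0: "h x \<noteq> 0" if "x \<in> S" for x using h(2)[OF that] f0[OF that] n by (metis zero_power)
  have der: "((\<lambda>t. h (x(i := t))) has_vector_derivative D * (h x / (of_nat n * f x))) (at (x i))"
    if x: "x \<in> S" and i: "i < d" and D: "((\<lambda>t. f (x(i := t))) has_vector_derivative D) (at (x i))" for x i D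
  proof -
    obtain T where T: "open T" "h x \<in> T"
      "\<And>w. w \<in> T \<Longrightarrow> w \<noteq> 0 \<and> w ^ n / h x ^ n \<notin> \<real>\<^sub>\<le>\<^sub>0 \<and> croot n (h x) (w ^ n) = w"
      by (rule croot_inverse[OF n h0[OF x]]) (rule that; assumption)
    have op: "openin (Euclidean_space d) (S \<inter> h -` T)"
      by (rule openin_Euclidean_space_preimage[OF S h(1) T(1)])
    have xT: "x \<in> S \<inter> h -` T" using x T(2) by simp
    have "\<forall>\<^sub>F t in nhds (x i). x(i := t) \<in> S \<inter> h -` T" by (rule eventually_fun_upd_in[OF op xT i])
    then have "\<forall>\<^sub>F t in at (x i). x(i := t) \<in> S \<inter> h -` T" by (simp add: eventually_nhds_conv_at)
    then have ev: "\<forall>\<^sub>F t in at (x i). (croot n (h x) \<circ> (\<lambda>t. f (x(i := t)))) t = h (x(i := t))"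
      by (rule eventually_mono) (use T(3) h(2) in force)
    have "f x / h x ^ n \<notin> \<real>\<^sub>\<le>\<^sub>0" using T(3)[OF T(2)] h(2)[OF x] by simp
    from croot_has_field_derivative[OF n h0[OF x] this]
    have "(croot n (h x) has_field_derivative h x / (of_nat n * f x)) (at (f (x(i := x i))))"
      using T(3)[OF T(2)] h(2)[OF x] by simp
    from field_vector_diff_chain_at[OF D this]
    show ?thesis
      by (rule has_vector_derivative_transform_eventually[OF _ ev]) (use T(3)[OF T(2)] h(2)[OF x] in auto)
  qed
  have "Ck_on d k S h" for k
  proof (induction k)
    case (Suc k)
    show ?case
      unfolding Ck_on.simps
    proof (intro conjI h(1) allI impI)
      fix i assume i: "i < d"
      have fk: "Ck_on d (Suc k) S f" using f unfolding smooth_on_def by blast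
      then obtain f' where f': "\<forall>x\<in>S. ((\<lambda>t. f (x(i := t))) has_vector_derivative f' x) (at (x i))" "Ck_on d k S f'"
        using i unfolding Ck_on.simps by blast
      have "Ck_on d k S (\<lambda>x. f' x * (h x * inverse (of_nat n * f x)))"
        by (intro Ck_on_bilinear[OF bounded_bilinear_mult] f'(2) Suc Ck_on_inverse Ck_on_const Ck_on_Suc[OF fk])
           (use f0 n in auto)
      then show "\<exists>g. (\<forall>x\<in>S. ((\<lambda>t. h (x(i := t))) has_vector_derivative g x) (at (x i))) \<and> Ck_on d k S g"
        using der[OF _ i f'(1)[rule_format]]
        by (intro exI[of _ "\<lambda>x. f' x * (h x * inverse (of_nat n * f x))"] conjI ballI) (simp_all add: divide_inverse)
    qed
  qed (use h(1) in simp)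
  then show ?thesis by (simp add: smooth_on_def)
qed

text \<open>Real roots are regarded as complex numbers, so that the square roots and
  \<open>b\<close>-th roots of norms in the charts fall under
  \<open>smooth_on_power_root\<close>.\<close>

lemma smooth_on_of_real_root:
  fixes f :: "(nat \<Rightarrow> real) \<Rightarrow> real"
  assumes S: "openin (Euclidean_space d) S" and f: "smooth_on d S (\<lambda>u. complex_of_real (f u))"
    and f0: "\<And>u. u \<in> S \<Longrightarrow> f u > 0" and n: "n > 0"
  shows "smooth_on d S (\<lambda>u. complex_of_real (root n (f u)))"
proof (rule smooth_on_power_root[OF S f _ _ _ n])
  have "continuous_on S (\<lambda>u. Re (complex_of_real (f u)))"
    by (intro continuous_on_Re smooth_on_continuous[OF f])
  then show "continuous_on S (\<lambda>u. complex_of_real (root n (f u)))"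
    by (intro continuous_on_of_real continuous_on_real_root) simp
  show "complex_of_real (f u) \<noteq> 0" "complex_of_real (root n (f u)) ^ n = complex_of_real (f u)" if "u \<in> S" for u
    using f0[OF that] n by (simp_all add: of_real_power[symmetric] real_root_pow_pos2 less_imp_le del: of_real_power)
qed

lemma smooth_on_of_real: "smooth_on d S f \<Longrightarrow> smooth_on d S (\<lambda>u. complex_of_real (f u))"
  by (rule smooth_on_linear[OF bounded_linear_of_real])

lemma smooth_on_cnj: "smooth_on d S f \<Longrightarrow> smooth_on d S (\<lambda>u. cnj (f u))"
  by (rule smooth_on_linear[OF bounded_linear_cnj])

section \<open>Constructing good charts\<close>

lemma smooth_fun_linear:
  fixes q :: "'m::euclidean_space \<Rightarrow> real"
  assumes "bounded_linear q"
  shows "smooth_fun d q"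
proof -
  obtain K where K: "\<And>x. norm (q x) \<le> norm x * K" using bounded_linear.bounded[OF assms] by blast
  have "\<bar>q p' - q p''\<bar> \<le> K * dist p' p''" for p' p''
    using K[of "p' - p''"] by (simp add: dist_norm linear_diff[OF bounded_linear.linear[OF assms]] mult.commute)
  then show ?thesis
    unfolding smooth_fun_def using smooth_on_linear[OF assms] zero_less_one by blast
qed

text \<open>\<open>\<sigma>\<close> may be defined on a domain \<open>\<Omega>\<close> that is too
  large and may leave \<open>T\<close>; the image of the chart is then the open subset of
  \<open>\<Omega>\<close> that \<open>\<sigma>\<close> maps into \<open>T\<close>.\<close>

lemma good_chartI:
  assumes O: "open T" and \<Omega>: "openin (Euclidean_space d) \<Omega>" and \<sigma>: "smooth_on d \<Omega> \<sigma>"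
    and inv: "\<And>u. u \<in> \<Omega> \<Longrightarrow> \<sigma> u \<in> M \<and> \<phi> (\<sigma> u) = u" "\<And>p. p \<in> M \<inter> T \<Longrightarrow> \<phi> p \<in> \<Omega> \<and> \<sigma> (\<phi> p) = p"
    and \<phi>: "\<And>i. i < d \<Longrightarrow> smooth_fun d (\<lambda>p. \<phi> p i)"
  shows "good_chart M d (M \<inter> T, \<phi>)"
proof -
  have inj: "inj_on \<phi> (M \<inter> T)" using inv(2) by (metis inj_onI)
  have im: "\<phi> ` (M \<inter> T) = \<Omega> \<inter> \<sigma> -` T"
  proof
    show "\<phi> ` (M \<inter> T) \<subseteq> \<Omega> \<inter> \<sigma> -` T" using inv(2) by auto
    show "\<Omega> \<inter> \<sigma> -` T \<subseteq> \<phi> ` (M \<inter> T)"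
    proof
      fix u assume u: "u \<in> \<Omega> \<inter> \<sigma> -` T"
      then show "u \<in> \<phi> ` (M \<inter> T)" using inv(1)[of u] by (intro image_eqI[of _ _ "\<sigma> u"]) auto
    qed
  qed
  have op: "openin (Euclidean_space d) (\<phi> ` (M \<inter> T))"
    unfolding im by (rule openin_Euclidean_space_preimage[OF \<Omega> smooth_on_continuous[OF \<sigma>] O])
  have "smooth_on d (\<phi> ` (M \<inter> T)) (inv_into (M \<inter> T) \<phi>)"
  proof (rule smooth_on_cong[OF op smooth_on_subset[OF \<sigma>]])
    show "\<phi> ` (M \<inter> T) \<subseteq> \<Omega>" using im by auto
    show "\<sigma> u = inv_into (M \<inter> T) \<phi> u" if "u \<in> \<phi> ` (M \<inter> T)" for u
      using that inv(2) inj by (auto simp: inv_into_f_f)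
  qed
  then show ?thesis
    unfolding good_chart_def using O inj op \<phi> by (auto simp: openin_open)
qed

text \<open>Transports charts by a symmetry of \<open>M\<close>; for the link the symmetry exchanges
  \<open>y\<close> and \<open>z\<close>.\<close>

lemma good_chart_isometry:
  fixes R :: "'m::euclidean_space \<Rightarrow> 'm"
  assumes R: "bounded_linear R" "\<And>p. R (R p) = p" "\<And>p. norm (R p) = norm p" "R ` M = M"
    and c: "good_chart M d (U, \<phi>)"
  shows "good_chart M d (R ` U, \<lambda>p. \<phi> (R p))"
proof -
  have cR: "continuous_on X R" for X using bounded_linear.continuous_on[OF R(1) continuous_on_id] by simp
  have img: "(\<lambda>p. \<phi> (R p)) ` R ` U = \<phi> ` U" using R(2) by (auto simp: image_image)
  have inj: "inj_on (\<lambda>p. \<phi> (R p)) (R ` U)"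
    using good_chartD(2)[OF c] R(2) by (auto simp: inj_on_def)
  obtain T where T: "open T" "U = M \<inter> T" using good_chartD(1)[OF c] by (auto simp: openin_open)
  have RM: "R p \<in> M" if "p \<in> M" for p using that R(4) by blast
  have "R ` U = M \<inter> R -` T"
  proof
    show "R ` U \<subseteq> M \<inter> R -` T" using RM R(2) T(2) by auto
    show "M \<inter> R -` T \<subseteq> R ` U"
    proof
      fix p assume "p \<in> M \<inter> R -` T"
      then show "p \<in> R ` U" using RM[of p] R(2)[of p] T(2) by (intro image_eqI[of _ _ "R p"]) auto
    qed
  qed
  moreover have "open (R -` T)" using cR[of UNIV] T(1) by (simp add: open_vimage)
  ultimately have op: "openin (top_of_set M) (R ` U)" by (auto simp: openin_open)
  have "smooth_on d (\<phi> ` U) (inv_into (R ` U) (\<lambda>p. \<phi> (R p)))"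
  proof (rule smooth_on_cong[OF good_chartD(3)[OF c] smooth_on_linear[OF R(1) good_chartD(4)[OF c]]])
    fix u assume u: "u \<in> \<phi> ` U"
    then have "inv_into U \<phi> u \<in> U" "\<phi> (inv_into U \<phi> u) = u" by (auto simp: inv_into_into f_inv_into_f)
    then show "R (inv_into U \<phi> u) = inv_into (R ` U) (\<lambda>p. \<phi> (R p)) u"
      using inv_into_f_f[OF inj, of "R (inv_into U \<phi> u)"] R(2) by auto
  qed
  moreover have "smooth_fun d (\<lambda>p. \<phi> (R p) i)" if i: "i < d" for i
    unfolding smooth_fun_def
  proof (intro conjI allI impI)
    fix p
    obtain e K where e: "e > 0" "\<And>p' p''. p' \<in> ball (R p) e \<Longrightarrow> p'' \<in> ball (R p) e \<Longrightarrow> \<bar>\<phi> p' i - \<phi> p'' i\<bar> \<le> K * dist p' p''"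
      using good_chartD(5)[OF c i, unfolded smooth_fun_def, THEN conjunct1] by meson
    have iso: "dist (R p') (R p'') = dist p' p''" for p' p''
      using R(3)[of "p' - p''"] by (simp add: dist_norm linear_diff[OF bounded_linear.linear[OF R(1)]])
    show "\<exists>e>0. \<exists>K. \<forall>p'\<in>ball p e. \<forall>p''\<in>ball p e. \<bar>\<phi> (R p') i - \<phi> (R p'') i\<bar> \<le> K * dist p' p''"
    proof (rule exI[of _ e], intro conjI e(1), rule exI[of _ K], intro ballI)
      fix p' p'' assume "p' \<in> ball p e" "p'' \<in> ball p e"
      then have "R p' \<in> ball (R p) e" "R p'' \<in> ball (R p) e" by (simp_all add: iso)
      from e(2)[OF this] show "\<bar>\<phi> (R p') i - \<phi> (R p'') i\<bar> \<le> K * dist p' p''" by (simp add: iso)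
    qed
  next
    fix S and f :: "(nat \<Rightarrow> real) \<Rightarrow> 'm"
    assume S: "openin (Euclidean_space d) S" and "smooth_on d S f"
    then have "smooth_on d S (\<lambda>u. R (f u))" by (intro smooth_on_linear[OF R(1)])
    from good_chartD(5)[OF c i, unfolded smooth_fun_def, THEN conjunct2, rule_format, OF S this] show "smooth_on d S (\<lambda>u. \<phi> (R (f u)) i)" .
  qed
  ultimately show ?thesis
    unfolding good_chart_def prod.case img by (intro conjI op inj good_chartD(3)[OF c] allI impI)
qed

section \<open>The link\<close>

text \<open>The exponent \<open>2 * b\<close> places (y^b, z^b) on the unit sphere of \<complex>^2,
  so the parallelogram law relates the sum of these powers, which is -x^a, to their difference. The
  norm condition is also homogeneous under the dilation, so it determines the radius of a
  point.\<close>

definition link :: "nat \<Rightarrow> nat \<Rightarrow> (complex \<times> complex \<times> complex) set" where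
  "link a b = {(x, y, z). x ^ a + y ^ b + z ^ b = 0 \<and> norm y ^ (2 * b) + norm z ^ (2 * b) = 1}"

lemma norm_power_diff_le:
  fixes z w :: complex
  assumes "norm z \<le> R" "norm w \<le> R"
  shows "norm (z ^ n - w ^ n) \<le> real n * R ^ (n - 1) * norm (z - w)"
proof -
  have R: "R \<ge> 0" using assms(1) norm_ge_zero order_trans by blast
  have "norm (\<Sum>i<n. w ^ (n - Suc i) * z ^ i) \<le> (\<Sum>i<n. R ^ (n - 1))"
  proof (rule sum_norm_le)
    fix i assume "i \<in> {..<n}"
    then have i: "n - Suc i + i = n - 1" by auto
    have "norm (w ^ (n - Suc i) * z ^ i) \<le> R ^ (n - Suc i) * R ^ i"
      unfolding norm_mult norm_power using assms R by (intro mult_mono power_mono) auto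
    then show "norm (w ^ (n - Suc i) * z ^ i) \<le> R ^ (n - 1)" by (simp add: power_add[symmetric] i)
  qed
  then have "norm (z - w) * norm (\<Sum>i<n. w ^ (n - Suc i) * z ^ i) \<le> norm (z - w) * (real n * R ^ (n - 1))"
    by (intro mult_left_mono) auto
  then show ?thesis
    unfolding power_diff_sumr2[of z n w] norm_mult by (simp only: mult.commute[of "real n * R ^ (n - 1)"])
qed

text \<open>Provides the third coordinate of the chart on the branch locus, which is not
  linear.\<close>

lemma smooth_fun_Im_power_diff:
  "smooth_fun d (\<lambda>p. Im (c * (fst (snd p) ^ n - snd (snd p) ^ n)))"
  for c :: complex
  unfolding smooth_fun_def
proof (intro conjI allI impI)
  fix p :: "'a::euclidean_space \<times> complex \<times> complex"
  define R where "R = norm p + 1"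
  show "\<exists>e>0. \<exists>K. \<forall>p'\<in>ball p e. \<forall>p''\<in>ball p e.
    \<bar>Im (c * (fst (snd p') ^ n - snd (snd p') ^ n)) - Im (c * (fst (snd p'') ^ n - snd (snd p'') ^ n))\<bar> \<le> K * dist p' p''"
  proof (rule exI[of _ 1], intro conjI zero_less_one, rule exI[of _ "norm c * (2 * (real n * R ^ (n - 1)))"], intro ballI)
    fix p' p'' :: "'a \<times> complex \<times> complex" assume "p' \<in> ball p 1" "p'' \<in> ball p 1"
    then have R: "norm p' \<le> R" "norm p'' \<le> R"
      using norm_triangle_ineq2[of p' p] norm_triangle_ineq2[of p'' p] by (auto simp: R_def dist_norm norm_minus_commute)
    have le: "norm (fst (snd q)) \<le> norm q" "norm (snd (snd q)) \<le> norm q" for q :: "'a \<times> complex \<times> complex"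
      using norm_fst_le[of "fst (snd q)" "snd (snd q)"] norm_snd_le[of "snd (snd q)" "fst (snd q)"] norm_snd_le[of "snd q" "fst q"]
      by (auto intro: order_trans)
    let ?A = "fst (snd p') ^ n - fst (snd p'') ^ n" and ?B = "snd (snd p') ^ n - snd (snd p'') ^ n"
    have A: "norm ?A \<le> real n * R ^ (n - 1) * norm (p' - p'')"
      by (rule order_trans[OF norm_power_diff_le[of _ R]])
         (use le[of p'] le[of p''] le[of "p' - p''"] R in \<open>auto intro!: mult_left_mono simp: R_def\<close>)
    have B: "norm ?B \<le> real n * R ^ (n - 1) * norm (p' - p'')"
      by (rule order_trans[OF norm_power_diff_le[of _ R]])
         (use le[of p'] le[of p''] le[of "p' - p''"] R in \<open>auto intro!: mult_left_mono simp: R_def\<close>)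
    have "\<bar>Im (c * (fst (snd p') ^ n - snd (snd p') ^ n)) - Im (c * (fst (snd p'') ^ n - snd (snd p'') ^ n))\<bar>
        = \<bar>Im (c * (?A - ?B))\<bar>" by (simp add: algebra_simps)
    also have "\<dots> \<le> norm c * norm (?A - ?B)" by (rule order_trans[OF abs_Im_le_cmod]) (simp add: norm_mult)
    also have "\<dots> \<le> norm c * (norm ?A + norm ?B)" by (intro mult_left_mono norm_triangle_ineq4) auto
    also have "\<dots> \<le> norm c * (2 * (real n * R ^ (n - 1)) * norm (p' - p''))"
      using A B by (intro mult_left_mono) auto
    finally show "\<bar>Im (c * (fst (snd p') ^ n - snd (snd p') ^ n)) - Im (c * (fst (snd p'') ^ n - snd (snd p'') ^ n))\<bar>
        \<le> norm c * (2 * (real n * R ^ (n - 1))) * dist p' p''" by (simp add: dist_norm mult.assoc)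
  qed
next
  fix S and f :: "_ \<Rightarrow> 'a \<times> complex \<times> complex" assume "smooth_on d S f"
  then have "smooth_on d S (\<lambda>u. fst (snd (f u)))" "smooth_on d S (\<lambda>u. snd (snd (f u)))"
    by (auto intro: smooth_on_linear[OF bounded_linear_fst] smooth_on_linear[OF bounded_linear_snd])
  then have "smooth_on d S (\<lambda>u. c * (fst (snd (f u)) ^ n - snd (snd (f u)) ^ n))"
    by (intro smooth_on_mult smooth_on_const smooth_on_diff smooth_on_power)
  then show "smooth_on d S (\<lambda>u. Im (c * (fst (snd (f u)) ^ n - snd (snd (f u)) ^ n)))"
    by (rule smooth_on_linear[OF bounded_linear_Im])
qed

text \<open>Both charts of the link combine a complex coordinate \<open>f\<close> with one real
  coordinate, the imaginary part of \<open>g\<close>, which measures an angle. Zeros beyond index 2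
  place the values in \<open>Euclidean_space 3\<close>.\<close>

definition chart_fun :: "('m \<Rightarrow> complex) \<Rightarrow> ('m \<Rightarrow> complex) \<Rightarrow> 'm \<Rightarrow> nat \<Rightarrow> real" where
  "chart_fun f g p = (\<lambda>i. if i = 0 then Re (f p) else if i = 1 then Im (f p) else if i = 2 then Im (g p) else 0)"

lemma chart_fun_eq_iff: "chart_fun f g p = u \<longleftrightarrow>
  f p = Complex (u 0) (u 1) \<and> Im (g p) = u 2 \<and> (\<forall>i\<ge>3. u i = 0)"
proof
  assume u: "chart_fun f g p = u"
  have "u 0 = Re (f p)" "u 1 = Im (f p)" "u 2 = Im (g p)" "\<forall>i\<ge>3. u i = 0"
    unfolding u[symmetric] chart_fun_def by simp_all
  then show "f p = Complex (u 0) (u 1) \<and> Im (g p) = u 2 \<and> (\<forall>i\<ge>3. u i = 0)"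
    by (simp add: complex_eq_iff)
next
  assume u: "f p = Complex (u 0) (u 1) \<and> Im (g p) = u 2 \<and> (\<forall>i\<ge>3. u i = 0)"
  show "chart_fun f g p = u"
  proof
    fix i :: nat
    consider "i = 0" | "i = 1" | "i = 2" | "i \<ge> 3" by linarith
    then show "chart_fun f g p i = u i"
      by cases (use u in \<open>simp_all add: chart_fun_def\<close>)
  qed
qed

lemma smooth_on_Complex: "smooth_on d S (\<lambda>u. Complex (u i) (u j))"
  unfolding Complex_eq by (intro smooth_on_add smooth_on_mult smooth_on_const smooth_on_of_real smooth_on_coordinate)

lemma continuous_on_Complex_coordinate: "continuous_on S (\<lambda>u::nat \<Rightarrow> real. Complex (u i) (u j))"
  by (rule smooth_on_continuous[OF smooth_on_Complex])

lemma openin_Euclidean_space_Collect: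
  "open {u. P u} \<Longrightarrow> openin (Euclidean_space d) {u. P u \<and> (\<forall>i\<ge>d. u i = 0)}"
  unfolding openin_Euclidean_space by (intro exI[of _ "{u. P u}"]) auto

lemma smooth_fun_chart_fun:
  assumes "bounded_linear f" "smooth_fun 3 (\<lambda>p. Im (g p))"
  shows "smooth_fun 3 (\<lambda>p. chart_fun f g p i)"
proof -
  have "smooth_fun 3 (\<lambda>p. Re (f p))" "smooth_fun 3 (\<lambda>p. Im (f p))"
    by (intro smooth_fun_linear bounded_linear_compose[OF bounded_linear_Re assms(1)]
        bounded_linear_compose[OF bounded_linear_Im assms(1)])+
  moreover have "smooth_fun 3 (\<lambda>p::'a. 0)" by (intro smooth_fun_linear bounded_linear_zero)
  ultimately show ?thesis unfolding chart_fun_def using assms(2) by (cases "i = 0"; cases "i = 1"; cases "i = 2") auto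
qed

lemma power_2b: "norm (w::complex) ^ (2 * b) = norm (w ^ b) ^ 2"
  by (simp add: norm_power power_mult mult.commute[of 2 b])

lemma cmod_Complex_mult: "norm (c * Complex s t) ^ 2 = norm c ^ 2 * (s\<^sup>2 + t\<^sup>2)"
  by (simp add: norm_mult power_mult_distrib cmod_power2)

lemma parallelogram_half:
  fixes s t :: complex
  shows "norm (s / 2 + t) ^ 2 + norm (s / 2 - t) ^ 2 = (norm s)\<^sup>2 / 2 + 2 * (norm t)\<^sup>2"
  unfolding cmod_power2 by (simp add: power2_eq_square field_simps)

text \<open>The coordinates are \<open>y\<close> and \<open>Im (z / z0)\<close>. The norm condition
  gives the modulus of \<open>z\<close> in terms of \<open>y\<close>, hence the positive real part
  of \<open>z / z0\<close>; then \<open>x\<close> is a branch of the \<open>a\<close>-th root, which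
  is smooth because \<open>x0\<close> is not 0.\<close>

lemma chart_away_from_branch_locus:
  assumes ab: "a > 0" "b > 0" and p0: "(x0, y0, z0) \<in> link a b" and x0: "x0 \<noteq> 0" and z0: "z0 \<noteq> 0"
  shows "\<exists>c. good_chart (link a b) 3 c \<and> (x0, y0, z0) \<in> fst c"
proof -
  define Y where "Y u = Complex (u 0) (u 1)" for u :: "nat \<Rightarrow> real"
  define e where "e u = 1 - norm (Y u) ^ (2 * b)" for u
  \<comment> \<open>On the link \<open>e u\<close> is |z|^(2b), so \<open>W u\<close> is the square
    of \<open>Re (z / z0)\<close>.\<close>
  define W where "W u = root b (e u) / (norm z0)\<^sup>2 - (u 2)\<^sup>2" for u
  define Z where "Z u = z0 * Complex (sqrt (W u)) (u 2)" for u
  define f where "f u = - (Y u ^ b + Z u ^ b)" for u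
  define \<sigma> where "\<sigma> u = (croot a x0 (f u), Y u, Z u)" for u
  define \<phi> where "\<phi> = chart_fun (\<lambda>p::complex \<times> complex \<times> complex. fst (snd p)) (\<lambda>p. snd (snd p) / z0)"
  define \<Omega> where "\<Omega> = {u. (e u > 0 \<and> W u > 0 \<and> f u / x0 ^ a \<notin> \<real>\<^sub>\<le>\<^sub>0) \<and> (\<forall>i\<ge>3. u i = 0)}"
  obtain Tx where Tx: "open Tx" "x0 \<in> Tx"
    "\<And>h. h \<in> Tx \<Longrightarrow> h \<noteq> 0 \<and> h ^ a / x0 ^ a \<notin> \<real>\<^sub>\<le>\<^sub>0 \<and> croot a x0 (h ^ a) = h"
    by (rule croot_inverse[OF ab(1) x0]) (rule that; assumption)
  define T where "T = {p::complex \<times> complex \<times> complex. fst p \<in> Tx \<and> Re (snd (snd p) / z0) > 0}"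
  have coord: "continuous_on UNIV (\<lambda>u::nat \<Rightarrow> real. u i)" for i by simp
  have Yc: "continuous_on UNIV Y" unfolding Y_def by (rule continuous_on_Complex_coordinate)
  have ec: "continuous_on UNIV e" unfolding e_def by (intro continuous_intros Yc)
  have Wc: "continuous_on UNIV W" unfolding W_def using z0 ab by (intro continuous_intros ec coord) auto
  have Zc: "continuous_on UNIV Z" unfolding Z_def Complex_eq by (intro continuous_intros Wc coord)
  have fc: "continuous_on UNIV f" unfolding f_def by (intro continuous_intros Yc Zc)
  have "open ({u. e u > 0} \<inter> ({u. W u > 0} \<inter> (\<lambda>u. f u / x0 ^ a) -` (- \<real>\<^sub>\<le>\<^sub>0)))"
    using x0 by (intro open_Int open_Collect_less open_vimage continuous_on_const ec Wc continuous_intros fc open_Compl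
        closed_nonpos_Reals_complex) auto
  moreover have "{u. e u > 0} \<inter> ({u. W u > 0} \<inter> (\<lambda>u. f u / x0 ^ a) -` (- \<real>\<^sub>\<le>\<^sub>0)) =
      {u. e u > 0 \<and> W u > 0 \<and> f u / x0 ^ a \<notin> \<real>\<^sub>\<le>\<^sub>0}" by auto
  ultimately have \<Omega>: "openin (Euclidean_space 3) \<Omega>"
    unfolding \<Omega>_def by (intro openin_Euclidean_space_Collect) simp
  have Ys: "smooth_on 3 \<Omega> Y" unfolding Y_def by (rule smooth_on_Complex)
  \<comment> \<open>The norm itself is not polynomial; its even power, written with
    \<open>cnj\<close>, is.\<close>
  have "complex_of_real (e u) = 1 - (Y u * cnj (Y u)) ^ b" for u
    by (simp add: e_def complex_norm_square[symmetric] power_mult)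
  then have es: "smooth_on 3 \<Omega> (\<lambda>u. complex_of_real (e u))"
    by (simp only:) (intro smooth_on_diff smooth_on_const smooth_on_power smooth_on_mult smooth_on_cnj Ys)
  have "smooth_on 3 \<Omega> (\<lambda>u. complex_of_real (root b (e u)))"
    by (rule smooth_on_of_real_root[OF \<Omega> es _ ab(2)]) (simp add: \<Omega>_def)
  then have "smooth_on 3 \<Omega> (\<lambda>u. complex_of_real (root b (e u)) * (1 / of_real ((norm z0)\<^sup>2)) - of_real (u 2) ^ 2)"
    by (intro smooth_on_diff smooth_on_mult smooth_on_power smooth_on_const smooth_on_of_real[OF smooth_on_coordinate])
  then have Ws: "smooth_on 3 \<Omega> (\<lambda>u. complex_of_real (W u))" by (simp add: W_def)
  have "smooth_on 3 \<Omega> (\<lambda>u. complex_of_real (sqrt (W u)))"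
    unfolding sqrt_def by (rule smooth_on_of_real_root[OF \<Omega> Ws]) (auto simp: \<Omega>_def)
  then have Zs: "smooth_on 3 \<Omega> Z"
    unfolding Z_def Complex_eq
    by (intro smooth_on_add smooth_on_mult smooth_on_const smooth_on_of_real[OF smooth_on_coordinate])
  have fs: "smooth_on 3 \<Omega> f"
    unfolding f_def by (intro smooth_on_uminus smooth_on_add smooth_on_power Ys Zs)
  have f0: "f u \<noteq> 0" if "u \<in> \<Omega>" for u using that by (auto simp: \<Omega>_def)
  have Xs: "smooth_on 3 \<Omega> (\<lambda>u. croot a x0 (f u))"
  proof (rule smooth_on_power_root[OF \<Omega> fs f0 _ _ ab(1)])
    show "continuous_on \<Omega> (\<lambda>u. croot a x0 (f u))"
      by (rule continuous_on_croot[OF ab(1) x0 continuous_on_subset[OF fc]]) (auto simp: \<Omega>_def)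
    show "croot a x0 (f u) ^ a = f u" if "u \<in> \<Omega>" for u by (rule croot_power[OF ab(1) x0 f0[OF that]])
  qed
  have \<sigma>s: "smooth_on 3 \<Omega> \<sigma>" unfolding \<sigma>_def by (intro smooth_on_Pair Xs Ys Zs)
  have T: "open T"
  proof -
    have "T = fst -` Tx \<inter> {p. 0 < Re (snd (snd p) / z0)}" by (auto simp: T_def)
    moreover have "open (fst -` Tx :: (complex \<times> complex \<times> complex) set)" by (intro open_vimage Tx(1) continuous_intros)
    moreover have "open {p :: complex \<times> complex \<times> complex. 0 < Re (snd (snd p) / z0)}"
      using z0 by (intro open_Collect_less continuous_intros) auto
    ultimately show ?thesis by (simp add: open_Int)
  qed
  have inv1: "\<sigma> u \<in> link a b \<and> \<phi> (\<sigma> u) = u" if u: "u \<in> \<Omega>" for u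
  proof
    have "norm (Z u) ^ 2 = root b (e u)"
      unfolding Z_def cmod_Complex_mult using u z0 by (simp add: \<Omega>_def W_def field_simps)
    then have "norm (Z u) ^ (2 * b) = e u"
      using u ab by (simp add: power_mult \<Omega>_def)
    moreover have "croot a x0 (f u) ^ a = f u" by (rule croot_power[OF ab(1) x0 f0[OF u]])
    ultimately show "\<sigma> u \<in> link a b" by (simp add: link_def \<sigma>_def e_def f_def)
    show "\<phi> (\<sigma> u) = u"
      unfolding \<phi>_def chart_fun_eq_iff using u z0 by (simp add: \<sigma>_def Y_def Z_def \<Omega>_def)
  qed
  have inv2: "\<phi> p \<in> \<Omega> \<and> \<sigma> (\<phi> p) = p" if p: "p \<in> link a b \<inter> T" for p
  proof -
    obtain x y z where xyz: "p = (x, y, z)" by (cases p)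
    have eq: "x ^ a + y ^ b + z ^ b = 0" "norm y ^ (2 * b) + norm z ^ (2 * b) = 1" and Tp: "x \<in> Tx" "Re (z / z0) > 0"
      using p by (auto simp: xyz link_def T_def)
    have z: "z \<noteq> 0" using Tp(2) by auto
    define u where "u = \<phi> p"
    have u: "y = Complex (u 0) (u 1)" "Im (z / z0) = u 2" "\<forall>i\<ge>3. u i = 0"
      using chart_fun_eq_iff[THEN iffD1, OF u_def[unfolded \<phi>_def, symmetric]] unfolding xyz by simp_all
    have Yu: "Y u = y" using u(1) by (simp add: Y_def)
    have eu: "e u = ((norm z)\<^sup>2) ^ b" using eq(2) by (simp add: e_def Yu power_mult[symmetric])
    have root: "root b (e u) = (norm z)\<^sup>2" unfolding eu using ab by (simp add: real_root_power_cancel)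
    have "(norm (z / z0))\<^sup>2 = (Re (z / z0))\<^sup>2 + (u 2)\<^sup>2" unfolding u(2)[symmetric] by (rule cmod_power2)
    then have W: "W u = (Re (z / z0))\<^sup>2" by (simp add: W_def root norm_divide power_divide)
    have "Complex (Re (z / z0)) (u 2) = z / z0" unfolding u(2)[symmetric] by (rule complex_surj)
    then have Zu: "Z u = z" using Tp(2) z0 by (simp add: Z_def W)
    have "x ^ a = - (y ^ b + z ^ b)" unfolding eq_neg_iff_add_eq_0 using eq(1) by (simp add: add.assoc)
    then have fu: "f u = x ^ a" by (simp only: f_def Yu Zu)
    have "u \<in> \<Omega>"
      using u(3) eu z W Tp Tx(3)[OF Tp(1)] by (auto simp: \<Omega>_def fu)
    moreover have "\<sigma> u = p" using Tx(3)[OF Tp(1)] by (simp add: \<sigma>_def Yu Zu fu xyz)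
    ultimately show ?thesis by (simp add: u_def)
  qed
  have "smooth_fun 3 (\<lambda>p. \<phi> p i)" for i
    unfolding \<phi>_def
  proof (rule smooth_fun_chart_fun)
    show "bounded_linear (\<lambda>p::complex \<times> complex \<times> complex. fst (snd p))"
      by (intro bounded_linear_compose[OF bounded_linear_fst] bounded_linear_snd)
    show "smooth_fun 3 (\<lambda>p::complex \<times> complex \<times> complex. Im (snd (snd p) / z0))"
      by (intro smooth_fun_linear bounded_linear_compose[OF bounded_linear_Im]
          bounded_linear_compose[OF bounded_linear_divide] bounded_linear_compose[OF bounded_linear_snd] bounded_linear_snd)
  qed
  from good_chartI[OF T \<Omega> \<sigma>s inv1 inv2 this]
  have "good_chart (link a b) 3 (link a b \<inter> T, \<phi>)" .
  moreover have "(x0, y0, z0) \<in> T" using Tx(2) z0 by (simp add: T_def)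
  ultimately show ?thesis using p0 by (intro exI[of _ "(link a b \<inter> T, \<phi>)"]) auto
qed

text \<open>At x = 0 the equation cannot be solved smoothly for \<open>x\<close>, so
  \<open>x\<close> becomes a coordinate. It fixes the sum of the powers y^b and z^b, and the
  parallelogram law fixes the modulus of their half difference, whose direction relative to
  \<open>D0\<close> is the third coordinate. Both powers are non-zero here, so \<open>y\<close> and
  \<open>z\<close> are smooth branches of \<open>b\<close>-th roots.\<close>

lemma chart_on_branch_locus:
  assumes ab: "a > 0" "b > 0" and p0: "(0, y0, z0) \<in> link a b"
  shows "\<exists>c. good_chart (link a b) 3 c \<and> (0, y0, z0) \<in> fst c"
proof -
  define D0 where "D0 = y0 ^ b"
  have "y0 ^ b + z0 ^ b = 0" using p0 ab by (simp add: link_def zero_power)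
  then have z0b: "z0 ^ b = - D0" by (simp add: D0_def eq_neg_iff_add_eq_0 add.commute)
  have "norm (y0 ^ b) ^ 2 + norm (z0 ^ b) ^ 2 = 1"
    using p0 unfolding power_2b[symmetric] by (simp add: link_def)
  then have "norm D0 ^ 2 + norm (- D0) ^ 2 = 1" unfolding z0b D0_def .
  then have D0: "norm D0 ^ 2 = 1 / 2" "D0 \<noteq> 0" by auto
  have y0: "y0 \<noteq> 0" and z0: "z0 \<noteq> 0" using D0(2) z0b ab by (auto simp: D0_def zero_power)
  define X where "X u = Complex (u 0) (u 1)" for u :: "nat \<Rightarrow> real"
  define S where "S u = - (X u ^ a)" for u
  \<comment> \<open>The squared modulus that the half difference \<open>D\<close> must have. Since
    \<open>D0\<close> has squared modulus 1/2, the quotient of \<open>D\<close> by \<open>D0\<close>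
    has squared modulus \<open>2 * \<Delta> u\<close>, and \<open>W\<close> is the square of its
    real part.\<close>
  define \<Delta> where "\<Delta> u = (1 - (norm (S u))\<^sup>2 / 2) / 2" for u
  define W where "W u = 2 * \<Delta> u - (u 2)\<^sup>2" for u
  define D where "D u = D0 * Complex (sqrt (W u)) (u 2)" for u
  define P where "P u = S u / 2 + D u" for u
  define Q where "Q u = S u / 2 - D u" for u
  define \<sigma> where "\<sigma> u = (X u, croot b y0 (P u), croot b z0 (Q u))" for u
  define \<phi> where "\<phi> = chart_fun (\<lambda>p::complex \<times> complex \<times> complex. fst p) (\<lambda>p. 1 / (2 * D0) * (fst (snd p) ^ b - snd (snd p) ^ b))"
  define \<Omega> where "\<Omega> = {u. (W u > 0 \<and> P u / y0 ^ b \<notin> \<real>\<^sub>\<le>\<^sub>0 \<and> Q u / z0 ^ b \<notin> \<real>\<^sub>\<le>\<^sub>0) \<and> (\<forall>i\<ge>3. u i = 0)}"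
  obtain Ty where Ty: "open Ty" "y0 \<in> Ty"
    "\<And>h. h \<in> Ty \<Longrightarrow> h \<noteq> 0 \<and> h ^ b / y0 ^ b \<notin> \<real>\<^sub>\<le>\<^sub>0 \<and> croot b y0 (h ^ b) = h"
    by (rule croot_inverse[OF ab(2) y0]) (rule that; assumption)
  obtain Tz where Tz: "open Tz" "z0 \<in> Tz"
    "\<And>h. h \<in> Tz \<Longrightarrow> h \<noteq> 0 \<and> h ^ b / z0 ^ b \<notin> \<real>\<^sub>\<le>\<^sub>0 \<and> croot b z0 (h ^ b) = h"
    by (rule croot_inverse[OF ab(2) z0]) (rule that; assumption)
  define T where "T = {p::complex \<times> complex \<times> complex. fst (snd p) \<in> Ty \<and> snd (snd p) \<in> Tz \<and>
    Re (1 / (2 * D0) * (fst (snd p) ^ b - snd (snd p) ^ b)) > 0}"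
  have coord: "continuous_on UNIV (\<lambda>u::nat \<Rightarrow> real. u i)" for i by simp
  have Xc: "continuous_on UNIV X" unfolding X_def by (rule continuous_on_Complex_coordinate)
  have Sc: "continuous_on UNIV S" unfolding S_def by (intro continuous_intros Xc)
  have Wc: "continuous_on UNIV W" unfolding W_def \<Delta>_def by (intro continuous_intros Sc coord) auto
  have Dc: "continuous_on UNIV D" unfolding D_def Complex_eq by (intro continuous_intros Wc coord)
  have Pc: "continuous_on UNIV P" unfolding P_def by (intro continuous_intros Sc Dc) auto
  have Qc: "continuous_on UNIV Q" unfolding Q_def by (intro continuous_intros Sc Dc) auto
  have "open ({u. W u > 0} \<inter> ((\<lambda>u. P u / y0 ^ b) -` (- \<real>\<^sub>\<le>\<^sub>0) \<inter> (\<lambda>u. Q u / z0 ^ b) -` (- \<real>\<^sub>\<le>\<^sub>0)))"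
    using y0 z0 by (intro open_Int open_Collect_less open_vimage continuous_on_const Wc continuous_intros Pc Qc open_Compl
        closed_nonpos_Reals_complex) auto
  moreover have "{u. W u > 0} \<inter> ((\<lambda>u. P u / y0 ^ b) -` (- \<real>\<^sub>\<le>\<^sub>0) \<inter> (\<lambda>u. Q u / z0 ^ b) -` (- \<real>\<^sub>\<le>\<^sub>0)) =
      {u. W u > 0 \<and> P u / y0 ^ b \<notin> \<real>\<^sub>\<le>\<^sub>0 \<and> Q u / z0 ^ b \<notin> \<real>\<^sub>\<le>\<^sub>0}" by auto
  ultimately have \<Omega>: "openin (Euclidean_space 3) \<Omega>"
    unfolding \<Omega>_def by (intro openin_Euclidean_space_Collect) simp
  have Xs: "smooth_on 3 \<Omega> X" unfolding X_def by (rule smooth_on_Complex)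
  have Ss: "smooth_on 3 \<Omega> S" unfolding S_def by (intro smooth_on_uminus smooth_on_power Xs)
  have "complex_of_real (W u) = (1 - 1 / 2 * (S u * cnj (S u))) - of_real (u 2) ^ 2" for u
    by (simp add: W_def \<Delta>_def complex_norm_square[symmetric])
  then have Ws: "smooth_on 3 \<Omega> (\<lambda>u. complex_of_real (W u))"
    by (simp only:) (intro smooth_on_diff smooth_on_const smooth_on_power smooth_on_mult smooth_on_cnj Ss
        smooth_on_of_real[OF smooth_on_coordinate])
  have "smooth_on 3 \<Omega> (\<lambda>u. complex_of_real (sqrt (W u)))"
    unfolding sqrt_def by (rule smooth_on_of_real_root[OF \<Omega> Ws]) (auto simp: \<Omega>_def)
  then have Ds: "smooth_on 3 \<Omega> D"
    unfolding D_def Complex_eq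
    by (intro smooth_on_add smooth_on_mult smooth_on_const smooth_on_of_real[OF smooth_on_coordinate])
  have S2: "smooth_on 3 \<Omega> (\<lambda>u. S u / 2)"
    using smooth_on_mult[OF smooth_on_const[of 3 \<Omega> "1/2"] Ss] by simp
  have Ps: "smooth_on 3 \<Omega> P" unfolding P_def by (intro smooth_on_add S2 Ds)
  have Qs: "smooth_on 3 \<Omega> Q" unfolding Q_def by (intro smooth_on_diff S2 Ds)
  have P0: "P u \<noteq> 0" and Q0: "Q u \<noteq> 0" if "u \<in> \<Omega>" for u using that by (auto simp: \<Omega>_def)
  have ys: "smooth_on 3 \<Omega> (\<lambda>u. croot b y0 (P u))"
  proof (rule smooth_on_power_root[OF \<Omega> Ps P0 _ _ ab(2)])
    show "continuous_on \<Omega> (\<lambda>u. croot b y0 (P u))"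
      by (rule continuous_on_croot[OF ab(2) y0 continuous_on_subset[OF Pc]]) (auto simp: \<Omega>_def)
    show "croot b y0 (P u) ^ b = P u" if "u \<in> \<Omega>" for u by (rule croot_power[OF ab(2) y0 P0[OF that]])
  qed
  have zs: "smooth_on 3 \<Omega> (\<lambda>u. croot b z0 (Q u))"
  proof (rule smooth_on_power_root[OF \<Omega> Qs Q0 _ _ ab(2)])
    show "continuous_on \<Omega> (\<lambda>u. croot b z0 (Q u))"
      by (rule continuous_on_croot[OF ab(2) z0 continuous_on_subset[OF Qc]]) (auto simp: \<Omega>_def)
    show "croot b z0 (Q u) ^ b = Q u" if "u \<in> \<Omega>" for u by (rule croot_power[OF ab(2) z0 Q0[OF that]])
  qed
  have \<sigma>s: "smooth_on 3 \<Omega> \<sigma>" unfolding \<sigma>_def by (intro smooth_on_Pair Xs ys zs)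
  have T: "open T"
  proof -
    have "T = (\<lambda>p. fst (snd p)) -` Ty \<inter> ((\<lambda>p. snd (snd p)) -` Tz \<inter> {p. 0 < Re (1 / (2 * D0) * (fst (snd p) ^ b - snd (snd p) ^ b))})"
      by (auto simp: T_def)
    moreover have "open ((\<lambda>p. fst (snd p)) -` Ty :: (complex \<times> complex \<times> complex) set)" by (intro open_vimage Ty(1) continuous_intros)
    moreover have "open ((\<lambda>p. snd (snd p)) -` Tz :: (complex \<times> complex \<times> complex) set)" by (intro open_vimage Tz(1) continuous_intros)
    moreover have "open {p :: complex \<times> complex \<times> complex. 0 < Re (1 / (2 * D0) * (fst (snd p) ^ b - snd (snd p) ^ b))}"
      by (intro open_Collect_less continuous_intros)
    ultimately show ?thesis by (simp add: open_Int)
  qed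
  note par = parallelogram_half
  have inv1: "\<sigma> u \<in> link a b \<and> \<phi> (\<sigma> u) = u" if u: "u \<in> \<Omega>" for u
  proof
    have pows: "croot b y0 (P u) ^ b = P u" "croot b z0 (Q u) ^ b = Q u"
      by (rule croot_power[OF ab(2) y0 P0[OF u]], rule croot_power[OF ab(2) z0 Q0[OF u]])
    have "(norm (D u))\<^sup>2 = \<Delta> u"
      unfolding D_def cmod_Complex_mult D0(1) using u by (simp add: \<Omega>_def W_def)
    then have "norm (P u) ^ 2 + norm (Q u) ^ 2 = 1"
      unfolding P_def Q_def par by (simp add: \<Delta>_def field_simps)
    then show "\<sigma> u \<in> link a b"
      by (simp add: link_def \<sigma>_def power_2b pows) (simp add: P_def Q_def S_def)
    show "\<phi> (\<sigma> u) = u"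
      unfolding \<phi>_def chart_fun_eq_iff using u D0(2) by (simp add: \<sigma>_def pows) (simp add: X_def P_def Q_def D_def \<Omega>_def)
  qed
  have inv2: "\<phi> p \<in> \<Omega> \<and> \<sigma> (\<phi> p) = p" if p: "p \<in> link a b \<inter> T" for p
  proof -
    obtain x y z where xyz: "p = (x, y, z)" by (cases p)
    define t where "t = 1 / (2 * D0) * (y ^ b - z ^ b)"
    have eq: "x ^ a + y ^ b + z ^ b = 0" "norm (y ^ b) ^ 2 + norm (z ^ b) ^ 2 = 1" and Tp: "y \<in> Ty" "z \<in> Tz" "Re t > 0"
      using p by (auto simp: xyz link_def T_def t_def power_2b)
    define u where "u = \<phi> p"
    have u: "x = Complex (u 0) (u 1)" "Im t = u 2" "\<forall>i\<ge>3. u i = 0"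
      using chart_fun_eq_iff[THEN iffD1, OF u_def[unfolded \<phi>_def, symmetric]] unfolding xyz t_def by simp_all
    have Xu: "X u = x" using u(1) by (simp add: X_def)
    have "y ^ b + z ^ b = - (x ^ a)" unfolding eq_neg_iff_add_eq_0 using eq(1) by (simp add: ac_simps)
    then have Su: "S u = y ^ b + z ^ b" by (simp only: S_def Xu)
    have y: "y ^ b = S u / 2 + D0 * t" and z: "z ^ b = S u / 2 - D0 * t"
      using D0(2) by (simp_all add: Su t_def field_simps)
    have "(norm (D0 * t))\<^sup>2 = \<Delta> u"
      using eq(2) unfolding y z par by (simp add: \<Delta>_def field_simps)
    then have "(norm t)\<^sup>2 = 2 * \<Delta> u" using D0(1) by (simp add: norm_mult power_mult_distrib)
    moreover have "(norm t)\<^sup>2 = (Re t)\<^sup>2 + (u 2)\<^sup>2" unfolding u(2)[symmetric] by (rule cmod_power2)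
    ultimately have W: "W u = (Re t)\<^sup>2" by (simp add: W_def)
    have "Complex (Re t) (u 2) = t" unfolding u(2)[symmetric] by (rule complex_surj)
    then have Du: "D u = D0 * t" using Tp(3) by (simp add: D_def W)
    have PQ: "P u = y ^ b" "Q u = z ^ b" by (simp_all add: P_def Q_def Du y z)
    have "u \<in> \<Omega>" using u(3) W Tp Ty(3)[OF Tp(1)] Tz(3)[OF Tp(2)] by (auto simp: \<Omega>_def PQ)
    moreover have "\<sigma> u = p" using Ty(3)[OF Tp(1)] Tz(3)[OF Tp(2)] by (simp add: \<sigma>_def Xu PQ xyz)
    ultimately show ?thesis by (simp add: u_def)
  qed
  have "smooth_fun 3 (\<lambda>p. \<phi> p i)" for i
    unfolding \<phi>_def by (rule smooth_fun_chart_fun[OF bounded_linear_fst smooth_fun_Im_power_diff])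
  from good_chartI[OF T \<Omega> \<sigma>s inv1 inv2 this]
  have "good_chart (link a b) 3 (link a b \<inter> T, \<phi>)" .
  moreover have "(0, y0, z0) \<in> T" using Ty(2) Tz(2) D0(2) by (simp add: T_def z0b D0_def[symmetric])
  ultimately show ?thesis using p0 by (intro exI[of _ "(link a b \<inter> T, \<phi>)"]) auto
qed

lemma link_norm_le:
  assumes "(x, y, z) \<in> link a b" "a > 0" "b > 0"
  shows "norm y \<le> 1" "norm z \<le> 1" "norm x \<le> 2"
proof -
  have eq: "x ^ a + y ^ b + z ^ b = 0" "norm y ^ (2 * b) + norm z ^ (2 * b) = 1"
    using assms(1) by (auto simp: link_def)
  have "norm y ^ (2 * b) \<le> 1" "norm z ^ (2 * b) \<le> 1" using eq(2) by (smt (verit) norm_ge_zero zero_le_power)+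
  then show y: "norm y \<le> 1" and z: "norm z \<le> 1"
    using assms(3) by (metis mult_pos_pos norm_ge_zero not_le one_less_power pos2)+
  have "norm (x ^ a) = norm (y ^ b + z ^ b)" using eq(1) by (metis add.assoc add_eq_0_iff norm_minus_cancel)
  also have "\<dots> \<le> norm (y ^ b) + norm (z ^ b)" by (rule norm_triangle_ineq)
  also have "\<dots> \<le> 1 + 1" using y z by (intro add_mono) (auto simp: norm_power power_le_one)
  finally have "norm x ^ a \<le> 2" by (simp add: norm_power)
  moreover have "2 < norm x ^ a" if "2 < norm x"
    using that assms(2) self_le_power[of "norm x" a] by linarith
  ultimately show "norm x \<le> 2" by linarith
qed

lemma compact_link:
  assumes "a > 0" "b > 0"
  shows "compact (link a b)"
proof -
  have "link a b = {p. fst p ^ a + fst (snd p) ^ b + snd (snd p) ^ b = 0} \<inter>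
      {p. norm (fst (snd p)) ^ (2 * b) + norm (snd (snd p)) ^ (2 * b) = 1}"
    by (auto simp: link_def)
  moreover have "closed {p::complex \<times> complex \<times> complex. fst p ^ a + fst (snd p) ^ b + snd (snd p) ^ b = 0}"
    "closed {p::complex \<times> complex \<times> complex. norm (fst (snd p)) ^ (2 * b) + norm (snd (snd p)) ^ (2 * b) = 1}"
    by (intro closed_Collect_eq continuous_intros)+
  ultimately have "closed (link a b)" by (simp add: closed_Int)
  moreover have "link a b \<subseteq> cball 0 2 \<times> cball 0 1 \<times> cball 0 1"
    using link_norm_le[OF _ assms] by auto
  then have "bounded (link a b)"
    by (rule bounded_subset[rotated]) (intro bounded_Times bounded_cball)
  ultimately show ?thesis by (simp add: compact_eq_bounded_closed)
qed

text \<open>Off the branch locus \<open>y\<close> and \<open>z\<close> do not both vanish; if z = 0,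
  the chart is taken at the mirror point with \<open>y\<close> and \<open>z\<close>
  exchanged.\<close>

lemma good_submanifold_link:
  assumes ab: "a > 0" "b > 0"
  shows "good_submanifold (link a b) 3"
proof
  show "compact (link a b)" by (rule compact_link[OF ab])
  fix p assume p: "p \<in> link a b"
  obtain x y z where xyz: "p = (x, y, z)" by (cases p)
  show "\<exists>c. good_chart (link a b) 3 c \<and> p \<in> fst c"
  proof (cases "x = 0")
    case True
    then show ?thesis using chart_on_branch_locus[OF ab] p xyz by simp
  next
    case x: False
    show ?thesis
    proof (cases "z = 0")
      case False
      then show ?thesis using chart_away_from_branch_locus[OF ab _ x] p xyz by simp
    next
      case True
      then have y: "y \<noteq> 0" using p ab by (auto simp: xyz link_def zero_power)
      define R :: "complex \<times> complex \<times> complex \<Rightarrow> _" where "R p = (fst p, snd (snd p), fst (snd p))" for p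
      have RR: "R (R p) = p" for p by (simp add: R_def)
      have R_link: "R p \<in> link a b" if "p \<in> link a b" for p using that by (auto simp: link_def R_def algebra_simps)
      have "(x, z, y) \<in> link a b" using R_link[OF p] by (simp add: R_def xyz)
      from chart_away_from_branch_locus[OF ab this x y]
      obtain U \<phi> where c: "good_chart (link a b) 3 (U, \<phi>)" "(x, z, y) \<in> U" by auto
      have "good_chart (link a b) 3 (R ` U, \<lambda>p. \<phi> (R p))"
      proof (rule good_chart_isometry[OF _ RR _ _ c(1)])
        show "bounded_linear R"
          unfolding R_def by (intro bounded_linear_Pair bounded_linear_fst bounded_linear_compose[OF bounded_linear_snd]
              bounded_linear_compose[OF bounded_linear_fst] bounded_linear_snd)
        show "norm (R p) = norm p" for p by (simp add: R_def norm_prod_def add.commute add.left_commute)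
        show "R ` link a b = link a b" 
        proof
          show "R ` link a b \<subseteq> link a b" using R_link by blast
          show "link a b \<subseteq> R ` link a b"
          proof
            fix p assume "p \<in> link a b"
            then show "p \<in> R ` link a b" using R_link RR[of p] by (intro image_eqI[of _ _ "R p"]) auto
          qed
        qed
      qed
      moreover have "p \<in> R ` U" using c(2) by (intro image_eqI[of _ _ "(x, z, y)"]) (simp_all add: R_def xyz)
      ultimately show ?thesis by (intro exI[of _ "(R ` U, \<lambda>p. \<phi> (R p))"]) simp
    qed
  qed
qed

section \<open>Bounded Lipschitz functions\<close>

text \<open>Boundedness and the Lipschitz property are carried together, as the product rule needs
  both. The gauge \<open>g\<close> on the index set is arbitrary, so the Lipschitz property can be
  measured in quantities derived from the index.\<close>

definition lip_bounded :: "'i set \<Rightarrow> ('i \<Rightarrow> 'i \<Rightarrow> real) \<Rightarrow> ('i \<Rightarrow> 'b::real_normed_vector) \<Rightarrow> bool" where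
  "lip_bounded I g f \<longleftrightarrow> (\<exists>B. \<forall>i\<in>I. norm (f i) \<le> B) \<and>
     (\<exists>K\<ge>0. \<forall>i\<in>I. \<forall>j\<in>I. norm (f i - f j) \<le> K * g i j)"

lemma lip_boundedI:
  assumes "\<And>i. i \<in> I \<Longrightarrow> norm (f i) \<le> B" "K \<ge> 0" "\<And>i j. i \<in> I \<Longrightarrow> j \<in> I \<Longrightarrow> norm (f i - f j) \<le> K * g i j"
  shows "lip_bounded I g f"
  unfolding lip_bounded_def using assms by blast

lemma lip_boundedE:
  assumes "lip_bounded I g f"
  obtains B K where "B \<ge> 0" "\<And>i. i \<in> I \<Longrightarrow> norm (f i) \<le> B" "K \<ge> 0"
    "\<And>i j. i \<in> I \<Longrightarrow> j \<in> I \<Longrightarrow> norm (f i - f j) \<le> K * g i j"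
proof -
  obtain B K where B: "\<And>i. i \<in> I \<Longrightarrow> norm (f i) \<le> B" and K: "K \<ge> 0"
    "\<And>i j. i \<in> I \<Longrightarrow> j \<in> I \<Longrightarrow> norm (f i - f j) \<le> K * g i j"
    using assms unfolding lip_bounded_def by blast
  show ?thesis
  proof (rule that[of "max B 0" K])
    show "norm (f i) \<le> max B 0" if "i \<in> I" for i using B[OF that] by simp
  qed (use K in auto)
qed

lemma lip_bounded_linear:
  assumes "bounded_linear h" "lip_bounded I g f"
  shows "lip_bounded I g (\<lambda>i. h (f i))"
proof -
  obtain B K where f: "B \<ge> 0" "\<And>i. i \<in> I \<Longrightarrow> norm (f i) \<le> B" "K \<ge> 0"
    "\<And>i j. i \<in> I \<Longrightarrow> j \<in> I \<Longrightarrow> norm (f i - f j) \<le> K * g i j"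
    by (rule lip_boundedE[OF assms(2)]) (rule that; assumption)
  obtain C where C: "C > 0" "\<And>x. norm (h x) \<le> norm x * C" using bounded_linear.pos_bounded[OF assms(1)] by blast
  show ?thesis
  proof (rule lip_boundedI)
    show "norm (h (f i)) \<le> B * C" if "i \<in> I" for i
      using C(2)[of "f i"] mult_right_mono[OF f(2)[OF that], of C] C(1) by linarith
    show "norm (h (f i) - h (f j)) \<le> K * C * g i j" if "i \<in> I" "j \<in> I" for i j
    proof -
      have "norm (h (f i) - h (f j)) \<le> norm (f i - f j) * C"
        using C(2)[of "f i - f j"] by (simp only: linear_diff[OF bounded_linear.linear[OF assms(1)]])
      also have "\<dots> \<le> K * g i j * C" using f(4)[OF that] C(1) by (intro mult_right_mono) auto
      finally show ?thesis by (simp only: mult_ac)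
    qed
    show "K * C \<ge> 0" using f(3) C(1) by simp
  qed
qed

lemma lip_bounded_add:
  assumes "lip_bounded I g f" "lip_bounded I g f'"
  shows "lip_bounded I g (\<lambda>i. f i + f' i)"
proof -
  obtain B K where f: "B \<ge> 0" "\<And>i. i \<in> I \<Longrightarrow> norm (f i) \<le> B" "K \<ge> 0"
    "\<And>i j. i \<in> I \<Longrightarrow> j \<in> I \<Longrightarrow> norm (f i - f j) \<le> K * g i j"
    by (rule lip_boundedE[OF assms(1)]) (rule that; assumption)
  obtain B' K' where f': "B' \<ge> 0" "\<And>i. i \<in> I \<Longrightarrow> norm (f' i) \<le> B'" "K' \<ge> 0"
    "\<And>i j. i \<in> I \<Longrightarrow> j \<in> I \<Longrightarrow> norm (f' i - f' j) \<le> K' * g i j"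
    by (rule lip_boundedE[OF assms(2)]) (rule that; assumption)
  show ?thesis
  proof (rule lip_boundedI)
    show "norm (f i + f' i) \<le> B + B'" if "i \<in> I" for i
      using norm_triangle_mono[OF f(2)[OF that] f'(2)[OF that]] .
    show "norm (f i + f' i - (f j + f' j)) \<le> (K + K') * g i j" if "i \<in> I" "j \<in> I" for i j
      using norm_triangle_mono[OF f(4)[OF that] f'(4)[OF that]] by (simp add: algebra_simps)
    show "K + K' \<ge> 0" using f(3) f'(3) by simp
  qed
qed

lemma lip_bounded_diff:
  assumes "lip_bounded I g f" "lip_bounded I g f'"
  shows "lip_bounded I g (\<lambda>i. f i - f' i)"
  using lip_bounded_add[OF assms(1) lip_bounded_linear[OF bounded_linear_minus[OF bounded_linear_ident] assms(2)]]
  by simp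

lemma lip_bounded_mult:
  fixes f f' :: "'i \<Rightarrow> 'b::real_normed_algebra"
  assumes "lip_bounded I g f" "lip_bounded I g f'"
  shows "lip_bounded I g (\<lambda>i. f i * f' i)"
proof -
  obtain B K where f: "B \<ge> 0" "\<And>i. i \<in> I \<Longrightarrow> norm (f i) \<le> B" "K \<ge> 0"
    "\<And>i j. i \<in> I \<Longrightarrow> j \<in> I \<Longrightarrow> norm (f i - f j) \<le> K * g i j"
    by (rule lip_boundedE[OF assms(1)]) (rule that; assumption)
  obtain B' K' where f': "B' \<ge> 0" "\<And>i. i \<in> I \<Longrightarrow> norm (f' i) \<le> B'" "K' \<ge> 0"
    "\<And>i j. i \<in> I \<Longrightarrow> j \<in> I \<Longrightarrow> norm (f' i - f' j) \<le> K' * g i j"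
    by (rule lip_boundedE[OF assms(2)]) (rule that; assumption)
  show ?thesis
  proof (rule lip_boundedI)
    show "norm (f i * f' i) \<le> B * B'" if "i \<in> I" for i
      using f(1) f(2)[OF that] f'(2)[OF that] by (intro order_trans[OF norm_mult_ineq] mult_mono) auto
    show "norm (f i * f' i - f j * f' j) \<le> (B * K' + K * B') * g i j" if "i \<in> I" "j \<in> I" for i j
    proof -
      have "f i * f' i - f j * f' j = f i * (f' i - f' j) + (f i - f j) * f' j" by (simp add: algebra_simps)
      also have "norm \<dots> \<le> norm (f i) * norm (f' i - f' j) + norm (f i - f j) * norm (f' j)"
        by (intro norm_triangle_mono norm_mult_ineq)
      also have "\<dots> \<le> B * (K' * g i j) + (K * g i j) * B'"
        using f(1,2) f(4)[OF that] f'(2) f'(4)[OF that] that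
        by (intro add_mono mult_mono) (auto intro: order_trans[OF norm_ge_zero])
      finally show ?thesis by (simp add: algebra_simps)
    qed
    show "B * K' + K * B' \<ge> 0" using f(1,3) f'(1,3) by simp
  qed
qed

lemma lip_bounded_compose:
  assumes f: "lip_bounded I g f" and A: "\<And>i. i \<in> I \<Longrightarrow> f i \<in> A"
    and h: "\<And>x. x \<in> A \<Longrightarrow> norm (h x) \<le> C" "L \<ge> 0" "\<And>x y. x \<in> A \<Longrightarrow> y \<in> A \<Longrightarrow> norm (h x - h y) \<le> L * norm (x - y)"
  shows "lip_bounded I g (\<lambda>i. h (f i))"
proof -
  obtain B K where f: "B \<ge> 0" "\<And>i. i \<in> I \<Longrightarrow> norm (f i) \<le> B" "K \<ge> 0"
    "\<And>i j. i \<in> I \<Longrightarrow> j \<in> I \<Longrightarrow> norm (f i - f j) \<le> K * g i j"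
    by (rule lip_boundedE[OF f]) (rule that; assumption)
  show ?thesis
  proof (rule lip_boundedI)
    show "norm (h (f i)) \<le> C" if "i \<in> I" for i by (rule h(1)[OF A[OF that]])
    show "norm (h (f i) - h (f j)) \<le> L * K * g i j" if "i \<in> I" "j \<in> I" for i j
      using h(3)[OF A[OF that(1)] A[OF that(2)]] mult_left_mono[OF f(4)[OF that] h(2)] by (simp add: mult.assoc)
    show "L * K \<ge> 0" using f(3) h(2) by simp
  qed
qed

lemma lip_bounded_inverse:
  fixes f :: "'i \<Rightarrow> 'b::real_normed_field"
  assumes f: "lip_bounded I g f" and c: "c > 0" "\<And>i. i \<in> I \<Longrightarrow> c \<le> norm (f i)"
  shows "lip_bounded I g (\<lambda>i. inverse (f i))"
proof (rule lip_bounded_compose[OF f, where A = "{x. c \<le> norm x}" and C = "inverse c" and L = "inverse c * inverse c"])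
  fix x y :: 'b assume "x \<in> {x. c \<le> norm x}" "y \<in> {x. c \<le> norm x}"
  then have xy: "c \<le> norm x" "c \<le> norm y" by auto
  then have "x \<noteq> 0" "y \<noteq> 0" using c(1) by auto
  then have "inverse x - inverse y = - (inverse x * (x - y) * inverse y)" by (rule inverse_diff_inverse)
  then have "norm (inverse x - inverse y) = norm (inverse x) * norm (inverse y) * norm (x - y)"
    by (simp add: norm_mult mult_ac)
  also have "\<dots> \<le> inverse c * inverse c * norm (x - y)"
    using xy c(1) by (intro mult_right_mono mult_mono) (auto simp: norm_inverse intro!: le_imp_inverse_le)
  finally show "norm (inverse x - inverse y) \<le> inverse c * inverse c * norm (x - y)" .
  show "norm (inverse x) \<le> inverse c" using xy(1) c(1) by (auto simp: norm_inverse intro!: le_imp_inverse_le)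
qed (use c in auto)

lemma lip_bounded_power:
  fixes f :: "'i \<Rightarrow> 'b::real_normed_algebra_1"
  assumes g: "\<And>i j. g i j \<ge> 0" and f: "lip_bounded I g f"
  shows "lip_bounded I g (\<lambda>i. f i ^ n)"
proof (induction n)
  case 0
  show ?case by (rule lip_boundedI[of _ _ 1 0]) (auto simp: g)
next
  case (Suc n)
  then show ?case using lip_bounded_mult[OF f Suc] by simp
qed

text \<open>The derivative of the root at z is its value divided by n * z; on this disc the value is
  at most 2 and |z| exceeds 1/2, whence the constant 4.\<close>

lemma croot_one_lipschitz:
  assumes n: "n > 0" and "w \<in> ball 1 (1/2)" "w' \<in> ball 1 (1/2)"
  shows "norm (croot n 1 w) \<le> 2" "norm (croot n 1 w - croot n 1 w') \<le> 4 * norm (w - w')"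
proof -
  have half: "1 / 2 < norm w" "norm w < 2" "w \<notin> \<real>\<^sub>\<le>\<^sub>0" if "w \<in> ball 1 (1/2)" for w :: complex
  proof -
    have d: "norm (1 - w) < 1 / 2" using that by (simp add: dist_norm)
    show "1 / 2 < norm w" using norm_triangle_ineq2[of 1 "1 - w"] d by simp
    show "norm w < 2" using norm_triangle_ineq2[of w 1] d by (simp add: norm_minus_commute)
    have "\<bar>Re (1 - w)\<bar> < 1 / 2" using abs_Re_le_cmod[of "1 - w"] d by linarith
    then have "Re w > 0" unfolding minus_complex.sel one_complex.sel by linarith
    then show "w \<notin> \<real>\<^sub>\<le>\<^sub>0" by (auto simp: complex_nonpos_Reals_iff)
  qed
  have bound: "norm (croot n 1 w) \<le> 2" if w: "w \<in> ball 1 (1/2)" for w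
  proof (rule ccontr)
    assume gt: "\<not> norm (croot n 1 w) \<le> 2"
    have "norm (croot n 1 w) ^ n = norm w"
      unfolding norm_power[symmetric] using half(3)[OF w] n by (subst croot_power) auto
    moreover have "norm (croot n 1 w) \<le> norm (croot n 1 w) ^ n" using gt n by (intro self_le_power) auto
    ultimately show False using half(2)[OF w] gt by linarith
  qed
  show "norm (croot n 1 w) \<le> 2" by (rule bound[OF assms(2)])
  show "norm (croot n 1 w - croot n 1 w') \<le> 4 * norm (w - w')"
  proof (rule field_differentiable_bound[OF convex_ball _ _ assms(2,3)])
    fix z :: complex assume z: "z \<in> ball 1 (1/2)"
    show "(croot n 1 has_field_derivative croot n 1 z / (of_nat n * z)) (at z within ball 1 (1/2))"
      using croot_has_field_derivative[OF n, of 1 z] half(3)[OF z] by (simp add: has_field_derivative_at_within)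
    have "1 / 2 \<le> real n * norm z"
      using mult_mono[of 1 "real n" "1/2" "norm z"] half(1)[OF z] n by simp
    then have "norm (croot n 1 z) / (real n * norm z) \<le> 2 / (1 / 2)"
      using bound[OF z] by (intro frac_le) auto
    then show "norm (croot n 1 z / (of_nat n * z)) \<le> 4" by (simp add: norm_divide norm_mult)
  qed
qed

lemma sqrt_lipschitz:
  fixes p q :: real
  assumes "p \<ge> 1/4" "q \<ge> 1/4"
  shows "\<bar>sqrt p - sqrt q\<bar> \<le> \<bar>p - q\<bar>"
proof -
  have half: "sqrt x \<ge> 1 / 2" if "x \<ge> 1/4" for x
    using that by (intro real_le_rsqrt) (simp add: power2_eq_square)
  have "p - q = (sqrt p - sqrt q) * (sqrt p + sqrt q)"
    using assms by (simp add: algebra_simps)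
  then have "\<bar>p - q\<bar> = \<bar>sqrt p - sqrt q\<bar> * (sqrt p + sqrt q)"
    using half[OF assms(1)] half[OF assms(2)] by (simp add: abs_mult)
  moreover have "\<bar>sqrt p - sqrt q\<bar> * 1 \<le> \<bar>sqrt p - sqrt q\<bar> * (sqrt p + sqrt q)"
    using half[OF assms(1)] half[OF assms(2)] by (intro mult_left_mono) auto
  ultimately show ?thesis by simp
qed

text \<open>For exponents below 1 the derivative is unbounded near 0. Bounding x^(k-1) = x^k / x by
  1 / x yields a constant proportional to 1 / r, the scale at which the radii are compared.\<close>

lemma powr_lipschitz:
  assumes "k > 0" "r > 0" "r / 2 \<le> r1" "r1 < 1" "r / 2 \<le> r2" "r2 < (1::real)"
  shows "\<bar>r1 powr k - r2 powr k\<bar> \<le> 2 * k / r * \<bar>r1 - r2\<bar>"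
proof -
  have "norm (r1 powr k - r2 powr k) \<le> 2 * k / r * norm (r1 - r2)"
  proof (rule field_differentiable_bound[where S = "{r/2..<1}" and f' = "\<lambda>x. k * x powr (k - 1)"])
    fix x assume "x \<in> {r/2..<1}"
    then have x: "r / 2 \<le> x" "x < 1" by simp_all
    have x0: "0 < x" using x(1) assms(2) by linarith
    show "((\<lambda>r. r powr k) has_field_derivative k * x powr (k - 1)) (at x within {r/2..<1})"
      by (rule has_field_derivative_at_within[OF has_real_derivative_powr[OF x0]])
    have "x powr (k - 1) = x powr k / x" using x0 by (simp add: powr_diff)
    also have "\<dots> \<le> 1 / (r / 2)" using x x0 assms(1,2) by (intro frac_le powr_le1) auto
    finally have "k * x powr (k - 1) \<le> k * (1 / (r / 2))" using assms(1) by (intro mult_left_mono) auto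
    then show "norm (k * x powr (k - 1)) \<le> 2 * k / r" using assms(1) by (simp add: mult.commute)
  qed (use assms in auto)
  then show ?thesis by simp
qed

lemma powr_lipschitz_1:
  assumes "k \<ge> 1" "0 < r1" "r1 < 1" "0 < r2" "r2 < (1::real)"
  shows "\<bar>r1 powr k - r2 powr k\<bar> \<le> k * \<bar>r1 - r2\<bar>"
proof -
  have "norm (r1 powr k - r2 powr k) \<le> k * norm (r1 - r2)"
  proof (rule field_differentiable_bound[where S = "{0<..<1}" and f' = "\<lambda>x. k * x powr (k - 1)"])
    fix x :: real assume "x \<in> {0<..<1}"
    then have x: "0 < x" "x < 1" by auto
    show "((\<lambda>r. r powr k) has_field_derivative k * x powr (k - 1)) (at x within {0<..<1})"
      by (rule has_field_derivative_at_within[OF has_real_derivative_powr[OF x(1)]])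
    have "x powr (k - 1) \<le> 1" using x assms(1) by (intro powr_le1) auto
    then have "k * x powr (k - 1) \<le> k * 1" using assms(1) by (intro mult_left_mono) auto
    then show "norm (k * x powr (k - 1)) \<le> k" using assms by simp
  qed (use assms in auto)
  then show ?thesis by simp
qed

text \<open>Beyond \<open>q *\<^sub>R (x - y)\<close> the difference contains
  \<open>(p - q) *\<^sub>R x\<close>. The longer vector \<open>x\<close> forms no obtuse angle with
  \<open>x - y\<close>, so this extra term cannot reduce the norm.\<close>

lemma radial_norm_ge:
  fixes x y :: "'b::real_inner"
  assumes "norm y \<le> norm x" "0 \<le> q" "q \<le> p"
  shows "q * norm (x - y) \<le> norm (p *\<^sub>R x - q *\<^sub>R y)"
proof -
  have ip: "0 \<le> (x - y) \<bullet> x"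
  proof -
    have "y \<bullet> x \<le> norm y * norm x" by (rule norm_cauchy_schwarz)
    also have "\<dots> \<le> norm x * norm x" using assms(1) by (rule mult_right_mono) simp
    also have "\<dots> = x \<bullet> x" by (simp add: power2_eq_square[symmetric] power2_norm_eq_inner)
    finally show ?thesis by (simp add: inner_diff_left)
  qed
  have "p *\<^sub>R x - q *\<^sub>R y = q *\<^sub>R (x - y) + (p - q) *\<^sub>R x" by (simp add: algebra_simps)
  moreover have "(norm (v + w))\<^sup>2 = (norm v)\<^sup>2 + (2 * (v \<bullet> w) + (norm w)\<^sup>2)" for v w :: 'b
    by (simp add: power2_norm_eq_inner inner_add_left inner_add_right inner_commute)
  ultimately have "(norm (p *\<^sub>R x - q *\<^sub>R y))\<^sup>2 =
      (norm (q *\<^sub>R (x - y)))\<^sup>2 + (2 * ((q *\<^sub>R (x - y)) \<bullet> ((p - q) *\<^sub>R x)) + (norm ((p - q) *\<^sub>R x))\<^sup>2)"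
    by (simp only:)
  moreover have "0 \<le> (q *\<^sub>R (x - y)) \<bullet> ((p - q) *\<^sub>R x)"
    unfolding inner_scaleR_left inner_scaleR_right using ip assms(2,3) by (intro mult_nonneg_nonneg) auto
  ultimately have "(norm (q *\<^sub>R (x - y)))\<^sup>2 \<le> (norm (p *\<^sub>R x - q *\<^sub>R y))\<^sup>2"
    using zero_le_power2[of "norm ((p - q) *\<^sub>R x)"] by linarith
  then have "norm (q *\<^sub>R (x - y)) \<le> norm (p *\<^sub>R x - q *\<^sub>R y)" by (rule power2_le_imp_le) simp
  then show ?thesis using assms(2) by simp
qed

lemma real_power_diff_le:
  fixes x y :: real
  assumes "0 \<le> x" "x \<le> R" "0 \<le> y" "y \<le> R"
  shows "\<bar>x ^ n - y ^ n\<bar> \<le> real n * R ^ (n - 1) * \<bar>x - y\<bar>"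
proof -
  have "\<bar>\<Sum>i<n. y ^ (n - Suc i) * x ^ i\<bar> \<le> (\<Sum>i<n. R ^ (n - 1))"
  proof (rule order_trans[OF sum_abs sum_mono])
    fix i assume "i \<in> {..<n}"
    then have i: "n - Suc i + i = n - 1" by auto
    have "y ^ (n - Suc i) * x ^ i \<le> R ^ (n - Suc i) * R ^ i"
      using assms by (intro mult_mono power_mono) auto
    then show "\<bar>y ^ (n - Suc i) * x ^ i\<bar> \<le> R ^ (n - 1)" using assms by (simp add: power_add[symmetric] i)
  qed
  then have "\<bar>x - y\<bar> * \<bar>\<Sum>i<n. y ^ (n - Suc i) * x ^ i\<bar> \<le> \<bar>x - y\<bar> * (real n * R ^ (n - 1))"
    by (intro mult_left_mono) auto
  then show ?thesis
    unfolding power_diff_sumr2[of x n y] abs_mult by (simp only: mult.commute[of "real n * R ^ (n - 1)"])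
qed

text \<open>x^n - y^n is x - y times a sum that at x = y = x0 equals n * x0^(n-1), which dominates
  by continuity. At x0 = 0 there is no such domination, so a slack \<rho> is allowed and absorbed
  elsewhere by the caller.\<close>

lemma power_diff_local_lower_bound:
  fixes x0 :: complex
  assumes n: "n > 0" and "\<rho> > 0"
  obtains e where "e > 0" "\<And>x y. norm (x - x0) < e \<Longrightarrow> norm (y - x0) < e \<Longrightarrow>
    (norm x ^ (n - 1) + norm y ^ (n - 1)) * norm (x - y) \<le> 2 * norm (x ^ n - y ^ n) + \<rho> * norm (x - y)"
proof -
  define F where "F p = norm (fst p) ^ (n - 1) + norm (snd p) ^ (n - 1) -
    2 * norm (\<Sum>i<n. snd p ^ (n - Suc i) * fst p ^ i)" for p :: "complex \<times> complex"
  have "isCont F (x0, x0)" unfolding F_def by (intro continuous_intros)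
  then have lim: "(F \<longlongrightarrow> F (x0, x0)) (nhds (x0, x0))"
    by (simp add: isCont_def tendsto_at_iff_tendsto_nhds)
  have "(\<Sum>i<n. x0 ^ (n - Suc i) * x0 ^ i) = of_nat n * x0 ^ (n - 1)"
  proof -
    have "(\<Sum>i<n. x0 ^ (n - Suc i) * x0 ^ i) = (\<Sum>i<n. x0 ^ (n - 1))"
      by (rule sum.cong[OF refl]) (simp add: power_add[symmetric])
    then show ?thesis by simp
  qed
  then have "F (x0, x0) = 2 * norm x0 ^ (n - 1) - 2 * (real n * norm x0 ^ (n - 1))"
    by (simp add: F_def norm_mult norm_power)
  also have "\<dots> \<le> 0" using mult_right_mono[of 1 "real n" "norm x0 ^ (n - 1)"] n by simp
  finally have "F (x0, x0) < \<rho>" using \<open>\<rho> > 0\<close> by simp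
  then have "\<forall>\<^sub>F p in nhds (x0, x0). F p < \<rho>" using lim by (rule order_tendstoD(2)[rotated])
  then obtain e where e: "e > 0" "\<And>p. dist p (x0, x0) < e \<Longrightarrow> F p < \<rho>"
    unfolding eventually_nhds_metric by blast
  show ?thesis
  proof (rule that[of "e / 2"])
    fix x y assume xy: "norm (x - x0) < e / 2" "norm (y - x0) < e / 2"
    have "dist (x, y) (x0, x0) \<le> norm (x - x0) + norm (y - x0)"
      using norm_Pair_le[of "x - x0" "y - x0"] by (simp add: dist_norm)
    then have "F (x, y) < \<rho>" using xy by (intro e(2)) auto
    then have "norm x ^ (n - 1) + norm y ^ (n - 1) \<le> 2 * norm (\<Sum>i<n. y ^ (n - Suc i) * x ^ i) + \<rho>"
      by (simp add: F_def)
    then have "(norm x ^ (n - 1) + norm y ^ (n - 1)) * norm (x - y) \<le>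
        (2 * norm (\<Sum>i<n. y ^ (n - Suc i) * x ^ i) + \<rho>) * norm (x - y)"
      by (rule mult_right_mono) simp
    also have "\<dots> = 2 * norm (x ^ n - y ^ n) + \<rho> * norm (x - y)"
      unfolding power_diff_sumr2[of x n y] norm_mult by (simp only: distrib_left distrib_right mult_ac)
    finally show "(norm x ^ (n - 1) + norm y ^ (n - 1)) * norm (x - y) \<le> 2 * norm (x ^ n - y ^ n) + \<rho> * norm (x - y)" .
  qed (use e in auto)
qed

lemma norm_triple:
  fixes x y z :: complex
  shows "norm x \<le> norm (x, y, z)" "norm y \<le> norm (x, y, z)" "norm z \<le> norm (x, y, z)"
    "norm (x, y, z) \<le> norm x + (norm y + norm z)"
proof -
  show "norm x \<le> norm (x, y, z)" by (rule norm_fst_le)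
  show "norm y \<le> norm (x, y, z)" by (rule order_trans[OF norm_fst_le norm_snd_le])
  show "norm z \<le> norm (x, y, z)" by (rule order_trans[OF norm_snd_le norm_snd_le])
  show "norm (x, y, z) \<le> norm x + (norm y + norm z)"
    by (rule order_trans[OF norm_Pair_le add_left_mono[OF norm_Pair_le]])
qed

lemma norm_pos_imp_nonzero: "7 / 16 \<le> norm w \<Longrightarrow> w \<noteq> (0 :: complex)"
  by auto

section \<open>Moving along the branches over the first coordinate\<close>

text \<open>On the link this is \<open>sqrt 2\<close> times the modulus of the half difference of
  y^b and z^b, whose sum is \<open>S\<close>; the quotient of two values is the factor by which
  \<open>tilt\<close> rescales that half difference.\<close>

definition tilt_scale :: "complex \<Rightarrow> real" where
  "tilt_scale S = sqrt (1 - (norm S)\<^sup>2 / 2)"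

text \<open>
  The new \<open>b\<close>-th powers must have sum \<open>S\<close> and, by the parallelogram law, half difference \<open>D\<close> with
  \<open>\<bar>S\<bar>\<^sup>2 / 2 + 2 \<bar>D\<bar>\<^sup>2 = 1\<close>; the direction of \<open>D\<close> is kept.
\<close>

definition tilt :: "nat \<Rightarrow> nat \<Rightarrow> complex \<Rightarrow> complex \<times> complex \<times> complex \<Rightarrow> complex \<times> complex \<times> complex" where
  "tilt a b X = (\<lambda>(x, y, z).
     let S = - (X ^ a); S' = y ^ b + z ^ b;
         D = of_real (tilt_scale S * inverse (tilt_scale S')) * ((y ^ b - z ^ b) / 2)
     in (X, croot b y (S / 2 + D), croot b z (S / 2 - D)))"

lemma fst_tilt [simp]: "fst (tilt a b X n) = X"
  by (simp add: tilt_def Let_def split: prod.splits)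

lemma tilt_scale_bounds:
  assumes "norm S \<le> 1 / 8"
  shows "1 - (norm S)\<^sup>2 / 2 \<ge> 127 / 128" "1 / 2 \<le> tilt_scale S" "tilt_scale S \<le> 1"
    "(tilt_scale S)\<^sup>2 = 1 - (norm S)\<^sup>2 / 2"
proof -
  have "(norm S)\<^sup>2 \<le> (1 / 8)\<^sup>2" using assms by (intro power_mono) auto
  then show 1: "1 - (norm S)\<^sup>2 / 2 \<ge> 127 / 128" by (simp add: power2_eq_square)
  show "1 / 2 \<le> tilt_scale S" unfolding tilt_scale_def using 1 by (intro real_le_rsqrt) (simp add: power2_eq_square)
  show "tilt_scale S \<le> 1" unfolding tilt_scale_def using 1 by (intro real_le_lsqrt) auto
  show "(tilt_scale S)\<^sup>2 = 1 - (norm S)\<^sup>2 / 2" unfolding tilt_scale_def using 1 by simp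
qed

lemma link_sq:
  assumes "(x, y, z) \<in> link a b"
  shows "y ^ b + z ^ b = - (x ^ a)" "(norm (y ^ b))\<^sup>2 + (norm (z ^ b))\<^sup>2 = 1"
    "(norm ((y ^ b - z ^ b) / 2))\<^sup>2 = (1 - (norm (x ^ a))\<^sup>2 / 2) / 2"
proof -
  show S: "y ^ b + z ^ b = - (x ^ a)"
    unfolding eq_neg_iff_add_eq_0 using assms by (simp add: link_def ac_simps)
  show sq: "(norm (y ^ b))\<^sup>2 + (norm (z ^ b))\<^sup>2 = 1"
    using assms unfolding link_def power_2b[symmetric] by simp
  have "y ^ b = (y ^ b + z ^ b) / 2 + (y ^ b - z ^ b) / 2" "z ^ b = (y ^ b + z ^ b) / 2 - (y ^ b - z ^ b) / 2"
    by (simp_all add: field_simps)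
  then have "(norm (y ^ b))\<^sup>2 + (norm (z ^ b))\<^sup>2 = (norm (y ^ b + z ^ b))\<^sup>2 / 2 + 2 * (norm ((y ^ b - z ^ b) / 2))\<^sup>2"
    using parallelogram_half[of "y ^ b + z ^ b" "(y ^ b - z ^ b) / 2"] by simp
  moreover have "A = (1 - B / 2) / 2" if "1 = B / 2 + 2 * A" for A B :: real using that by simp
  ultimately show "(norm ((y ^ b - z ^ b) / 2))\<^sup>2 = (1 - (norm (x ^ a))\<^sup>2 / 2) / 2"
    unfolding sq S norm_minus_cancel by blast
qed

locale tilting =
  fixes a b :: nat
  assumes a_pos: "a > 0" and b_pos: "b > 0"
begin

text \<open>The bound 1/8 keeps both \<open>b\<close>-th powers at modulus at least 7/16 and the
  quotients of new by old powers within 1/2 of 1, far from the cut of the root.\<close>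

definition "near = {n \<in> link a b. norm (fst n ^ a) \<le> 1 / 8}"

text \<open>The two numbers whose \<open>b\<close>-th roots \<open>tilt\<close> takes, relative to the old ones, stay close to 1.\<close>

lemma tilt_estimates:
  assumes n: "(x, y, z) \<in> near" and X: "norm (X ^ a) \<le> 1 / 8"
  defines "D \<equiv> of_real (tilt_scale (- (X ^ a)) * inverse (tilt_scale (y ^ b + z ^ b))) * ((y ^ b - z ^ b) / 2)"
  shows "7 / 16 \<le> norm (y ^ b)" "7 / 16 \<le> norm (z ^ b)"
    "(norm D)\<^sup>2 = (1 - (norm (X ^ a))\<^sup>2 / 2) / 2"
    "norm (- (X ^ a) / 2 + D) \<ge> 7 / 16" "norm (- (X ^ a) / 2 - D) \<ge> 7 / 16"
    "(- (X ^ a) / 2 + D) / y ^ b \<in> ball 1 (1/2)" "(- (X ^ a) / 2 - D) / z ^ b \<in> ball 1 (1/2)"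
proof -
  have n': "(x, y, z) \<in> link a b" "norm (x ^ a) \<le> 1 / 8" using n by (auto simp: near_def)
  note eq = link_sq[OF n'(1)]
  define D' where "D' = (y ^ b - z ^ b) / 2"
  define w where "w = tilt_scale (- (X ^ a))"
  define w' where "w' = tilt_scale (y ^ b + z ^ b)"
  have w: "127 / 128 \<le> w\<^sup>2" "1 / 2 \<le> w" "w \<le> 1" "w\<^sup>2 = 1 - (norm (X ^ a))\<^sup>2 / 2"
    unfolding w_def using tilt_scale_bounds[of "- (X ^ a)"] X by simp_all
  have w': "127 / 128 \<le> w'\<^sup>2" "1 / 2 \<le> w'" "w' \<le> 1" "w'\<^sup>2 = 1 - (norm (x ^ a))\<^sup>2 / 2"
    unfolding w'_def eq(1) using tilt_scale_bounds[of "- (x ^ a)"] n'(2) by simp_all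
  have nD': "(norm D')\<^sup>2 = w'\<^sup>2 / 2" unfolding D'_def eq(3) w'(4) ..
  have D: "D = of_real (w / w') * D'" unfolding D_def w_def w'_def D'_def divide_inverse by (rule refl)
  have "norm D = \<bar>w / w'\<bar> * norm D'" unfolding D norm_mult norm_of_real by (rule refl)
  moreover have "\<bar>w / w'\<bar> = w / w'" using w(2) w'(2) by simp
  ultimately have nD: "norm D = w / w' * norm D'" by (simp only:)
  then have nDw: "(norm D)\<^sup>2 = w\<^sup>2 / 2" unfolding nD power_mult_distrib power_divide nD' using w'(2) by simp
  then show "(norm D)\<^sup>2 = (1 - (norm (X ^ a))\<^sup>2 / 2) / 2" by (simp add: w(4))
  have half: "1 / 2 \<le> norm D'" "1 / 2 \<le> norm D"
    using nD' nDw w(1) w'(1) by (intro power2_le_imp_le[of "1/2"]; simp add: power2_eq_square)+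
  have y: "y ^ b = - (x ^ a) / 2 + D'" and z: "z ^ b = - (x ^ a) / 2 - D'"
    unfolding eq(1)[symmetric] D'_def by (simp_all add: field_simps)
  \<comment> \<open>7/16 is 1/2 - 1/16: the half difference has modulus at least 1/2, the half sum
    at most 1/16.\<close>
  have big: "7 / 16 \<le> norm (- v / 2 + E)" "7 / 16 \<le> norm (- v / 2 - E)" if "norm v \<le> 1 / 8" "1 / 2 \<le> norm E" for v E :: complex
  proof -
    have v: "norm (v / 2) \<le> 1 / 16" using that(1) by (simp add: norm_divide)
    have "- v / 2 + E = E - v / 2" "norm (- v / 2 - E) = norm (E - - (v / 2))"
      by simp (subst norm_minus_cancel[symmetric], simp)
    then show "7 / 16 \<le> norm (- v / 2 + E)" "7 / 16 \<le> norm (- v / 2 - E)"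
      using norm_triangle_ineq2[of E "v / 2"] norm_triangle_ineq2[of E "- (v / 2)"] that(2) v
      unfolding norm_minus_cancel by simp_all
  qed
  show hy: "7 / 16 \<le> norm (y ^ b)" and hz: "7 / 16 \<le> norm (z ^ b)"
    unfolding y z by (rule big[OF n'(2) half(1)])+
  show "norm (- (X ^ a) / 2 + D) \<ge> 7 / 16" "norm (- (X ^ a) / 2 - D) \<ge> 7 / 16" by (rule big[OF X half(2)])+
  \<comment> \<open>\<open>D\<close> is a positive multiple of \<open>D'\<close>, so their distance
    is the difference of the moduli. It is bounded by the difference of the squares, since the
    moduli add up to at least 1.\<close>
  have dD: "norm (D - D') \<le> 1 / 64"
  proof -
    have "D - D' = of_real (w / w' - 1) * D'" by (simp add: D algebra_simps)
    then have "norm (D - D') = \<bar>w / w' - 1\<bar> * norm D'" by (simp only: norm_mult norm_of_real)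
    also have "\<dots> = \<bar>norm D - norm D'\<bar>"
    proof -
      have "norm D - norm D' = (w / w' - 1) * norm D'" unfolding nD by (simp add: left_diff_distrib)
      then show ?thesis by (simp only: abs_mult abs_norm_cancel)
    qed
    finally have e: "norm (D - D') = \<bar>norm D - norm D'\<bar>" .
    have "\<bar>norm D - norm D'\<bar> * (norm D + norm D') = \<bar>(norm D)\<^sup>2 - (norm D')\<^sup>2\<bar>"
      by (simp add: power2_eq_square square_diff_square_factored abs_mult mult.commute)
    also have "\<dots> \<le> 1 / 64"
    proof -
      have "w\<^sup>2 \<le> 1" "w'\<^sup>2 \<le> 1" using w(2,3) w'(2,3) by (simp_all add: power_le_one)
      then show ?thesis unfolding nDw nD' using w(1) w'(1) by linarith
    qed
    finally have le: "\<bar>norm D - norm D'\<bar> * (norm D + norm D') \<le> 1 / 64" .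
    have "\<bar>norm D - norm D'\<bar> * 1 \<le> \<bar>norm D - norm D'\<bar> * (norm D + norm D')"
      using half by (intro mult_left_mono) auto
    from order_trans[OF this le] show ?thesis unfolding e by (simp only: mult_1_right)
  qed
  have dS: "norm (- (X ^ a) / 2 - - (x ^ a) / 2) \<le> 1 / 8"
  proof -
    have "norm (- (X ^ a) / 2 - - (x ^ a) / 2) \<le> norm (- (X ^ a) / 2) + norm (- (x ^ a) / 2)" by (rule norm_triangle_ineq4)
    then show ?thesis using X n'(2) by (simp add: norm_divide)
  qed
  \<comment> \<open>The distance 9/64 = 1/8 + 1/64 comes from half sum and half difference; divided
    by 7/16 it is 9/28, less than 1/2.\<close>
  have close: "q / p \<in> ball 1 (1/2)" if "7 / 16 \<le> norm p" "norm (q - p) \<le> 9 / 64" for p q :: complex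
  proof -
    have p: "p \<noteq> 0" using that(1) by auto
    then have "1 - q / p = (p - q) / p" by (simp add: field_simps)
    then have "norm (1 - q / p) = norm (q - p) / norm p" by (simp add: norm_divide norm_minus_commute)
    also have "\<dots> \<le> (9 / 64) / (7 / 16)" using that by (intro frac_le) auto
    finally show ?thesis by (simp add: dist_norm)
  qed
  have "norm ((- (X ^ a) / 2 + D) - y ^ b) \<le> 9 / 64"
  proof -
    have e: "(- (X ^ a) / 2 + D) - y ^ b = (- (X ^ a) / 2 - - (x ^ a) / 2) + (D - D')" by (simp add: y)
    have "norm ((- (X ^ a) / 2 + D) - y ^ b) \<le> 1 / 8 + 1 / 64" unfolding e by (rule norm_triangle_mono[OF dS dD])
    also have "\<dots> = 9 / 64" by simp
    finally show ?thesis .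
  qed
  then show "(- (X ^ a) / 2 + D) / y ^ b \<in> ball 1 (1/2)" by (rule close[OF hy])
  have "norm ((- (X ^ a) / 2 - D) - z ^ b) \<le> 9 / 64"
  proof -
    have e: "(- (X ^ a) / 2 - D) - z ^ b = (- (X ^ a) / 2 - - (x ^ a) / 2) - (D - D')" by (simp add: z)
    have "norm ((- (X ^ a) / 2 - D) - z ^ b) \<le> 1 / 8 + 1 / 64"
      unfolding e by (rule order_trans[OF norm_triangle_ineq4 add_mono[OF dS dD]])
    also have "\<dots> = 9 / 64" by simp
    finally show ?thesis .
  qed
  then show "(- (X ^ a) / 2 - D) / z ^ b \<in> ball 1 (1/2)" by (rule close[OF hz])
qed

lemma near_nonzero:
  assumes "(x, y, z) \<in> near"
  shows "y \<noteq> 0" "z \<noteq> 0"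
proof -
  have "7 / 16 \<le> norm (y ^ b)" "7 / 16 \<le> norm (z ^ b)"
    using tilt_estimates(1,2)[OF assms, of 0] a_pos by (simp_all add: zero_power)
  then show "y \<noteq> 0" "z \<noteq> 0" using b_pos by (auto simp: zero_power)
qed

lemma tilt_in_near:
  assumes n: "n \<in> near" and X: "norm (X ^ a) \<le> 1 / 8"
  shows "tilt a b X n \<in> near"
proof -
  obtain x y z where xyz: "n = (x, y, z)" by (cases n)
  define D where "D = complex_of_real (tilt_scale (- (X ^ a)) * inverse (tilt_scale (y ^ b + z ^ b))) * ((y ^ b - z ^ b) / 2)"
  note est = tilt_estimates[OF n[unfolded xyz] X, folded D_def]
  note nz = near_nonzero[OF n[unfolded xyz]]
  have PQ: "- (X ^ a) / 2 + D \<noteq> 0" "- (X ^ a) / 2 - D \<noteq> 0" using est(4,5) norm_pos_imp_nonzero by blast+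
  have "norm (- (X ^ a) / 2 + D) ^ 2 + norm (- (X ^ a) / 2 - D) ^ 2 = 1"
    unfolding parallelogram_half est(3) by (simp add: field_simps)
  then have "(X, croot b y (- (X ^ a) / 2 + D), croot b z (- (X ^ a) / 2 - D)) \<in> link a b"
    unfolding link_def mem_Collect_eq prod.case power_2b
      croot_power[OF b_pos nz(1) PQ(1)] croot_power[OF b_pos nz(2) PQ(2)] by simp
  then show ?thesis using X by (simp add: near_def tilt_def xyz Let_def D_def)
qed

text \<open>The direction of the half difference is kept, so the two rescalings cancel. The branches
  cancel because the logarithm of the inverse is the negative logarithm off the cut, and the
  quotient of new by old power is within 1/2 of 1.\<close>

lemma tilt_tilt:
  assumes n: "n \<in> near" and X: "norm (X ^ a) \<le> 1 / 8"
  shows "tilt a b (fst n) (tilt a b X n) = n"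
proof -
  obtain x y z where xyz: "n = (x, y, z)" by (cases n)
  define w where "w = tilt_scale (- (X ^ a))"
  define w' where "w' = tilt_scale (y ^ b + z ^ b)"
  define D' where "D' = (y ^ b - z ^ b) / 2"
  define D where "D = complex_of_real (w * inverse w') * D'"
  note est = tilt_estimates[OF n[unfolded xyz] X, folded w_def w'_def D'_def, folded D_def]
  note nz = near_nonzero[OF n[unfolded xyz]]
  define P where "P = - (X ^ a) / 2 + D"
  define Q where "Q = - (X ^ a) / 2 - D"
  have n': "(x, y, z) \<in> link a b" "norm (x ^ a) \<le> 1 / 8" using n by (auto simp: near_def xyz)
  note eq = link_sq[OF n'(1)]
  have w: "w > 0" "w' > 0"
    unfolding w_def w'_def eq(1) using tilt_scale_bounds(2)[of "- (X ^ a)"] tilt_scale_bounds(2)[of "- (x ^ a)"] X n'(2)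
    by simp_all
  have PQ: "P \<noteq> 0" "Q \<noteq> 0" unfolding P_def Q_def using est(4,5) norm_pos_imp_nonzero by blast+
  have tX: "tilt a b X n = (X, croot b y P, croot b z Q)"
    by (simp add: tilt_def xyz Let_def P_def Q_def D_def w_def w'_def D'_def)
  have pows: "croot b y P ^ b = P" "croot b z Q ^ b = Q"
    by (rule croot_power[OF b_pos nz(1) PQ(1)], rule croot_power[OF b_pos nz(2) PQ(2)])
  have PQ_eq: "(P + Q) = - (X ^ a)" "(P - Q) / 2 = D" by (simp_all add: P_def Q_def)
  have DD: "complex_of_real (w' * inverse w) * D = D'"
  proof -
    have 1: "w' * inverse w * (w * inverse w') = 1" using w by (simp add: divide_simps)
    have "complex_of_real (w' * inverse w) * D = complex_of_real (w' * inverse w * (w * inverse w')) * D'"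
      unfolding D_def by (simp only: of_real_mult mult.assoc)
    then show ?thesis unfolding 1 by simp
  qed
  have yz: "- (x ^ a) / 2 + D' = y ^ b" "- (x ^ a) / 2 - D' = z ^ b"
    unfolding eq(1)[symmetric] D'_def by (simp_all add: field_simps)
  have cancel: "croot b (croot b v p) (v ^ b) = v" if v: "v \<noteq> 0" and p: "p \<noteq> 0" "p / v ^ b \<in> ball 1 (1/2)" for v p :: complex
  proof -
    have "\<bar>Re (1 - p / v ^ b)\<bar> < 1 / 2"
      using p(2) abs_Re_le_cmod[of "1 - p / v ^ b"] by (simp add: dist_norm)
    then have "Re (p / v ^ b) > 0" unfolding minus_complex.sel one_complex.sel by linarith
    then have "p / v ^ b \<notin> \<real>\<^sub>\<le>\<^sub>0" by (auto simp: complex_nonpos_Reals_iff)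
    then have "Ln (inverse (p / v ^ b)) = - Ln (p / v ^ b)" by (rule Ln_inverse)
    then have "Ln (v ^ b / p) = - Ln (p / v ^ b)" by (simp only: inverse_divide)
    then show ?thesis
      unfolding croot_def[of b "croot b v p"] croot_power[OF b_pos v p(1)]
      by (simp add: croot_def exp_add[symmetric] mult.assoc)
  qed
  have "tilt a b x (X, croot b y P, croot b z Q) =
      (x, croot b (croot b y P) (- (x ^ a) / 2 + complex_of_real (tilt_scale (- (x ^ a)) * inverse (tilt_scale (P + Q))) * ((P - Q) / 2)),
          croot b (croot b z Q) (- (x ^ a) / 2 - complex_of_real (tilt_scale (- (x ^ a)) * inverse (tilt_scale (P + Q))) * ((P - Q) / 2)))"
    by (simp add: tilt_def Let_def pows)
  also have "complex_of_real (tilt_scale (- (x ^ a)) * inverse (tilt_scale (P + Q))) * ((P - Q) / 2) = D'"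
    unfolding PQ_eq eq(1)[symmetric] w_def[symmetric] w'_def[symmetric] by (rule DD)
  also have "- (x ^ a) / 2 + D' = y ^ b" by (rule yz)
  also have "- (x ^ a) / 2 - D' = z ^ b" by (rule yz)
  finally have "tilt a b x (tilt a b X n) = (x, croot b (croot b y P) (y ^ b), croot b (croot b z Q) (z ^ b))"
    unfolding tX .
  moreover have "croot b (croot b y P) (y ^ b) = y"
    by (rule cancel[OF nz(1) PQ(1)]) (unfold P_def, rule est(6))
  moreover have "croot b (croot b z Q) (z ^ b) = z"
    by (rule cancel[OF nz(2) PQ(2)]) (unfold Q_def, rule est(7))
  moreover have "fst n = x" by (simp add: xyz)
  ultimately show ?thesis using xyz by (simp only:)
qed

lemma tilt_self:
  assumes n: "n \<in> near"
  shows "tilt a b (fst n) n = n"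
proof -
  have 1: "norm (fst n ^ a) \<le> 1 / 8" using n by (simp add: near_def)
  obtain x y z where xyz: "n = (x, y, z)" by (cases n)
  have "(x, y, z) \<in> link a b" "norm (x ^ a) \<le> 1 / 8" using n by (auto simp: near_def xyz)
  note eq = link_sq[OF this(1)]
  note nz = near_nonzero[OF n[unfolded xyz]]
  have w: "tilt_scale (- (x ^ a)) \<noteq> 0" using tilt_scale_bounds(2)[of "- (x ^ a)"] \<open>norm (x ^ a) \<le> 1 / 8\<close> by auto
  have yz: "- (x ^ a) / 2 + (y ^ b - z ^ b) / 2 = y ^ b" "- (x ^ a) / 2 - (y ^ b - z ^ b) / 2 = z ^ b"
    unfolding eq(1)[symmetric] by (simp_all add: field_simps)
  have "tilt a b x (x, y, z) = (x, croot b y (- (x ^ a) / 2 + (y ^ b - z ^ b) / 2), croot b z (- (x ^ a) / 2 - (y ^ b - z ^ b) / 2))"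
    unfolding tilt_def Let_def prod.case eq(1) using w by simp
  also have "\<dots> = (x, y, z)" unfolding yz using nz by (simp add: croot_def)
  finally show ?thesis by (simp add: xyz)
qed

text \<open>The new \<open>Y\<close> and \<open>Z\<close> are built by sums, products, quotients and
  roots from \<open>y\<close>, \<open>z\<close> and \<open>X ^ a\<close>. Neither \<open>x\<close>
  nor \<open>X\<close> enters otherwise, and the gauge \<open>g\<close> therefore measures
  \<open>X ^ a\<close>: a Lipschitz bound in \<open>X ^ a\<close> is stronger near X = 0 than one in
  \<open>X\<close>.\<close>

lemma tilt_lipschitz:
  obtains K where "K \<ge> 0"
    "\<And>X x y z Y Z X' x' y' z' Y' Z'. (x, y, z) \<in> near \<Longrightarrow> (x', y', z') \<in> near \<Longrightarrow>
      norm (X ^ a) \<le> 1 / 8 \<Longrightarrow> norm (X' ^ a) \<le> 1 / 8 \<Longrightarrow>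
      tilt a b X (x, y, z) = (X, Y, Z) \<Longrightarrow> tilt a b X' (x', y', z') = (X', Y', Z') \<Longrightarrow>
      norm (Y - Y') + norm (Z - Z') \<le> K * (norm (y - y') + norm (z - z') + norm (X ^ a - X' ^ a))"
proof -
  define I :: "(complex \<times> complex \<times> complex \<times> complex) set" where "I = {(X, n). norm (X ^ a) \<le> 1 / 8 \<and> n \<in> near}"
  define g where "g i j = norm (fst (snd (snd i)) - fst (snd (snd j))) + norm (snd (snd (snd i)) - snd (snd (snd j)))
    + norm (fst i ^ a - fst j ^ a)" for i j :: "complex \<times> complex \<times> complex \<times> complex"
  have g0: "g i j \<ge> 0" for i j by (simp add: g_def)
  define yy where "yy = (\<lambda>i::complex \<times> complex \<times> complex \<times> complex. fst (snd (snd i)))"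
  define zz where "zz = (\<lambda>i::complex \<times> complex \<times> complex \<times> complex. snd (snd (snd i)))"
  define S where "S = (\<lambda>i::complex \<times> complex \<times> complex \<times> complex. - (fst i ^ a))"
  define S' where "S' = (\<lambda>i. yy i ^ b + zz i ^ b)"
  have I: "norm (fst i ^ a) \<le> 1 / 8" "(fst (snd i), yy i, zz i) \<in> near" if "i \<in> I" for i
    using that by (auto simp: I_def yy_def zz_def)
  have y: "lip_bounded I g yy" and z: "lip_bounded I g zz"
    using link_norm_le(1,2)[OF _ a_pos b_pos] I(2)
    by (intro lip_boundedI[of _ _ 1 1]; force simp: near_def g_def yy_def zz_def)+
  have S: "lip_bounded I g S"
    using I(1) by (intro lip_boundedI[of _ _ "1/8" 1]) (auto simp: S_def g_def norm_minus_commute)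
  have yb: "lip_bounded I g (\<lambda>i. yy i ^ b)" and zb: "lip_bounded I g (\<lambda>i. zz i ^ b)"
    by (intro lip_bounded_power g0 y z)+
  have S': "lip_bounded I g S'" unfolding S'_def by (intro lip_bounded_add yb zb)
  have S'_le: "norm (S' i) \<le> 1 / 8" if "i \<in> I" for i
  proof -
    have "(fst (snd i), yy i, zz i) \<in> link a b" "norm (fst (snd i) ^ a) \<le> 1 / 8"
      using I(2)[OF that] by (auto simp: near_def)
    then show ?thesis unfolding S'_def using link_sq(1) by simp
  qed
  have S_le: "norm (S i) \<le> 1 / 8" if "i \<in> I" for i using I(1)[OF that] by (simp add: S_def)
  have scale: "lip_bounded I g (\<lambda>i. tilt_scale (f i))" if f: "lip_bounded I g f" "\<And>i. i \<in> I \<Longrightarrow> norm (f i) \<le> 1 / 8" for f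
  proof (rule lip_bounded_compose[OF f(1), where A = "{S. norm S \<le> 1 / 8}" and C = 1 and L = 1])
    fix x y :: complex assume "x \<in> {S. norm S \<le> 1 / 8}" "y \<in> {S. norm S \<le> 1 / 8}"
    then have xy: "norm x \<le> 1 / 8" "norm y \<le> 1 / 8" by auto
    have "\<bar>tilt_scale x - tilt_scale y\<bar> \<le> \<bar>(1 - (norm x)\<^sup>2 / 2) - (1 - (norm y)\<^sup>2 / 2)\<bar>"
      unfolding tilt_scale_def using tilt_scale_bounds(1)[OF xy(1)] tilt_scale_bounds(1)[OF xy(2)]
      by (intro sqrt_lipschitz) auto
    also have "\<dots> = \<bar>norm x - norm y\<bar> * ((norm x + norm y) / 2)"
    proof -
      have "(1 - (norm x)\<^sup>2 / 2) - (1 - (norm y)\<^sup>2 / 2) = - ((norm x - norm y) * ((norm x + norm y) / 2))"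
        by (simp add: power2_eq_square field_simps)
      then show ?thesis by (simp add: abs_mult)
    qed
    also have "\<dots> \<le> norm (x - y) * 1"
      using xy by (intro mult_mono norm_triangle_ineq3) auto
    finally show "norm (tilt_scale x - tilt_scale y) \<le> 1 * norm (x - y)" by simp
    show "norm (tilt_scale x) \<le> 1" using tilt_scale_bounds(2,3)[OF xy(1)] by simp
  qed (use f(2) in auto)
  have inv_scale: "lip_bounded I g (\<lambda>i. inverse (tilt_scale (S' i)))"
  proof (rule lip_bounded_inverse[OF scale[OF S' S'_le]])
    show "1 / 2 \<le> norm (tilt_scale (S' i))" if "i \<in> I" for i using tilt_scale_bounds(2)[OF S'_le[OF that]] by simp
  qed auto
  define D where "D = (\<lambda>i. complex_of_real (tilt_scale (S i) * inverse (tilt_scale (S' i))) * ((yy i ^ b - zz i ^ b) / 2))"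
  have D: "lip_bounded I g D"
    unfolding D_def
    by (intro lip_bounded_mult lip_bounded_linear[OF bounded_linear_of_real] lip_bounded_linear[OF bounded_linear_divide]
        lip_bounded_diff yb zb inv_scale scale[OF S S_le])
  have S2: "lip_bounded I g (\<lambda>i. S i / 2)" by (rule lip_bounded_linear[OF bounded_linear_divide S])
  have est: "7 / 16 \<le> norm (yy i ^ b)" "7 / 16 \<le> norm (zz i ^ b)"
    "(S i / 2 + D i) / yy i ^ b \<in> ball 1 (1/2)" "(S i / 2 - D i) / zz i ^ b \<in> ball 1 (1/2)" if "i \<in> I" for i
    unfolding D_def S_def S'_def using tilt_estimates[OF I(2)[OF that] I(1)[OF that]] by blast+
  \<comment> \<open>The branch varies with \<open>v i\<close>; since
    \<open>croot b v p = v * croot b 1 (p / v ^ b)\<close>, the fixed branch at 1 suffices.\<close>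
  have root: "lip_bounded I g (\<lambda>i. croot b (v i) (p i))"
    if v: "lip_bounded I g v" "lip_bounded I g (\<lambda>i. v i ^ b)" "\<And>i. i \<in> I \<Longrightarrow> 7 / 16 \<le> norm (v i ^ b)"
      and p: "lip_bounded I g p" "\<And>i. i \<in> I \<Longrightarrow> p i / v i ^ b \<in> ball 1 (1/2)" for v p
  proof -
    have "lip_bounded I g (\<lambda>i. p i * inverse (v i ^ b))"
      by (intro lip_bounded_mult p(1) lip_bounded_inverse[OF v(2) _ v(3)]) auto
    then have "lip_bounded I g (\<lambda>i. croot b 1 (p i * inverse (v i ^ b)))"
    proof (rule lip_bounded_compose[where A = "ball 1 (1/2)" and C = 2 and L = 4])
      show "p i * inverse (v i ^ b) \<in> ball 1 (1/2)" if "i \<in> I" for i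
        using p(2)[OF that] unfolding divide_inverse .
      show "norm (croot b 1 x) \<le> 2" if "x \<in> ball 1 (1/2)" for x
        by (rule croot_one_lipschitz(1)[OF b_pos that that])
      show "norm (croot b 1 x - croot b 1 y) \<le> 4 * norm (x - y)" if "x \<in> ball 1 (1/2)" "y \<in> ball 1 (1/2)" for x y
        by (rule croot_one_lipschitz(2)[OF b_pos that])
    qed simp
    then have lip: "lip_bounded I g (\<lambda>i. v i * croot b 1 (p i * inverse (v i ^ b)))"
      by (rule lip_bounded_mult[OF v(1)])
    have eq: "v i * croot b 1 (p i * inverse (v i ^ b)) = croot b (v i) (p i)" if "i \<in> I" for i
      unfolding croot_def divide_inverse by simp
    obtain B K where "\<And>i. i \<in> I \<Longrightarrow> norm (v i * croot b 1 (p i * inverse (v i ^ b))) \<le> B" "K \<ge> 0"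
      "\<And>i j. i \<in> I \<Longrightarrow> j \<in> I \<Longrightarrow> norm (v i * croot b 1 (p i * inverse (v i ^ b)) - v j * croot b 1 (p j * inverse (v j ^ b))) \<le> K * g i j"
      by (rule lip_boundedE[OF lip]) (rule that; assumption)
    then show ?thesis by (intro lip_boundedI[of _ _ B K]) (simp_all add: eq)
  qed
  have Yl: "lip_bounded I g (\<lambda>i. croot b (yy i) (S i / 2 + D i))"
    by (intro root y yb est(1,3) lip_bounded_add S2 D)
  have Zl: "lip_bounded I g (\<lambda>i. croot b (zz i) (S i / 2 - D i))"
    by (intro root z zb est(2,4) lip_bounded_diff S2 D)
  obtain B1 K1 where 1: "B1 \<ge> 0" "\<And>i. i \<in> I \<Longrightarrow> norm (croot b (yy i) (S i / 2 + D i)) \<le> B1" "K1 \<ge> 0"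
    "\<And>i j. i \<in> I \<Longrightarrow> j \<in> I \<Longrightarrow> norm (croot b (yy i) (S i / 2 + D i) - croot b (yy j) (S j / 2 + D j)) \<le> K1 * g i j"
    by (rule lip_boundedE[OF Yl]) (rule that; assumption)
  obtain B2 K2 where 2: "B2 \<ge> 0" "\<And>i. i \<in> I \<Longrightarrow> norm (croot b (zz i) (S i / 2 - D i)) \<le> B2" "K2 \<ge> 0"
    "\<And>i j. i \<in> I \<Longrightarrow> j \<in> I \<Longrightarrow> norm (croot b (zz i) (S i / 2 - D i) - croot b (zz j) (S j / 2 - D j)) \<le> K2 * g i j"
    by (rule lip_boundedE[OF Zl]) (rule that; assumption)
  show ?thesis
  proof (rule that[of "K1 + K2"])
    show "K1 + K2 \<ge> 0" using 1(3) 2(3) by simp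
    fix X x y z Y Z X' x' y' z' Y' Z'
    assume n: "(x, y, z) \<in> near" "(x', y', z') \<in> near" "norm (X ^ a) \<le> 1 / 8" "norm (X' ^ a) \<le> 1 / 8"
      and T: "tilt a b X (x, y, z) = (X, Y, Z)" "tilt a b X' (x', y', z') = (X', Y', Z')"
    define i where "i = (X, x, y, z)"
    define j where "j = (X', x', y', z')"
    have ij: "i \<in> I" "j \<in> I" using n by (auto simp: I_def i_def j_def)
    have "Y = croot b (yy i) (S i / 2 + D i)" "Z = croot b (zz i) (S i / 2 - D i)"
      using T(1) by (auto simp: tilt_def Let_def i_def yy_def zz_def S_def S'_def D_def)
    moreover have "Y' = croot b (yy j) (S j / 2 + D j)" "Z' = croot b (zz j) (S j / 2 - D j)"
      using T(2) by (auto simp: tilt_def Let_def j_def yy_def zz_def S_def S'_def D_def)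
    ultimately have "norm (Y - Y') + norm (Z - Z') \<le> K1 * g i j + K2 * g i j"
      using 1(4)[OF ij] 2(4)[OF ij] by simp
    then show "norm (Y - Y') + norm (Z - Z') \<le> (K1 + K2) * (norm (y - y') + norm (z - z') + norm (X ^ a - X' ^ a))"
      by (simp add: g_def i_def j_def distrib_right)
  qed
qed

end

lemma norm_le_components:
  fixes n n' :: "complex \<times> complex \<times> complex"
  shows "norm (n - n') \<le> norm (fst n - fst n') + (norm (fst (snd n) - fst (snd n')) + norm (snd (snd n) - snd (snd n')))"
    "norm (fst n - fst n') \<le> norm (n - n')" "norm (fst (snd n) - fst (snd n')) \<le> norm (n - n')"
    "norm (snd (snd n) - snd (snd n')) \<le> norm (n - n')"
proof -
  have e: "n - n' = (fst n - fst n', fst (snd n) - fst (snd n'), snd (snd n) - snd (snd n'))"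
    by (simp add: prod_eq_iff)
  show "norm (n - n') \<le> norm (fst n - fst n') + (norm (fst (snd n) - fst (snd n')) + norm (snd (snd n) - snd (snd n')))"
    "norm (fst n - fst n') \<le> norm (n - n')" "norm (fst (snd n) - fst (snd n')) \<le> norm (n - n')"
    "norm (snd (snd n) - snd (snd n')) \<le> norm (n - n')"
    unfolding e by (rule norm_triple)+
qed

section \<open>Shrinking the first coordinate near the branch locus\<close>

locale conical_map = tilting a b for a b :: nat +
  assumes a_ge_2: "2 \<le> a" and a_less_b: "a < b"
begin

definition "expo = real b / real a"
definition "kap = expo - 1"
text \<open>\<open>near\<close> is the region |x| \<le> \<open>2 * del\<close>, while
  \<open>rad\<close> moves only points with |x| < \<open>del\<close>. In the collar between them
  \<open>push\<close> is the identity, so it extends by the identity outside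
  \<open>near\<close>.\<close>

definition "del = root a (1 / 8) / 2"
definition "shrink r \<xi> = max (r powr kap) (min 1 ((\<xi> / del) ^ (a - 1)))" for r \<xi> :: real
definition "rad r x = shrink r (norm x) *\<^sub>R x" for r and x :: complex
definition "push r n = (if n \<in> near then tilt a b (rad r (fst n)) n else n)" for r

lemma expo: "expo > 1" "kap > 0"
  using a_less_b a_pos by (simp_all add: expo_def kap_def)

lemma del: "del > 0" "(2 * del) ^ a = 1 / 8" "2 * del \<le> 1"
  using a_pos real_root_le_1_iff[OF a_pos, of "1/8"] by (simp_all add: del_def real_root_gt_zero real_root_pow_pos2)

lemma norm_power_a_iff: "norm (x ^ a) \<le> 1 / 8 \<longleftrightarrow> norm (x::complex) \<le> 2 * del"
  unfolding norm_power del(2)[symmetric] by (rule power_mono_iff) (use del a_pos in auto)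

lemma norm_power_a_le: "norm (x::complex) \<le> 2 * del \<Longrightarrow> norm (x ^ a) \<le> 1 / 8"
  by (simp only: norm_power_a_iff)

lemma near_iff: "n \<in> link a b \<Longrightarrow> n \<in> near \<longleftrightarrow> norm (fst n) \<le> 2 * del"
  unfolding near_def mem_Collect_eq norm_power_a_iff by simp

lemma powr_kap: "0 < r \<Longrightarrow> r < 1 \<Longrightarrow> 0 < r powr kap \<and> r powr kap < 1"
  using expo(2) powr_less_mono2[of kap r 1] by simp

section \<open>The radial homeomorphism of the first coordinate\<close>

text \<open>Together the lower and upper bounds say that \<open>shrink r \<xi>\<close> is comparable
  with \<open>r powr kap + \<xi> ^ (a - 1)\<close> on the unit interval, with constants independent
  of \<open>r\<close>.\<close>

lemma shrink_basic:
  assumes "0 < r" "r < 1" "0 \<le> \<xi>"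
  shows "r powr kap \<le> shrink r \<xi>" "0 < shrink r \<xi>" "shrink r \<xi> \<le> 1"
    and "del \<le> \<xi> \<Longrightarrow> shrink r \<xi> = 1"
    and "\<xi> \<le> 1 \<Longrightarrow> \<xi> ^ (a - 1) \<le> shrink r \<xi>"
    and "shrink r \<xi> \<le> r powr kap + (1 / del) ^ (a - 1) * \<xi> ^ (a - 1)"
proof -
  note p = powr_kap[OF assms(1,2)]
  have q: "0 \<le> (\<xi> / del) ^ (a - 1)" using assms(3) del(1) by simp
  show "r powr kap \<le> shrink r \<xi>" "0 < shrink r \<xi>" "shrink r \<xi> \<le> 1"
    using p by (auto simp: shrink_def less_max_iff_disj)
  show one: "shrink r \<xi> = 1" if "del \<le> \<xi>"
  proof -
    have "1 \<le> (\<xi> / del) ^ (a - 1)" using that del(1) by (intro one_le_power) simp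
    then show ?thesis using p by (simp add: shrink_def)
  qed
  show "\<xi> ^ (a - 1) \<le> shrink r \<xi>" if "\<xi> \<le> 1"
  proof -
    have "\<xi> * 1 \<le> \<xi> * (1 / del)" using assms(3) del by (intro mult_left_mono) auto
    then have "\<xi> ^ (a - 1) \<le> (\<xi> / del) ^ (a - 1)" using assms(3) by (intro power_mono) auto
    moreover have "\<xi> ^ (a - 1) \<le> 1" using that assms(3) by (rule power_le_one[rotated])
    ultimately show ?thesis by (simp add: shrink_def le_max_iff_disj)
  qed
  show "shrink r \<xi> \<le> r powr kap + (1 / del) ^ (a - 1) * \<xi> ^ (a - 1)"
  proof -
    have "shrink r \<xi> \<le> r powr kap + (\<xi> / del) ^ (a - 1)" using conjunct1[OF p] q unfolding shrink_def max_def min_def by (simp only: split: if_split) linarith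
    then show ?thesis by (simp add: power_divide)
  qed
qed

lemma shrink_mono:
  assumes "0 \<le> \<xi>" "\<xi> \<le> \<eta>"
  shows "shrink r \<xi> \<le> shrink r \<eta>"
  unfolding shrink_def using assms del(1) by (intro max.mono min.mono power_mono divide_right_mono) auto

text \<open>A doubling property: points of comparable modulus are scaled by comparable
  factors.\<close>

lemma shrink_double:
  assumes "0 < r" "r < 1" "0 \<le> \<eta>" "0 \<le> \<xi>" "\<xi> \<le> 2 * \<eta>"
  shows "shrink r \<xi> \<le> 2 ^ (a - 1) * shrink r \<eta>"
proof -
  have two: "(1::real) \<le> 2 ^ (a - 1)" by simp
  have "(\<xi> / del) ^ (a - 1) \<le> (2 * (\<eta> / del)) ^ (a - 1)"
    using assms del(1) by (intro power_mono) (auto simp: divide_right_mono field_simps)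
  then have 1: "(\<xi> / del) ^ (a - 1) \<le> 2 ^ (a - 1) * (\<eta> / del) ^ (a - 1)" by (simp only: power_mult_distrib)
  have "r powr kap * 1 \<le> 2 ^ (a - 1) * r powr kap" using two by (simp add: mult_le_cancel_right1)
  then have "r powr kap \<le> 2 ^ (a - 1) * shrink r \<eta>"
    using shrink_basic(1)[OF assms(1-3)] order_trans mult_left_mono[of "r powr kap" "shrink r \<eta>" "2 ^ (a - 1)"] by fastforce
  moreover have "min 1 ((\<xi> / del) ^ (a - 1)) \<le> 2 ^ (a - 1) * min 1 ((\<eta> / del) ^ (a - 1))"
  proof -
    have "min 1 p \<le> k * min 1 q" if "1 \<le> k" "p \<le> k * q" for p q k :: real
      using that by (cases "1 \<le> q") (auto simp: min_def)
    from this[OF two 1] show ?thesis .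
  qed
  moreover have "2 ^ (a - 1) * min 1 ((\<eta> / del) ^ (a - 1)) \<le> 2 ^ (a - 1) * shrink r \<eta>"
    by (rule mult_left_mono) (simp_all add: shrink_def)
  ultimately show ?thesis unfolding shrink_def[of r \<xi>] by (intro max.boundedI; linarith)
qed

text \<open>Let |y| \<le> |x|. If |x| \<le> 2 |y|, the two scale factors are comparable by doubling
  and \<open>radial_norm_ge\<close> applies. Otherwise the difference of the moduli is already
  comparable with |x - y|, and \<open>rad\<close> increases it by at least the larger factor
  \<open>p\<close>, up to constants.\<close>

lemma rad_lower:
  fixes x y :: complex
  assumes r: "0 < r" "r < 1" and "norm x \<le> 1" "norm y \<le> 1"
  shows "(r powr kap + norm x ^ (a - 1) + norm y ^ (a - 1)) * norm (x - y) \<le> 3 * (2 ^ (a - 1) + 3) * norm (rad r x - rad r y)"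
proof -
  have *: "(r powr kap + norm x ^ (a - 1) + norm y ^ (a - 1)) * norm (x - y) \<le> 3 * (2 ^ (a - 1) + 3) * norm (rad r x - rad r y)"
    if xy: "norm x \<le> 1" "norm y \<le> norm x" for x y :: complex
  proof -
    define p q where "p = shrink r (norm x)" and "q = shrink r (norm y)"
    have qp: "0 < q" "q \<le> p" unfolding p_def q_def using shrink_basic(2)[OF r norm_ge_zero] shrink_mono[OF norm_ge_zero xy(2)] by auto
    have "norm y ^ (a - 1) \<le> norm x ^ (a - 1)" using xy(2) by (intro power_mono) auto
    then have sum: "r powr kap + norm x ^ (a - 1) + norm y ^ (a - 1) \<le> 3 * p"
      using shrink_basic(1)[OF r norm_ge_zero[of x]] shrink_basic(5)[OF r norm_ge_zero xy(1)] unfolding p_def by linarith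
    let ?d = "norm (rad r x - rad r y)"
    have "p * norm (x - y) \<le> (2 ^ (a - 1) + 3) * ?d"
    proof (cases "norm x \<le> 2 * norm y")
      case True
      have "p \<le> 2 ^ (a - 1) * q" unfolding p_def q_def by (rule shrink_double[OF r norm_ge_zero norm_ge_zero True])
      then have "p * norm (x - y) \<le> 2 ^ (a - 1) * q * norm (x - y)" by (rule mult_right_mono) simp
      also have "\<dots> = 2 ^ (a - 1) * (q * norm (x - y))" by (rule mult.assoc)
      also have "\<dots> \<le> 2 ^ (a - 1) * ?d"
        using radial_norm_ge[OF xy(2), of q p] qp by (intro mult_left_mono) (auto simp: rad_def p_def q_def)
      finally show ?thesis using norm_ge_zero[of "rad r x - rad r y"] unfolding distrib_right by linarith
    next
      case False
      \<comment> \<open>From |x| > 2 |y|: |x| + |y| \<le> 3 |x| - 3 |y|.\<close>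
      have "norm (x - y) \<le> 3 * (norm x - norm y)" using norm_triangle_ineq4[of x y] False by simp
      then have "p * norm (x - y) \<le> p * (3 * (norm x - norm y))" using qp by (intro mult_left_mono) auto
      also have "\<dots> = 3 * (p * norm x - p * norm y)" by (simp add: algebra_simps)
      also have "\<dots> \<le> 3 * (p * norm x - q * norm y)" using mult_right_mono[OF qp(2), of "norm y"] by simp
      also have "\<dots> \<le> 3 * ?d"
        using norm_triangle_ineq2[of "rad r x" "rad r y"] qp by (simp add: rad_def p_def[symmetric] q_def[symmetric])
      also have "\<dots> \<le> (2 ^ (a - 1) + 3) * ?d" by (intro mult_right_mono) auto
      finally show ?thesis .
    qed
    then have "3 * (p * norm (x - y)) \<le> 3 * ((2 ^ (a - 1) + 3) * ?d)" by simp
    moreover have "(r powr kap + norm x ^ (a - 1) + norm y ^ (a - 1)) * norm (x - y) \<le> 3 * p * norm (x - y)"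
      using sum by (rule mult_right_mono) simp
    ultimately show ?thesis by (simp only: mult.assoc)
  qed
  show ?thesis
  proof (cases "norm y \<le> norm x")
    case True
    then show ?thesis using *[of x y] assms by simp
  next
    case False
    then show ?thesis using *[of y x] assms by (simp add: norm_minus_commute add_ac)
  qed
qed

text \<open>The difference is split as p (x - y) + (p - q) y with scale factors p and q. In the
  second term the variation of |x|^(a-1) is of order a - 2 in the moduli, and the factor |y|
  restores the order a - 1 that the left-hand weight provides.\<close>

lemma rad_upper:
  fixes x y :: complex
  assumes r: "0 < r1" "r1 < 1" "0 < r2" "r2 < 1" and xy: "norm x \<le> 1" "norm y \<le> 1"
  defines "B \<equiv> (1 / del) ^ (a - 1)"
  shows "norm (rad r1 x - rad r2 y) \<le>
    (B * (1 + real a)) * ((r1 powr kap + norm x ^ (a - 1) + norm y ^ (a - 1)) * norm (x - y)) + \<bar>r1 powr kap - r2 powr kap\<bar>"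
proof -
  define p q where "p = shrink r1 (norm x)" and "q = shrink r2 (norm y)"
  define W where "W = r1 powr kap + norm x ^ (a - 1) + norm y ^ (a - 1)"
  define R where "R = max (norm x) (norm y)"
  have B: "1 \<le> B" unfolding B_def using del by (intro one_le_power) (simp add: field_simps)
  have "p \<le> r1 powr kap + B * norm x ^ (a - 1)" unfolding p_def B_def by (rule shrink_basic(6)[OF r(1,2) norm_ge_zero])
  also have "\<dots> \<le> B * W"
  proof -
    have "1 * r1 powr kap \<le> B * r1 powr kap" using B by (rule mult_right_mono) simp
    moreover have "0 \<le> B * norm y ^ (a - 1)" using B by simp
    ultimately show ?thesis unfolding W_def distrib_left by linarith
  qed
  finally have p: "p \<le> B * W" .
  have maxmin: "\<bar>max \<alpha> (min 1 \<beta>) - max \<gamma> (min 1 \<zeta>)\<bar> \<le> \<bar>\<alpha> - \<gamma>\<bar> + \<bar>\<beta> - \<zeta>\<bar>" for \<alpha> \<beta> \<gamma> \<zeta> :: real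
    by linarith
  have W0: "0 \<le> W" unfolding W_def by (intro add_nonneg_nonneg) auto
  have R0: "0 \<le> R" "norm y \<le> R" "norm x \<le> R" by (simp_all add: R_def le_max_iff_disj)
  have "\<bar>p - q\<bar> \<le> \<bar>r1 powr kap - r2 powr kap\<bar> + \<bar>(norm x / del) ^ (a - 1) - (norm y / del) ^ (a - 1)\<bar>"
    unfolding p_def q_def shrink_def by (rule maxmin)
  also have "(norm x / del) ^ (a - 1) - (norm y / del) ^ (a - 1) = B * (norm x ^ (a - 1) - norm y ^ (a - 1))"
    by (simp add: B_def power_divide right_diff_distrib)
  also have "\<bar>B * (norm x ^ (a - 1) - norm y ^ (a - 1))\<bar> = B * \<bar>norm x ^ (a - 1) - norm y ^ (a - 1)\<bar>"
    using B by (simp add: abs_mult)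
  finally have pq: "\<bar>p - q\<bar> \<le> \<bar>r1 powr kap - r2 powr kap\<bar> + B * \<bar>norm x ^ (a - 1) - norm y ^ (a - 1)\<bar>" .
  have "\<bar>norm x ^ (a - 1) - norm y ^ (a - 1)\<bar> * norm y \<le> real a * (W * norm (x - y))"
  proof -
    have "\<bar>norm x ^ (a - 1) - norm y ^ (a - 1)\<bar> * norm y \<le> (real (a - 1) * R ^ (a - 1 - 1) * \<bar>norm x - norm y\<bar>) * R"
      by (rule mult_mono[OF real_power_diff_le]) (use R0 in auto)
    also have "\<dots> = real (a - 1) * (R ^ (a - 1 - 1) * R) * \<bar>norm x - norm y\<bar>" by (simp only: mult_ac)
    \<comment> \<open>Here \<open>a \<ge> 2\<close> matters: for a = 1 the truncated exponents would
      not add up.\<close>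
    also have "R ^ (a - 1 - 1) * R = R ^ (a - 1)"
    proof -
      have "R ^ (a - 1 - 1) * R = R ^ Suc (a - 1 - 1)" by (simp only: power_Suc mult.commute)
      also have "Suc (a - 1 - 1) = a - 1" using a_ge_2 by simp
      finally show ?thesis .
    qed
    also have "real (a - 1) * R ^ (a - 1) * \<bar>norm x - norm y\<bar> \<le> real a * W * norm (x - y)"
    proof (intro mult_mono norm_triangle_ineq3)
      have "R ^ (a - 1) \<le> norm x ^ (a - 1) + norm y ^ (a - 1)" unfolding R_def max_def by simp
      moreover have "0 \<le> r1 powr kap" by simp
      ultimately show "R ^ (a - 1) \<le> W" unfolding W_def by linarith
    qed (use R0 W0 in auto)
    finally show ?thesis by (simp only: mult.assoc)
  qed
  then have "B * (\<bar>norm x ^ (a - 1) - norm y ^ (a - 1)\<bar> * norm y) \<le> B * (real a * (W * norm (x - y)))"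
    using B by (intro mult_left_mono) auto
  moreover have "\<bar>p - q\<bar> * norm y \<le> (\<bar>r1 powr kap - r2 powr kap\<bar> + B * \<bar>norm x ^ (a - 1) - norm y ^ (a - 1)\<bar>) * norm y"
    using pq by (rule mult_right_mono) simp
  moreover have "\<bar>r1 powr kap - r2 powr kap\<bar> * norm y \<le> \<bar>r1 powr kap - r2 powr kap\<bar> * 1"
    using xy by (intro mult_left_mono) auto
  moreover have "p * norm (x - y) \<le> B * W * norm (x - y)" using p by (rule mult_right_mono) simp
  moreover have "norm (rad r1 x - rad r2 y) \<le> p * norm (x - y) + \<bar>p - q\<bar> * norm y"
  proof -
    have "rad r1 x - rad r2 y = p *\<^sub>R (x - y) + (p - q) *\<^sub>R y" by (simp add: rad_def p_def q_def algebra_simps)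
    moreover have "0 < p" unfolding p_def by (rule shrink_basic(2)[OF r(1,2) norm_ge_zero])
    ultimately show ?thesis using norm_triangle_ineq[of "p *\<^sub>R (x - y)" "(p - q) *\<^sub>R y"] by simp
  qed
  ultimately have "norm (rad r1 x - rad r2 y) \<le> B * W * norm (x - y) + (\<bar>r1 powr kap - r2 powr kap\<bar> + B * (real a * (W * norm (x - y))))"
    unfolding distrib_right mult.assoc by linarith
  also have "\<dots> = (B * (1 + real a)) * (W * norm (x - y)) + \<bar>r1 powr kap - r2 powr kap\<bar>" by (simp add: algebra_simps)
  finally show ?thesis unfolding W_def .
qed

lemma rad_norm_le: "0 < r \<Longrightarrow> r < 1 \<Longrightarrow> norm (rad r x) \<le> norm x"
  using shrink_basic(2,3)[of r "norm x"] by (simp add: rad_def mult_left_le_one_le)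

lemma rad_id: "0 < r \<Longrightarrow> r < 1 \<Longrightarrow> del \<le> norm x \<Longrightarrow> rad r x = x"
  by (simp add: rad_def shrink_basic(4))

lemma rad_id':
  assumes "0 < r" "r < 1" "del \<le> norm (rad r x)"
  shows "rad r x = x"
  using rad_norm_le[OF assms(1,2), of x] assms by (intro rad_id) auto

text \<open>\<open>rad r\<close> preserves arguments, so the intermediate value theorem for the
  modulus is enough; at modulus \<open>2 * del\<close> the factor is already 1.\<close>

lemma rad_surj:
  assumes r: "0 < r" "r < 1" and X: "norm X \<le> 2 * del"
  obtains x where "norm x \<le> 2 * del" "rad r x = X"
proof -
  let ?f = "\<lambda>\<xi>. shrink r \<xi> * \<xi>"
  have d2: "0 \<le> 2 * del" "del \<le> 2 * del" using del(1) by auto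
  have cont: "continuous_on {0..2 * del} ?f"
    unfolding shrink_def using del(1) by (intro continuous_intros) auto
  have ends: "?f 0 \<le> norm X" "norm X \<le> ?f (2 * del)"
    using X shrink_basic(4)[OF r d2(1) d2(2)] by auto
  obtain \<xi> where \<xi>: "0 \<le> \<xi>" "\<xi> \<le> 2 * del" "?f \<xi> = norm X"
    using IVT'[OF ends d2(1) cont] by blast
  show ?thesis
  proof (cases "X = 0")
    case True
    then show ?thesis using that[of 0] d2(1) by (simp add: rad_def)
  next
    case False
    define x where "x = (\<xi> / norm X) *\<^sub>R X"
    have nx: "norm x = \<xi>" using \<xi>(1) False by (simp add: x_def)
    have "rad r x = (?f \<xi> / norm X) *\<^sub>R X" by (simp add: rad_def nx) (simp add: x_def)
    then have "rad r x = X" using \<xi>(3) False by simp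
    then show ?thesis using that[of x] nx \<xi>(2) by simp
  qed
qed

lemma rad_inj:
  assumes r: "0 < r" "r < 1" and "norm x \<le> 2 * del" "norm y \<le> 2 * del" "rad r x = rad r y"
  shows "x = y"
proof -
  have "(r powr kap + norm x ^ (a - 1) + norm y ^ (a - 1)) * norm (x - y) \<le> 0"
    using rad_lower[OF r order_trans[OF assms(3) del(3)] order_trans[OF assms(4) del(3)]] assms(5) by simp
  moreover have "r powr kap + norm x ^ (a - 1) + norm y ^ (a - 1) > 0"
    using powr_kap[OF r] by (intro add_pos_nonneg) auto
  ultimately have "norm (x - y) \<le> 0" by (simp add: mult_le_0_iff)
  then show ?thesis by simp
qed

lemma rad_2del_iff:
  assumes r: "0 < r" "r < 1"
  shows "norm (rad r x) \<le> 2 * del \<longleftrightarrow> norm x \<le> 2 * del"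
  using rad_norm_le[OF r, of x] rad_id[OF r, of x] del(1) by (cases "norm x \<le> 2 * del") auto

section \<open>The homeomorphism of the link for fixed radius\<close>

lemma fst_push:
  assumes r: "0 < r" "r < 1" and n: "n \<in> link a b"
  shows "fst (push r n) = rad r (fst n)"
  using rad_id[OF r, of "fst n"] near_iff[OF n] del(1) by (simp add: push_def)

lemma push_near:
  assumes r: "0 < r" "r < 1" and n: "n \<in> near"
  shows "push r n \<in> near" "tilt a b (fst n) (push r n) = n" "push r n = tilt a b (rad r (fst n)) n"
    "norm (rad r (fst n)) \<le> 2 * del" "norm (fst n) \<le> 2 * del"
proof -
  have l: "n \<in> link a b" using n by (simp add: near_def)
  show 1: "norm (fst n) \<le> 2 * del" using n near_iff[OF l] by simp
  then show 2: "norm (rad r (fst n)) \<le> 2 * del" using rad_2del_iff[OF r] by simp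
  show 3: "push r n = tilt a b (rad r (fst n)) n" using n by (simp add: push_def)
  show "push r n \<in> near" "tilt a b (fst n) (push r n) = n"
    unfolding 3 by (rule tilt_in_near[OF n norm_power_a_le[OF 2]], rule tilt_tilt[OF n norm_power_a_le[OF 2]])
qed

lemma push_id:
  assumes r: "0 < r" "r < 1" and n: "n \<in> link a b" "del \<le> norm (fst n)"
  shows "push r n = n"
  using rad_id[OF r n(2)] tilt_self[of n] by (simp add: push_def)

lemma push_link: "0 < r \<Longrightarrow> r < 1 \<Longrightarrow> n \<in> link a b \<Longrightarrow> push r n \<in> link a b"
  using push_near(1)[of r n] by (cases "n \<in> near") (auto simp: near_def push_def)

lemma push_near_iff:
  assumes r: "0 < r" "r < 1" and n: "n \<in> link a b"
  shows "push r n \<in> near \<longleftrightarrow> n \<in> near"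
  unfolding near_iff[OF n] near_iff[OF push_link[OF r n]] fst_push[OF r n] by (rule rad_2del_iff[OF r])

text \<open>The first coordinate is recovered by injectivity of \<open>rad\<close>, and tilting back
  to it recovers the point.\<close>

lemma push_inj:
  assumes r: "0 < r" "r < 1" and n: "n \<in> link a b" "n' \<in> link a b" and eq: "push r n = push r n'"
  shows "n = n'"
proof (cases "n \<in> near")
  case True
  then have True': "n' \<in> near" using push_near_iff[OF r n(1)] push_near_iff[OF r n(2)] eq by simp
  have "fst n = fst n'"
    using rad_inj[OF r push_near(5)[OF r True] push_near(5)[OF r True']] fst_push[OF r n(1)] fst_push[OF r n(2)] eq by simp
  then have "tilt a b (fst n) (push r n) = tilt a b (fst n') (push r n')" by (simp only: eq)
  then show ?thesis unfolding push_near(2)[OF r True] push_near(2)[OF r True'] .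
next
  case False
  then have "n' \<notin> near" using push_near_iff[OF r n(1)] push_near_iff[OF r n(2)] eq by simp
  with False show ?thesis using eq by (simp add: push_def)
qed

text \<open>A preimage is the tilt of \<open>m\<close> over a preimage of \<open>fst m\<close> under
  \<open>rad\<close>, since tilting back returns to \<open>m\<close>.\<close>

lemma push_surj:
  assumes r: "0 < r" "r < 1" and m: "m \<in> link a b"
  obtains n where "n \<in> link a b" "push r n = m"
proof (cases "m \<in> near")
  case True
  then have "norm (fst m) \<le> 2 * del" using near_iff[OF m] by simp
  then obtain x where x: "norm x \<le> 2 * del" "rad r x = fst m" by (rule rad_surj[OF r])
  define n where "n = tilt a b x m"
  have n: "n \<in> near" unfolding n_def by (rule tilt_in_near[OF True norm_power_a_le[OF x(1)]])
  have "push r n = tilt a b (fst m) n" using n x(2) by (simp add: push_def n_def)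
  also have "\<dots> = m" unfolding n_def by (rule tilt_tilt[OF True norm_power_a_le[OF x(1)]])
  finally show ?thesis using that[of n] n by (simp add: near_def)
next
  case False
  then show ?thesis using that[of m] m by (simp add: push_def)
qed

text \<open>Up to a constant, \<open>r * om r n n'\<close> is the distance of the dilations of \<open>n\<close> and \<open>n'\<close> by \<open>r\<close>.\<close>

definition "om r n n' = r powr kap * norm (fst n - fst n') + (norm (fst (snd n) - fst (snd n')) + norm (snd (snd n) - snd (snd n')))"
  for r and n n' :: "complex \<times> complex \<times> complex"

section \<open>Local bi-Lipschitz estimates for \<open>push\<close>, uniform in the radius\<close>

lemma tilt_lipschitz_components:
  obtains K where "K \<ge> 0"
    "\<And>X n X' n'. n \<in> near \<Longrightarrow> n' \<in> near \<Longrightarrow> norm X \<le> 2 * del \<Longrightarrow> norm X' \<le> 2 * del \<Longrightarrow>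
      norm (fst (snd (tilt a b X n)) - fst (snd (tilt a b X' n'))) + norm (snd (snd (tilt a b X n)) - snd (snd (tilt a b X' n')))
      \<le> K * (norm (fst (snd n) - fst (snd n')) + norm (snd (snd n) - snd (snd n')) + norm (X ^ a - X' ^ a))"
proof -
  obtain K where K: "K \<ge> 0"
    "\<And>X x y z Y Z X' x' y' z' Y' Z'. (x, y, z) \<in> near \<Longrightarrow> (x', y', z') \<in> near \<Longrightarrow>
      norm (X ^ a) \<le> 1 / 8 \<Longrightarrow> norm (X' ^ a) \<le> 1 / 8 \<Longrightarrow>
      tilt a b X (x, y, z) = (X, Y, Z) \<Longrightarrow> tilt a b X' (x', y', z') = (X', Y', Z') \<Longrightarrow>
      norm (Y - Y') + norm (Z - Z') \<le> K * (norm (y - y') + norm (z - z') + norm (X ^ a - X' ^ a))"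
    by (rule tilt_lipschitz) (rule that; assumption)
  show ?thesis
  proof (rule that[OF K(1)])
    fix X X' :: complex and n n' :: "complex \<times> complex \<times> complex"
    assume *: "n \<in> near" "n' \<in> near" "norm X \<le> 2 * del" "norm X' \<le> 2 * del"
    have split: "tilt a b X n = (X, fst (snd (tilt a b X n)), snd (snd (tilt a b X n)))" for X n
      by (simp add: prod_eq_iff)
    have n: "n = (fst n, fst (snd n), snd (snd n))" for n :: "complex \<times> complex \<times> complex" by simp
    show "norm (fst (snd (tilt a b X n)) - fst (snd (tilt a b X' n'))) + norm (snd (snd (tilt a b X n)) - snd (snd (tilt a b X' n')))
      \<le> K * (norm (fst (snd n) - fst (snd n')) + norm (snd (snd n) - snd (snd n')) + norm (X ^ a - X' ^ a))"
      by (rule K(2)[of "fst n" _ _ "fst n'"])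
         (use * norm_power_a_le split in simp_all)
  qed
qed

lemma link_component_le:
  assumes "n \<in> link a b"
  shows "norm (fst n) \<le> 2" "norm (fst (snd n)) \<le> 1" "norm (snd (snd n)) \<le> 1"
  using link_norm_le[of "fst n" "fst (snd n)" "snd (snd n)" a b] assms a_pos b_pos by simp_all

text \<open>The equation of the link expresses x^a through y^b and z^b, and both variables have
  modulus at most 1. With \<open>power_diff_local_lower_bound\<close> this controls |x|^(a-1) |dx|
  by the movement of \<open>y\<close> and \<open>z\<close>.\<close>

lemma power_a_diff_le:
  assumes "n \<in> link a b" "n' \<in> link a b"
  shows "norm (fst n ^ a - fst n' ^ a) \<le> real b * (norm (fst (snd n) - fst (snd n')) + norm (snd (snd n) - snd (snd n')))"
proof -
  obtain x y z x' y' z' where xyz: "n = (x, y, z)" "n' = (x', y', z')" by (cases n; cases n')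
  have "x ^ a = - (y ^ b + z ^ b)" "x' ^ a = - (y' ^ b + z' ^ b)"
    using link_sq(1)[of x y z a b] link_sq(1)[of x' y' z' a b] assms xyz by simp_all
  then have "x ^ a - x' ^ a = - ((y ^ b - y' ^ b) + (z ^ b - z' ^ b))" by simp
  then have "norm (x ^ a - x' ^ a) = norm ((y ^ b - y' ^ b) + (z ^ b - z' ^ b))"
    by (simp only: norm_minus_cancel)
  also have "\<dots> \<le> norm (y ^ b - y' ^ b) + norm (z ^ b - z' ^ b)" by (rule norm_triangle_ineq)
  finally have "norm (x ^ a - x' ^ a) \<le> norm (y ^ b - y' ^ b) + norm (z ^ b - z' ^ b)" .
  moreover have "norm (y ^ b - y' ^ b) \<le> real b * 1 ^ (b - 1) * norm (y - y')" "norm (z ^ b - z' ^ b) \<le> real b * 1 ^ (b - 1) * norm (z - z')"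
    using link_component_le[OF assms(1)] link_component_le[OF assms(2)] xyz by (intro norm_power_diff_le; simp)+
  ultimately show ?thesis by (simp add: xyz distrib_left)
qed

lemma powr_kap_bounds:
  assumes "0 < r" "0 < r1" "r1 \<le> 2 * r"
  shows "r1 powr kap \<le> 2 powr kap * r powr kap" "1 \<le> 2 powr kap"
proof -
  have "r1 powr kap \<le> (2 * r) powr kap" using assms expo(2) by (intro powr_mono2) auto
  then show "r1 powr kap \<le> 2 powr kap * r powr kap" using assms by (simp add: powr_mult)
  show "1 \<le> 2 powr kap" using expo(2) by (intro ge_one_powr_ge_zero) auto
qed

lemma powr_kap_diff:
  assumes "0 < r" "r / 2 \<le> r1" "r1 < 1" "r / 2 \<le> r2" "r2 < 1"
  shows "\<bar>r1 powr kap - r2 powr kap\<bar> \<le> 2 * kap * (\<bar>r1 - r2\<bar> / r)"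
  using powr_lipschitz[OF expo(2) assms] by simp

text \<open>Near a point of the branch locus both \<open>r powr kap * norm (x - y)\<close> and the movement of the
  other two coordinates are needed to control \<open>rad\<close>; elsewhere the latter suffices.\<close>

lemma push_lipschitz:
  obtains C where "C \<ge> 0"
    "\<And>r n0. 0 < r \<Longrightarrow> r < 1 \<Longrightarrow> n0 \<in> link a b \<Longrightarrow> \<exists>e>0. \<forall>r1 n1 r2 n2.
      r / 2 \<le> r1 \<longrightarrow> r1 \<le> 2 * r \<longrightarrow> r1 < 1 \<longrightarrow> r / 2 \<le> r2 \<longrightarrow> r2 < 1 \<longrightarrow>
      n1 \<in> link a b \<longrightarrow> n2 \<in> link a b \<longrightarrow> norm (fst n1 - fst n0) < e \<longrightarrow> norm (fst n2 - fst n0) < e \<longrightarrow>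
      norm (push r1 n1 - push r2 n2) \<le> C * (\<bar>r1 - r2\<bar> / r + om r n1 n2)"
proof -
  obtain KT where KT: "KT \<ge> 0"
    "\<And>X n X' n'. n \<in> near \<Longrightarrow> n' \<in> near \<Longrightarrow> norm X \<le> 2 * del \<Longrightarrow> norm X' \<le> 2 * del \<Longrightarrow>
      norm (fst (snd (tilt a b X n)) - fst (snd (tilt a b X' n'))) + norm (snd (snd (tilt a b X n)) - snd (snd (tilt a b X' n')))
      \<le> KT * (norm (fst (snd n) - fst (snd n')) + norm (snd (snd n) - snd (snd n')) + norm (X ^ a - X' ^ a))"
    by (rule tilt_lipschitz_components) (rule that; assumption)
  define KU where "KU = (1 / del) ^ (a - 1) * (1 + real a)"
  have KU: "KU \<ge> 0" unfolding KU_def using del(1) by simp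
  \<comment> \<open>Bounds the movement of \<open>rad\<close>. In the bracket,
    \<open>2 powr kap\<close> accounts for \<open>r1\<close> versus \<open>r\<close>,
    \<open>2 * real b\<close> for the movement of x^a, and 1 for the slack; \<open>2 * kap\<close>
    comes from the variation of \<open>r powr kap\<close>.\<close>
  define CX where "CX = KU * (2 powr kap + 2 * real b + 1) + 2 * kap"
  have CX: "CX \<ge> 0" unfolding CX_def using KU expo(2) by (intro add_nonneg_nonneg mult_nonneg_nonneg) auto
  define C1 where "C1 = CX + KT * (1 + real a * CX)"
  define C2 where "C2 = 4 * real b / del ^ (a - 1) + 1"
  have C1: "C1 \<ge> 0" unfolding C1_def using CX KT(1) by (intro add_nonneg_nonneg mult_nonneg_nonneg) auto
  have C2: "C2 \<ge> 0" unfolding C2_def using del(1) by (intro add_nonneg_nonneg) auto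
  show ?thesis
  proof (rule that[of "C1 + C2"])
    show "C1 + C2 \<ge> 0" using C1 C2 by simp
    fix r :: real and n0 assume r: "0 < r" "r < 1" and n0: "n0 \<in> link a b"
    let ?P = "\<lambda>e. \<forall>r1 n1 r2 n2.
      r / 2 \<le> r1 \<longrightarrow> r1 \<le> 2 * r \<longrightarrow> r1 < 1 \<longrightarrow> r / 2 \<le> r2 \<longrightarrow> r2 < 1 \<longrightarrow>
      n1 \<in> link a b \<longrightarrow> n2 \<in> link a b \<longrightarrow> norm (fst n1 - fst n0) < e \<longrightarrow> norm (fst n2 - fst n0) < e \<longrightarrow>
      norm (push r1 n1 - push r2 n2) \<le> (C1 + C2) * (\<bar>r1 - r2\<bar> / r + om r n1 n2)"
    show "\<exists>e>0. ?P e"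
    proof (cases "norm (fst n0) < 2 * del")
      case True
      \<comment> \<open>The slack \<open>r powr kap\<close> is admissible because \<open>om\<close>
        contains \<open>r powr kap\<close> times the movement of \<open>x\<close>. It shrinks the
        radius \<open>e\<close> as \<open>r\<close> tends to 0, but not the constant.\<close>
      obtain e where e: "e > 0" "\<And>x y. norm (x - fst n0) < e \<Longrightarrow> norm (y - fst n0) < e \<Longrightarrow>
          (norm x ^ (a - 1) + norm y ^ (a - 1)) * norm (x - y) \<le> 2 * norm (x ^ a - y ^ a) + r powr kap * norm (x - y)"
        by (rule power_diff_local_lower_bound[OF a_pos conjunct1[OF powr_kap[OF r]], of "fst n0"]) (rule that; assumption)
      define e' where "e' = min e (2 * del - norm (fst n0))"
      show ?thesis
      proof (intro exI[of _ e'] conjI allI impI)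
        show "e' > 0" using e(1) True by (simp add: e'_def)
        fix r1 n1 r2 n2
        assume r1: "r / 2 \<le> r1" "r1 \<le> 2 * r" "r1 < 1" and r2: "r / 2 \<le> r2" "r2 < 1"
          and n: "n1 \<in> link a b" "n2 \<in> link a b" and d: "norm (fst n1 - fst n0) < e'" "norm (fst n2 - fst n0) < e'"
        have rp: "0 < r1" "0 < r2" using r(1) r1(1) r2(1) by auto
        have nn: "norm (fst n1) \<le> 2 * del" "norm (fst n2) \<le> 2 * del"
          using d norm_triangle_ineq2[of "fst n1" "fst n0"] norm_triangle_ineq2[of "fst n2" "fst n0"] by (auto simp: e'_def)
        then have near: "n1 \<in> near" "n2 \<in> near" using near_iff[OF n(1)] near_iff[OF n(2)] by auto
        define dx where "dx = norm (fst n1 - fst n2)"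
        define dyz where "dyz = norm (fst (snd n1) - fst (snd n2)) + norm (snd (snd n1) - snd (snd n2))"
        define w where "w = \<bar>r1 - r2\<bar> / r + om r n1 n2"
        have om: "om r n1 n2 = r powr kap * dx + dyz" by (simp add: om_def dx_def dyz_def)
        have pos: "0 \<le> dx" "0 \<le> dyz" "0 \<le> \<bar>r1 - r2\<bar> / r" "0 \<le> r powr kap * dx" using r by (auto simp: dx_def dyz_def)
        have le_w: "r powr kap * dx \<le> w" "dyz \<le> w" "\<bar>r1 - r2\<bar> / r \<le> w" "0 \<le> w" unfolding w_def om using pos by linarith+
        have "(norm (fst n1) ^ (a - 1) + norm (fst n2) ^ (a - 1)) * dx \<le> 2 * norm (fst n1 ^ a - fst n2 ^ a) + r powr kap * dx"
          using e(2)[of "fst n1" "fst n2"] d by (simp add: e'_def dx_def)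
        also have "norm (fst n1 ^ a - fst n2 ^ a) \<le> real b * dyz" unfolding dyz_def by (rule power_a_diff_le[OF n])
        also have "real b * dyz \<le> real b * w" using le_w(2) by (rule mult_left_mono) simp
        finally have 1: "(norm (fst n1) ^ (a - 1) + norm (fst n2) ^ (a - 1)) * dx \<le> 2 * (real b * w) + w"
          using le_w(1) by linarith
        have "r1 powr kap * dx \<le> 2 powr kap * (r powr kap * dx)"
          using mult_right_mono[OF powr_kap_bounds(1)[OF r(1) rp(1) r1(2)] pos(1)] by (simp add: mult.assoc)
        also have "\<dots> \<le> 2 powr kap * w" using le_w(1) by (rule mult_left_mono) simp
        finally have "(r1 powr kap + norm (fst n1) ^ (a - 1) + norm (fst n2) ^ (a - 1)) * dx \<le> (2 powr kap + 2 * real b + 1) * w"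
          using 1 unfolding distrib_right by linarith
        then have "KU * ((r1 powr kap + norm (fst n1) ^ (a - 1) + norm (fst n2) ^ (a - 1)) * dx) \<le> KU * ((2 powr kap + 2 * real b + 1) * w)"
          using KU by (rule mult_left_mono)
        moreover have "\<bar>r1 powr kap - r2 powr kap\<bar> \<le> 2 * kap * w"
          using order_trans[OF powr_kap_diff[OF r(1) r1(1,3) r2] mult_left_mono[OF le_w(3)]] expo(2) by simp
        moreover have "norm (rad r1 (fst n1) - rad r2 (fst n2)) \<le>
            KU * ((r1 powr kap + norm (fst n1) ^ (a - 1) + norm (fst n2) ^ (a - 1)) * dx) + \<bar>r1 powr kap - r2 powr kap\<bar>"
          unfolding KU_def dx_def
          by (rule rad_upper[OF rp(1) r1(3) rp(2) r2(2) order_trans[OF nn(1) del(3)] order_trans[OF nn(2) del(3)]])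
        ultimately have dX: "norm (rad r1 (fst n1) - rad r2 (fst n2)) \<le> CX * w"
          unfolding CX_def distrib_right mult.assoc by linarith
        have "norm (rad r1 (fst n1) ^ a - rad r2 (fst n2) ^ a) \<le> real a * 1 ^ (a - 1) * norm (rad r1 (fst n1) - rad r2 (fst n2))"
          using push_near(4)[OF rp(1) r1(3) near(1)] push_near(4)[OF rp(2) r2(2) near(2)] del(3) by (intro norm_power_diff_le) auto
        also have "\<dots> \<le> real a * (CX * w)" using mult_left_mono[OF dX, of "real a"] by simp
        finally have dXa: "norm (rad r1 (fst n1) ^ a - rad r2 (fst n2) ^ a) \<le> real a * (CX * w)" .
        have "norm (fst (snd (push r1 n1)) - fst (snd (push r2 n2))) + norm (snd (snd (push r1 n1)) - snd (snd (push r2 n2)))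
            \<le> KT * (dyz + norm (rad r1 (fst n1) ^ a - rad r2 (fst n2) ^ a))"
          unfolding push_near(3)[OF rp(1) r1(3) near(1)] push_near(3)[OF rp(2) r2(2) near(2)] dyz_def
          by (rule KT(2)[OF near push_near(4)[OF rp(1) r1(3) near(1)] push_near(4)[OF rp(2) r2(2) near(2)]])
        also have "\<dots> \<le> KT * (w + real a * (CX * w))" using le_w(2) dXa KT(1) by (intro mult_left_mono add_mono) auto
        finally have "norm (push r1 n1 - push r2 n2) \<le> CX * w + KT * (w + real a * (CX * w))"
          using norm_le_components(1)[of "push r1 n1" "push r2 n2"] dX
          unfolding fst_push[OF rp(1) r1(3) n(1)] fst_push[OF rp(2) r2(2) n(2)] by linarith
        also have "\<dots> = C1 * w" by (simp add: C1_def algebra_simps)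
        also have "\<dots> \<le> (C1 + C2) * w" using C2 le_w(4) by (intro mult_right_mono) auto
        finally show "norm (push r1 n1 - push r2 n2) \<le> (C1 + C2) * (\<bar>r1 - r2\<bar> / r + om r n1 n2)" unfolding w_def .
      qed
    next
      case False
      \<comment> \<open>Away from the branch locus the weights are at least
        \<open>2 * \<rho>\<close>, so half of the left-hand side absorbs the slack.\<close>
      define \<rho> where "\<rho> = del ^ (a - 1) / 2"
      have \<rho>: "\<rho> > 0" using del(1) by (simp add: \<rho>_def)
      obtain e where e: "e > 0" "\<And>x y. norm (x - fst n0) < e \<Longrightarrow> norm (y - fst n0) < e \<Longrightarrow>
          (norm x ^ (a - 1) + norm y ^ (a - 1)) * norm (x - y) \<le> 2 * norm (x ^ a - y ^ a) + \<rho> * norm (x - y)"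
        by (rule power_diff_local_lower_bound[OF a_pos \<rho>, of "fst n0"]) (rule that; assumption)
      show ?thesis
      proof (intro exI[of _ "min e del"] conjI allI impI)
        show "min e del > 0" using e(1) del(1) by simp
        fix r1 n1 r2 n2
        assume r1: "r / 2 \<le> r1" "r1 \<le> 2 * r" "r1 < 1" and r2: "r / 2 \<le> r2" "r2 < 1"
          and n: "n1 \<in> link a b" "n2 \<in> link a b" and d: "norm (fst n1 - fst n0) < min e del" "norm (fst n2 - fst n0) < min e del"
        have rp: "0 < r1" "0 < r2" using r(1) r1(1) r2(1) by auto
        have big: "del \<le> norm (fst n1)" "del \<le> norm (fst n2)"
          using d False norm_triangle_ineq2[of "fst n0" "fst n1"] norm_triangle_ineq2[of "fst n0" "fst n2"]
          by (auto simp: norm_minus_commute)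
        define dx where "dx = norm (fst n1 - fst n2)"
        define dyz where "dyz = norm (fst (snd n1) - fst (snd n2)) + norm (snd (snd n1) - snd (snd n2))"
        define w where "w = \<bar>r1 - r2\<bar> / r + om r n1 n2"
        have om: "om r n1 n2 = r powr kap * dx + dyz" by (simp add: om_def dx_def dyz_def)
        have pos: "0 \<le> dx" "0 \<le> dyz" "0 \<le> \<bar>r1 - r2\<bar> / r" "0 \<le> r powr kap * dx" using r by (auto simp: dx_def dyz_def)
        have le_w: "dyz \<le> w" "0 \<le> w" unfolding w_def om using pos by linarith+
        have "2 * \<rho> \<le> norm (fst n1) ^ (a - 1) + norm (fst n2) ^ (a - 1)"
        proof -
          have "del ^ (a - 1) \<le> norm (fst n1) ^ (a - 1)" using big(1) del(1) by (intro power_mono) auto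
          moreover have "0 \<le> norm (fst n2) ^ (a - 1)" by simp
          moreover have "2 * \<rho> = del ^ (a - 1)" by (simp add: \<rho>_def)
          ultimately show ?thesis by linarith
        qed
        then have "2 * \<rho> * dx \<le> (norm (fst n1) ^ (a - 1) + norm (fst n2) ^ (a - 1)) * dx" using pos(1) by (rule mult_right_mono)
        also have "\<dots> \<le> 2 * norm (fst n1 ^ a - fst n2 ^ a) + \<rho> * dx" using e(2)[of "fst n1" "fst n2"] d by (simp add: dx_def)
        finally have "\<rho> * dx \<le> 2 * norm (fst n1 ^ a - fst n2 ^ a)" by simp
        also have "norm (fst n1 ^ a - fst n2 ^ a) \<le> real b * dyz" unfolding dyz_def by (rule power_a_diff_le[OF n])
        also have "real b * dyz \<le> real b * w" using le_w(1) by (rule mult_left_mono) simp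
        finally have "\<rho> * dx \<le> 2 * (real b * w)" by simp
        then have dx: "dx \<le> 4 * real b / del ^ (a - 1) * w"
          using del(1) by (simp add: \<rho>_def field_simps)
        have "norm (n1 - n2) \<le> dx + dyz" using norm_le_components(1)[of n1 n2] by (simp add: dx_def dyz_def)
        also have "\<dots> \<le> C2 * w" using dx le_w(1) unfolding C2_def distrib_right by linarith
        also have "\<dots> \<le> (C1 + C2) * w" using C1 le_w(2) by (intro mult_right_mono) auto
        finally show "norm (push r1 n1 - push r2 n2) \<le> (C1 + C2) * (\<bar>r1 - r2\<bar> / r + om r n1 n2)"
          unfolding w_def push_id[OF rp(1) r1(3) n(1) big(1)] push_id[OF rp(2) r2(2) n(2) big(2)] .
      qed
    qed
  qed
qed

text \<open>The inverse direction rests on \<open>rad_lower\<close>, which is valid on all of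
  \<open>near\<close>; the radius \<open>e\<close> serves only to keep both points in
  \<open>near\<close> or both outside the region that \<open>push\<close> moves.\<close>

lemma push_inverse_lipschitz:
  obtains C where "C \<ge> 0"
    "\<And>r m0. 0 < r \<Longrightarrow> r < 1 \<Longrightarrow> \<exists>e>0. \<forall>r1 n1 r2 n2.
      r / 2 \<le> r1 \<longrightarrow> r1 < 1 \<longrightarrow> r / 2 \<le> r2 \<longrightarrow> r2 < 1 \<longrightarrow>
      n1 \<in> link a b \<longrightarrow> n2 \<in> link a b \<longrightarrow> norm (push r1 n1 - m0) < e \<longrightarrow> norm (push r2 n2 - m0) < e \<longrightarrow>
      om r n1 n2 \<le> C * (\<bar>r1 - r2\<bar> / r + norm (push r1 n1 - push r2 n2))"
proof -
  obtain KT where KT: "KT \<ge> 0"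
    "\<And>X n X' n'. n \<in> near \<Longrightarrow> n' \<in> near \<Longrightarrow> norm X \<le> 2 * del \<Longrightarrow> norm X' \<le> 2 * del \<Longrightarrow>
      norm (fst (snd (tilt a b X n)) - fst (snd (tilt a b X' n'))) + norm (snd (snd (tilt a b X n)) - snd (snd (tilt a b X' n')))
      \<le> KT * (norm (fst (snd n) - fst (snd n')) + norm (snd (snd n) - snd (snd n')) + norm (X ^ a - X' ^ a))"
    by (rule tilt_lipschitz_components) (rule that; assumption)
  define KL :: real where "KL = 3 * (2 ^ (a - 1) + 3)"
  have KL: "KL \<ge> 0" by (simp add: KL_def)
  define CX where "CX = KL * (1 + 2 * kap)"
  have CX: "CX \<ge> 0" unfolding CX_def using KL expo(2) by (intro mult_nonneg_nonneg) auto
  define C1 where "C1 = 2 powr kap * CX + KT * (2 + real a * CX)"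
  have C1: "C1 \<ge> 0" unfolding C1_def using CX KT(1) by (intro add_nonneg_nonneg mult_nonneg_nonneg) auto
  show ?thesis
  proof (rule that[of "C1 + 3"])
    show "C1 + 3 \<ge> 0" using C1 by simp
    fix r :: real and m0 :: "complex \<times> complex \<times> complex" assume r: "0 < r" "r < 1"
    let ?P = "\<lambda>e. \<forall>r1 n1 r2 n2.
      r / 2 \<le> r1 \<longrightarrow> r1 < 1 \<longrightarrow> r / 2 \<le> r2 \<longrightarrow> r2 < 1 \<longrightarrow>
      n1 \<in> link a b \<longrightarrow> n2 \<in> link a b \<longrightarrow> norm (push r1 n1 - m0) < e \<longrightarrow> norm (push r2 n2 - m0) < e \<longrightarrow>
      om r n1 n2 \<le> (C1 + 3) * (\<bar>r1 - r2\<bar> / r + norm (push r1 n1 - push r2 n2))"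
    show "\<exists>e>0. ?P e"
    proof (cases "norm (fst m0) < 2 * del")
      case True
      show ?thesis
      proof (intro exI[of _ "2 * del - norm (fst m0)"] conjI allI impI)
        show "2 * del - norm (fst m0) > 0" using True by simp
        fix r1 n1 r2 n2
        assume r1: "r / 2 \<le> r1" "r1 < 1" and r2: "r / 2 \<le> r2" "r2 < 1" and n: "n1 \<in> link a b" "n2 \<in> link a b"
          and d: "norm (push r1 n1 - m0) < 2 * del - norm (fst m0)" "norm (push r2 n2 - m0) < 2 * del - norm (fst m0)"
        have rp: "0 < r1" "0 < r2" using r(1) r1(1) r2(1) by auto
        have "norm (fst (push r1 n1)) \<le> 2 * del" "norm (fst (push r2 n2)) \<le> 2 * del"
          using d norm_le_components(2)[of "push r1 n1" m0] norm_le_components(2)[of "push r2 n2" m0]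
            norm_triangle_ineq2[of "fst (push r1 n1)" "fst m0"] norm_triangle_ineq2[of "fst (push r2 n2)" "fst m0"] by linarith+
        then have near: "n1 \<in> near" "n2 \<in> near"
          unfolding near_iff[OF n(1)] near_iff[OF n(2)] fst_push[OF rp(1) r1(2) n(1)] fst_push[OF rp(2) r2(2) n(2)]
            rad_2del_iff[OF rp(1) r1(2)] rad_2del_iff[OF rp(2) r2(2)] .
        note nn = push_near(5)[OF rp(1) r1(2) near(1)] push_near(5)[OF rp(2) r2(2) near(2)]
        define dx where "dx = norm (fst n1 - fst n2)"
        define dyz where "dyz = norm (fst (snd n1) - fst (snd n2)) + norm (snd (snd n1) - snd (snd n2))"
        define D where "D = norm (push r1 n1 - push r2 n2)"
        define w where "w = \<bar>r1 - r2\<bar> / r + D"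
        have pos: "0 \<le> dx" "0 \<le> \<bar>r1 - r2\<bar> / r" "0 \<le> D" using r by (auto simp: dx_def D_def)
        have le_w: "D \<le> w" "\<bar>r1 - r2\<bar> / r \<le> w" "0 \<le> w" unfolding w_def using pos by linarith+
        define W where "W = r1 powr kap + norm (fst n1) ^ (a - 1) + norm (fst n2) ^ (a - 1)"
        \<comment> \<open>\<open>rad_lower\<close> compares two points at the same radius, so
          \<open>r2\<close> is first replaced by \<open>r1\<close>.\<close>
        have shift: "norm (rad r1 (fst n2) - rad r2 (fst n2)) \<le> 2 * kap * w"
        proof -
          have "norm (rad r1 (fst n2) - rad r2 (fst n2)) \<le> \<bar>r1 powr kap - r2 powr kap\<bar>"
            using rad_upper[OF rp(1) r1(2) rp(2) r2(2) order_trans[OF nn(2) del(3)] order_trans[OF nn(2) del(3)]] by simp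
          also have "\<dots> \<le> 2 * kap * (\<bar>r1 - r2\<bar> / r)" by (rule powr_kap_diff[OF r(1) r1 r2])
          also have "\<dots> \<le> 2 * kap * w" using le_w(2) expo(2) by (intro mult_left_mono) auto
          finally show ?thesis .
        qed
        have "norm (rad r1 (fst n1) - rad r2 (fst n2)) \<le> D"
          using norm_le_components(2)[of "push r1 n1" "push r2 n2"]
          unfolding D_def fst_push[OF rp(1) r1(2) n(1)] fst_push[OF rp(2) r2(2) n(2)] .
        then have "norm (rad r1 (fst n1) - rad r1 (fst n2)) \<le> w + 2 * kap * w"
          using shift le_w(1) norm_triangle_ineq[of "rad r1 (fst n1) - rad r2 (fst n2)" "rad r2 (fst n2) - rad r1 (fst n2)"]
          by (simp add: norm_minus_commute)
        then have "KL * norm (rad r1 (fst n1) - rad r1 (fst n2)) \<le> KL * (w + 2 * kap * w)" using KL by (rule mult_left_mono)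
        moreover have "W * dx \<le> KL * norm (rad r1 (fst n1) - rad r1 (fst n2))"
          unfolding W_def dx_def KL_def
          by (rule rad_lower[OF rp(1) r1(2) order_trans[OF nn(1) del(3)] order_trans[OF nn(2) del(3)]])
        ultimately have Wdx: "W * dx \<le> CX * w" by (simp add: CX_def algebra_simps)
        have W: "r1 powr kap \<le> W" "norm (fst n1) ^ (a - 1) \<le> W" "norm (fst n2) ^ (a - 1) \<le> W"
          using zero_le_power[of "norm (fst n1)" "a - 1"] zero_le_power[of "norm (fst n2)" "a - 1"] powr_ge_zero[of r1 kap]
          unfolding W_def by (simp_all del: powr_ge_zero)
        have "r powr kap * dx \<le> 2 powr kap * (CX * w)"
        proof -
          have "r powr kap \<le> 2 powr kap * r1 powr kap" using powr_kap_bounds(1)[OF rp(1) r(1)] r1(1) by simp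
          then have "r powr kap * dx \<le> 2 powr kap * r1 powr kap * dx" using pos(1) by (rule mult_right_mono)
          also have "\<dots> = 2 powr kap * (r1 powr kap * dx)" by (rule mult.assoc)
          also have "\<dots> \<le> 2 powr kap * (CX * w)"
            using order_trans[OF mult_right_mono[OF W(1) pos(1)] Wdx] by (intro mult_left_mono) auto
          finally show ?thesis .
        qed
        moreover have xa: "norm (fst n1 ^ a - fst n2 ^ a) \<le> real a * (CX * w)"
        proof -
          define R where "R = max (norm (fst n1)) (norm (fst n2))"
          have "R ^ (a - 1) \<le> W" unfolding R_def max_def using W by simp
          then have "R ^ (a - 1) * dx \<le> CX * w" using order_trans[OF mult_right_mono[OF _ pos(1)] Wdx] by blast
          then have "real a * (R ^ (a - 1) * dx) \<le> real a * (CX * w)" by (rule mult_left_mono) simp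
          moreover have "norm (fst n1 ^ a - fst n2 ^ a) \<le> real a * R ^ (a - 1) * dx"
            unfolding dx_def by (rule norm_power_diff_le) (simp_all add: R_def)
          ultimately show ?thesis by (simp only: mult.assoc)
        qed
        moreover have "dyz \<le> KT * (w + w + real a * (CX * w))"
        proof -
          have yz: "norm (fst (snd (push r1 n1)) - fst (snd (push r2 n2))) \<le> w"
            "norm (snd (snd (push r1 n1)) - snd (snd (push r2 n2))) \<le> w"
            using norm_le_components(3,4)[of "push r1 n1" "push r2 n2"] le_w(1) unfolding D_def by linarith+
          \<comment> \<open>Tilting is undone by tilting back to the old first coordinate, so the
            same Lipschitz bound applies with the roles of \<open>n\<close> and
            \<open>push r n\<close> exchanged.\<close>
          have "dyz \<le> KT * (norm (fst (snd (push r1 n1)) - fst (snd (push r2 n2))) +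
              norm (snd (snd (push r1 n1)) - snd (snd (push r2 n2))) + norm (fst n1 ^ a - fst n2 ^ a))"
            using KT(2)[OF push_near(1)[OF rp(1) r1(2) near(1)] push_near(1)[OF rp(2) r2(2) near(2)] nn]
            unfolding push_near(2)[OF rp(1) r1(2) near(1)] push_near(2)[OF rp(2) r2(2) near(2)] dyz_def .
          also have "\<dots> \<le> KT * (w + w + real a * (CX * w))"
            by (intro mult_left_mono add_mono yz xa KT(1))
          finally show ?thesis .
        qed
        ultimately have "r powr kap * dx + dyz \<le> 2 powr kap * (CX * w) + KT * (w + w + real a * (CX * w))"
          by (intro add_mono)
        also have "\<dots> = C1 * w" by (simp add: C1_def algebra_simps)
        also have "\<dots> \<le> (C1 + 3) * w" using le_w(3) by (intro mult_right_mono) auto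
        finally show "om r n1 n2 \<le> (C1 + 3) * (\<bar>r1 - r2\<bar> / r + norm (push r1 n1 - push r2 n2))"
          unfolding w_def D_def om_def dx_def dyz_def .
      qed
    next
      case False
      show ?thesis
      proof (intro exI[of _ del] conjI allI impI)
        show "del > 0" by (rule del(1))
        fix r1 n1 r2 n2
        assume r1: "r / 2 \<le> r1" "r1 < 1" and r2: "r / 2 \<le> r2" "r2 < 1" and n: "n1 \<in> link a b" "n2 \<in> link a b"
          and d: "norm (push r1 n1 - m0) < del" "norm (push r2 n2 - m0) < del"
        have rp: "0 < r1" "0 < r2" using r(1) r1(1) r2(1) by auto
        \<comment> \<open>The first coordinate of \<open>m0\<close> has modulus at least
          \<open>2 * del\<close>; within \<open>del\<close> of it the modulus stays at least
          \<open>del\<close>, where \<open>push\<close> is the identity.\<close>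
        have big: "del \<le> norm (rad r1 (fst n1))" "del \<le> norm (rad r2 (fst n2))"
          using d False norm_le_components(2)[of "push r1 n1" m0] norm_le_components(2)[of "push r2 n2" m0]
            norm_triangle_ineq2[of "fst m0" "fst (push r1 n1)"] norm_triangle_ineq2[of "fst m0" "fst (push r2 n2)"]
          unfolding fst_push[OF rp(1) r1(2) n(1)] fst_push[OF rp(2) r2(2) n(2)] by (auto simp: norm_minus_commute)
        have id: "push r1 n1 = n1" "push r2 n2 = n2"
          using push_id[OF rp(1) r1(2) n(1)] push_id[OF rp(2) r2(2) n(2)] rad_id'[OF rp(1) r1(2) big(1)] rad_id'[OF rp(2) r2(2) big(2)] big
          by simp_all
        have "r powr kap * norm (fst n1 - fst n2) \<le> 1 * norm (n1 - n2)"
          using powr_kap[OF r] norm_le_components(2)[of n1 n2] by (intro mult_mono) auto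
        then have "om r n1 n2 \<le> 3 * norm (n1 - n2)"
          using norm_le_components(3,4)[of n1 n2] unfolding om_def by linarith
        also have "\<dots> \<le> (C1 + 3) * (\<bar>r1 - r2\<bar> / r + norm (n1 - n2))" using C1 r by (intro mult_mono) auto
        finally show "om r n1 n2 \<le> (C1 + 3) * (\<bar>r1 - r2\<bar> / r + norm (push r1 n1 - push r2 n2))" unfolding id .
      qed
    qed
  qed
qed

end

section \<open>The conical parametrization\<close>

locale brieskorn_cone = conical_map a b for a b :: nat +
  fixes s t u :: complex
  assumes stu: "s \<noteq> 0" "t \<noteq> 0" "u \<noteq> 0"
begin

definition "emb r n = (s * (of_real (r powr expo) * fst n), t * (of_real r * fst (snd n)), u * (of_real r * snd (snd n)))" for r :: real

definition "emb_dist r1 n1 r2 n2 = norm (emb r1 n1 - emb r2 n2)"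

lemma emb_components:
  "norm (of_real (r1 powr expo) * fst n1 - of_real (r2 powr expo) * fst n2) \<le> emb_dist r1 n1 r2 n2 / norm s"
  "norm (of_real r1 * fst (snd n1) - of_real r2 * fst (snd n2)) \<le> emb_dist r1 n1 r2 n2 / norm t"
  "norm (of_real r1 * snd (snd n1) - of_real r2 * snd (snd n2)) \<le> emb_dist r1 n1 r2 n2 / norm u"
proof -
  have *: "norm w \<le> E / norm v" if "v \<noteq> 0" "norm (v * w) \<le> E" for v w :: complex and E :: real
    using that by (simp add: norm_mult field_simps)
  note c = norm_le_components(2-4)[of "emb r1 n1" "emb r2 n2", folded emb_dist_def, unfolded emb_def fst_conv snd_conv right_diff_distrib[symmetric]]
  show "norm (of_real (r1 powr expo) * fst n1 - of_real (r2 powr expo) * fst n2) \<le> emb_dist r1 n1 r2 n2 / norm s"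
    by (rule *[OF stu(1) c(1)])
  show "norm (of_real r1 * fst (snd n1) - of_real r2 * fst (snd n2)) \<le> emb_dist r1 n1 r2 n2 / norm t"
    by (rule *[OF stu(2) c(2)])
  show "norm (of_real r1 * snd (snd n1) - of_real r2 * snd (snd n2)) \<le> emb_dist r1 n1 r2 n2 / norm u"
    by (rule *[OF stu(3) c(3)])
qed

lemma powr_expo: "0 < r \<Longrightarrow> r powr expo = r * r powr kap"
  using powr_add[of r 1 kap] by (simp add: kap_def)

lemma scaled_diff:
  fixes x y :: complex
  assumes "0 \<le> p"
  shows "norm (of_real p * x - of_real q * y) \<le> p * norm (x - y) + \<bar>p - q\<bar> * norm y"
    "p * norm (x - y) \<le> norm (of_real p * x - of_real q * y) + \<bar>p - q\<bar> * norm y"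
proof -
  have e: "of_real p * x - of_real q * y = of_real p * (x - y) + of_real (p - q) * y"
    by (simp add: algebra_simps)
  have n: "norm (complex_of_real p * (x - y)) = p * norm (x - y)" "norm (of_real (p - q) * y) = \<bar>p - q\<bar> * norm y"
    using assms by (simp_all only: norm_mult norm_of_real abs_of_nonneg)
  show "norm (of_real p * x - of_real q * y) \<le> p * norm (x - y) + \<bar>p - q\<bar> * norm y"
    unfolding e n[symmetric] by (rule norm_triangle_ineq)
  show "p * norm (x - y) \<le> norm (of_real p * x - of_real q * y) + \<bar>p - q\<bar> * norm y"
    unfolding e n[symmetric] using norm_diff_ineq[of "complex_of_real p * (x - y)" "of_real (p - q) * y"] by linarith
qed

text \<open>The factor \<open>r powr expo\<close> splits as \<open>r * r powr kap\<close>, which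
  produces the weight in \<open>om\<close>; the change of radius is harmless because
  \<open>expo > 1\<close> makes \<open>r powr expo\<close> Lipschitz on the unit interval.\<close>

lemma emb_upper:
  obtains C where "C \<ge> 0"
    "\<And>r r1 n1 r2 n2. 0 < r \<Longrightarrow> 0 < r1 \<Longrightarrow> r1 < 1 \<Longrightarrow> r1 \<le> 2 * r \<Longrightarrow> 0 < r2 \<Longrightarrow> r2 < 1 \<Longrightarrow>
      n1 \<in> link a b \<Longrightarrow> n2 \<in> link a b \<Longrightarrow> emb_dist r1 n1 r2 n2 \<le> C * (\<bar>r1 - r2\<bar> + r * om r n1 n2)"
proof -
  define A where "A = 2 * 2 powr kap + 2 * expo"
  have A: "A \<ge> 0" using expo by (simp add: A_def)
  show ?thesis
  proof (rule that[of "norm s * A + norm t * 2 + norm u * 2"])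
    show "0 \<le> norm s * A + norm t * 2 + norm u * 2" using A by simp
    fix r r1 r2 :: real and n1 n2 :: "complex \<times> complex \<times> complex"
    assume r: "0 < r" "0 < r1" "r1 < 1" "r1 \<le> 2 * r" "0 < r2" "r2 < 1" and n: "n1 \<in> link a b" "n2 \<in> link a b"
    define dx where "dx = norm (fst n1 - fst n2)"
    define dy where "dy = norm (fst (snd n1) - fst (snd n2))"
    define dz where "dz = norm (snd (snd n1) - snd (snd n2))"
    have om: "om r n1 n2 = r powr kap * dx + (dy + dz)" by (simp add: om_def dx_def dy_def dz_def)
    define w where "w = \<bar>r1 - r2\<bar> + r * om r n1 n2"
    have pos: "0 \<le> dx" "0 \<le> dy" "0 \<le> dz" by (simp_all add: dx_def dy_def dz_def)
    have "r * om r n1 n2 = r * (r powr kap * dx) + r * dy + r * dz" unfolding om by (simp add: distrib_left)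
    moreover have "0 \<le> r * (r powr kap * dx)" "0 \<le> r * dy" "0 \<le> r * dz" using pos r(1) by auto
    ultimately have le: "r * (r powr kap * dx) \<le> w" "r * dy \<le> w" "r * dz \<le> w" "\<bar>r1 - r2\<bar> \<le> w" "0 \<le> w"
      "\<bar>r1 - r2\<bar> + r * (r powr kap * dx) \<le> w" "\<bar>r1 - r2\<bar> + r * dy \<le> w" "\<bar>r1 - r2\<bar> + r * dz \<le> w"
      unfolding w_def by linarith+
    note lc = link_component_le[OF n(2)]
    have "norm (of_real (r1 powr expo) * fst n1 - of_real (r2 powr expo) * fst n2) \<le> A * w"
    proof -
      have "r1 powr expo * dx \<le> (2 * r) * (2 powr kap * r powr kap) * dx"
        unfolding powr_expo[OF r(2)] using r(4) powr_kap_bounds(1)[OF r(1,2,4)] r(1) pos(1)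
        by (intro mult_right_mono mult_mono) auto
      also have "\<dots> = 2 * 2 powr kap * (r * (r powr kap * dx))" by (simp only: mult_ac)
      also have "\<dots> \<le> 2 * 2 powr kap * w" using le(1) by (intro mult_left_mono) auto
      finally have 1: "r1 powr expo * dx \<le> 2 * 2 powr kap * w" .
      have "\<bar>r1 powr expo - r2 powr expo\<bar> * norm (fst n2) \<le> (expo * \<bar>r1 - r2\<bar>) * 2"
        using powr_lipschitz_1[OF less_imp_le[OF expo(1)] r(2,3,5,6)] lc(1) expo(1) by (intro mult_mono) auto
      also have "\<dots> \<le> 2 * expo * w" using mult_left_mono[OF le(4), of "2 * expo"] expo(1) by (simp add: mult_ac)
      finally have "\<bar>r1 powr expo - r2 powr expo\<bar> * norm (fst n2) \<le> 2 * expo * w" .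
      with 1 show ?thesis
        using scaled_diff(1)[of "r1 powr expo" "fst n1" "r2 powr expo" "fst n2"] unfolding dx_def A_def distrib_right by simp
    qed
    then have 1: "norm s * norm (of_real (r1 powr expo) * fst n1 - of_real (r2 powr expo) * fst n2) \<le> norm s * (A * w)"
      by (rule mult_left_mono) simp
    have lin: "norm (of_real r1 * v1 - of_real r2 * v2) \<le> 2 * w"
      if "norm v2 \<le> 1" "\<bar>r1 - r2\<bar> + r * norm (v1 - v2) \<le> w" for v1 v2 :: complex
    proof -
      have "r1 * norm (v1 - v2) \<le> (2 * r) * norm (v1 - v2)" using r(4) by (rule mult_right_mono) simp
      moreover have "\<bar>r1 - r2\<bar> * norm v2 \<le> \<bar>r1 - r2\<bar> * 1" using that(1) by (rule mult_left_mono) simp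
      moreover have "norm (of_real r1 * v1 - of_real r2 * v2) \<le> r1 * norm (v1 - v2) + \<bar>r1 - r2\<bar> * norm v2"
        by (rule scaled_diff(1)) (use r(2) in simp)
      ultimately show ?thesis using that(2) by simp
    qed
    have 2: "norm t * norm (of_real r1 * fst (snd n1) - of_real r2 * fst (snd n2)) \<le> norm t * (2 * w)"
      by (intro mult_left_mono lin lc) (use le(7) in \<open>simp_all add: dy_def\<close>)
    have 3: "norm u * norm (of_real r1 * snd (snd n1) - of_real r2 * snd (snd n2)) \<le> norm u * (2 * w)"
      by (intro mult_left_mono lin lc) (use le(8) in \<open>simp_all add: dz_def\<close>)
    have "emb_dist r1 n1 r2 n2 \<le> norm s * (A * w) + (norm t * (2 * w) + norm u * (2 * w))"
      using norm_le_components(1)[of "emb r1 n1" "emb r2 n2", folded emb_dist_def] 1 2 3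
      unfolding emb_def fst_conv snd_conv right_diff_distrib[symmetric] norm_mult by linarith
    also have "\<dots> = (norm s * A + norm t * 2 + norm u * 2) * w" by (simp add: algebra_simps)
    finally show "emb_dist r1 n1 r2 n2 \<le> (norm s * A + norm t * 2 + norm u * 2) * (\<bar>r1 - r2\<bar> + r * om r n1 n2)"
      unfolding w_def .
  qed
qed

text \<open>The radius is determined by the last two coordinates, as r^(2b) is the sum of the 2b-th
  powers of their moduli. Both the difference of r1^(2b) and r2^(2b) and that of the coordinate
  powers carry the factor r1^(2b-1), which cancels and leaves a constant independent of the
  radius.\<close>

lemma radius_diff_le:
  assumes n: "n1 \<in> link a b" "n2 \<in> link a b" and r: "0 \<le> r2" "r2 \<le> r1" "0 < r1"
  shows "r1 - r2 \<le> 2 * real b * (norm (of_real r1 * fst (snd n1) - of_real r2 * fst (snd n2)) +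
    norm (of_real r1 * snd (snd n1) - of_real r2 * snd (snd n2)))"
proof -
  define R where "R = r1 ^ (2 * b - 1)"
  have R: "R > 0" using r(3) by (simp add: R_def)
  have b2: "2 * b = Suc (2 * b - 1)" using b_pos by simp
  have r1b: "r1 ^ (2 * b) = R * r1" unfolding R_def by (subst b2) simp
  have "r2 ^ (2 * b) = r2 ^ (2 * b - 1) * r2" by (subst b2) simp
  also have "\<dots> \<le> R * r2" unfolding R_def using r by (intro mult_right_mono power_mono) auto
  finally have r2b: "r2 ^ (2 * b) \<le> R * r2" .
  have sum1: "r ^ (2 * b) = (r * norm (fst (snd n))) ^ (2 * b) + (r * norm (snd (snd n))) ^ (2 * b)"
    if "n \<in> link a b" for r :: real and n
  proof -
    have "norm (fst (snd n)) ^ (2 * b) + norm (snd (snd n)) ^ (2 * b) = 1"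
      using that by (auto simp: link_def)
    then show ?thesis unfolding power_mult_distrib distrib_left[symmetric] by simp
  qed
  have step: "(r1 * norm v1) ^ (2 * b) - (r2 * norm v2) ^ (2 * b) \<le> real (2 * b) * R * norm (of_real r1 * v1 - of_real r2 * v2)"
    if v: "norm v1 \<le> 1" "norm v2 \<le> 1" for v1 v2 :: complex
  proof -
    have "\<bar>(r1 * norm v1) ^ (2 * b) - (r2 * norm v2) ^ (2 * b)\<bar> \<le> real (2 * b) * r1 ^ (2 * b - 1) * \<bar>r1 * norm v1 - r2 * norm v2\<bar>"
    proof (rule real_power_diff_le)
      show "r1 * norm v1 \<le> r1" using v(1) r(3) by (simp add: mult_left_le)
      show "r2 * norm v2 \<le> r1" using order_trans[OF mult_left_le[OF v(2) r(1)] r(2)] by simp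
    qed (use r in auto)
    also have "\<bar>r1 * norm v1 - r2 * norm v2\<bar> \<le> norm (of_real r1 * v1 - of_real r2 * v2)"
      using norm_triangle_ineq3[of "of_real r1 * v1" "of_real r2 * v2"] r by (simp add: norm_mult)
    finally show ?thesis using R by (simp add: R_def mult_left_mono)
  qed
  let ?d = "norm (of_real r1 * fst (snd n1) - of_real r2 * fst (snd n2)) + norm (of_real r1 * snd (snd n1) - of_real r2 * snd (snd n2))"
  have "R * (r1 - r2) \<le> r1 ^ (2 * b) - r2 ^ (2 * b)" using r1b r2b by (simp add: right_diff_distrib)
  also have "\<dots> \<le> real (2 * b) * R * ?d"
    using step[OF link_component_le(2)[OF n(1)] link_component_le(2)[OF n(2)]]
      step[OF link_component_le(3)[OF n(1)] link_component_le(3)[OF n(2)]]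
    unfolding sum1[OF n(1), of r1] sum1[OF n(2), of r2] distrib_left by linarith
  also have "\<dots> = R * (2 * real b * ?d)" by simp
  finally show ?thesis using R by (simp only: mult_le_cancel_left_pos)
qed

lemma emb_lower_radius:
  obtains C where "C \<ge> 0"
    "\<And>r1 n1 r2 n2. 0 < r1 \<Longrightarrow> 0 < r2 \<Longrightarrow> n1 \<in> link a b \<Longrightarrow> n2 \<in> link a b \<Longrightarrow> \<bar>r1 - r2\<bar> \<le> C * emb_dist r1 n1 r2 n2"
proof (rule that[of "2 * real b * (1 / norm t + 1 / norm u)"])
  have *: "r1 - r2 \<le> 2 * real b * (1 / norm t + 1 / norm u) * emb_dist r1 n1 r2 n2"
    if "0 < r1" "0 < r2" "n1 \<in> link a b" "n2 \<in> link a b" "r2 \<le> r1" for r1 r2 :: real and n1 n2 :: "complex \<times> complex \<times> complex"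
  proof -
    have "r1 - r2 \<le> 2 * real b * (emb_dist r1 n1 r2 n2 / norm t + emb_dist r1 n1 r2 n2 / norm u)"
      by (rule order_trans[OF radius_diff_le[OF that(3,4) less_imp_le[OF that(2)] that(5,1)]])
         (intro mult_left_mono add_mono emb_components, simp)
    then show ?thesis by (simp add: algebra_simps)
  qed
  fix r1 r2 :: real and n1 n2 :: "complex \<times> complex \<times> complex"
  assume r: "0 < r1" "0 < r2" "n1 \<in> link a b" "n2 \<in> link a b"
  have "emb_dist r2 n2 r1 n1 = emb_dist r1 n1 r2 n2" by (simp add: emb_dist_def norm_minus_commute)
  then show "\<bar>r1 - r2\<bar> \<le> 2 * real b * (1 / norm t + 1 / norm u) * emb_dist r1 n1 r2 n2"
    using *[OF r] *[OF r(2,1,4,3)] by (cases "r2 \<le> r1") auto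
qed simp

text \<open>Once the difference of the radii is bounded, the radial part can be subtracted from each
  coordinate, and what remains is the movement within the link.\<close>

lemma emb_lower:
  obtains C where "C \<ge> 0"
    "\<And>r r1 n1 r2 n2. 0 < r \<Longrightarrow> r / 2 \<le> r1 \<Longrightarrow> r1 < 1 \<Longrightarrow> 0 < r2 \<Longrightarrow> r2 < 1 \<Longrightarrow>
      n1 \<in> link a b \<Longrightarrow> n2 \<in> link a b \<Longrightarrow> r * om r n1 n2 \<le> C * emb_dist r1 n1 r2 n2"
proof -
  obtain C where C: "C \<ge> 0"
    "\<And>r1 n1 r2 n2. 0 < r1 \<Longrightarrow> 0 < r2 \<Longrightarrow> n1 \<in> link a b \<Longrightarrow> n2 \<in> link a b \<Longrightarrow> \<bar>r1 - r2\<bar> \<le> C * emb_dist r1 n1 r2 n2"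
    by (rule emb_lower_radius) (rule that; assumption)
  define A where "A = 2 * 2 powr kap * (1 / norm s + 2 * expo * C)"
  define B where "B = 2 * (1 / norm t + C) + 2 * (1 / norm u + C)"
  show ?thesis
  proof (rule that[of "A + B"])
    show "A + B \<ge> 0" unfolding A_def B_def using C(1) expo(1) by (intro add_nonneg_nonneg mult_nonneg_nonneg) auto
    fix r r1 r2 :: real and n1 n2 :: "complex \<times> complex \<times> complex"
    assume r: "0 < r" "r / 2 \<le> r1" "r1 < 1" "0 < r2" "r2 < 1" and n: "n1 \<in> link a b" "n2 \<in> link a b"
    have rp: "0 < r1" "r \<le> 2 * r1" using r(1,2) by auto
    define E where "E = emb_dist r1 n1 r2 n2"
    have E: "0 \<le> E" by (simp add: E_def emb_dist_def)
    have dr: "\<bar>r1 - r2\<bar> \<le> C * E" unfolding E_def by (rule C(2)[OF rp(1) r(4) n])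
    note lc = link_component_le[OF n(2)]
    have "r powr expo * norm (fst n1 - fst n2) \<le> A * E"
    proof -
      have "r1 powr expo * norm (fst n1 - fst n2) \<le> E / norm s + (expo * (C * E)) * 2"
      proof (rule order_trans[OF scaled_diff(2)[of _ _ _ "r2 powr expo"]], simp, rule add_mono)
        show "norm (of_real (r1 powr expo) * fst n1 - of_real (r2 powr expo) * fst n2) \<le> E / norm s"
          unfolding E_def by (rule emb_components)
        have "\<bar>r1 powr expo - r2 powr expo\<bar> \<le> expo * (C * E)"
          by (rule order_trans[OF powr_lipschitz_1[OF less_imp_le[OF expo(1)] rp(1) r(3,4,5)] mult_left_mono[OF dr]])
            (use expo(1) in simp)
        then show "\<bar>r1 powr expo - r2 powr expo\<bar> * norm (fst n2) \<le> (expo * (C * E)) * 2"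
          using lc(1) expo(1) C(1) E by (intro mult_mono) auto
      qed
      then have "2 * 2 powr kap * (r1 powr expo * norm (fst n1 - fst n2)) \<le> 2 * 2 powr kap * (E / norm s + (expo * (C * E)) * 2)"
        by (rule mult_left_mono) simp
      moreover have "r powr expo * norm (fst n1 - fst n2) \<le> 2 * 2 powr kap * (r1 powr expo * norm (fst n1 - fst n2))"
      proof -
        have "r * r powr kap \<le> (2 * r1) * (2 powr kap * r1 powr kap)"
          using rp r(1) powr_kap_bounds(1)[OF rp(1) r(1) rp(2)] by (intro mult_mono) auto
        then have "r powr expo \<le> 2 * 2 powr kap * r1 powr expo"
          unfolding powr_expo[OF r(1)] powr_expo[OF rp(1)] by (simp only: mult_ac)
        from mult_right_mono[OF this, of "norm (fst n1 - fst n2)"] show ?thesis by (simp only: mult.assoc norm_ge_zero)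
      qed
      moreover have "2 * 2 powr kap * (E / norm s + (expo * (C * E)) * 2) = A * E" by (simp add: A_def algebra_simps)
      ultimately show ?thesis by linarith
    qed
    moreover have lin: "r * norm (v1 - v2) \<le> 2 * (F + C * E)"
      if "norm v2 \<le> 1" "norm (of_real r1 * v1 - of_real r2 * v2) \<le> F" for v1 v2 :: complex and F
    proof -
      have "\<bar>r1 - r2\<bar> * norm v2 \<le> C * E * 1" using dr that(1) C(1) E by (intro mult_mono) auto
      moreover have "r1 * norm (v1 - v2) \<le> norm (of_real r1 * v1 - of_real r2 * v2) + \<bar>r1 - r2\<bar> * norm v2"
        by (rule scaled_diff(2)) (use rp in simp)
      moreover have "r * norm (v1 - v2) \<le> 2 * r1 * norm (v1 - v2)" using rp(2) by (rule mult_right_mono) simp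
      ultimately show ?thesis using that(2) by simp
    qed
    have "r * norm (fst (snd n1) - fst (snd n2)) \<le> 2 * (E / norm t + C * E)"
      "r * norm (snd (snd n1) - snd (snd n2)) \<le> 2 * (E / norm u + C * E)"
      unfolding E_def[symmetric] by (rule lin[OF lc(2) emb_components(2)[of r1 n1 r2 n2, folded E_def]],
        rule lin[OF lc(3) emb_components(3)[of r1 n1 r2 n2, folded E_def]])
    moreover have "2 * (E / norm t + C * E) + 2 * (E / norm u + C * E) = B * E" by (simp add: B_def algebra_simps)
    moreover have "r * om r n1 n2 = r powr expo * norm (fst n1 - fst n2) +
        (r * norm (fst (snd n1) - fst (snd n2)) + r * norm (snd (snd n1) - snd (snd n2)))"
      unfolding om_def powr_expo[OF r(1)] by (simp add: distrib_left mult.assoc)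
    ultimately show "r * om r n1 n2 \<le> (A + B) * emb_dist r1 n1 r2 n2"
      unfolding E_def[symmetric] distrib_right by linarith
  qed
qed

definition "cone_map r m = (if r = 0 then 0 else emb r (inv_into (link a b) (push r) m))" for r :: real

lemma cone_map_push:
  assumes "0 < r" "r < 1" "n \<in> link a b"
  shows "cone_map r (push r n) = emb r n"
proof -
  have "inj_on (push r) (link a b)" using push_inj[OF assms(1,2)] by (rule inj_onI)
  then show ?thesis using assms by (simp add: cone_map_def inv_into_f_f)
qed

lemma link_nonempty: "link a b \<noteq> {}"
proof -
  have "croot a 1 (- 1) ^ a = - 1" by (rule croot_power[OF a_pos]) auto
  then have "(croot a 1 (- 1), 0, 1) \<in> link a b" using b_pos by (simp add: link_def zero_power)
  then show ?thesis by blast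
qed

text \<open>\<open>cone_map\<close> passes through the inverse of \<open>push\<close>. Hence its
  Lipschitz bound combines \<open>emb_upper\<close> with \<open>push_inverse_lipschitz\<close>, and
  the bound for its inverse combines the lower bounds for \<open>emb\<close> with
  \<open>push_lipschitz\<close>.\<close>

lemma cone_parametrization_exists: "\<exists>L. cone_parametrization (link a b) 3 cone_map L"
proof -
  obtain CU where CU: "CU \<ge> 0"
    "\<And>r r1 n1 r2 n2. 0 < r \<Longrightarrow> 0 < r1 \<Longrightarrow> r1 < 1 \<Longrightarrow> r1 \<le> 2 * r \<Longrightarrow> 0 < r2 \<Longrightarrow> r2 < 1 \<Longrightarrow>
      n1 \<in> link a b \<Longrightarrow> n2 \<in> link a b \<Longrightarrow> emb_dist r1 n1 r2 n2 \<le> CU * (\<bar>r1 - r2\<bar> + r * om r n1 n2)"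
    by (rule emb_upper) (rule that; assumption)
  obtain CR where CR: "CR \<ge> 0"
    "\<And>r1 n1 r2 n2. 0 < r1 \<Longrightarrow> 0 < r2 \<Longrightarrow> n1 \<in> link a b \<Longrightarrow> n2 \<in> link a b \<Longrightarrow> \<bar>r1 - r2\<bar> \<le> CR * emb_dist r1 n1 r2 n2"
    by (rule emb_lower_radius) (rule that; assumption)
  obtain CL where CL: "CL \<ge> 0"
    "\<And>r r1 n1 r2 n2. 0 < r \<Longrightarrow> r / 2 \<le> r1 \<Longrightarrow> r1 < 1 \<Longrightarrow> 0 < r2 \<Longrightarrow> r2 < 1 \<Longrightarrow>
      n1 \<in> link a b \<Longrightarrow> n2 \<in> link a b \<Longrightarrow> r * om r n1 n2 \<le> CL * emb_dist r1 n1 r2 n2"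
    by (rule emb_lower) (rule that; assumption)
  obtain CP where CP: "CP \<ge> 0"
    "\<And>r n0. 0 < r \<Longrightarrow> r < 1 \<Longrightarrow> n0 \<in> link a b \<Longrightarrow> \<exists>e>0. \<forall>r1 n1 r2 n2.
      r / 2 \<le> r1 \<longrightarrow> r1 \<le> 2 * r \<longrightarrow> r1 < 1 \<longrightarrow> r / 2 \<le> r2 \<longrightarrow> r2 < 1 \<longrightarrow>
      n1 \<in> link a b \<longrightarrow> n2 \<in> link a b \<longrightarrow> norm (fst n1 - fst n0) < e \<longrightarrow> norm (fst n2 - fst n0) < e \<longrightarrow>
      norm (push r1 n1 - push r2 n2) \<le> CP * (\<bar>r1 - r2\<bar> / r + om r n1 n2)"
    by (rule push_lipschitz) (rule that; assumption)
  obtain CI where CI: "CI \<ge> 0"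
    "\<And>r m0. 0 < r \<Longrightarrow> r < 1 \<Longrightarrow> \<exists>e>0. \<forall>r1 n1 r2 n2.
      r / 2 \<le> r1 \<longrightarrow> r1 < 1 \<longrightarrow> r / 2 \<le> r2 \<longrightarrow> r2 < 1 \<longrightarrow>
      n1 \<in> link a b \<longrightarrow> n2 \<in> link a b \<longrightarrow> norm (push r1 n1 - m0) < e \<longrightarrow> norm (push r2 n2 - m0) < e \<longrightarrow>
      om r n1 n2 \<le> CI * (\<bar>r1 - r2\<bar> / r + norm (push r1 n1 - push r2 n2))"
    by (rule push_inverse_lipschitz) (rule that; assumption)
  \<comment> \<open>\<open>L1\<close> serves \<open>k_lipschitz\<close>, \<open>L2\<close> serves
    \<open>k_inverse_lipschitz\<close>, and \<open>L3\<close> and \<open>L4\<close> serve the upper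
    and lower bounds of the norm.\<close>
  define L1 where "L1 = CU * (1 + CI)"
  define L2 where "L2 = (1 + CP) * CR + CP * CL"
  define L3 where "L3 = 2 * norm s + norm t + norm u"
  define L4 where "L4 = 1 / norm t + 1 / norm u"
  define L where "L = 1 + L1 + L2 + L3 + L4"
  have "L1 \<ge> 0" "L2 \<ge> 0" "L3 \<ge> 0" "L4 \<ge> 0"
    unfolding L1_def L2_def L3_def L4_def using CU(1) CR(1) CL(1) CP(1) CI(1)
    by (auto intro!: add_nonneg_nonneg mult_nonneg_nonneg)
  then have L: "1 \<le> L" "L1 \<le> L" "L2 \<le> L" "L3 \<le> L" "L4 \<le> L" unfolding L_def by linarith+
  interpret good_submanifold "link a b" 3 by (rule good_submanifold_link[OF a_pos b_pos])
  have "cone_parametrization (link a b) 3 cone_map L"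
  proof
    show "link a b \<noteq> {}" by (rule link_nonempty)
    show "cone_map 0 m = 0" for m by (simp add: cone_map_def)
    show "1 \<le> L" by (rule L(1))
  next
    fix r r' :: real and m m' assume r: "0 < r" "r < 1" and m: "m \<in> link a b" and r': "0 < r'" "r' < 1" and m': "m' \<in> link a b"
      and eq: "cone_map r m = cone_map r' m'"
    obtain n where n: "n \<in> link a b" "push r n = m" by (rule push_surj[OF r m])
    obtain n' where n': "n' \<in> link a b" "push r' n' = m'" by (rule push_surj[OF r' m'])
    have "emb r n = emb r' n'" using eq cone_map_push[OF r n(1)] cone_map_push[OF r' n'(1)] n(2) n'(2) by simp
    then have 0: "emb_dist r n r' n' = 0" by (simp add: emb_dist_def)
    have "r = r'" using CR(2)[OF r(1) r'(1) n(1) n'(1)] 0 by simp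
    have "r * om r n n' \<le> 0" using CL(2)[OF r(1) _ r(2) r' n(1) n'(1)] 0 r by simp
    then have "om r n n' \<le> 0" using r(1) by (simp add: mult_le_0_iff)
    moreover have "0 \<le> r powr kap * norm (fst n - fst n')" by simp
    moreover have "0 < r powr kap" using powr_kap[OF r] by blast
    ultimately have z: "r powr kap * norm (fst n - fst n') = 0" "norm (fst (snd n) - fst (snd n')) = 0" "norm (snd (snd n) - snd (snd n')) = 0"
      unfolding om_def using norm_ge_zero[of "fst (snd n) - fst (snd n')"] norm_ge_zero[of "snd (snd n) - snd (snd n')"] by linarith+
    have "fst n = fst n'" using z(1) \<open>0 < r powr kap\<close> by simp
    moreover have "fst (snd n) = fst (snd n')" "snd (snd n) = snd (snd n')" using z(2,3) by simp_all
    ultimately have "n = n'" by (simp add: prod_eq_iff)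
    then show "r = r' \<and> m = m'" using \<open>r = r'\<close> n(2) n'(2) by simp
  next
    fix r :: real and m assume r: "0 < r" "r < 1" and m: "m \<in> link a b"
    obtain n where n: "n \<in> link a b" "push r n = m" by (rule push_surj[OF r m])
    have k: "cone_map r m = emb r n" using cone_map_push[OF r n(1)] n(2) by simp
    note lc = link_component_le[OF n(1)]
    have kap1: "r powr kap \<le> 1" using powr_kap[OF r] by simp
    have "norm (emb r n) \<le> norm s * (r * 2) + (norm t * (r * 1) + norm u * (r * 1))"
    proof -
      have "r powr expo * norm (fst n) \<le> r * 2"
        unfolding powr_expo[OF r(1)] using kap1 lc(1) r by (intro mult_mono) (auto simp: mult_left_le)
      then have "norm (s * (of_real (r powr expo) * fst n)) \<le> norm s * (r * 2)"
        by (simp add: norm_mult mult_left_mono)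
      moreover have "norm (t * (of_real r * fst (snd n))) \<le> norm t * (r * 1)" "norm (u * (of_real r * snd (snd n))) \<le> norm u * (r * 1)"
        unfolding norm_mult norm_of_real using lc(2,3) r by (auto intro!: mult_left_mono)
      ultimately show ?thesis unfolding emb_def by (intro order_trans[OF norm_triple(4)] add_mono)
    qed
    also have "\<dots> = L3 * r" by (simp add: L3_def algebra_simps)
    also have "\<dots> \<le> L * r" using L(4) r by (intro mult_right_mono) auto
    finally show "norm (cone_map r m) \<le> L * r" unfolding k .
    \<comment> \<open>The last two moduli are at most 1, so they are at least their 2b-th powers,
      which add up to 1.\<close>
    have one: "1 \<le> norm (fst (snd n)) + norm (snd (snd n))"
    proof -
      have le: "v ^ (2 * b) \<le> v" if "0 \<le> v" "v \<le> 1" for v :: real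
        using power_decreasing[of 1 "2 * b" v] that b_pos by simp
      have "norm (fst (snd n)) ^ (2 * b) + norm (snd (snd n)) ^ (2 * b) = 1" using n(1) by (auto simp: link_def)
      then show ?thesis using le[OF norm_ge_zero lc(2)] le[OF norm_ge_zero lc(3)] by linarith
    qed
    have "r * norm (fst (snd n)) \<le> norm (emb r n) / norm t" "r * norm (snd (snd n)) \<le> norm (emb r n) / norm u"
    proof -
      have "norm t * (r * norm (fst (snd n))) \<le> norm (emb r n)" "norm u * (r * norm (snd (snd n))) \<le> norm (emb r n)"
        using norm_le_components(3,4)[of "emb r n" 0] r by (simp_all add: emb_def norm_mult)
      then show "r * norm (fst (snd n)) \<le> norm (emb r n) / norm t" "r * norm (snd (snd n)) \<le> norm (emb r n) / norm u"
        using stu by (simp_all add: field_simps)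
    qed
    moreover have "r * 1 \<le> r * (norm (fst (snd n)) + norm (snd (snd n)))" using one r by (intro mult_left_mono) auto
    moreover have "norm (emb r n) / norm t + norm (emb r n) / norm u = L4 * norm (emb r n)" by (simp add: L4_def algebra_simps)
    ultimately have "r \<le> L4 * norm (emb r n)" unfolding distrib_left by linarith
    also have "\<dots> \<le> L * norm (emb r n)" using L(5) by (intro mult_right_mono) auto
    finally show "r \<le> L * norm (cone_map r m)" unfolding k .
  next
    fix r :: real and m assume r: "0 < r" "r < 1" and m: "m \<in> link a b"
    obtain e0 where e0: "e0 > 0" "\<And>r1 n1 r2 n2. r / 2 \<le> r1 \<Longrightarrow> r1 < 1 \<Longrightarrow> r / 2 \<le> r2 \<Longrightarrow> r2 < 1 \<Longrightarrow>
      n1 \<in> link a b \<Longrightarrow> n2 \<in> link a b \<Longrightarrow> norm (push r1 n1 - m) < e0 \<Longrightarrow> norm (push r2 n2 - m) < e0 \<Longrightarrow>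
      om r n1 n2 \<le> CI * (\<bar>r1 - r2\<bar> / r + norm (push r1 n1 - push r2 n2))"
      using CI(2)[OF r, of m] by blast
    show "\<exists>e>0. \<forall>r' m' r'' m''. 0 < r' \<longrightarrow> r' < 1 \<longrightarrow> m' \<in> link a b \<longrightarrow> 0 < r'' \<longrightarrow> r'' < 1 \<longrightarrow> m'' \<in> link a b \<longrightarrow>
        \<bar>r' - r\<bar> < e \<longrightarrow> dist m' m < e \<longrightarrow> \<bar>r'' - r\<bar> < e \<longrightarrow> dist m'' m < e \<longrightarrow>
        dist (cone_map r' m') (cone_map r'' m'') \<le> L * (\<bar>r' - r''\<bar> + r * dist m' m'')"
    proof (intro exI[of _ "min e0 (r / 2)"] conjI allI impI)
      show "0 < min e0 (r / 2)" using e0(1) r by simp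
      fix r' r'' :: real and m' m'' assume r': "0 < r'" "r' < 1" and m': "m' \<in> link a b" and r'': "0 < r''" "r'' < 1" and m'': "m'' \<in> link a b"
        and d: "\<bar>r' - r\<bar> < min e0 (r / 2)" "dist m' m < min e0 (r / 2)" "\<bar>r'' - r\<bar> < min e0 (r / 2)" "dist m'' m < min e0 (r / 2)"
      obtain n' where n': "n' \<in> link a b" "push r' n' = m'" by (rule push_surj[OF r' m'])
      obtain n'' where n'': "n'' \<in> link a b" "push r'' n'' = m''" by (rule push_surj[OF r'' m''])
      have rb: "r / 2 \<le> r'" "r' \<le> 2 * r" "r / 2 \<le> r''" using d(1,3) unfolding min_less_iff_conj abs_less_iff by linarith+
      define w where "w = \<bar>r' - r''\<bar> + r * dist m' m''"
      have "om r n' n'' \<le> CI * (\<bar>r' - r''\<bar> / r + dist m' m'')"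
        using e0(2)[OF rb(1) r'(2) rb(3) r''(2) n'(1) n''(1)] d(2,4) n'(2) n''(2) by (simp add: dist_norm)
      then have "r * om r n' n'' \<le> r * (CI * (\<bar>r' - r''\<bar> / r + dist m' m''))" using r by (intro mult_left_mono) auto
      also have "\<dots> = CI * w" using r by (simp add: w_def field_simps)
      finally have 1: "r * om r n' n'' \<le> CI * w" .
      have w: "\<bar>r' - r''\<bar> \<le> w" "0 \<le> w" using r by (simp_all add: w_def)
      have "emb_dist r' n' r'' n'' \<le> CU * (\<bar>r' - r''\<bar> + r * om r n' n'')"
        by (rule CU(2)[OF r(1) r' rb(2) r'' n'(1) n''(1)])
      also have "\<dots> \<le> CU * (w + CI * w)" using 1 w CU(1) by (intro mult_left_mono add_mono) auto
      also have "\<dots> = L1 * w" by (simp add: L1_def algebra_simps)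
      also have "\<dots> \<le> L * w" using L(2) w by (intro mult_right_mono) auto
      finally show "dist (cone_map r' m') (cone_map r'' m'') \<le> L * (\<bar>r' - r''\<bar> + r * dist m' m'')"
        using cone_map_push[OF r' n'(1)] cone_map_push[OF r'' n''(1)] n'(2) n''(2)
        by (simp add: w_def emb_dist_def dist_norm)
    qed
  next
    fix r :: real and m assume r: "0 < r" "r < 1" and m: "m \<in> link a b"
    obtain n where n: "n \<in> link a b" "push r n = m" by (rule push_surj[OF r m])
    have k: "cone_map r m = emb r n" using cone_map_push[OF r n(1)] n(2) by simp
    obtain e0 where e0: "e0 > 0" "\<And>r1 n1 r2 n2. r / 2 \<le> r1 \<Longrightarrow> r1 \<le> 2 * r \<Longrightarrow> r1 < 1 \<Longrightarrow> r / 2 \<le> r2 \<Longrightarrow> r2 < 1 \<Longrightarrow>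
      n1 \<in> link a b \<Longrightarrow> n2 \<in> link a b \<Longrightarrow> norm (fst n1 - fst n) < e0 \<Longrightarrow> norm (fst n2 - fst n) < e0 \<Longrightarrow>
      norm (push r1 n1 - push r2 n2) \<le> CP * (\<bar>r1 - r2\<bar> / r + om r n1 n2)"
      using CP(2)[OF r n(1)] by blast
    have kp: "0 < r powr kap" using powr_kap[OF r] by blast
    \<comment> \<open>Closeness in the image is turned into the hypotheses of
      \<open>push_lipschitz\<close>: \<open>e1\<close> brings the radius within \<open>r / 2\<close>
      of \<open>r\<close>, and \<open>e2\<close> brings the first coordinate within
      \<open>e0\<close> of that of \<open>n\<close>. Adding 1 to \<open>CR\<close> and
      \<open>CL\<close> avoids division by 0.\<close>
    define e1 where "e1 = r / (2 * (CR + 1))"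
    define e2 where "e2 = r * (r powr kap * e0) / (CL + 1)"
    have e1: "e1 > 0" "CR * e1 < r / 2"
      using r CR(1) by (simp_all add: e1_def field_simps)
    have e2: "e2 > 0" "CL * e2 < r * (r powr kap * e0)"
      using r CL(1) e0(1) kp by (simp_all add: e2_def field_simps)
    have near: "r / 2 \<le> r' \<and> r' \<le> 2 * r \<and> norm (fst n' - fst n) < e0"
      if r': "0 < r'" "r' < 1" and n': "n' \<in> link a b" and d: "emb_dist r' n' r n < min e1 e2" for r' n'
    proof -
      have "\<bar>r' - r\<bar> \<le> CR * emb_dist r' n' r n" by (rule CR(2)[OF r'(1) r(1) n' n(1)])
      also have "\<dots> \<le> CR * e1" using d CR(1) by (intro mult_left_mono) auto
      finally have 1: "\<bar>r' - r\<bar> < r / 2" using e1(2) by linarith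
      then have rb: "r / 2 \<le> r'" "r' \<le> 2 * r" by linarith+
      have "r * om r n' n \<le> CL * emb_dist r' n' r n" by (rule CL(2)[OF r(1) rb(1) r'(2) r n' n(1)])
      also have "\<dots> \<le> CL * e2" using d CL(1) by (intro mult_left_mono) auto
      finally have "r * om r n' n < r * (r powr kap * e0)" using e2(2) by linarith
      then have "om r n' n < r powr kap * e0" using r(1) by simp
      then have "r powr kap * norm (fst n' - fst n) < r powr kap * e0"
        unfolding om_def using norm_ge_zero[of "fst (snd n') - fst (snd n)"] norm_ge_zero[of "snd (snd n') - snd (snd n)"] by linarith
      then have "norm (fst n' - fst n) < e0" using kp by (simp only: mult_less_cancel_left_pos)
      with rb show ?thesis by blast
    qed
    show "\<exists>e>0. \<forall>r' m' r'' m''. 0 < r' \<longrightarrow> r' < 1 \<longrightarrow> m' \<in> link a b \<longrightarrow> 0 < r'' \<longrightarrow> r'' < 1 \<longrightarrow> m'' \<in> link a b \<longrightarrow>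
        dist (cone_map r' m') (cone_map r m) < e \<longrightarrow> dist (cone_map r'' m'') (cone_map r m) < e \<longrightarrow>
        \<bar>r' - r''\<bar> + r * dist m' m'' \<le> L * dist (cone_map r' m') (cone_map r'' m'')"
    proof (intro exI[of _ "min e1 e2"] conjI allI impI)
      show "0 < min e1 e2" using e1(1) e2(1) by simp
      fix r' r'' :: real and m' m'' assume r': "0 < r'" "r' < 1" and m': "m' \<in> link a b" and r'': "0 < r''" "r'' < 1" and m'': "m'' \<in> link a b"
        and d: "dist (cone_map r' m') (cone_map r m) < min e1 e2" "dist (cone_map r'' m'') (cone_map r m) < min e1 e2"
      obtain n' where n': "n' \<in> link a b" "push r' n' = m'" by (rule push_surj[OF r' m'])
      obtain n'' where n'': "n'' \<in> link a b" "push r'' n'' = m''" by (rule push_surj[OF r'' m''])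
      have k': "cone_map r' m' = emb r' n'" using cone_map_push[OF r' n'(1)] n'(2) by simp
      have k'': "cone_map r'' m'' = emb r'' n''" using cone_map_push[OF r'' n''(1)] n''(2) by simp
      have near': "r / 2 \<le> r'" "r' \<le> 2 * r" "norm (fst n' - fst n) < e0"
        using near[OF r' n'(1)] d(1) unfolding k k' emb_dist_def dist_norm by blast+
      have near'': "r / 2 \<le> r''" "r'' \<le> 2 * r" "norm (fst n'' - fst n) < e0"
        using near[OF r'' n''(1)] d(2) unfolding k k'' emb_dist_def dist_norm by blast+
      define E where "E = emb_dist r' n' r'' n''"
      have E: "0 \<le> E" by (simp add: E_def emb_dist_def)
      have "dist m' m'' \<le> CP * (\<bar>r' - r''\<bar> / r + om r n' n'')"
        using e0(2)[OF near'(1,2) r'(2) near''(1) r''(2) n'(1) n''(1) near'(3) near''(3)] n'(2) n''(2) by (simp add: dist_norm)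
      then have "r * dist m' m'' \<le> r * (CP * (\<bar>r' - r''\<bar> / r + om r n' n''))" using r by (intro mult_left_mono) auto
      also have "\<dots> = CP * (\<bar>r' - r''\<bar> + r * om r n' n'')" using r by (simp add: field_simps)
      also have "\<dots> \<le> CP * (CR * E + CL * E)"
        unfolding E_def using CR(2)[OF r'(1) r''(1) n'(1) n''(1)] CL(2)[OF r(1) near'(1) r'(2) r'' n'(1) n''(1)] CP(1)
        by (intro mult_left_mono add_mono)
      finally have "\<bar>r' - r''\<bar> + r * dist m' m'' \<le> CR * E + CP * (CR * E + CL * E)"
        using CR(2)[OF r'(1) r''(1) n'(1) n''(1)] unfolding E_def by linarith
      also have "\<dots> = L2 * E" by (simp add: L2_def algebra_simps)
      also have "\<dots> \<le> L * E" using L(3) E by (intro mult_right_mono) auto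
      finally show "\<bar>r' - r''\<bar> + r * dist m' m'' \<le> L * dist (cone_map r' m') (cone_map r'' m'')"
        unfolding k' k'' E_def emb_dist_def dist_norm .
    qed
  qed
  then show ?thesis by blast
qed

text \<open>\<open>s\<close>, \<open>t\<close>, \<open>u\<close> normalise the equation, and the
  weighted dilation multiplies it by r^b, so the image lies in the variety. Conversely every point
  of the variety with \<open>N\<close> below 1 is a dilated point of the link with radius the 2b-th
  root of \<open>N\<close>, so the image contains a neighbourhood of the origin.\<close>

lemma metrically_conical_brieskorn:
  assumes \<alpha>: "\<alpha>\<^sub>0 * s ^ a = 1" "\<alpha>\<^sub>1 * t ^ b = 1" "\<alpha>\<^sub>2 * u ^ b = 1"
  shows "metrically_conical (brieskorn \<alpha>\<^sub>0 \<alpha>\<^sub>1 \<alpha>\<^sub>2 a b b) (0, 0, 0)"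
proof -
  obtain L where "cone_parametrization (link a b) 3 cone_map L" using cone_parametrization_exists by blast
  then interpret cp: cone_parametrization "link a b" 3 cone_map L .
  define N where "N p = norm (fst (snd p) / t) ^ (2 * b) + norm (snd (snd p) / u) ^ (2 * b)" for p :: "complex \<times> complex \<times> complex"
  \<comment> \<open>The weight \<open>expo = b / a\<close> is chosen so that all three terms of the
    equation scale by r^b.\<close>
  have pw: "(complex_of_real (r powr expo)) ^ a = of_real r ^ b" if "0 < r" for r
  proof -
    have "(r powr expo) ^ a = r powr (expo * real a)" using that by (simp add: powr_powr[symmetric] powr_realpow)
    also have "\<dots> = r ^ b" using that a_pos by (simp add: expo_def powr_realpow)
    finally show ?thesis by (simp add: of_real_power[symmetric] del: of_real_power)
  qed
  have eq: "\<alpha>\<^sub>0 * (s * x) ^ a + \<alpha>\<^sub>1 * (t * y) ^ b + \<alpha>\<^sub>2 * (u * z) ^ b = x ^ a + y ^ b + z ^ b" for x y z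
    unfolding power_mult_distrib mult.assoc[symmetric] \<alpha> by simp
  have sub: "cp.U \<subseteq> brieskorn \<alpha>\<^sub>0 \<alpha>\<^sub>1 \<alpha>\<^sub>2 a b b"
  proof
    fix p assume "p \<in> cp.U"
    then obtain r m where rm: "r \<in> {0..<1}" "m \<in> link a b" "p = cone_map r m" by (rule cp.U_cases)
    show "p \<in> brieskorn \<alpha>\<^sub>0 \<alpha>\<^sub>1 \<alpha>\<^sub>2 a b b"
    proof (cases "r = 0")
      case True
      then show ?thesis using rm(3) a_pos b_pos by (simp add: cone_map_def brieskorn_def zero_power zero_prod_def)
    next
      case False
      then have r: "0 < r" "r < 1" using rm(1) by auto
      obtain n where n: "n \<in> link a b" "push r n = m" by (rule push_surj[OF r rm(2)])
      have p: "p = emb r n" using cone_map_push[OF r n(1)] n(2) rm(3) by simp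
      have n0: "fst n ^ a + fst (snd n) ^ b + snd (snd n) ^ b = 0" using n(1) by (auto simp: link_def)
      have "(of_real (r powr expo) * fst n) ^ a + (of_real r * fst (snd n)) ^ b + (of_real r * snd (snd n)) ^ b
          = of_real r ^ b * (fst n ^ a + fst (snd n) ^ b + snd (snd n) ^ b)"
        unfolding power_mult_distrib pw[OF r(1)] by (simp only: distrib_left)
      then show ?thesis unfolding p emb_def brieskorn_def mem_Collect_eq prod.case eq n0 by simp
    qed
  qed
  have W: "open {p. N p < 1}"
    unfolding N_def using stu by (intro open_Collect_less continuous_intros) auto
  have W0: "0 \<in> {p. N p < 1}" using b_pos by (simp add: N_def zero_power)
  have nbhd: "{p. N p < 1} \<inter> brieskorn \<alpha>\<^sub>0 \<alpha>\<^sub>1 \<alpha>\<^sub>2 a b b \<subseteq> cp.U"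
  proof
    fix p assume p: "p \<in> {p. N p < 1} \<inter> brieskorn \<alpha>\<^sub>0 \<alpha>\<^sub>1 \<alpha>\<^sub>2 a b b"
    define x y z where "x = fst p / s" and "y = fst (snd p) / t" and "z = snd (snd p) / u"
    have pxyz: "p = (s * x, t * y, u * z)" using stu by (simp add: x_def y_def z_def)
    have Np: "norm y ^ (2 * b) + norm z ^ (2 * b) < 1" using p by (simp add: N_def y_def z_def)
    have xyz: "x ^ a + y ^ b + z ^ b = 0"
      using p eq[of x y z] by (simp add: pxyz brieskorn_def)
    define r where "r = root (2 * b) (norm y ^ (2 * b) + norm z ^ (2 * b))"
    have b2: "0 < 2 * b" using b_pos by simp
    have s0: "0 \<le> norm y ^ (2 * b) + norm z ^ (2 * b)" by simp
    have rpow: "r ^ (2 * b) = norm y ^ (2 * b) + norm z ^ (2 * b)" unfolding r_def by (rule real_root_pow_pos2[OF b2 s0])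
    have r01: "0 \<le> r" "r < 1" unfolding r_def using s0 Np real_root_lt_1_iff[OF b2] by (simp_all add: real_root_ge_zero)
    show "p \<in> cp.U"
    proof (cases "r = 0")
      case True
      then have "norm y ^ (2 * b) + norm z ^ (2 * b) = 0" using rpow b2 by (simp add: zero_power)
      then have "norm y ^ (2 * b) = 0" "norm z ^ (2 * b) = 0" by (simp_all add: add_nonneg_eq_0_iff)
      then have yz: "y = 0" "z = 0" by simp_all
      then have "x = 0" using xyz b_pos by (simp add: zero_power)
      then have "p = 0" using yz by (simp add: pxyz zero_prod_def)
      then show ?thesis using cp.zero_in_U by simp
    next
      case False
      then have r: "0 < r" "r < 1" using r01 by auto
      \<comment> \<open>Undoing the dilation; its image under \<open>push r\<close> is the point of
        the cone base.\<close>
      define n where "n = (x / of_real (r powr expo), y / of_real r, z / of_real r)"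
      have rc: "complex_of_real (r powr expo) \<noteq> 0" "complex_of_real r \<noteq> 0" using r by simp_all
      have n: "n \<in> link a b"
      proof -
        have "(x / of_real (r powr expo)) ^ a + (y / of_real r) ^ b + (z / of_real r) ^ b = (x ^ a + y ^ b + z ^ b) / of_real r ^ b"
          unfolding power_divide pw[OF r(1)] by (simp only: add_divide_distrib)
        moreover have "norm (y / of_real r) ^ (2 * b) + norm (z / of_real r) ^ (2 * b) = r ^ (2 * b) / r ^ (2 * b)"
          unfolding norm_divide norm_of_real power_divide rpow[symmetric] using r(1) rpow by (simp add: add_divide_distrib[symmetric])
        ultimately show ?thesis using r xyz by (simp add: n_def link_def)
      qed
      have "p = emb r n" unfolding pxyz emb_def n_def using rc by simp
      then have "p = cone_map r (push r n)" using cone_map_push[OF r n] by simp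
      then show ?thesis unfolding cp.U_def using r push_link[OF r n] by (intro image_eqI[of _ _ "(r, push r n)"]) auto
    qed
  qed
  have "metrically_conical (brieskorn \<alpha>\<^sub>0 \<alpha>\<^sub>1 \<alpha>\<^sub>2 a b b) 0"
    by (rule cp.metrically_conical[OF sub W W0 nbhd])
  then show ?thesis by (simp add: zero_prod_def)
qed

end

theorem theorem1p3:
  fixes a b :: nat and \<alpha>\<^sub>0 \<alpha>\<^sub>1 \<alpha>\<^sub>2 :: complex
  assumes "2 \<le> a" and "a < b"
    and "\<alpha>\<^sub>0 \<noteq> 0" and "\<alpha>\<^sub>1 \<noteq> 0" and "\<alpha>\<^sub>2 \<noteq> 0"
  shows "metrically_conical (brieskorn \<alpha>\<^sub>0 \<alpha>\<^sub>1 \<alpha>\<^sub>2 a b b) (0, 0, 0)"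
proof -
  have pos: "a > 0" "b > 0" using assms(1,2) by auto
  \<comment> \<open>The coordinate scalings are roots of the inverse coefficients; they do not
    vanish, being exponentials.\<close>
  have root: "\<alpha> * croot n 1 (1 / \<alpha>) ^ n = 1 \<and> croot n 1 (1 / \<alpha>) \<noteq> 0" if "n > 0" "\<alpha> \<noteq> 0" for n and \<alpha> :: complex
  proof -
    have "croot n 1 (1 / \<alpha>) ^ n = 1 / \<alpha>" using that by (intro croot_power) auto
    moreover have "croot n 1 (1 / \<alpha>) \<noteq> 0" by (simp add: croot_def)
    ultimately show ?thesis using that by simp
  qed
  interpret brieskorn_cone a b "croot a 1 (1 / \<alpha>\<^sub>0)" "croot b 1 (1 / \<alpha>\<^sub>1)" "croot b 1 (1 / \<alpha>\<^sub>2)"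
    using assms pos root by unfold_locales auto
  show ?thesis
    using root[OF pos(1) assms(3)] root[OF pos(2) assms(4)] root[OF pos(2) assms(5)]
    by (intro metrically_conical_brieskorn) auto
qed

end
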